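(* Let $g\ge 0$ and $s\ge 1$ be integers with $(g,s)\ne(0,1),(0,2)$, and let $z_1,\dots,z_s$ be complex numbers with $\operatorname{Re} z_i>0$. Then the Laplace transform of the function $\operatorname{map}_g$ equals $$\int_{\mathbb{R}_{\ge 0}^s} e^{-(z_1\xi_1+\dots+z_s\xi_s)}\,\operatorname{map}_g(\xi_1,\dots,\xi_s)\,\frac{d\xi_1\cdots d\xi_s}{\xi_1\cdots\xi_s}=2\sum_{\Gamma\in\Gamma^{3}_{g,s}}\frac{1}{|\operatorname{Aut}(\Gamma)|}\prod_{e\in e(\Gamma)}\frac{2^{-1/2}}{\sqrt{z_{1,e}}+\sqrt{z_{2,e}}}.$$ Here $e(\Gamma)$ is the set of edges of $\Gamma$, and $z_{1,e},z_{2,e}$ are the two (possibly equal) variables $z_i$ corresponding to the cells on the two sides of the edge $e$; square roots are principal.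
   Context: Maps: for positive integers $k_1,\dots,k_s$ take $s$ oriented polygons, numbered $1,\dots,s$, the $i$-th being a $k_i$-gon, each with one marked vertex. $\operatorname{Map}_g(k_1,\dots,k_s)$ is the set of all ways to glue the sides of these polygons in pairs, consistently with orientation, such that the resulting closed oriented surface is connected of genus $g$. (Because of numbering and marked vertices, this is just a set of pairings of the $|k|=k_1+\dots+k_s$ sides; it is empty if $|k|$ is odd.) The function $\operatorname{map}_g(\xi_1,\dots,\xi_s)$, $\xi_i>0$, is the function determined by the asymptotics $$2^{-|k|}\,\left|\operatorname{Map}_g(k_1,\dots,k_s)\right|\sim \operatorname{map}_g(\xi_1,\dots,\xi_s)\,t^{3g-3+3s/2},\qquad t\to\infty,$$ where the $k_i$ are positive integers with $|k|$ even and $k_i/t\to\xi_i$. Ribbon graphs: a ribbon graph is a connected graph (loops and multiple edges allowed) with a cyclic order on the half-edges at every vertex; thickening vertices to disks and edges to ribbons gives an oriented surface with boundary. The boundary components are called cells; filling each with a disk gives a closed surface whose genus is the genus of the ribbon graph. $\Gamma^3_{g,s}$ is the set of isomorphism classes of ribbon graphs of genus $g$ with all vertices 3-valent and with $s$ cells numbered by $1,\dots,s$. $\operatorname{Aut}(\Gamma)$ is the group of automorphisms of the ribbon graph with marked cells (automorphisms act on half-edges, preserve cyclic orders, and preserve each cell). *)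

theory Defs
  imports "HOL-Analysis.Analysis" "HOL-Library.Landau_Symbols" "HOL-Combinatorics.Combinatorics"
begin

section \<open>Gluings of polygons\<close>

definition total_sides :: "nat \<Rightarrow> (nat \<Rightarrow> nat) \<Rightarrow> nat" where
  "total_sides s k = (\<Sum>i=1..s. k i)"

definition sides :: "nat \<Rightarrow> (nat \<Rightarrow> nat) \<Rightarrow> (nat \<times> nat) set" where
  "sides s k = (SIGMA i:{1..s}. {..<k i})"

text \<open>The sides of polygon \<open>i\<close> are numbered along its orientation, starting at the marked vertex.
  The pair \<open>(i, j)\<close> also names the corner at which side \<open>(i, j)\<close> starts; this side then ends at the
  corner \<open>next_side k (i, j)\<close>.\<close>

definition next_side :: "(nat \<Rightarrow> nat) \<Rightarrow> nat \<times> nat \<Rightarrow> nat \<times> nat" where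
  "next_side k = (\<lambda>(i, j). (i, Suc j mod k i))"

definition pairings :: "'a set \<Rightarrow> ('a \<Rightarrow> 'a) set" where
  "pairings A = {p. p permutes A \<and> (\<forall>x\<in>A. p x \<noteq> x \<and> p (p x) = x)}"

text \<open>Gluing two sides consistently with the orientation reverses one of them, so the start of a side
  is identified with the end of its partner.  (As the pairing is an involution, this also accounts for
  the identification of its end with the start of the partner.)  The vertices of the glued surface are
  the classes of corners under the equivalence relation generated by these identifications.\<close>

definition corner_gluing ::
  "nat \<Rightarrow> (nat \<Rightarrow> nat) \<Rightarrow> (nat \<times> nat \<Rightarrow> nat \<times> nat) \<Rightarrow> ((nat \<times> nat) \<times> (nat \<times> nat)) set" where
  "corner_gluing s k p = {(x, next_side k (p x)) |x. x \<in> sides s k}"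

definition surface_vertices ::
  "nat \<Rightarrow> (nat \<Rightarrow> nat) \<Rightarrow> (nat \<times> nat \<Rightarrow> nat \<times> nat) \<Rightarrow> (nat \<times> nat) set set" where
  "surface_vertices s k p = sides s k // (corner_gluing s k p \<union> (corner_gluing s k p)\<inverse>)\<^sup>*"

definition surface_connected ::
  "nat \<Rightarrow> (nat \<Rightarrow> nat) \<Rightarrow> (nat \<times> nat \<Rightarrow> nat \<times> nat) \<Rightarrow> bool" where
  "surface_connected s k p \<longleftrightarrow>
     (\<forall>i\<in>{1..s}. \<forall>j\<in>{1..s}. (i, j) \<in> {(fst x, fst (p x)) |x. x \<in> sides s k}\<^sup>*)"

text \<open>The genus is read off from the Euler characteristic \<open>V - E + F = 2 - 2 g\<close>.\<close>

definition Maps :: "nat \<Rightarrow> nat \<Rightarrow> (nat \<Rightarrow> nat) \<Rightarrow> (nat \<times> nat \<Rightarrow> nat \<times> nat) set" where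
  "Maps g s k = {p \<in> pairings (sides s k).
     surface_connected s k p \<and>
     int (card (surface_vertices s k p)) - int (total_sides s k div 2) + int s = 2 - 2 * int g}"

definition map_asymptotics :: "nat \<Rightarrow> nat \<Rightarrow> (nat \<Rightarrow> real) \<Rightarrow> real \<Rightarrow> bool" where
  "map_asymptotics g s \<xi> c \<longleftrightarrow>
     (\<forall>k :: real \<Rightarrow> nat \<Rightarrow> nat.
        (\<forall>t. (\<forall>i\<in>{1..s}. 0 < k t i) \<and> even (total_sides s (k t))) \<and>
        (\<forall>i\<in>{1..s}. ((\<lambda>t. real (k t i) / t) \<longlongrightarrow> \<xi> i) at_top) \<longrightarrow>
        (\<lambda>t. real (card (Maps g s (k t))) / 2 ^ total_sides s (k t))
          \<sim>[at_top] (\<lambda>t. c * t powr (3 * real g - 3 + 3 * real s / 2)))"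

text \<open>Only the values \<open>\<xi> 1, \<dots>, \<xi> s\<close> matter, and only for positive values is \<open>map_fun\<close>
  meaningful.\<close>

definition map_fun :: "nat \<Rightarrow> nat \<Rightarrow> (nat \<Rightarrow> real) \<Rightarrow> real" where
  "map_fun g s \<xi> = (THE c. map_asymptotics g s \<xi> c)"


section \<open>Ribbon graphs\<close>

text \<open>The cycles of \<open>rot\<close> are the cyclic orders of the half-edges around the vertices, and \<open>flip\<close>
  exchanges the two halves of each edge.\<close>

record 'h ribbon_graph =
  half_edges :: "'h set"
  rot :: "'h \<Rightarrow> 'h"
  flip :: "'h \<Rightarrow> 'h"

record 'h numbered_ribbon_graph = "'h ribbon_graph" +
  cell_no :: "'h \<Rightarrow> nat"

definition rg_vertices :: "('h, 'm) ribbon_graph_scheme \<Rightarrow> 'h set set" where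
  "rg_vertices \<Gamma> = orbit (rot \<Gamma>) ` half_edges \<Gamma>"

definition rg_edges :: "('h, 'm) ribbon_graph_scheme \<Rightarrow> 'h set set" where
  "rg_edges \<Gamma> = (\<lambda>h. {h, flip \<Gamma> h}) ` half_edges \<Gamma>"

text \<open>A boundary component of the thickened graph runs along the edge of \<open>h\<close> to its other end
  \<open>flip h\<close> and continues with the next half-edge at that vertex.  A ribbon has two sides, one
  traversed in the direction of each of its two half-edges; hence the cells on the two sides of the
  edge \<open>{h, flip h}\<close> are the orbits containing \<open>h\<close> and \<open>flip h\<close>.\<close>

definition rg_cell :: "('h, 'm) ribbon_graph_scheme \<Rightarrow> 'h \<Rightarrow> 'h set" where
  "rg_cell \<Gamma> h = orbit (rot \<Gamma> \<circ> flip \<Gamma>) h"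

definition rg_cells :: "('h, 'm) ribbon_graph_scheme \<Rightarrow> 'h set set" where
  "rg_cells \<Gamma> = rg_cell \<Gamma> ` half_edges \<Gamma>"

text \<open>Connectedness: since \<open>rot\<close> is a permutation of a finite set, no symmetric closure is needed.
  The graph consisting of one vertex without edges has no half-edges and is not represented.\<close>

definition ribbon_graph :: "('h, 'm) ribbon_graph_scheme \<Rightarrow> bool" where
  "ribbon_graph \<Gamma> \<longleftrightarrow>
     finite (half_edges \<Gamma>) \<and> half_edges \<Gamma> \<noteq> {} \<and>
     rot \<Gamma> permutes half_edges \<Gamma> \<and>
     flip \<Gamma> \<in> pairings (half_edges \<Gamma>) \<and>
     (\<forall>h\<in>half_edges \<Gamma>. \<forall>h'\<in>half_edges \<Gamma>.
        (h, h') \<in> {(x, y). x \<in> half_edges \<Gamma> \<and> (y = rot \<Gamma> x \<or> y = flip \<Gamma> x)}\<^sup>*)"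

definition rg_has_genus :: "('h, 'm) ribbon_graph_scheme \<Rightarrow> nat \<Rightarrow> bool" where
  "rg_has_genus \<Gamma> g \<longleftrightarrow>
     int (card (rg_vertices \<Gamma>)) - int (card (rg_edges \<Gamma>)) + int (card (rg_cells \<Gamma>))
       = 2 - 2 * int g"

text \<open>The cell numbers are recorded on half-edges: \<open>cell_no \<Gamma> h\<close> is the number of the cell
  containing \<open>h\<close>.\<close>

definition cells_numbered :: "('h, 'm) numbered_ribbon_graph_scheme \<Rightarrow> nat \<Rightarrow> bool" where
  "cells_numbered \<Gamma> s \<longleftrightarrow>
     (\<forall>h\<in>half_edges \<Gamma>. \<forall>h'\<in>half_edges \<Gamma>.
        cell_no \<Gamma> h = cell_no \<Gamma> h' \<longleftrightarrow> rg_cell \<Gamma> h = rg_cell \<Gamma> h') \<and>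
     cell_no \<Gamma> ` half_edges \<Gamma> = {1..s}"

definition rg_iso ::
  "('h, 'm) numbered_ribbon_graph_scheme \<Rightarrow> ('k, 'n) numbered_ribbon_graph_scheme \<Rightarrow> ('h \<Rightarrow> 'k) \<Rightarrow> bool"
  where
  "rg_iso \<Gamma> \<Gamma>' f \<longleftrightarrow>
     bij_betw f (half_edges \<Gamma>) (half_edges \<Gamma>') \<and>
     (\<forall>h\<in>half_edges \<Gamma>.
        f (rot \<Gamma> h) = rot \<Gamma>' (f h) \<and> f (flip \<Gamma> h) = flip \<Gamma>' (f h) \<and>
        cell_no \<Gamma>' (f h) = cell_no \<Gamma> h)"

definition rg_Aut :: "('h, 'm) numbered_ribbon_graph_scheme \<Rightarrow> ('h \<Rightarrow> 'h) set" where
  "rg_Aut \<Gamma> = {f. f permutes half_edges \<Gamma> \<and> rg_iso \<Gamma> \<Gamma> f}"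

text \<open>Up to isomorphism, the half-edges of a finite ribbon graph may be taken to be natural
  numbers.\<close>

definition trivalent_graphs :: "nat \<Rightarrow> nat \<Rightarrow> nat numbered_ribbon_graph set" where
  "trivalent_graphs g s = {\<Gamma>. ribbon_graph \<Gamma> \<and> rg_has_genus \<Gamma> g \<and> cells_numbered \<Gamma> s \<and>
     (\<forall>v\<in>rg_vertices \<Gamma>. card v = 3)}"

definition trivalent_classes :: "nat \<Rightarrow> nat \<Rightarrow> nat numbered_ribbon_graph set set" where
  "trivalent_classes g s = trivalent_graphs g s //
     {(\<Gamma>, \<Gamma>'). \<Gamma> \<in> trivalent_graphs g s \<and> \<Gamma>' \<in> trivalent_graphs g s \<and> (\<exists>f. rg_iso \<Gamma> \<Gamma>' f)}"

text \<open>The inner sum has exactly two terms, one for each side of the edge, also when both sides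
  belong to the same cell.\<close>

definition rg_weight ::
  "(nat \<Rightarrow> complex) \<Rightarrow> ('h, 'm) numbered_ribbon_graph_scheme \<Rightarrow> complex" where
  "rg_weight z \<Gamma> = 1 / of_nat (card (rg_Aut \<Gamma>)) *
     (\<Prod>e\<in>rg_edges \<Gamma>. of_real (2 powr (- 1 / 2)) / (\<Sum>h\<in>e. csqrt (z (cell_no \<Gamma> h))))"

text \<open>The weight is invariant under isomorphism, so the choice of representative is immaterial.\<close>

definition class_weight :: "(nat \<Rightarrow> complex) \<Rightarrow> nat numbered_ribbon_graph set \<Rightarrow> complex" where
  "class_weight z C = rg_weight z (SOME \<Gamma>. \<Gamma> \<in> C)"


section \<open>The integrand of the Laplace transform\<close>

text \<open>On the boundary of the orthant, where \<open>map_fun\<close> is not meaningful, the integrand is \<open>0\<close>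
  because of division by zero; the boundary is a null set.\<close>

definition laplace_integrand :: "nat \<Rightarrow> nat \<Rightarrow> (nat \<Rightarrow> complex) \<Rightarrow> (nat \<Rightarrow> real) \<Rightarrow> complex" where
  "laplace_integrand g s z \<xi> =
     exp (- (\<Sum>i=1..s. z i * of_real (\<xi> i))) * of_real (map_fun g s \<xi>) / of_real (\<Prod>i=1..s. \<xi> i)"

end

theory Submission
  imports Defs "HOL-Complex_Analysis.Complex_Analysis" "HOL-Probability.Distributions" "HOL-Real_Asymp.Real_Asymp"
begin

text \<open>Removing univalent vertices from a gluing repeatedly leaves a gluing of an \<open>m i\<close>-gon for each
  \<open>i\<close>, and the number of ways to undo this is the product of the binomial coefficients
  \<open>k i choose ((k i - m i) div 2)\<close>.  Suppressing the bivalent vertices of what is left gives a ribbon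
  graph whose vertices have valence at least 3, with positive integer edge lengths such that the
  \<open>i\<close>-th cell has perimeter \<open>m i\<close>.  So the number of maps is a finite sum over graphs of lattice sums
  over edge lengths.  By the local limit theorem for the binomial coefficients, the
  lattice sum of a graph with \<open>d\<close> edges, divided by \<open>2 ^ total_sides s k\<close>, is of the order \<open>t powr (d / 2)\<close>, where the leading
  coefficient is an integral over real edge lengths of the Gaussian weights
  \<open>sqrt (2 / (pi * \<xi>)) * y * exp (- (y\<^sup>2 / (2 * \<xi>)))\<close> of the perimeters \<open>y\<close>; the trivalent graphs
  have the most edges and hence dominate.  The Laplace transform of this weight in \<open>\<xi>\<close> with respect
  to \<open>d\<xi> / \<xi>\<close> is \<open>2 * exp (- (y * sqrt (2 * z)))\<close>, which is multiplicative in the edge lengths, so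
  that the integral over edge lengths splits into one factor for each edge.  Automorphisms enter
  because isomorphism classes are counted through labellings of the half-edges.\<close>

section \<open>Permutations, orbits and gluings\<close>

text \<open>Parity shapes the constant. Each perimeter must have the parity of its polygon. As every
  edge has two sides and the graph is connected, these s conditions on the edge lengths have rank s
  - 1 and admit a share 2 / 2 ^ s of the lattice points. The Laplace transform contributes a factor
  2 for each cell, so that just the 2 of the theorem survives. The binomial coefficients arise from
  a reflection argument: the corners of one polygon are tested for leaves one after the other, and
  the counts obey a ballot recurrence. Of the excluded cases, (0, 1) consists of trees, which have
  nothing left after the removal of leaves, and (0, 2) reduces to cycles with bivalent vertices
  only. Asymptotic equivalence to a leading term with coefficient 0 would mean exact vanishing.
  Instead of constructing trivalent graphs, the proof splits vertices to show that without trivalent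
  graphs there are no graphs at all. For complex variables the transform of the Gaussian weight is
  computed on the real axis and continued analytically.\<close>

lemma card_image_le_factor:
  assumes "finite X" and "\<And>x y. x \<in> X \<Longrightarrow> y \<in> X \<Longrightarrow> A x = A y \<Longrightarrow> B x = B y"
  shows "card (B ` X) \<le> card (A ` X)"
proof -
  have "B ` X \<subseteq> (\<lambda>C. B (SOME x. x \<in> X \<and> A x = C)) ` (A ` X)"
  proof
    fix b assume "b \<in> B ` X"
    then obtain x where x: "x \<in> X" "b = B x" by auto
    have "(SOME z. z \<in> X \<and> A z = A x) \<in> X \<and> A (SOME z. z \<in> X \<and> A z = A x) = A x"
      by (rule someI[of "\<lambda>z. z \<in> X \<and> A z = A x" x]) (use x in auto)
    then have "B (SOME z. z \<in> X \<and> A z = A x) = b"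
      using assms(2) x by blast
    then show "b \<in> (\<lambda>C. B (SOME x. x \<in> X \<and> A x = C)) ` (A ` X)"
      using x by blast
  qed
  then show ?thesis
    by (meson assms(1) card_image_le card_mono finite_imageI order_trans)
qed

text \<open>Allows a double count to be given by a relation, so that no inverse map has to be
  written down. Leaf removal, subdivision of graphs and the labelling arguments are all counted in
  this way.\<close>

lemma card_eq_by_relation:
  assumes "\<And>a. a \<in> A \<Longrightarrow> \<exists>b\<in>B. R a b" and "\<And>b. b \<in> B \<Longrightarrow> \<exists>a\<in>A. R a b"
    and "\<And>a b b'. a \<in> A \<Longrightarrow> b \<in> B \<Longrightarrow> b' \<in> B \<Longrightarrow> R a b \<Longrightarrow> R a b' \<Longrightarrow> b = b'"
    and "\<And>a a' b. a \<in> A \<Longrightarrow> a' \<in> A \<Longrightarrow> b \<in> B \<Longrightarrow> R a b \<Longrightarrow> R a' b \<Longrightarrow> a = a'"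
  shows "card A = card B"
proof -
  obtain F where F: "\<And>a. a \<in> A \<Longrightarrow> F a \<in> B \<and> R a (F a)"
    using assms(1) by metis
  have "inj_on F A"
    by (rule inj_onI) (metis F assms(4))
  moreover have "F ` A = B"
    using F assms(2,3) by (auto simp: image_iff) metis
  ultimately show ?thesis
    by (metis card_image)
qed

lemma pairingsI:
  assumes "\<And>x. x \<in> A \<Longrightarrow> p x \<in> A" "\<And>x. x \<in> A \<Longrightarrow> p x \<noteq> x" "\<And>x. x \<in> A \<Longrightarrow> p (p x) = x"
    "\<And>x. x \<notin> A \<Longrightarrow> p x = x"
  shows "p \<in> pairings A"
proof -
  have "bij_betw p A A"
    by (rule bij_betw_byWitness[where f' = p]) (use assms in auto)
  then have "p permutes A"
    using assms(4) by (intro bij_imp_permutes) auto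
  then show ?thesis
    using assms by (auto simp: pairings_def)
qed

lemma pairings_double: "p \<in> pairings A \<Longrightarrow> p (p x) = x"
  by (cases "x \<in> A") (auto simp: pairings_def permutes_not_in)

lemma pairings_in: "p \<in> pairings A \<Longrightarrow> x \<in> A \<Longrightarrow> p x \<in> A"
  by (auto simp: pairings_def permutes_in_image)

lemma pairings_neq: "p \<in> pairings A \<Longrightarrow> x \<in> A \<Longrightarrow> p x \<noteq> x"
  by (auto simp: pairings_def)

lemma pairings_out: "p \<in> pairings A \<Longrightarrow> x \<notin> A \<Longrightarrow> p x = x"
  by (auto simp: pairings_def permutes_not_in)

lemma pairings_permutes: "p \<in> pairings A \<Longrightarrow> p permutes A"
  by (auto simp: pairings_def)

lemma finite_pairings: "finite A \<Longrightarrow> finite (pairings A)"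
  by (rule finite_subset[OF _ finite_permutations[of A]]) (auto simp: pairings_def)

lemma pairings_eqI:
  assumes "p \<in> pairings A" "q \<in> pairings A" "\<And>x. x \<in> A \<Longrightarrow> p x = q x"
  shows "p = q"
  using assms pairings_out by (metis ext)

lemma orbit_self: "f permutes S \<Longrightarrow> finite S \<Longrightarrow> x \<in> orbit f x"
  by (intro permutation_self_in_orbit) (auto simp: permutation_permutes)

lemma orbit_eq_iff: "f permutes S \<Longrightarrow> finite S \<Longrightarrow> orbit f x = orbit f y \<longleftrightarrow> y \<in> orbit f x"
  by (metis cyclic_on_orbit orbit_cyclic_eq3 orbit_self)

lemma orbit_map:
  assumes "w \<in> orbit f v" "v \<in> K" "\<And>v. v \<in> K \<Longrightarrow> f v \<in> K"
    and "\<And>v. v \<in> K \<Longrightarrow> \<pi> (f v) \<in> orbit f' (\<pi> v)"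
  shows "w \<in> K \<and> \<pi> w \<in> orbit f' (\<pi> v)"
  using assms(1)
proof induction
  case base
  then show ?case using assms by auto
next
  case (step y)
  then show ?case using assms(3,4) orbit_trans by metis
qed

text \<open>The two hypotheses about \<open>\<iota>\<close> and \<open>\<pi>\<close> say that they induce mutually inverse maps of orbits.\<close>

lemma card_orbits_eq:
  assumes fin: "finite H" "finite H'" and f: "f permutes H" "f' permutes H'"
    and K: "K \<subseteq> H" "\<And>v. v \<in> K \<Longrightarrow> f v \<in> K"
    and \<iota>: "\<And>u. u \<in> H' \<Longrightarrow> \<iota> u \<in> K" "\<And>u. u \<in> H' \<Longrightarrow> \<iota> (f' u) \<in> orbit f (\<iota> u)"
    and \<pi>: "\<And>v. v \<in> K \<Longrightarrow> \<pi> v \<in> H'" "\<And>v. v \<in> K \<Longrightarrow> \<pi> (f v) \<in> orbit f' (\<pi> v)"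
    and \<pi>\<iota>: "\<And>u. u \<in> H' \<Longrightarrow> \<pi> (\<iota> u) \<in> orbit f' u"
    and \<iota>\<pi>: "\<And>v. v \<in> K \<Longrightarrow> \<iota> (\<pi> v) \<in> orbit f v"
  shows "card (orbit f ` K) = card (orbit f' ` H')"
proof -
  have f'H: "f' v \<in> H'" if "v \<in> H'" for v
    using f(2) that by (simp add: permutes_in_image)
  note eq = orbit_eq_iff[OF f(1) fin(1)] and eq' = orbit_eq_iff[OF f(2) fin(2)]
  have 1: "orbit f ` K = (\<lambda>u. orbit f (\<iota> u)) ` H'"
  proof -
    have "orbit f v = orbit f (\<iota> (\<pi> v))" if "v \<in> K" for v
      using \<iota>\<pi>[OF that] eq by blast
    then show ?thesis using \<pi>(1) \<iota>(1) by (auto simp: image_iff)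
  qed
  have 2: "orbit f' ` H' = (\<lambda>v. orbit f' (\<pi> v)) ` K"
  proof -
    have "orbit f' u = orbit f' (\<pi> (\<iota> u))" if "u \<in> H'" for u
      using \<pi>\<iota>[OF that] eq' by blast
    then show ?thesis using \<pi>(1) \<iota>(1) by (auto simp: image_iff)
  qed
  have a: "card ((\<lambda>u. orbit f (\<iota> u)) ` H') \<le> card (orbit f' ` H')"
  proof (rule card_image_le_factor[OF fin(2)])
    fix x y assume "x \<in> H'" "y \<in> H'" "orbit f' x = orbit f' y"
    then have "y \<in> orbit f' x" using eq' by blast
    from orbit_map[OF this \<open>x \<in> H'\<close> f'H, of \<iota> f] \<iota>(2)
    show "orbit f (\<iota> x) = orbit f (\<iota> y)" using eq by blast
  qed
  have b: "card ((\<lambda>v. orbit f' (\<pi> v)) ` K) \<le> card (orbit f ` K)"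
  proof (rule card_image_le_factor)
    show "finite K" using K fin finite_subset by blast
    fix x y assume "x \<in> K" "y \<in> K" "orbit f x = orbit f y"
    then have "y \<in> orbit f x" using eq by blast
    from orbit_map[OF this \<open>x \<in> K\<close> K(2), of \<pi> f'] \<pi>(2)
    show "orbit f' (\<pi> x) = orbit f' (\<pi> y)" using eq' by blast
  qed
  show ?thesis using a b 1 2 by simp
qed

text \<open>One notion for polygon gluings and for labelled graphs: \<tau> is the face permutation,
  \<open>c\<close> gives the cell numbers, and \<open>\<tau> \<circ> p\<close> turns around the
  vertices. Leaving the underlying set arbitrary makes gluings of sets of different sizes
  comparable. Connectedness is asked of the cells, and \<open>s\<close> enters as the number of
  faces.\<close>

definition gluings :: "nat \<Rightarrow> nat \<Rightarrow> 'a set \<Rightarrow> ('a \<Rightarrow> 'a) \<Rightarrow> ('a \<Rightarrow> nat) \<Rightarrow> ('a \<Rightarrow> 'a) set" where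
  "gluings g s H \<tau> c = {p \<in> pairings H.
     (\<forall>i\<in>{1..s}. \<forall>j\<in>{1..s}. (i, j) \<in> {(c x, c (p x)) |x. x \<in> H}\<^sup>*) \<and>
     int (card (orbit (\<tau> \<circ> p) ` H)) - int (card H div 2) + int s = 2 - 2 * int g}"

lemma gluings_pairings: "p \<in> gluings g s H \<tau> c \<Longrightarrow> p \<in> pairings H"
  by (simp add: gluings_def)

lemma finite_gluings: "finite H \<Longrightarrow> finite (gluings g s H \<tau> c)"
  using finite_pairings[of H] by (simp add: gluings_def)

lemma gluings_transfer:
  assumes "p \<in> pairings H" "p' \<in> pairings H'"
    and "{(c x, c (p x)) |x. x \<in> H}\<^sup>* = {(c' x, c' (p' x)) |x. x \<in> H'}\<^sup>*"
    and "int (card (orbit (\<tau> \<circ> p) ` H)) - int (card H div 2) =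
      int (card (orbit (\<tau>' \<circ> p') ` H')) - int (card H' div 2)"
  shows "p \<in> gluings g s H \<tau> c \<longleftrightarrow> p' \<in> gluings g s H' \<tau>' c'"
  using assms unfolding gluings_def by simp

text \<open>Extended by the identity so as to be a permutation in the sense of
  \<open>permutes\<close>, to which the orbit lemmas apply.\<close>

definition nx :: "nat \<Rightarrow> (nat \<Rightarrow> nat) \<Rightarrow> nat \<times> nat \<Rightarrow> nat \<times> nat" where
  "nx s k x = (if x \<in> sides s k then next_side k x else x)"

lemma in_sides: "(i, j) \<in> sides s k \<longleftrightarrow> 1 \<le> i \<and> i \<le> s \<and> j < k i"
  by (auto simp: sides_def)

lemma finite_sides [simp]: "finite (sides s k)"
  by (auto simp: sides_def)

lemma card_sides: "card (sides s k) = total_sides s k"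
  by (simp add: sides_def total_sides_def)

lemma nx_simp: "(i, j) \<in> sides s k \<Longrightarrow> nx s k (i, j) = (i, if Suc j = k i then 0 else Suc j)"
  by (auto simp: nx_def next_side_def in_sides mod_Suc)

lemma fst_nx [simp]: "fst (nx s k x) = fst x"
  by (cases x) (auto simp: nx_def next_side_def)

lemma nx_permutes: "nx s k permutes sides s k"
proof -
  have into: "nx s k ` sides s k \<subseteq> sides s k"
    by (auto simp: nx_simp in_sides split: if_splits)
  have "inj_on (nx s k) (sides s k)"
    by (rule inj_onI) (auto simp: nx_simp in_sides split: if_splits)
  with into have "bij_betw (nx s k) (sides s k) (sides s k)"
    by (simp add: bij_betw_def endo_inj_surj)
  then show ?thesis
    by (rule bij_imp_permutes) (simp add: nx_def)
qed

text \<open>Some power of a permutation of a finite set is its inverse, so backward steps add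
  nothing to the forward orbit. This turns the classes in \<open>surface_vertices\<close> into
  orbits.\<close>

lemma rtrancl_eq_orbit:
  assumes "f permutes H" "finite H" "x \<in> H"
  shows "({(x, f x) |x. x \<in> H} \<union> {(x, f x) |x. x \<in> H}\<inverse>)\<^sup>* `` {x} = orbit f x"
proof (intro set_eqI iffI)
  note eq = orbit_eq_iff[OF assms(1,2)] and self = orbit_self[OF assms(1,2)]
  fix y assume "y \<in> ({(x, f x) |x. x \<in> H} \<union> {(x, f x) |x. x \<in> H}\<inverse>)\<^sup>* `` {x}"
  then have "(x, y) \<in> ({(x, f x) |x. x \<in> H} \<union> {(x, f x) |x. x \<in> H}\<inverse>)\<^sup>*" by simp
  then show "y \<in> orbit f x"
  proof induction
    case base
    then show ?case using self .
  next
    case (step y z)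
    then have "z = f y \<or> y = f z" by auto
    then show ?case
      using step eq by (metis orbit.base orbit_trans)
  qed
next
  fix y assume "y \<in> orbit f x"
  then have "y \<in> H \<and> (x, y) \<in> ({(x, f x) |x. x \<in> H} \<union> {(x, f x) |x. x \<in> H}\<inverse>)\<^sup>*"
  proof induction
    case base
    then show ?case using assms by (auto simp: permutes_in_image)
  next
    case (step y)
    then have "(y, f y) \<in> {(x, f x) |x. x \<in> H}" by auto
    with step show ?case
      using assms by (auto simp: permutes_in_image intro: rtrancl_into_rtrancl)
  qed
  then show "y \<in> ({(x, f x) |x. x \<in> H} \<union> {(x, f x) |x. x \<in> H}\<inverse>)\<^sup>* `` {x}" by simp
qed

lemma Maps_eq_gluings: "Maps g s k = gluings g s (sides s k) (nx s k) fst"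
proof -
  have "surface_vertices s k p = orbit (nx s k \<circ> p) ` sides s k" if p: "p \<in> pairings (sides s k)" for p
  proof -
    let ?f = "nx s k \<circ> p"
    have f: "?f permutes sides s k"
      using p nx_permutes by (auto intro: permutes_compose simp: pairings_def)
    have "corner_gluing s k p = {(x, ?f x) |x. x \<in> sides s k}"
      unfolding corner_gluing_def using pairings_in[OF p] by (auto simp: nx_def)
    then have "surface_vertices s k p = (\<lambda>x. ({(x, ?f x) |x. x \<in> sides s k} \<union>
        {(x, ?f x) |x. x \<in> sides s k}\<inverse>)\<^sup>* `` {x}) ` sides s k"
      unfolding surface_vertices_def quotient_def by auto
    also have "\<dots> = orbit ?f ` sides s k"
      by (rule image_cong[OF refl]) (rule rtrancl_eq_orbit[OF f finite_sides])
    finally show ?thesis .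
  qed
  then show ?thesis
    unfolding Maps_def gluings_def surface_connected_def card_sides by auto
qed

section \<open>Removing univalent vertices\<close>

text \<open>If the neighbouring sides x and y = \<tau> x are glued to each other, then \<tau> (p y)
  = y, so the corner y alone is a univalent vertex. Deleting both sides removes one edge and one
  vertex and keeps the Euler characteristic. The map \<iota> embeds the remaining sides, with
  \<tau>' bridging the gap; the condition \<tau> y \<noteq> x excludes a 2-gon, whose face would
  disappear. \<open>P\<close> and \<open>P'\<close> carry a further condition through the
  bijection.\<close>

lemma leaf_removal:
  fixes H :: "'a set" and H' :: "'b set"
  assumes fin: "finite H" "finite H'" and \<tau>: "\<tau> permutes H" and \<tau>': "\<tau>' permutes H'"
    and \<iota>: "bij_betw \<iota> H' (H - {x, y})" and xy: "x \<in> H" "y \<in> H" "x \<noteq> y" "\<tau> x = y" "\<tau> y \<noteq> x"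
    and \<iota>\<tau>: "\<And>u. u \<in> H' \<Longrightarrow> \<iota> (\<tau>' u) = (if \<tau> (\<iota> u) = x then \<tau> y else \<tau> (\<iota> u))"
    and c: "\<And>u. u \<in> H' \<Longrightarrow> c (\<iota> u) = c' u" "c x = c y"
    and PP': "\<And>p p'. p \<in> pairings H \<Longrightarrow> p' \<in> pairings H' \<Longrightarrow> p x = y \<Longrightarrow>
      (\<And>u. u \<in> H' \<Longrightarrow> \<iota> (p' u) = p (\<iota> u)) \<Longrightarrow> P p \<longleftrightarrow> P' p'"
  shows "card {p \<in> gluings g s H \<tau> c. p x = y \<and> P p} = card {p \<in> gluings g s H' \<tau>' c'. P' p}"
proof -
  define \<kappa> where "\<kappa> = inv_into H' \<iota>"
  have \<iota>in: "\<iota> u \<in> H" "\<iota> u \<noteq> x" "\<iota> u \<noteq> y" and \<kappa>\<iota>: "\<kappa> (\<iota> u) = u" if "u \<in> H'" for u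
    using \<iota> that unfolding \<kappa>_def bij_betw_def by auto
  have \<kappa>in: "\<kappa> v \<in> H'" and \<iota>\<kappa>: "\<iota> (\<kappa> v) = v" if "v \<in> H" "v \<noteq> x" "v \<noteq> y" for v
    using \<iota> that unfolding \<kappa>_def bij_betw_def
    by (metis (no_types, lifting) Diff_iff empty_iff insert_iff inv_into_into f_inv_into_f)+
  have inj\<tau>: "\<tau> a = \<tau> b \<longleftrightarrow> a = b" for a b
    using \<tau> permutes_inj by (metis injD)
  have \<tau>y: "\<tau> y \<in> H" "\<tau> y \<noteq> x" "\<tau> y \<noteq> y"
    using xy \<tau> inj\<tau> by (auto simp: permutes_in_image)
  have cardH: "card H = card H' + 2"
  proof -
    have "card H' = card (H - {x, y})" using \<iota> bij_betw_same_card by blast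
    moreover have "card (H - {x, y}) = card H - card {x, y}"
      using xy by (intro card_Diff_subset) auto
    moreover have "card {x, y} \<le> card H"
      using xy fin by (intro card_mono) auto
    ultimately show ?thesis using xy(3) by simp
  qed
  define R where "R p p' \<longleftrightarrow> p x = y \<and> (\<forall>u\<in>H'. \<iota> (p' u) = p (\<iota> u))" for p p'
  have key: "p \<in> gluings g s H \<tau> c \<longleftrightarrow> p' \<in> gluings g s H' \<tau>' c'"
    if p: "p \<in> pairings H" and p': "p' \<in> pairings H'" and R: "R p p'" for p p'
  proof (rule gluings_transfer[OF p p'])
    have px: "p x = y" and py: "p y = x" and \<iota>p: "\<And>u. u \<in> H' \<Longrightarrow> \<iota> (p' u) = p (\<iota> u)"
      using R pairings_double[OF p] unfolding R_def by auto
    let ?S = "{(c v, c (p v)) |v. v \<in> H}" and ?S' = "{(c' v, c' (p' v)) |v. v \<in> H'}"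
    have "?S' \<subseteq> ?S"
    proof
      fix z assume "z \<in> ?S'"
      then obtain u where "u \<in> H'" "z = (c' u, c' (p' u))" by auto
      then show "z \<in> ?S"
        using \<iota>p c(1) \<iota>in pairings_in[OF p'] by (auto intro!: exI[of _ "\<iota> u"]) metis
    qed
    moreover have "?S \<subseteq> ?S'\<^sup>*"
    proof
      fix z assume "z \<in> ?S"
      then obtain v where v: "v \<in> H" "z = (c v, c (p v))" by auto
      show "z \<in> ?S'\<^sup>*"
      proof (cases "v = x \<or> v = y")
        case True
        then show ?thesis using v c(2) px py by auto
      next
        case False
        then have u: "\<kappa> v \<in> H'" "\<iota> (\<kappa> v) = v" using v \<kappa>in \<iota>\<kappa> by auto
        then have "z = (c' (\<kappa> v), c' (p' (\<kappa> v)))"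
          using v c(1) \<iota>p pairings_in[OF p'] by metis
        then have "z \<in> ?S'" using u by auto
        then show ?thesis by auto
      qed
    qed
    ultimately show "?S\<^sup>* = ?S'\<^sup>*" by (rule rtrancl_subset)
    define f f' where "f = \<tau> \<circ> p" and "f' = \<tau>' \<circ> p'"
    have f: "f permutes H" and f': "f' permutes H'"
      unfolding f_def f'_def using \<tau> \<tau>' p p' by (auto intro: permutes_compose simp: pairings_def)
    have fy: "f y = y" using py xy by (simp add: f_def)
    have fx: "f x = \<tau> y" by (simp add: f_def px)
    have injf: "f a = f b \<longleftrightarrow> a = b" for a b
      using f permutes_inj by (metis injD)
    have \<iota>f: "\<iota> (f' u) = (if f (\<iota> u) = x then \<tau> y else f (\<iota> u))" if "u \<in> H'" for u
      using \<iota>\<tau>[of "p' u"] \<iota>p that pairings_in[OF p'] by (simp add: f_def f'_def)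
    \<comment> \<open>The vertex cycle passes through x to f x = \<tau> y, while the shorter cycle
      jumps over x. Orbits therefore correspond if x is sent to \<tau> y; only the fixed point y is
      lost, and it is added back below.\<close>
    have "card (orbit f ` (H - {y})) = card (orbit f' ` H')"
    proof (rule card_orbits_eq[where \<iota> = \<iota> and \<pi> = "\<lambda>v. if v = x then \<kappa> (\<tau> y) else \<kappa> v", OF fin f f'])
      show "H - {y} \<subseteq> H" by auto
      show "f v \<in> H - {y}" if "v \<in> H - {y}" for v
        using that f fy injf by (metis DiffE DiffI permutes_in_image singletonD singletonI)
      show "\<iota> u \<in> H - {y}" if "u \<in> H'" for u using \<iota>in that by auto
      show "\<iota> (f' u) \<in> orbit f (\<iota> u)" if "u \<in> H'" for u
        using \<iota>f[OF that] fx by (metis orbit.base orbit.step)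
      show "(if v = x then \<kappa> (\<tau> y) else \<kappa> v) \<in> H'" if "v \<in> H - {y}" for v
        using that \<kappa>in \<tau>y by auto
      show "(if f w = x then \<kappa> (\<tau> y) else \<kappa> (f w)) \<in> orbit f' (if w = x then \<kappa> (\<tau> y) else \<kappa> w)"
        if "w \<in> H - {y}" for w
      proof (cases "w = x")
        case True
        then show ?thesis using that fx \<tau>y orbit_self[OF f' fin(2)] by auto
      next
        case False
        then have w: "\<kappa> w \<in> H'" "\<iota> (\<kappa> w) = w" using that \<kappa>in \<iota>\<kappa> by auto
        have "f' (\<kappa> w) \<in> H'" using f' w by (simp add: permutes_in_image)
        then have "f' (\<kappa> w) = (if f w = x then \<kappa> (\<tau> y) else \<kappa> (f w))"
          using \<iota>f[OF w(1)] w \<kappa>\<iota> by metis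
        then show ?thesis using that False by (metis orbit.base)
      qed
      show "(if \<iota> u = x then \<kappa> (\<tau> y) else \<kappa> (\<iota> u)) \<in> orbit f' u" if "u \<in> H'" for u
        using that \<kappa>\<iota> \<iota>in orbit_self[OF f' fin(2)] by simp
      show "\<iota> (if v = x then \<kappa> (\<tau> y) else \<kappa> v) \<in> orbit f v" if "v \<in> H - {y}" for v
        using that \<iota>\<kappa> \<tau>y fx orbit_self[OF f fin(1)] by (auto intro: orbit_eqI)
    qed
    moreover have "card (orbit f ` H) = Suc (card (orbit f ` (H - {y})))"
    proof -
      have "orbit f ` H = insert {y} (orbit f ` (H - {y}))"
        using xy(2) fy orbit_eq_singleton_iff[of f y] by auto
      moreover have "{y} \<notin> orbit f ` (H - {y})"
        using orbit_self[OF f fin(1)] by (metis DiffE imageE singletonD)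
      ultimately show ?thesis using fin by simp
    qed
    ultimately show "int (card (orbit (\<tau> \<circ> p) ` H)) - int (card H div 2) =
        int (card (orbit (\<tau>' \<circ> p') ` H')) - int (card H' div 2)"
      using cardH by (simp add: f_def f'_def)
  qed
  show ?thesis
  proof (rule card_eq_by_relation[where R = R])
    fix p assume p: "p \<in> {p \<in> gluings g s H \<tau> c. p x = y \<and> P p}"
    then have pp: "p \<in> pairings H" and px: "p x = y" by (auto dest: gluings_pairings)
    have py: "p y = x" using px pairings_double[OF pp] by auto
    define p' where "p' u = (if u \<in> H' then \<kappa> (p (\<iota> u)) else u)" for u
    have pin: "p (\<iota> u) \<in> H" "p (\<iota> u) \<noteq> x" "p (\<iota> u) \<noteq> y" if "u \<in> H'" for u
      using \<iota>in[OF that] pairings_in[OF pp] pairings_double[OF pp] px py by metis+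
    have \<iota>p': "\<iota> (p' u) = p (\<iota> u)" if "u \<in> H'" for u
      using that pin \<iota>\<kappa> by (simp add: p'_def)
    have pp': "p' \<in> pairings H'"
    proof (rule pairingsI)
      fix u assume u: "u \<in> H'"
      then show in': "p' u \<in> H'" using \<kappa>in pin by (simp add: p'_def)
      show "p' u \<noteq> u" using \<iota>p'[OF u] pairings_neq[OF pp] \<iota>in[OF u] by metis
      show "p' (p' u) = u"
        using \<iota>p'[OF u] \<iota>p'[OF in'] pairings_double[OF pp] \<kappa>\<iota> u
        by (metis in' p'_def)
    qed (simp add: p'_def)
    have R: "R p p'" using px \<iota>p' by (simp add: R_def)
    then show "\<exists>p'\<in>{p \<in> gluings g s H' \<tau>' c'. P' p}. R p p'"
      using key[OF pp pp' R] PP'[OF pp pp' px \<iota>p'] p by auto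
  next
    fix p' assume p': "p' \<in> {p \<in> gluings g s H' \<tau>' c'. P' p}"
    then have pp': "p' \<in> pairings H'" by (auto dest: gluings_pairings)
    define p where "p v = (if v = x then y else if v = y then x else if v \<in> H then \<iota> (p' (\<kappa> v)) else v)" for v
    have pin: "p v \<in> H" "p v \<noteq> x" "p v \<noteq> y" "\<kappa> (p v) = p' (\<kappa> v)" "p v \<noteq> v"
      if "v \<in> H" "v \<noteq> x" "v \<noteq> y" for v
    proof -
      have "p' (\<kappa> v) \<in> H'" using \<kappa>in[OF that] pairings_in[OF pp'] by blast
      then show "p v \<in> H" "p v \<noteq> x" "p v \<noteq> y" "\<kappa> (p v) = p' (\<kappa> v)"
        using that \<iota>in \<kappa>\<iota> by (auto simp: p_def)
      then show "p v \<noteq> v" using pairings_neq[OF pp' \<kappa>in[OF that]] by metis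
    qed
    have \<iota>p': "\<iota> (p' u) = p (\<iota> u)" if "u \<in> H'" for u
      using that \<iota>in \<kappa>\<iota> by (simp add: p_def)
    have pp: "p \<in> pairings H"
    proof (rule pairingsI)
      fix v assume v: "v \<in> H"
      show "p v \<in> H" using pin v xy by (cases "v = x \<or> v = y") (auto simp: p_def)
      show "p v \<noteq> v" using pin v xy by (cases "v = x \<or> v = y") (auto simp: p_def)
      show "p (p v) = v"
      proof (cases "v = x \<or> v = y")
        case True
        then show ?thesis using xy by (auto simp: p_def)
      next
        case False
        then have v: "v \<in> H" "v \<noteq> x" "v \<noteq> y" using v by auto
        have "p (p v) = \<iota> (p' (\<kappa> (p v)))" using pin[OF v] by (simp add: p_def)
        also have "\<dots> = v" using pin[OF v] pairings_double[OF pp'] \<iota>\<kappa>[OF v] by simp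
        finally show ?thesis .
      qed
    qed (use xy in \<open>auto simp: p_def\<close>)
    have px: "p x = y" by (simp add: p_def)
    have R: "R p p'" using px \<iota>p' by (simp add: R_def)
    then show "\<exists>p\<in>{p \<in> gluings g s H \<tau> c. p x = y \<and> P p}. R p p'"
      using key[OF pp pp' R] PP'[OF pp pp' px \<iota>p'] p' px by auto
  next
    fix p p' p'' assume p: "p \<in> {p \<in> gluings g s H \<tau> c. p x = y \<and> P p}"
      "p' \<in> {p \<in> gluings g s H' \<tau>' c'. P' p}" "p'' \<in> {p \<in> gluings g s H' \<tau>' c'. P' p}"
      and R: "R p p'" "R p p''"
    then have "p' u = p'' u" if "u \<in> H'" for u
      using that \<kappa>\<iota> pairings_in[of p' H'] pairings_in[of p'' H'] gluings_pairings
      unfolding R_def mem_Collect_eq by metis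
    then show "p' = p''" using p by (auto intro: pairings_eqI dest: gluings_pairings)
  next
    fix p q p' assume p: "p \<in> {p \<in> gluings g s H \<tau> c. p x = y \<and> P p}"
      "q \<in> {p \<in> gluings g s H \<tau> c. p x = y \<and> P p}" "p' \<in> {p \<in> gluings g s H' \<tau>' c'. P' p}"
      and R: "R p p'" "R q p'"
    have pp: "p \<in> pairings H" "q \<in> pairings H" using p by (auto dest: gluings_pairings)
    have "p v = q v" if "v \<in> H" for v
    proof (cases "v = x \<or> v = y")
      case True
      then show ?thesis using R pairings_double[OF pp(1)] pairings_double[OF pp(2)] unfolding R_def by metis
    next
      case False
      then show ?thesis using R \<kappa>in \<iota>\<kappa> that unfolding R_def by metis
    qed
    then show "p = q" using pp by (auto intro: pairings_eqI)
  qed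
qed

section \<open>The ballot recurrence and its solution by reflection\<close>

definition bcoef :: "nat \<Rightarrow> nat \<Rightarrow> nat" where
  "bcoef n m = (if m \<le> n \<and> even (n - m) then n choose ((n - m) div 2) else 0)"

lemma sum_choose_eq_sum_bcoef:
  fixes f :: "int \<Rightarrow> int"
  shows "(\<Sum>j | 2 * j < n. int (n choose j) * f (int n - 2 * int j)) =
    (\<Sum>m=1..n. int (bcoef n m) * f (int m))"
proof -
  have "(\<Sum>m=1..n. int (bcoef n m) * f (int m)) = (\<Sum>m | m \<in> {1..n} \<and> even (n - m). int (bcoef n m) * f (int m))"
    by (rule sum.mono_neutral_right) (simp_all add: bcoef_def subset_iff)
  also have "\<dots> = (\<Sum>j | 2 * j < n. int (n choose j) * f (int n - 2 * int j))"
  proof (rule sum.reindex_bij_witness[of _ "\<lambda>j. n - 2 * j" "\<lambda>m. (n - m) div 2"])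
    fix m assume "m \<in> {m. m \<in> {1..n} \<and> even (n - m)}"
    then have m: "1 \<le> m" "m \<le> n" "even (n - m)" by auto
    then obtain j where j: "n - m = 2 * j" by (elim evenE)
    then have mj: "m = n - 2 * j" "2 * j \<le> n" using m by auto
    show "n - 2 * ((n - m) div 2) = m" "(n - m) div 2 \<in> {j. 2 * j < n}"
      using j m by auto
    have "int n - 2 * int j = int m" using mj by simp
    then show "int (n choose ((n - m) div 2)) * f (int n - 2 * int ((n - m) div 2)) = int (bcoef n m) * f (int m)"
      using j m by (simp add: bcoef_def)
  qed auto
  finally show ?thesis by simp
qed

text \<open>\<open>Lh\<close> extends the diagonal values to all integers so that the recurrence for \<open>A n a\<close> becomes that
  of an unrestricted walk (reflection principle, with mirror at \<open>-1\<close>).\<close>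

lemma ballot_recurrence_solution:
  fixes A :: "nat \<Rightarrow> nat \<Rightarrow> nat" and C :: "nat \<Rightarrow> nat"
  assumes A00: "A 0 0 = 0"
    and h0: "\<And>n. 1 \<le> n \<Longrightarrow> A n 0 = A n 1"
    and h1: "\<And>n a. 1 \<le> a \<Longrightarrow> a < n \<Longrightarrow> A n a = A n (Suc a) + A (n - 2) (a - 1)"
    and h2: "\<And>m. 1 \<le> m \<Longrightarrow> A m m = C m + (if 2 \<le> m then A (m - 2) (m - 2) else 0)"
    and n: "1 \<le> n"
  shows "A n 0 = (\<Sum>m=1..n. bcoef n m * C m)"
proof -
  define Lh :: "int \<Rightarrow> int" where
    "Lh x = (if 1 \<le> x then int (A (nat x) (nat x)) else
             if x \<le> -3 then - int (A (nat (-x-2)) (nat (-x-2))) else 0)" for x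
  have Lh_refl: "Lh (- x - 2) = - Lh x" for x
    by (auto simp: Lh_def)
  \<comment> \<open>The sum of \<open>Lh\<close> over the endpoints of all walks of d free steps +1
    or -1 from a; j is the number of downward steps.\<close>
  define W where "W d a = (\<Sum>j\<le>d. int (d choose j) * Lh (a + int d - 2 * int j))" for d a
  have W_Suc: "W (Suc d) a = W d (a + 1) + W d (a - 1)" for d a
  proof -
    have "W (Suc d) a = Lh (a + int (Suc d)) +
        (\<Sum>j\<le>d. int (Suc d choose Suc j) * Lh (a + int (Suc d) - 2 * int (Suc j)))"
      unfolding W_def by (subst sum.atMost_Suc_shift) simp
    also have "(\<Sum>j\<le>d. int (Suc d choose Suc j) * Lh (a + int (Suc d) - 2 * int (Suc j))) =
        (\<Sum>j\<le>d. int (d choose j) * Lh (a - 1 + int d - 2 * int j)) +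
        (\<Sum>j\<le>d. int (d choose Suc j) * Lh (a + 1 + int d - 2 * int (Suc j)))"
      unfolding sum.distrib[symmetric] by (rule sum.cong) (auto simp: algebra_simps)
    also have "Lh (a + int (Suc d)) + (\<dots> ) = W d (a - 1) +
        (Lh (a + 1 + int d) + (\<Sum>j\<le>d. int (d choose Suc j) * Lh (a + 1 + int d - 2 * int (Suc j))))"
      by (simp add: W_def algebra_simps)
    also have "Lh (a + 1 + int d) + (\<Sum>j\<le>d. int (d choose Suc j) * Lh (a + 1 + int d - 2 * int (Suc j))) =
        (\<Sum>j\<le>Suc d. int (d choose j) * Lh (a + 1 + int d - 2 * int j))"
      by (subst sum.atMost_Suc_shift) simp
    also have "\<dots> = W d (a + 1)"
      by (simp add: W_def)
    finally show ?thesis by simp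
  qed
  have flip: "(\<Sum>j\<le>d. int (d choose j) * h j) = (\<Sum>j\<le>d. int (d choose j) * h (d - j))" for d and h :: "nat \<Rightarrow> int"
    by (rule sum.reindex_bij_witness[of _ "\<lambda>j. d - j" "\<lambda>j. d - j"]) (auto simp: binomial_symmetric[symmetric])
  have W_refl: "W d (- 2 - a) = - W d a" for d a
  proof -
    have "W d a = (\<Sum>j\<le>d. int (d choose j) * Lh (a + int d - 2 * int (d - j)))"
      unfolding W_def by (rule flip[of d "\<lambda>j. Lh (a + int d - 2 * int j)"])
    also have "\<dots> = (\<Sum>j\<le>d. - (int (d choose j) * Lh (- 2 - a + int d - 2 * int j)))"
    proof (rule sum.cong[OF refl])
      fix j assume "j \<in> {..d}"
      then have "a + int d - 2 * int (d - j) = - (- 2 - a + int d - 2 * int j) - 2"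
        by (simp add: of_nat_diff)
      then show "int (d choose j) * Lh (a + int d - 2 * int (d - j)) = - (int (d choose j) * Lh (- 2 - a + int d - 2 * int j))"
        by (simp only: Lh_refl)
    qed
    finally show ?thesis by (simp add: W_def sum_negf)
  qed
  have W_m1: "W d (- 1) = 0" for d
    using W_refl[of d "-1"] by simp
  \<comment> \<open>With d = n - a, both terms of \<open>h1\<close> lower d by one and sit at a + 1
    and a - 1, which is the recurrence of \<open>W\<close>. At a = 0 only the term at a + 1 occurs,
    by \<open>h0\<close>, in accordance with \<open>W d (- 1) = 0\<close>.\<close>
  have AW: "int (A (d + a) a) = W d (int a)" for d a
  proof (induction d arbitrary: a)
    case 0
    then show ?case using A00 by (cases "a = 0") (auto simp: W_def Lh_def Suc_le_eq)
  next
    case (Suc d)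
    show ?case
    proof (cases "a = 0")
      case True
      then show ?thesis using h0[of "Suc d"] Suc[of 1] W_m1[of d] by (simp add: W_Suc)
    next
      case False
      then obtain b where b: "a = Suc b" using not0_implies_Suc by blast
      then show ?thesis
        using h1[of a "Suc d + a"] Suc[of "Suc a"] Suc[of b] by (simp add: W_Suc)
    qed
  qed
  \<comment> \<open>By \<open>h2\<close> these diagonal differences are the values of
    \<open>C\<close> at positive arguments; the antisymmetry of \<open>Lh\<close> about -1 makes
    \<open>Ch\<close> even.\<close>
  define Ch where "Ch x = Lh x - Lh (x - 2)" for x
  have Ch_even: "Ch (- x) = Ch x" for x
    using Lh_refl[of x] Lh_refl[of "x - 2"] by (simp add: Ch_def)
  have Ch0: "Ch 0 = 0" by (simp add: Ch_def Lh_def)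
  have Ch_C: "Ch (int m) = int (C m)" if "1 \<le> m" for m
    using h2[OF that] A00 that
    by (auto simp: Ch_def Lh_def nat_diff_distrib of_nat_diff)
  \<comment> \<open>Antisymmetry doubles \<open>W n 0\<close> and at the same time replaces
    \<open>Lh\<close> by its difference \<open>Ch\<close>. As \<open>Ch\<close> is even and
    \<open>Ch 0 = 0\<close>, the terms with n < 2 j repeat those with 2 j < n, and the factor 2
    cancels.\<close>
  have "2 * W n 0 = W n 0 - W n (- 2)"
    using W_refl[of n 0] by simp
  also have "\<dots> = (\<Sum>j\<le>n. int (n choose j) * Ch (int n - 2 * int j))"
    by (simp add: W_def Ch_def sum_subtractf[symmetric] algebra_simps)
  also have "\<dots> = (\<Sum>j | 2 * j < n. int (n choose j) * Ch (int n - 2 * int j)) +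
      (\<Sum>j\<in>{j. j \<le> n \<and> n \<le> 2 * j}. int (n choose j) * Ch (int n - 2 * int j))"
    by (subst sum.union_disjoint[symmetric]) (auto intro: sum.cong finite_subset[of _ "{..n}"])
  also have "(\<Sum>j\<in>{j. j \<le> n \<and> n \<le> 2 * j}. int (n choose j) * Ch (int n - 2 * int j)) =
      (\<Sum>j\<in>{j. j \<le> n \<and> n < 2 * j}. int (n choose j) * Ch (int n - 2 * int j))"
  proof (rule sum.mono_neutral_right)
    show "\<forall>j\<in>{j. j \<le> n \<and> n \<le> 2 * j} - {j. j \<le> n \<and> n < 2 * j}. int (n choose j) * Ch (int n - 2 * int j) = 0"
    proof
      fix j assume "j \<in> {j. j \<le> n \<and> n \<le> 2 * j} - {j. j \<le> n \<and> n < 2 * j}"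
      then have "n = 2 * j" by auto
      then have "int n - 2 * int j = 0" by simp
      then show "int (n choose j) * Ch (int n - 2 * int j) = 0" using Ch0 by simp
    qed
  qed (auto intro: finite_subset[of _ "{..n}"])
  also have "\<dots> = (\<Sum>j | 2 * j < n. int (n choose j) * Ch (int n - 2 * int j))"
  proof (rule sum.reindex_bij_witness[of _ "\<lambda>j. n - j" "\<lambda>j. n - j"])
    fix j assume "j \<in> {j. j \<le> n \<and> n < 2 * j}"
    then have "int n - 2 * int (n - j) = - (int n - 2 * int j)"
      by (auto simp: of_nat_diff)
    then show "int (n choose (n - j)) * Ch (int n - 2 * int (n - j)) = int (n choose j) * Ch (int n - 2 * int j)"
      using binomial_symmetric[of j n] \<open>j \<in> _\<close> by (simp add: Ch_even[of "int n - 2 * int j", symmetric])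
  qed auto
  also have "\<dots> = (\<Sum>m=1..n. int (bcoef n m) * Ch (int m))"
    by (rule sum_choose_eq_sum_bcoef)
  also have "\<dots> = (\<Sum>m=1..n. int (bcoef n m * C m))"
    by (rule sum.cong) (auto simp: Ch_C)
  finally have "W n 0 = int (\<Sum>m=1..n. bcoef n m * C m)"
    by simp
  then have "int (A n 0) = int (\<Sum>m=1..n. bcoef n m * C m)"
    using AW[of n 0] by simp
  then show ?thesis by (simp only: of_nat_eq_iff)
qed

text \<open>The equation p x = nx x means that \<open>nx s k x\<close> is fixed by the vertex
  rotation \<open>nx s k \<circ> p\<close>, i.e. that the corner between x and the next side is a
  univalent vertex. Such a vertex has a single corner and so belongs to one polygon, which permits
  treating the polygons one by one.\<close>

definition leafless :: "nat \<Rightarrow> (nat \<Rightarrow> nat) \<Rightarrow> (nat \<times> nat \<Rightarrow> nat \<times> nat) \<Rightarrow> nat \<Rightarrow> bool" where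
  "leafless s k p i \<longleftrightarrow> (\<forall>j<k i. p (i, j) \<noteq> nx s k (i, j))"

definition leafless_maps :: "nat \<Rightarrow> nat \<Rightarrow> (nat \<Rightarrow> nat) \<Rightarrow> nat set \<Rightarrow> (nat \<times> nat \<Rightarrow> nat \<times> nat) set" where
  "leafless_maps g s k I = {p \<in> Maps g s k. \<forall>i\<in>I. leafless s k p i}"

lemma isolated_polygon:
  assumes "p \<in> gluings g s H \<tau> c" "i \<in> {1..s}" "\<And>x. x \<in> H \<Longrightarrow> c x = i \<Longrightarrow> c (p x) = i"
  shows "s = 1"
proof (rule ccontr)
  assume "s \<noteq> 1"
  then obtain j where j: "j \<in> {1..s}" "j \<noteq> i"
    using assms(2) by (cases "i = 1") (auto intro: that[of 1] that[of 2])
  have "(i, j) \<in> {(c x, c (p x)) |x. x \<in> H}\<^sup>*"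
    using assms j by (auto simp: gluings_def)
  then have "j = i"
    by induction (use assms(3) in auto)
  then show False using j by simp
qed

text \<open>An empty polygon is glued to nothing, so by connectedness it would be the only one, and
  then 1 = 2 - 2 g fails by parity. This gives the boundary value of the recurrence after both sides
  of a 2-gon have been cut off.\<close>

lemma gluings_empty_polygon:
  assumes "i \<in> {1..s}" "k i = 0"
  shows "gluings g s (sides s k) (nx s k) fst = {}"
proof (rule ccontr)
  assume "gluings g s (sides s k) (nx s k) fst \<noteq> {}"
  then obtain p where p: "p \<in> gluings g s (sides s k) (nx s k) fst" by auto
  have s: "s = 1"
    by (rule isolated_polygon[OF p assms(1)]) (use assms in \<open>auto simp: in_sides\<close>)
  then have "sides s k = {}" using assms by (auto simp: sides_def)
  then have "int s = 2 - 2 * int g" using p by (simp add: gluings_def)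
  then show False using s by presburger
qed

text \<open>A 2-gon with its two sides glued is a sphere by itself. When leaves are cut off, it is
  the case that \<open>leaf_removal\<close> cannot treat; the exclusion of (0, 1) disposes of
  it.\<close>

lemma gluings_closed_bigon:
  assumes "i \<in> {1..s}" "k i = 2" "p \<in> gluings g s (sides s k) (nx s k) fst" "p (i, 0) = (i, 1)"
  shows "(g, s) = (0, 1)"
proof -
  have pp: "p \<in> pairings (sides s k)" using assms gluings_pairings by blast
  have p1: "p (i, 1) = (i, 0)" using pairings_double[OF pp, of "(i, 0)"] assms by simp
  have s: "s = 1"
    by (rule isolated_polygon[OF assms(3,1)]) (use assms p1 in \<open>auto simp: in_sides less_2_cases_iff\<close>)
  then have i: "i = 1" using assms by simp
  have H: "sides s k = {(1, 0), (1, 1)}"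
    using s i assms by (auto simp: sides_def)
  have "orbit (nx s k \<circ> p) (1, 0) = {(1, 0)}" "orbit (nx s k \<circ> p) (1, 1) = {(1, 1)}"
    unfolding orbit_eq_singleton_iff using assms(4) p1 assms(2) i H by (auto simp: nx_simp)
  then have "orbit (nx s k \<circ> p) ` sides s k = {{(1, 0)}, {(1, 1)}}"
    using H by auto
  then have "int s + 1 = 2 - 2 * int g"
    using assms(3) H by (simp add: gluings_def)
  then show ?thesis using s by auto
qed

text \<open>The family that obeys the ballot recurrence: no two consecutive sides among the first a
  sides of polygon i are glued to each other, and the polygons in \<open>I\<close> are already free
  of leaves. Nothing is required of polygon i for a \<le> 1, and for a = k i only the corner at the
  marked vertex is untested.\<close>

definition partly_leafless ::
  "nat \<Rightarrow> nat \<Rightarrow> (nat \<Rightarrow> nat) \<Rightarrow> nat set \<Rightarrow> nat \<Rightarrow> nat \<Rightarrow> (nat \<times> nat \<Rightarrow> nat \<times> nat) set" where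
  "partly_leafless g s k I i a = {p \<in> gluings g s (sides s k) (nx s k) fst.
     (\<forall>i'\<in>I. leafless s k p i') \<and> (\<forall>j. Suc j < a \<longrightarrow> p (i, j) \<noteq> (i, Suc j))}"

lemma finite_partly_leafless: "finite (partly_leafless g s k I i a)"
  unfolding partly_leafless_def by (rule finite_subset[OF _ finite_gluings[OF finite_sides]]) auto

text \<open>The next corner to be tested lies between the sides a - 1 and a. Either it is no leaf,
  or these sides are glued and can be cut off. In the remaining (n - 2)-gon the old sides a - 2 and
  a + 1 become neighbours with no condition on them, so only a - 1 sides count as tested.\<close>

lemma card_partly_leafless_step:
  assumes gs: "(g, s) \<noteq> (0, 1)" and i: "i \<in> {1..s}" "i \<notin> I" and I: "I \<subseteq> {1..s}"
    and k: "k i = n" and k': "k' = k(i := n - 2)" and a: "1 \<le> a" "a < n"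
  shows "card (partly_leafless g s k I i a) =
    card (partly_leafless g s k I i (Suc a)) + card (partly_leafless g s k' I i (a - 1))"
proof -
  define P where "P p \<longleftrightarrow> (\<forall>i'\<in>I. leafless s k p i') \<and> (\<forall>j. Suc j < a \<longrightarrow> p (i, j) \<noteq> (i, Suc j))" for p
  define P' where "P' p \<longleftrightarrow> (\<forall>i'\<in>I. leafless s k' p i') \<and> (\<forall>j. Suc j < a - 1 \<longrightarrow> p (i, j) \<noteq> (i, Suc j))" for p
  let ?G = "{p \<in> gluings g s (sides s k) (nx s k) fst. p (i, a - 1) = (i, a) \<and> P p}"
  have "partly_leafless g s k I i a = partly_leafless g s k I i (Suc a) \<union> ?G"
  proof -
    obtain b where b: "a = Suc b" using a by (cases a) auto
    have "(\<forall>j. Suc j < Suc a \<longrightarrow> Q j) \<longleftrightarrow> (\<forall>j. Suc j < a \<longrightarrow> Q j) \<and> Q b" for Q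
      unfolding b by (auto simp: less_Suc_eq)
    then show ?thesis
      unfolding partly_leafless_def P_def using b by auto
  qed
  moreover have "partly_leafless g s k I i (Suc a) \<inter> ?G = {}"
  proof -
    have "p (i, a - 1) \<noteq> (i, a)" if "p \<in> partly_leafless g s k I i (Suc a)" for p
    proof -
      have "\<forall>j. Suc j < Suc a \<longrightarrow> p (i, j) \<noteq> (i, Suc j)"
        using that by (simp add: partly_leafless_def)
      moreover have "Suc (a - 1) = a" using a by simp
      ultimately show ?thesis by (metis lessI)
    qed
    then show ?thesis by auto
  qed
  moreover have "finite ?G" by (rule finite_subset[OF _ finite_gluings[OF finite_sides]]) auto
  ultimately have 1: "card (partly_leafless g s k I i a) = card (partly_leafless g s k I i (Suc a)) + card ?G"
    using finite_partly_leafless by (simp add: card_Un_disjoint)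
  have 2: "partly_leafless g s k' I i (a - 1) = {p \<in> gluings g s (sides s k') (nx s k') fst. P' p}"
    unfolding partly_leafless_def P'_def by auto
  have "card ?G = card {p \<in> gluings g s (sides s k') (nx s k') fst. P' p}"
  proof (cases "n = 2")
    case True
    then have a1: "a = 1" using a by simp
    then have "?G = {}"
      using gluings_closed_bigon[of i s k] i(1) k True gs by auto
    moreover have "gluings g s (sides s k') (nx s k') fst = {}"
      by (rule gluings_empty_polygon[OF i(1)]) (use True k' in auto)
    ultimately show ?thesis by (simp only: card.empty) simp
  next
    case False
    then have n: "3 \<le> n" using a by auto
    define \<iota> :: "nat \<times> nat \<Rightarrow> nat \<times> nat" where
      "\<iota> = (\<lambda>(i', j). if i' = i \<and> a - 1 \<le> j then (i', j + 2) else (i', j))"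
    define \<kappa> :: "nat \<times> nat \<Rightarrow> nat \<times> nat" where
      "\<kappa> = (\<lambda>(i', j). if i' = i \<and> a - 1 \<le> j then (i', j - 2) else (i', j))"
    have \<iota>inj: "\<iota> u = \<iota> v \<longleftrightarrow> u = v" for u v
      by (cases u, cases v) (auto simp: \<iota>_def split: if_splits)
    show ?thesis
    proof (rule leaf_removal[OF finite_sides finite_sides nx_permutes nx_permutes, where \<iota> = \<iota>])
      show "bij_betw \<iota> (sides s k') (sides s k - {(i, a - 1), (i, a)})"
        by (rule bij_betw_byWitness[where f' = \<kappa>])
           (use a k k' i n in \<open>auto simp: \<iota>_def \<kappa>_def in_sides split: if_splits\<close>)
      show "(i, a - 1) \<in> sides s k" "(i, a) \<in> sides s k" "(i, a - 1) \<noteq> (i, a)"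
        using a k i by (auto simp: in_sides)
      show "nx s k (i, a - 1) = (i, a)" "nx s k (i, a) \<noteq> (i, a - 1)"
        using a k i n by (auto simp: in_sides nx_simp)
      show "\<iota> (nx s k' u) = (if nx s k (\<iota> u) = (i, a - 1) then nx s k (i, a) else nx s k (\<iota> u))"
        if "u \<in> sides s k'" for u
      proof -
        obtain i' j where u: "u = (i', j)" by (cases u)
        have u': "(i', j) \<in> sides s k'" using that u by simp
        show ?thesis
        proof (cases "i' = i")
          case False
          then have "(i', j) \<in> sides s k" using u' k' by (auto simp: in_sides)
          then show ?thesis using False u u' k' by (auto simp: \<iota>_def nx_simp)
        next
          case True
          then have j: "j < n - 2" using u' k' by (auto simp: in_sides)
          then have s: "(i, j) \<in> sides s k" "(i, j + 2) \<in> sides s k" "(i, a) \<in> sides s k"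
            using i k a by (auto simp: in_sides)
          then show ?thesis using True u u' k' j k a n
            by (auto simp: \<iota>_def nx_simp)
        qed
      qed
      show "fst (\<iota> u) = fst u" for u by (cases u) (auto simp: \<iota>_def)
      show "fst (i, a - 1) = fst (i, a)" by simp
      fix p p' assume p: "p \<in> pairings (sides s k)" and p': "p' \<in> pairings (sides s k')"
        and px: "p (i, a - 1) = (i, a)" and \<iota>p: "\<And>u. u \<in> sides s k' \<Longrightarrow> \<iota> (p' u) = p (\<iota> u)"
      have py: "p (i, a) = (i, a - 1)" using pairings_double[OF p] px by metis
      have "leafless s k p i' \<longleftrightarrow> leafless s k' p' i'" if "i' \<in> I" for i'
      proof -
        have i': "i' \<noteq> i" "k' i' = k i'" "i' \<in> {1..s}" using that i I k' by auto
        have "p (i', j) = nx s k (i', j) \<longleftrightarrow> p' (i', j) = nx s k' (i', j)" if "j < k i'" for j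
        proof -
          have 1: "(i', j) \<in> sides s k" "(i', j) \<in> sides s k'" using i' that by (auto simp: in_sides)
          have "\<iota> (p' (i', j)) = p (i', j)" using \<iota>p[OF 1(2)] i' by (simp add: \<iota>_def)
          moreover have "\<iota> (nx s k' (i', j)) = nx s k (i', j)"
            using 1 i' by (simp add: \<iota>_def nx_simp)
          ultimately show ?thesis using \<iota>inj by metis
        qed
        then show ?thesis using i' by (simp add: leafless_def)
      qed
      moreover have "(\<forall>j. Suc j < a \<longrightarrow> p (i, j) \<noteq> (i, Suc j)) \<longleftrightarrow>
          (\<forall>j. Suc j < a - 1 \<longrightarrow> p' (i, j) \<noteq> (i, Suc j))"
      proof -
        have "p (i, j) = (i, Suc j) \<longleftrightarrow> p' (i, j) = (i, Suc j)" if "Suc j < a - 1" for j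
        proof -
          have "(i, j) \<in> sides s k'" using that i k' a by (auto simp: in_sides)
          then have "\<iota> (p' (i, j)) = p (i, j)" using \<iota>p that by (simp add: \<iota>_def)
          moreover have "\<iota> (i, Suc j) = (i, Suc j)" using that by (simp add: \<iota>_def)
          ultimately show ?thesis using \<iota>inj by metis
        qed
        \<comment> \<open>The condition on the sides a - 2 and a - 1 has no counterpart after the
          cut; it is automatic, since side a - 1 is glued to side a.\<close>
        moreover have "p (i, j) \<noteq> (i, Suc j)" if "Suc j < a" "\<not> Suc j < a - 1" for j
        proof
          assume *: "p (i, j) = (i, Suc j)"
          have "Suc j = a - 1" using that by simp
          then have "p (i, a - 1) = (i, j)" using * pairings_double[OF p] by metis
          then show False using px that by simp
        qed
        ultimately show ?thesis using a by (meson diff_le_self less_le_trans)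
      qed
      ultimately show "P p \<longleftrightarrow> P' p'" by (simp add: P_def P'_def)
    qed
  qed
  then show ?thesis using 1 2 by simp
qed

text \<open>Only the corner at the marked vertex, between the last side and side 0, is left to test.
  If these sides are glued, both are cut off and the marked vertex moves to the start of side 1. No
  consecutive sides of the rest are glued, which gives a diagonal value of the recurrence
  again.\<close>

lemma card_partly_leafless_cyclic:
  assumes gs: "(g, s) \<noteq> (0, 1)" and i: "i \<in> {1..s}" "i \<notin> I" and I: "I \<subseteq> {1..s}"
    and k: "k i = n" and k': "k' = k(i := n - 2)" and n: "1 \<le> n"
  shows "card (partly_leafless g s k I i n) = card (leafless_maps g s k (insert i I)) +
    (if 2 \<le> n then card (partly_leafless g s k' I i (n - 2)) else 0)"
proof -
  have lf: "leafless_maps g s k (insert i I) = {p \<in> gluings g s (sides s k) (nx s k) fst.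
      (\<forall>i'\<in>I. leafless s k p i') \<and> leafless s k p i}"
    by (auto simp: leafless_maps_def Maps_eq_gluings)
  have nx: "nx s k (i, j) = (i, if Suc j = n then 0 else Suc j)" if "j < n" for j
    using that nx_simp[of i j s k] i k by (simp add: in_sides)
  have leafless_i: "leafless s k p i \<longleftrightarrow> (\<forall>j. Suc j < n \<longrightarrow> p (i, j) \<noteq> (i, Suc j)) \<and> p (i, n - 1) \<noteq> (i, 0)" for p
  proof -
    have "leafless s k p i \<longleftrightarrow> (\<forall>j<n. p (i, j) \<noteq> (i, if Suc j = n then 0 else Suc j))"
      using nx by (simp add: leafless_def k)
    also have "\<dots> \<longleftrightarrow> (\<forall>j. Suc j < n \<longrightarrow> p (i, j) \<noteq> (i, Suc j)) \<and> p (i, n - 1) \<noteq> (i, 0)"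
    proof -
      obtain n' where n': "n = Suc n'" using n by (cases n) auto
      show ?thesis unfolding n' All_less_Suc by auto
    qed
    finally show ?thesis .
  qed
  show ?thesis
  \<comment> \<open>For n = 1 a side cannot be glued to itself, and for n = 2 gluing the last side
    to side 0 is the gluing already tested, so the cyclic condition adds nothing. The correction
    term is absent or counts gluings with an empty polygon.\<close>
  proof (cases "n \<le> 2")
    case True
    have "leafless s k p i \<longleftrightarrow> (\<forall>j. Suc j < n \<longrightarrow> p (i, j) \<noteq> (i, Suc j))"
      if p: "p \<in> gluings g s (sides s k) (nx s k) fst" for p
    proof (cases "n = 1")
      case True
      have "(i, 0) \<in> sides s k" using i k True by (simp add: in_sides)
      then show ?thesis using True pairings_neq[OF gluings_pairings[OF p]] by (simp add: leafless_i)
    next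
      case False
      then have "n = 2" using True n by simp
      then show ?thesis using pairings_double[OF gluings_pairings[OF p]]
        by (auto simp: leafless_i less_Suc_eq numeral_2_eq_2) metis
    qed
    then have "partly_leafless g s k I i n = leafless_maps g s k (insert i I)"
      unfolding lf partly_leafless_def by auto
    moreover have "partly_leafless g s k' I i (n - 2) = {}" if "2 \<le> n"
    proof -
      have "gluings g s (sides s k') (nx s k') fst = {}"
        by (rule gluings_empty_polygon[OF i(1)]) (use True that k' in auto)
      then show ?thesis by (simp add: partly_leafless_def)
    qed
    ultimately show ?thesis by simp
  next
    case False
    then have n: "3 \<le> n" by simp
    define P where "P p \<longleftrightarrow> (\<forall>i'\<in>I. leafless s k p i') \<and> (\<forall>j. Suc j < n \<longrightarrow> p (i, j) \<noteq> (i, Suc j))" for p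
    define P' where "P' p \<longleftrightarrow> (\<forall>i'\<in>I. leafless s k' p i') \<and> (\<forall>j. Suc j < n - 2 \<longrightarrow> p (i, j) \<noteq> (i, Suc j))" for p
    let ?G = "{p \<in> gluings g s (sides s k) (nx s k) fst. p (i, n - 1) = (i, 0) \<and> P p}"
    have "partly_leafless g s k I i n = leafless_maps g s k (insert i I) \<union> ?G"
      unfolding partly_leafless_def lf P_def leafless_i by auto
    moreover have "leafless_maps g s k (insert i I) \<inter> ?G = {}"
      unfolding lf leafless_i by auto
    moreover have "finite ?G" "finite (leafless_maps g s k (insert i I))"
      unfolding lf by (rule finite_subset[OF _ finite_gluings[OF finite_sides]]; auto)+
    ultimately have 1: "card (partly_leafless g s k I i n) = card (leafless_maps g s k (insert i I)) + card ?G"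
      by (simp add: card_Un_disjoint)
    have 2: "partly_leafless g s k' I i (n - 2) = {p \<in> gluings g s (sides s k') (nx s k') fst. P' p}"
      unfolding partly_leafless_def P'_def by auto
    define \<iota> :: "nat \<times> nat \<Rightarrow> nat \<times> nat" where
      "\<iota> = (\<lambda>(i', j). if i' = i then (i', Suc j) else (i', j))"
    define \<kappa> :: "nat \<times> nat \<Rightarrow> nat \<times> nat" where
      "\<kappa> = (\<lambda>(i', j). if i' = i then (i', j - 1) else (i', j))"
    have \<iota>inj: "\<iota> u = \<iota> v \<longleftrightarrow> u = v" for u v
      by (cases u, cases v) (auto simp: \<iota>_def split: if_splits)
    have "card ?G = card {p \<in> gluings g s (sides s k') (nx s k') fst. P' p}"
    proof (rule leaf_removal[OF finite_sides finite_sides nx_permutes nx_permutes, where \<iota> = \<iota>])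
      show "bij_betw \<iota> (sides s k') (sides s k - {(i, n - 1), (i, 0)})"
        by (rule bij_betw_byWitness[where f' = \<kappa>])
           (use k k' i n in \<open>auto simp: \<iota>_def \<kappa>_def in_sides split: if_splits\<close>)
      show "(i, n - 1) \<in> sides s k" "(i, 0) \<in> sides s k" "(i, n - 1) \<noteq> (i, 0)"
        using k i n by (auto simp: in_sides)
      show "nx s k (i, n - 1) = (i, 0)" "nx s k (i, 0) \<noteq> (i, n - 1)"
        using n nx by auto
      show "\<iota> (nx s k' u) = (if nx s k (\<iota> u) = (i, n - 1) then nx s k (i, 0) else nx s k (\<iota> u))"
        if "u \<in> sides s k'" for u
      proof -
        obtain i' j where u: "u = (i', j)" by (cases u)
        have u': "(i', j) \<in> sides s k'" using that u by simp
        show ?thesis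
        proof (cases "i' = i")
          case False
          then have "(i', j) \<in> sides s k" using u' k' by (auto simp: in_sides)
          then show ?thesis using False u u' k' by (auto simp: \<iota>_def nx_simp)
        next
          case True
          then have j: "j < n - 2" using u' k' by (auto simp: in_sides)
          then show ?thesis using True u u' k' k n
            by (auto simp: \<iota>_def nx_simp nx)
        qed
      qed
      show "fst (\<iota> u) = fst u" for u by (cases u) (auto simp: \<iota>_def)
      show "fst (i, n - 1) = fst (i, 0)" by simp
      fix p p' assume p: "p \<in> pairings (sides s k)" and p': "p' \<in> pairings (sides s k')"
        and px: "p (i, n - 1) = (i, 0)" and \<iota>p: "\<And>u. u \<in> sides s k' \<Longrightarrow> \<iota> (p' u) = p (\<iota> u)"
      have py: "p (i, 0) = (i, n - 1)" using pairings_double[OF p] px by metis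
      have "leafless s k p i' \<longleftrightarrow> leafless s k' p' i'" if "i' \<in> I" for i'
      proof -
        have i': "i' \<noteq> i" "k' i' = k i'" "i' \<in> {1..s}" using that i I k' by auto
        have "p (i', j) = nx s k (i', j) \<longleftrightarrow> p' (i', j) = nx s k' (i', j)" if "j < k i'" for j
        proof -
          have 1: "(i', j) \<in> sides s k" "(i', j) \<in> sides s k'" using i' that by (auto simp: in_sides)
          have "\<iota> (p' (i', j)) = p (i', j)" using \<iota>p[OF 1(2)] i' by (simp add: \<iota>_def)
          moreover have "\<iota> (nx s k' (i', j)) = nx s k (i', j)"
            using 1 i' by (simp add: \<iota>_def nx_simp)
          ultimately show ?thesis using \<iota>inj by metis
        qed
        then show ?thesis using i' by (simp add: leafless_def)
      qed
      moreover have "(\<forall>j. Suc j < n \<longrightarrow> p (i, j) \<noteq> (i, Suc j)) \<longleftrightarrow>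
          (\<forall>j. Suc j < n - 2 \<longrightarrow> p' (i, j) \<noteq> (i, Suc j))"
      proof -
        have *: "p (i, Suc j) = (i, Suc (Suc j)) \<longleftrightarrow> p' (i, j) = (i, Suc j)" if "Suc j < n - 2" for j
        proof -
          have "(i, j) \<in> sides s k'" using that i k' by (auto simp: in_sides)
          then have "\<iota> (p' (i, j)) = p (i, Suc j)" using \<iota>p that by (simp add: \<iota>_def)
          moreover have "\<iota> (i, Suc j) = (i, Suc (Suc j))" by (simp add: \<iota>_def)
          ultimately show ?thesis using \<iota>inj by metis
        qed
        \<comment> \<open>Pairs containing side 0 or side n - 1 are harmless, because these two
          sides are glued to each other. All other pairs correspond under a shift of the index by
          one.\<close>
        have first: "p (i, 0) \<noteq> (i, Suc 0)" using py n by simp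
        have last: "p (i, j) \<noteq> (i, Suc j)" if "Suc j = n - 1" for j
        proof
          assume *: "p (i, j) = (i, Suc j)"
          then have "p (i, n - 1) = (i, j)" using that pairings_double[OF p] by metis
          then show False using px that n by simp
        qed
        show ?thesis
        proof (intro iffI allI impI)
          fix j assume "\<forall>j. Suc j < n \<longrightarrow> p (i, j) \<noteq> (i, Suc j)" "Suc j < n - 2"
          then show "p' (i, j) \<noteq> (i, Suc j)" using *[of j] by simp
        next
          fix j assume a: "\<forall>j. Suc j < n - 2 \<longrightarrow> p' (i, j) \<noteq> (i, Suc j)" "Suc j < n"
          show "p (i, j) \<noteq> (i, Suc j)"
          proof (cases j)
            case 0
            then show ?thesis using first by simp
          next
            case (Suc l)
            show ?thesis
            proof (cases "Suc j = n - 1")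
              case True
              then show ?thesis by (rule last)
            next
              case False
              then have "Suc l < n - 2" using Suc a(2) by simp
              then show ?thesis using *[of l] a(1) Suc by simp
            qed
          qed
        qed
      qed
      ultimately show "P p \<longleftrightarrow> P' p'" by (simp add: P_def P'_def)
    qed
    then show ?thesis using 1 2 n by simp
  qed
qed

text \<open>Letting the length n of polygon i vary makes the number of
  \<open>partly_leafless\<close> gluings a solution of the ballot recurrence. Here
  \<open>bcoef n m\<close> is the number of walks of n steps +1 or -1 from 0 to m.\<close>

lemma card_leafless_maps_insert:
  assumes gs: "(g, s) \<noteq> (0, 1)" and i: "i \<in> {1..s}" "i \<notin> I" and I: "I \<subseteq> {1..s}" and k: "1 \<le> k i"
  shows "card (leafless_maps g s k I) =
    (\<Sum>m=1..k i. bcoef (k i) m * card (leafless_maps g s (k(i := m)) (insert i I)))"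
proof -
  define A where "A n a = card (partly_leafless g s (k(i := n)) I i a)" for n a
  define C where "C m = card (leafless_maps g s (k(i := m)) (insert i I))" for m
  have "A (k i) 0 = (\<Sum>m=1..k i. bcoef (k i) m * C m)"
  proof (rule ballot_recurrence_solution[OF _ _ _ _ k])
    show "A 0 0 = 0"
      using gluings_empty_polygon[OF i(1), of "k(i := 0)" g] by (simp add: A_def partly_leafless_def)
    show "A n 0 = A n 1" for n
      by (simp add: A_def partly_leafless_def)
    show "A n a = A n (Suc a) + A (n - 2) (a - 1)" if "1 \<le> a" "a < n" for n a
      unfolding A_def by (rule card_partly_leafless_step[OF gs i I]) (use that in auto)
    show "A m m = C m + (if 2 \<le> m then A (m - 2) (m - 2) else 0)" if "1 \<le> m" for m
      unfolding A_def C_def by (rule card_partly_leafless_cyclic[OF gs i I]) (use that in auto)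
  qed
  moreover have "A (k i) 0 = card (leafless_maps g s k I)"
    by (simp add: A_def partly_leafless_def leafless_maps_def Maps_eq_gluings)
  ultimately show ?thesis by (simp add: C_def)
qed

text \<open>Induction over the set \<open>I\<close> of polygons already freed of leaves. It works
  because cutting leaves off one polygon does not affect leaflessness of the others.\<close>

lemma card_Maps_sum_leafless:
  assumes gs: "(g, s) \<noteq> (0, 1)" and k: "\<And>i. i \<in> {1..s} \<Longrightarrow> 1 \<le> k i"
  shows "card (Maps g s k) = (\<Sum>m\<in>(\<Pi>\<^sub>E i\<in>{1..s}. {1..k i}).
    (\<Prod>i=1..s. bcoef (k i) (m i)) * card (leafless_maps g s m {1..s}))"
proof -
  have "card (leafless_maps g s k {}) = (\<Sum>m\<in>(\<Pi>\<^sub>E i\<in>I. {1..k i}).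
      (\<Prod>i\<in>I. bcoef (k i) (m i)) * card (leafless_maps g s (\<lambda>i. if i \<in> I then m i else k i) I))"
    if "I \<subseteq> {1..s}" for I
    using finite_subset[OF that finite_atLeastAtMost] that
  proof (induction I)
    case empty
    then show ?case by simp
  next
    case (insert i I)
    then have i: "i \<in> {1..s}" "i \<notin> I" and I: "I \<subseteq> {1..s}" by auto
    have "(\<Sum>m\<in>(\<Pi>\<^sub>E j\<in>insert i I. {1..k j}). (\<Prod>j\<in>insert i I. bcoef (k j) (m j)) *
          card (leafless_maps g s (\<lambda>j. if j \<in> insert i I then m j else k j) (insert i I))) =
        (\<Sum>(x, m)\<in>{1..k i} \<times> (\<Pi>\<^sub>E j\<in>I. {1..k j}). (\<Prod>j\<in>insert i I. bcoef (k j) ((m(i := x)) j)) *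
          card (leafless_maps g s (\<lambda>j. if j \<in> insert i I then (m(i := x)) j else k j) (insert i I)))"
      unfolding PiE_insert_eq
      by (subst sum.reindex[OF inj_combinator[OF i(2)]]) (simp add: case_prod_unfold)
    also have "\<dots> = (\<Sum>(x, m)\<in>{1..k i} \<times> (\<Pi>\<^sub>E j\<in>I. {1..k j}). (\<Prod>j\<in>I. bcoef (k j) (m j)) * (bcoef (k i) x *
          card (leafless_maps g s ((\<lambda>j. if j \<in> I then m j else k j)(i := x)) (insert i I))))"
    proof (rule sum.cong[OF refl], clarify)
      fix x m
      have "(\<lambda>j. if j \<in> insert i I then (m(i := x)) j else k j) = (\<lambda>j. if j \<in> I then m j else k j)(i := x)"
        using i by auto
      moreover have "(\<Prod>j\<in>insert i I. bcoef (k j) ((m(i := x)) j)) = bcoef (k i) x * (\<Prod>j\<in>I. bcoef (k j) (m j))"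
      proof -
        have "(\<Prod>j\<in>I. bcoef (k j) ((m(i := x)) j)) = (\<Prod>j\<in>I. bcoef (k j) (m j))"
          by (rule prod.cong) (use i in auto)
        then show ?thesis using insert.hyps by simp
      qed
      ultimately show "(\<Prod>j\<in>insert i I. bcoef (k j) ((m(i := x)) j)) *
          card (leafless_maps g s (\<lambda>j. if j \<in> insert i I then (m(i := x)) j else k j) (insert i I)) =
          (\<Prod>j\<in>I. bcoef (k j) (m j)) * (bcoef (k i) x *
          card (leafless_maps g s ((\<lambda>j. if j \<in> I then m j else k j)(i := x)) (insert i I)))"
        by simp
    qed
    also have "\<dots> = (\<Sum>m\<in>(\<Pi>\<^sub>E j\<in>I. {1..k j}). (\<Prod>j\<in>I. bcoef (k j) (m j)) * (\<Sum>x=1..k i. bcoef (k i) x *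
          card (leafless_maps g s ((\<lambda>j. if j \<in> I then m j else k j)(i := x)) (insert i I))))"
      by (subst sum.cartesian_product[symmetric], subst sum.swap) (simp add: sum_distrib_left)
    also have "\<dots> = (\<Sum>m\<in>(\<Pi>\<^sub>E j\<in>I. {1..k j}). (\<Prod>j\<in>I. bcoef (k j) (m j)) *
          card (leafless_maps g s (\<lambda>j. if j \<in> I then m j else k j) I))"
    proof (rule sum.cong[OF refl])
      fix m
      have "k i \<ge> 1" using k i by simp
      then show "(\<Prod>j\<in>I. bcoef (k j) (m j)) * (\<Sum>x=1..k i. bcoef (k i) x *
          card (leafless_maps g s ((\<lambda>j. if j \<in> I then m j else k j)(i := x)) (insert i I))) =
          (\<Prod>j\<in>I. bcoef (k j) (m j)) * card (leafless_maps g s (\<lambda>j. if j \<in> I then m j else k j) I)"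
        using card_leafless_maps_insert[OF gs i I, of "\<lambda>j. if j \<in> I then m j else k j"] i by simp
    qed
    finally show ?case using insert.IH[OF I] by simp
  qed
  from this[OF order_refl]
  have "card (Maps g s k) = (\<Sum>m\<in>(\<Pi>\<^sub>E i\<in>{1..s}. {1..k i}). (\<Prod>i=1..s. bcoef (k i) (m i)) *
      card (leafless_maps g s (\<lambda>i. if i \<in> {1..s} then m i else k i) {1..s}))"
    by (simp add: leafless_maps_def)
  also have "\<dots> = (\<Sum>m\<in>(\<Pi>\<^sub>E i\<in>{1..s}. {1..k i}). (\<Prod>i=1..s. bcoef (k i) (m i)) *
      card (leafless_maps g s m {1..s}))"
  proof (rule sum.cong[OF refl])
    fix m
    let ?m = "\<lambda>i. if i \<in> {1..s} then m i else k i"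
    have s: "sides s ?m = sides s m" by (auto simp: sides_def)
    then have "nx s ?m = nx s m" by (auto simp: nx_def next_side_def sides_def fun_eq_iff)
    then have "leafless_maps g s ?m {1..s} = leafless_maps g s m {1..s}"
      using s by (auto simp: leafless_maps_def Maps_eq_gluings leafless_def)
    then show "(\<Prod>i=1..s. bcoef (k i) (m i)) * card (leafless_maps g s ?m {1..s}) =
        (\<Prod>i=1..s. bcoef (k i) (m i)) * card (leafless_maps g s m {1..s})" by simp
  qed
  finally show ?thesis .
qed

lemma card_bijections:
  assumes "finite A" "finite B" "card A = card B"
  shows "card {\<phi> \<in> A \<rightarrow>\<^sub>E B. bij_betw \<phi> A B} = fact (card A)"
proof -
  obtain \<phi>0 where \<phi>0: "bij_betw \<phi>0 A B"
    using assms finite_same_card_bij by blast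
  define \<psi> where "\<psi> = inv_into A \<phi>0"
  have \<psi>: "bij_betw \<psi> B A" unfolding \<psi>_def using \<phi>0 by (rule bij_betw_inv_into)
  have \<psi>\<phi>: "\<psi> (\<phi>0 a) = a" if "a \<in> A" for a
    using \<phi>0 that by (simp add: \<psi>_def bij_betw_inv_into_left)
  have \<phi>\<psi>: "\<phi>0 (\<psi> b) = b" if "b \<in> B" for b
    using \<phi>0 that by (simp add: \<psi>_def bij_betw_inv_into_right)
  have "bij_betw (\<lambda>p. restrict (\<phi>0 \<circ> p) A) {p. p permutes A} {\<phi> \<in> A \<rightarrow>\<^sub>E B. bij_betw \<phi> A B}"
  proof (rule bij_betw_byWitness[where f' = "\<lambda>\<phi> a. if a \<in> A then \<psi> (\<phi> a) else a"])
    show "\<forall>p\<in>{p. p permutes A}. (\<lambda>a. if a \<in> A then \<psi> (restrict (\<phi>0 \<circ> p) A a) else a) = p"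
      by (auto simp: fun_eq_iff \<psi>\<phi> permutes_in_image permutes_not_in)
    show "\<forall>\<phi>\<in>{\<phi> \<in> A \<rightarrow>\<^sub>E B. bij_betw \<phi> A B}. restrict (\<phi>0 \<circ> (\<lambda>a. if a \<in> A then \<psi> (\<phi> a) else a)) A = \<phi>"
      by (auto simp: fun_eq_iff \<phi>\<psi> PiE_def Pi_def extensional_def)
    show "(\<lambda>p. restrict (\<phi>0 \<circ> p) A) ` {p. p permutes A} \<subseteq> {\<phi> \<in> A \<rightarrow>\<^sub>E B. bij_betw \<phi> A B}"
    proof clarify
      fix p assume p: "p permutes A"
      have "bij_betw (\<phi>0 \<circ> p) A B"
        using permutes_imp_bij[OF p] \<phi>0 by (rule bij_betw_trans)
      moreover from this have "bij_betw (restrict (\<phi>0 \<circ> p) A) A B"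
        by (subst bij_betw_cong[of A _ "\<phi>0 \<circ> p"]) auto
      ultimately show "restrict (\<phi>0 \<circ> p) A \<in> A \<rightarrow>\<^sub>E B \<and> bij_betw (restrict (\<phi>0 \<circ> p) A) A B"
        by (auto simp: bij_betw_def)
    qed
    show "(\<lambda>\<phi> a. if a \<in> A then \<psi> (\<phi> a) else a) ` {\<phi> \<in> A \<rightarrow>\<^sub>E B. bij_betw \<phi> A B} \<subseteq> {p. p permutes A}"
    proof clarify
      fix \<phi> assume "\<phi> \<in> A \<rightarrow>\<^sub>E B" "bij_betw \<phi> A B"
      then have "bij_betw (\<psi> \<circ> \<phi>) A A"
        using \<psi> by (blast intro: bij_betw_trans)
      then have "bij_betw (\<lambda>a. if a \<in> A then \<psi> (\<phi> a) else a) A A"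
        by (subst bij_betw_cong[of A _ "\<psi> \<circ> \<phi>"]) auto
      then show "(\<lambda>a. if a \<in> A then \<psi> (\<phi> a) else a) permutes A"
        by (rule bij_imp_permutes) auto
    qed
  qed
  from bij_betw_same_card[OF this] show ?thesis
    using card_permutations[OF refl assms(1)] by simp
qed

section \<open>Suppressing bivalent vertices\<close>

text \<open>\<open>nx s m \<circ> p\<close> turns around the vertices, so its square fixes exactly
  the corners at vertices of valence 1 or 2. The remaining corners lie at vertices of valence at
  least 3, and each becomes the start of a half-edge of the core graph.\<close>

definition core_set :: "nat \<Rightarrow> (nat \<Rightarrow> nat) \<Rightarrow> (nat \<times> nat \<Rightarrow> nat \<times> nat) \<Rightarrow> (nat \<times> nat) set" where
  "core_set s m p = {x \<in> sides s m. nx s m (p (nx s m (p x))) \<noteq> x}"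

text \<open>A labelled graph is given by its face permutation \<open>\<tau>\<close>, its edge involution \<open>f\<close> and the cell
  numbers \<open>c\<close> of the half-edges; the vertex permutation is \<open>\<tau> \<circ> f\<close>.  The last condition says that all
  vertices have valence at least 3.\<close>

definition labelled_graphs :: "nat \<Rightarrow> nat \<Rightarrow> nat \<Rightarrow> ((nat \<Rightarrow> nat) \<times> (nat \<Rightarrow> nat) \<times> (nat \<Rightarrow> nat)) set" where
  "labelled_graphs g s n = {(\<tau>, f, c). \<tau> permutes {..<n} \<and> c \<in> {..<n} \<rightarrow>\<^sub>E {1..s} \<and> c ` {..<n} = {1..s} \<and>
     (\<forall>h<n. \<forall>h'<n. c h = c h' \<longleftrightarrow> h' \<in> orbit \<tau> h) \<and> f \<in> gluings g s {..<n} \<tau> c \<and>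
     (\<forall>h<n. \<tau> (f h) \<noteq> h \<and> \<tau> (f (\<tau> (f h))) \<noteq> h)}"

definition perimeter :: "nat \<Rightarrow> (nat \<Rightarrow> nat) \<Rightarrow> (nat \<Rightarrow> nat) \<Rightarrow> nat \<Rightarrow> nat" where
  "perimeter n c l i = (\<Sum>h | h < n \<and> c h = i. l h)"

definition edge_lengths :: "nat \<Rightarrow> nat \<Rightarrow> (nat \<Rightarrow> nat) \<Rightarrow> (nat \<Rightarrow> nat) \<Rightarrow> (nat \<Rightarrow> nat) \<Rightarrow> (nat \<Rightarrow> nat) set" where
  "edge_lengths n s f c m = {l \<in> {..<n} \<rightarrow>\<^sub>E {1..}. (\<forall>h<n. l (f h) = l h) \<and> (\<forall>i\<in>{1..s}. perimeter n c l i = m i)}"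

text \<open>The half-edge \<open>h\<close> is subdivided into \<open>l h\<close> consecutive sides of a polygon, of which \<open>\<phi> h\<close> is the
  first.\<close>

definition tiling ::
  "nat \<Rightarrow> (nat \<Rightarrow> nat) \<Rightarrow> nat \<Rightarrow> (nat \<Rightarrow> nat) \<Rightarrow> (nat \<Rightarrow> nat) \<Rightarrow> (nat \<Rightarrow> nat \<times> nat) \<Rightarrow> bool" where
  "tiling s m n \<tau> l \<phi> \<longleftrightarrow> \<phi> \<in> {..<n} \<rightarrow>\<^sub>E sides s m \<and>
     bij_betw (\<lambda>(h, j). (nx s m ^^ j) (\<phi> h)) (SIGMA h:{..<n}. {..<l h}) (sides s m) \<and>
     (\<forall>h<n. (nx s m ^^ l h) (\<phi> h) = \<phi> (\<tau> h))"

section \<open>Walks around a polygon and layouts of half-edges on it\<close>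

lemma nx_funpow_permutes: "(nx s m ^^ j) permutes sides s m"
  using nx_permutes by (induction j) (auto simp: permutes_id[unfolded id_def] intro: permutes_compose)

lemma nx_funpow_in: "(nx s m ^^ j) x \<in> sides s m \<longleftrightarrow> x \<in> sides s m"
  using nx_funpow_permutes by (rule permutes_in_image)

lemma nx_funpow_inj: "(nx s m ^^ j) x = (nx s m ^^ j) y \<longleftrightarrow> x = y"
  using nx_funpow_permutes permutes_inj by (metis injD)

lemma fst_nx_funpow [simp]: "fst ((nx s m ^^ j) x) = fst x"
  by (induction j) auto

lemma nx_funpow:
  assumes "(i, j) \<in> sides s m"
  shows "(nx s m ^^ a) (i, j) = (i, (j + a) mod m i)"
proof (induction a)
  case 0
  then show ?case using assms by (simp add: in_sides)
next
  case (Suc a)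
  have "(i, (j + a) mod m i) \<in> sides s m"
    using assms by (auto simp: in_sides)
  then show ?case
    using Suc by (simp add: nx_def next_side_def mod_simps)
qed

lemma nx_transitive:
  assumes "x \<in> sides s m" "y \<in> sides s m" "fst x = fst y"
  shows "\<exists>a. (nx s m ^^ a) x = y"
proof -
  obtain i j j' where x: "x = (i, j)" "y = (i, j')" using assms(3) by (metis prod.collapse)
  then have "j < m i" "j' < m i" using assms by (auto simp: in_sides)
  then have "(j + (m i - j + j')) mod m i = j'" by simp
  then show ?thesis using nx_funpow[of i j s m "m i - j + j'"] assms x by auto
qed

lemma card_involution_orbits:
  assumes "finite H" "f permutes H" "K \<subseteq> H" "\<And>x. x \<in> K \<Longrightarrow> f x \<in> K"
    and "\<And>x. x \<in> K \<Longrightarrow> f x \<noteq> x" "\<And>x. x \<in> K \<Longrightarrow> f (f x) = x"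
  shows "card K = 2 * card (orbit f ` K)"
proof -
  have orb: "orbit f x = {x, f x}" if "x \<in> K" for x
  proof
    show "orbit f x \<subseteq> {x, f x}"
    proof
      fix y assume "y \<in> orbit f x"
      then show "y \<in> {x, f x}" by induction (use assms(6)[OF that] in auto)
    qed
    show "{x, f x} \<subseteq> orbit f x" using orbit_self[OF assms(2,1)] by (auto intro: orbit.base)
  qed
  have finK: "finite K" using assms finite_subset by blast
  have "K = \<Union> (orbit f ` K)" using orb assms(4) by auto
  then have "card K = card (\<Union> (orbit f ` K))" by simp
  also have "\<dots> = (\<Sum>C\<in>orbit f ` K. card C)"
  proof (rule card_Union_disjoint)
    show "pairwise disjnt (orbit f ` K)"
      unfolding pairwise_def disjnt_def using orbit_eq_iff[OF assms(2,1)] by blast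
    show "finite C" if "C \<in> orbit f ` K" for C using that orb by auto
  qed
  also have "\<dots> = (\<Sum>C\<in>orbit f ` K. 2)"
  proof (rule sum.cong[OF refl])
    fix C assume "C \<in> orbit f ` K"
    then obtain x where x: "x \<in> K" "C = {x, f x}" using orb by auto
    then show "card C = 2" using assms(5)[OF x(1)] by simp
  qed
  finally show ?thesis by simp
qed

lemma card_orbits_split:
  assumes "finite H" "f permutes H" "K \<subseteq> H" "\<And>x. x \<in> K \<Longrightarrow> f x \<in> K"
  shows "card (orbit f ` H) = card (orbit f ` K) + card (orbit f ` (H - K))"
proof -
  have finK: "finite K" using assms finite_subset by blast
  have sub: "orbit f x \<subseteq> K" if "x \<in> K" for x
  proof
    fix y assume "y \<in> orbit f x"
    then show "y \<in> K" by induction (use assms(4) that in auto)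
  qed
  have "orbit f ` H = orbit f ` K \<union> orbit f ` (H - K)" using assms(3) by auto
  moreover have "orbit f ` K \<inter> orbit f ` (H - K) = {}"
    using sub orbit_self[OF assms(2,1)] by blast
  ultimately show ?thesis using assms(1) finK by (simp add: card_Un_disjoint)
qed

text \<open>Once one half-edge of each cell is placed, the others follow by walking around the
  polygon with the prescribed lengths, and the walk closes up because the perimeter of cell i is m
  i. The only freedom is one of m i positions in each polygon. These factors later become the factor
  m in \<open>walk_weight\<close>.\<close>

lemma card_tiling_sets:
  assumes s: "1 \<le> s" and G: "(\<tau>, f, c) \<in> labelled_graphs g s n" and l: "l \<in> edge_lengths n s f c m"
    and m: "\<And>i. i \<in> {1..s} \<Longrightarrow> 1 \<le> m i"
  shows "card {\<phi>. tiling s m n \<tau> l \<phi> \<and> (\<forall>h<n. fst (\<phi> h) = c h)} = (\<Prod>i=1..s. m i)"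
proof -
  have \<tau>: "\<tau> permutes {..<n}" and cS: "c ` {..<n} = {1..s}"
    and corb: "\<And>h h'. h < n \<Longrightarrow> h' < n \<Longrightarrow> c h = c h' \<longleftrightarrow> h' \<in> orbit \<tau> h"
    using G by (auto simp: labelled_graphs_def)
  have per: "perimeter n c l i = m i" if "i \<in> {1..s}" for i using l that by (simp add: edge_lengths_def)
  have l1: "1 \<le> l h" if "h < n" for h using l that by (auto simp: edge_lengths_def PiE_def Pi_def)
  have \<tau>lt: "\<tau> h < n \<longleftrightarrow> h < n" for h using permutes_in_image[OF \<tau>, of h] by simp
  have cin: "c h \<in> {1..s}" if "h < n" for h using cS that by auto
  have c\<tau>: "c (\<tau> h) = c h" if "h < n" for h
    using corb[of h "\<tau> h"] that \<tau>lt[of h] orbit.base[of \<tau> h] by simp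
  \<comment> \<open>A base half-edge in each cell. Below, r i is the number of half-edges of cell i,
    and S i a is the distance from the base to its a-th successor.\<close>
  define b where "b i = (SOME h. h < n \<and> c h = i)" for i
  have b: "b i < n" "c (b i) = i" if "i \<in> {1..s}" for i
  proof -
    have "\<exists>h. h < n \<and> c h = i" using cS that by (metis image_iff lessThan_iff)
    then have "b i < n \<and> c (b i) = i" unfolding b_def by (rule someI_ex)
    then show "b i < n" "c (b i) = i" by auto
  qed
  define r where "r i = funpow_dist1 \<tau> (b i) (b i)" for i
  have bself: "b i \<in> orbit \<tau> (b i)" for i using orbit_self[OF \<tau>] by simp
  have r_ret: "(\<tau> ^^ r i) (b i) = b i" for i unfolding r_def using funpow_dist1_prop[OF bself] .
  have r_pos: "0 < r i" for i by (simp add: r_def)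
  have r_inj: "(\<tau> ^^ a) (b i) = (\<tau> ^^ a') (b i) \<longleftrightarrow> a = a'" if "a < r i" "a' < r i" for a a' i
    using funpow_neq_less_funpow_dist1[OF bself] that by (auto simp: r_def)
  have pow_in: "(\<tau> ^^ a) (b i) < n \<and> c ((\<tau> ^^ a) (b i)) = i" if "i \<in> {1..s}" for i a
    by (induction a) (use b[OF that] \<tau>lt c\<tau> in auto)
  have cell: "{h. h < n \<and> c h = i} = (\<lambda>a. (\<tau> ^^ a) (b i)) ` {..<r i}" if "i \<in> {1..s}" for i
  proof -
    have "{h. h < n \<and> c h = i} = orbit \<tau> (b i)"
    proof (intro set_eqI iffI)
      fix h assume "h \<in> {h. h < n \<and> c h = i}"
      then show "h \<in> orbit \<tau> (b i)" using corb[of "b i" h] b[OF that] by auto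
    next
      fix h assume h: "h \<in> orbit \<tau> (b i)"
      then have "h < n" using permutes_orbit_subset[OF \<tau>, of "b i"] b[OF that] by auto
      then show "h \<in> {h. h < n \<and> c h = i}" using corb[of "b i" h] b[OF that] h by auto
    qed
    also have "\<dots> = (\<lambda>a. (\<tau> ^^ a) (b i)) ` {..<r i}"
      unfolding r_def lessThan_atLeast0 by (rule orbit_conv_funpow_dist1[OF bself])
    finally show ?thesis .
  qed
  define S where "S i a = (\<Sum>q<a. l ((\<tau> ^^ q) (b i)))" for i a
  have S_r: "S i (r i) = m i" if "i \<in> {1..s}" for i
  proof -
    have "m i = (\<Sum>h\<in>(\<lambda>a. (\<tau> ^^ a) (b i)) ` {..<r i}. l h)"
      using per[OF that] unfolding perimeter_def cell[OF that] by simp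
    also have "\<dots> = S i (r i)" unfolding S_def
      by (subst sum.reindex) (auto simp: inj_on_def r_inj)
    finally show ?thesis by simp
  qed
  have full: "(nx s m ^^ m i) (i, j) = (i, j)" if "(i, j) \<in> sides s m" for i j
    using nx_funpow[OF that, of "m i"] that by (simp add: in_sides)
  let ?T = "{\<phi>. tiling s m n \<tau> l \<phi> \<and> (\<forall>h<n. fst (\<phi> h) = c h)}"
  have "card ?T = card (\<Pi>\<^sub>E i\<in>{1..s}. {..<m i})"
  proof (rule card_eq_by_relation[where R = "\<lambda>\<phi> x. \<forall>i\<in>{1..s}. \<phi> (b i) = (i, x i)"])
    fix \<phi> assume \<phi>: "\<phi> \<in> ?T"
    then have in': "\<phi> h \<in> sides s m" "fst (\<phi> h) = c h" if "h < n" for h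
      using that by (auto simp: tiling_def)
    let ?x = "\<lambda>i\<in>{1..s}. snd (\<phi> (b i))"
    have "\<phi> (b i) = (i, ?x i)" "?x i < m i" if "i \<in> {1..s}" for i
      using in'[OF b(1)[OF that]] b(2)[OF that] that
      by (auto simp: prod_eq_iff in_sides split: prod.splits)
        (metis in_sides prod.collapse)
    then show "\<exists>x\<in>\<Pi>\<^sub>E i\<in>{1..s}. {..<m i}. \<forall>i\<in>{1..s}. \<phi> (b i) = (i, x i)"
      by (intro bexI[of _ ?x]) auto
  next
    fix x assume x: "x \<in> (\<Pi>\<^sub>E i\<in>{1..s}. {..<m i})"
    have xs: "(i, x i) \<in> sides s m" if "i \<in> {1..s}" for i
      using x that by (auto simp: in_sides)
    define dist where "dist h = (SOME a. a < r (c h) \<and> (\<tau> ^^ a) (b (c h)) = h)" for h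
    have dist: "dist h < r (c h)" "(\<tau> ^^ dist h) (b (c h)) = h" if "h < n" for h
    proof -
      have "h \<in> {h'. h' < n \<and> c h' = c h}" using that by simp
      then have "\<exists>a. a < r (c h) \<and> (\<tau> ^^ a) (b (c h)) = h"
        unfolding cell[OF cin[OF that]] by auto
      then have "dist h < r (c h) \<and> (\<tau> ^^ dist h) (b (c h)) = h"
        unfolding dist_def by (rule someI_ex)
      then show "dist h < r (c h)" "(\<tau> ^^ dist h) (b (c h)) = h" by auto
    qed
    have dist_eq: "dist ((\<tau> ^^ a) (b i)) = a" if "i \<in> {1..s}" "a < r i" for i a
      using dist[of "(\<tau> ^^ a) (b i)"] pow_in[OF that(1), of a] r_inj that by auto
    define \<phi> where "\<phi> = (\<lambda>h\<in>{..<n}. (nx s m ^^ S (c h) (dist h)) (c h, x (c h)))"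
    have \<phi>pow: "\<phi> ((\<tau> ^^ a) (b i)) = (nx s m ^^ S i a) (i, x i)" if "i \<in> {1..s}" "a < r i" for i a
      using pow_in[OF that(1), of a] dist_eq[OF that] by (simp add: \<phi>_def)
    have \<phi>\<tau>: "(nx s m ^^ l h) (\<phi> h) = \<phi> (\<tau> h)" if "h < n" for h
    proof -
      let ?i = "c h" and ?a = "dist h"
      have i: "?i \<in> {1..s}" using cin[OF that] .
      have "(nx s m ^^ l h) (\<phi> h) = (nx s m ^^ S ?i (Suc ?a)) (?i, x ?i)"
        using dist[OF that] that by (simp add: \<phi>_def S_def funpow_add add.commute)
      moreover have "\<phi> (\<tau> h) = (nx s m ^^ S ?i (Suc ?a)) (?i, x ?i)"
      proof (cases "Suc ?a < r ?i")
        case True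
        have "\<tau> h = (\<tau> ^^ Suc ?a) (b ?i)" using dist[OF that] by simp
        then show ?thesis using \<phi>pow[OF i True] by metis
      next
        case False
        then have ra: "r ?i = Suc ?a" using dist(1)[OF that] by simp
        have "\<tau> h = (\<tau> ^^ Suc ?a) (b ?i)" using dist[OF that] by simp
        then have "\<tau> h = (\<tau> ^^ 0) (b ?i)" using r_ret[of ?i] ra by simp
        then have "\<phi> (\<tau> h) = (?i, x ?i)"
          using \<phi>pow[OF i r_pos] by (simp add: S_def)
        then show ?thesis using S_r[OF i] ra full[OF xs[OF i]] by simp
      qed
      ultimately show ?thesis by simp
    qed
    have \<phi>in: "\<phi> h \<in> sides s m" "fst (\<phi> h) = c h" if "h < n" for h
      using that xs[OF cin[OF that]] by (auto simp: \<phi>_def nx_funpow_in)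
    let ?t = "\<lambda>(h, j). (nx s m ^^ j) (\<phi> h)"
    let ?D = "SIGMA h:{..<n}. {..<l h}"
    have sub: "?t ` ?D \<subseteq> sides s m" using \<phi>in by (auto simp: nx_funpow_in)
    have sup: "sides s m \<subseteq> ?t ` ?D"
    proof
      fix y assume y: "y \<in> sides s m"
      obtain i j where ij: "y = (i, j)" by (cases y)
      have i: "i \<in> {1..s}" "j < m i" using y ij by (auto simp: in_sides)
      obtain t0 where "(nx s m ^^ t0) (i, x i) = y"
        using nx_transitive[OF xs[OF i(1)] y] ij by auto
      then have t: "(nx s m ^^ (t0 mod m i)) (i, x i) = y"
        using nx_funpow[OF xs[OF i(1)]] by (simp add: mod_simps)
      let ?t = "t0 mod m i"
      have tm: "?t < m i" using i by simp
      \<comment> \<open>The first partial sum beyond the position t; the half-edge with number a - 1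
        is the one whose run of sides contains t.\<close>
      define a where "a = (LEAST a. ?t < S i a)"
      have ex: "?t < S i (r i)" using tm S_r[OF i(1)] by simp
      have a: "?t < S i a" unfolding a_def using ex by (rule LeastI)
      have "a \<noteq> 0"
      proof
        assume "a = 0"
        then have "S i a = 0" by (simp add: S_def)
        then show False using a by simp
      qed
      then obtain a' where a': "a = Suc a'" using not0_implies_Suc by blast
      have "a \<le> r i" unfolding a_def using ex by (rule Least_le)
      then have a'r: "a' < r i" using a' by simp
      have le: "S i a' \<le> ?t"
        using not_less_Least[of a' "\<lambda>a. ?t < S i a"] a' unfolding a_def[symmetric] by simp
      let ?h = "(\<tau> ^^ a') (b i)"
      have "?t - S i a' < l ?h" using a le unfolding a' by (simp add: S_def)
      moreover have "(nx s m ^^ (?t - S i a')) (\<phi> ?h) = y"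
      proof -
        have "(nx s m ^^ (?t - S i a')) (\<phi> ?h) = (nx s m ^^ (?t - S i a' + S i a')) (i, x i)"
          unfolding \<phi>pow[OF i(1) a'r] funpow_add by simp
        then show ?thesis using le t by simp
      qed
      moreover have "?h < n" using pow_in[OF i(1)] by simp
      ultimately show "y \<in> (\<lambda>(h, j). (nx s m ^^ j) (\<phi> h)) ` ?D"
        by (intro image_eqI[of _ _ "(?h, ?t - S i a')"]) auto
    qed
    \<comment> \<open>The runs cover all sides, and their total length is the number of sides, so
      they cannot overlap.\<close>
    have "card ?D = (\<Sum>h<n. l h)" by simp
    also have "\<dots> = (\<Sum>i\<in>{1..s}. \<Sum>h | h \<in> {..<n} \<and> c h = i. l h)"
      by (rule sum.group[symmetric]) (use cS in auto)
    also have "\<dots> = (\<Sum>i\<in>{1..s}. m i)"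
      by (rule sum.cong[OF refl]) (use per in \<open>simp add: perimeter_def\<close>)
    also have "\<dots> = card (sides s m)" by (simp add: card_sides total_sides_def)
    finally have "card ?D = card (sides s m)" .
    moreover have im: "?t ` ?D = sides s m" using sub sup by (rule equalityI)
    ultimately have "inj_on ?t ?D"
      by (intro eq_card_imp_inj_on) auto
    then have "tiling s m n \<tau> l \<phi>"
      unfolding tiling_def bij_betw_def using im \<phi>\<tau> \<phi>in by (auto simp: \<phi>_def)
    moreover have "\<phi> (b i) = (i, x i)" if "i \<in> {1..s}" for i
      using \<phi>pow[OF that r_pos] by (simp add: S_def)
    ultimately show "\<exists>\<phi>\<in>?T. \<forall>i\<in>{1..s}. \<phi> (b i) = (i, x i)"
      using \<phi>in by blast
  next
    fix \<phi> x x' assume "x \<in> (\<Pi>\<^sub>E i\<in>{1..s}. {..<m i})" "x' \<in> (\<Pi>\<^sub>E i\<in>{1..s}. {..<m i})"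
      "\<forall>i\<in>{1..s}. \<phi> (b i) = (i, x i)" "\<forall>i\<in>{1..s}. \<phi> (b i) = (i, x' i)"
    then show "x = x'" by (intro PiE_ext) auto
  next
    fix \<phi> \<phi>' x assume \<phi>: "\<phi> \<in> ?T" "\<phi>' \<in> ?T"
      and x: "\<forall>i\<in>{1..s}. \<phi> (b i) = (i, x i)" "\<forall>i\<in>{1..s}. \<phi>' (b i) = (i, x i)"
    have "\<phi> h = \<phi>' h" if "h < n" for h
    proof -
      have i: "c h \<in> {1..s}" using cin[OF that] .
      have "\<phi> ((\<tau> ^^ a) (b (c h))) = \<phi>' ((\<tau> ^^ a) (b (c h)))" for a
      proof (induction a)
        case 0
        then show ?case using x i by simp
      next
        case (Suc a)
        have "(\<tau> ^^ a) (b (c h)) < n" using pow_in[OF i] by simp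
        then show ?case using \<phi> Suc unfolding mem_Collect_eq tiling_def by (metis funpow.simps(2) o_apply)
      qed
      note eq = this
      have "h \<in> {h'. h' < n \<and> c h' = c h}" using that by simp
      then obtain a where a: "(\<tau> ^^ a) (b (c h)) = h"
        unfolding cell[OF i] by (elim imageE) (rule that[OF sym])
      show ?thesis using eq[of a] unfolding a .
    qed
    moreover have "\<phi> \<in> {..<n} \<rightarrow>\<^sub>E sides s m" "\<phi>' \<in> {..<n} \<rightarrow>\<^sub>E sides s m"
      using \<phi> by (simp_all add: tiling_def)
    ultimately show "\<phi> = \<phi>'" by (metis PiE_ext lessThan_iff)
  qed
  then show ?thesis by (simp add: card_PiE)
qed

text \<open>Relates a pairing p to a graph (\<tau>, f) with lengths l laid out by \<phi>: the run of
  h is glued to the run of f h in reverse order, side j to side l h - 1 - j. Both directions of the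
  count, from maps to graphs and back, use this one relation.\<close>

locale subdivision =
  fixes s n :: nat and m :: "nat \<Rightarrow> nat" and \<tau> f l :: "nat \<Rightarrow> nat"
    and \<phi> :: "nat \<Rightarrow> nat \<times> nat" and p :: "nat \<times> nat \<Rightarrow> nat \<times> nat"
  assumes \<tau>: "\<tau> permutes {..<n}" and f: "f \<in> pairings {..<n}"
    and l1: "\<And>h. h < n \<Longrightarrow> 1 \<le> l h" and lf: "\<And>h. h < n \<Longrightarrow> l (f h) = l h"
    and T: "tiling s m n \<tau> l \<phi>"
    and p_out: "\<And>x. x \<notin> sides s m \<Longrightarrow> p x = x"
    and p_side: "\<And>h j. h < n \<Longrightarrow> j < l h \<Longrightarrow> p ((nx s m ^^ j) (\<phi> h)) = (nx s m ^^ (l h - 1 - j)) (\<phi> (f h))"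
begin

abbreviation "\<sigma> h j \<equiv> (nx s m ^^ j) (\<phi> h)"

abbreviation "rotation \<equiv> nx s m \<circ> p"

lemma f_less: "h < n \<Longrightarrow> f h < n"
  using pairings_in[OF f] by simp

lemma \<phi>_in: "h < n \<Longrightarrow> \<phi> h \<in> sides s m"
  using T by (auto simp: tiling_def)

lemma \<sigma>_in: "h < n \<Longrightarrow> \<sigma> h j \<in> sides s m"
  using \<phi>_in by (simp add: nx_funpow_in)

lemma \<sigma>_inj:
  assumes "h < n" "h' < n" "j < l h" "j' < l h'" "\<sigma> h j = \<sigma> h' j'"
  shows "h = h' \<and> j = j'"
proof -
  have "inj_on (\<lambda>(h, j). \<sigma> h j) (SIGMA h:{..<n}. {..<l h})"
    using T by (simp add: tiling_def bij_betw_def)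
  from inj_onD[OF this, of "(h, j)" "(h', j')"] show ?thesis using assms by simp
qed

lemma \<sigma>_ex:
  assumes "x \<in> sides s m"
  obtains h j where "h < n" "j < l h" "x = \<sigma> h j"
proof -
  have "x \<in> (\<lambda>(h, j). \<sigma> h j) ` (SIGMA h:{..<n}. {..<l h})"
    using T assms by (simp add: tiling_def bij_betw_def)
  then show ?thesis using that by auto
qed

lemma \<phi>_inj: "h < n \<Longrightarrow> h' < n \<Longrightarrow> \<phi> h = \<phi> h' \<Longrightarrow> h = h'"
  using \<sigma>_inj[of h h' 0 0] l1[of h] l1[of h'] by simp

lemma \<sigma>_end: "h < n \<Longrightarrow> \<sigma> h (l h) = \<phi> (\<tau> h)"
  using T by (simp add: tiling_def)

lemma p_pairing: "p \<in> pairings (sides s m)"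
proof (rule pairingsI)
  fix x assume "x \<in> sides s m"
  then obtain h j where hj: "h < n" "j < l h" "x = \<sigma> h j" by (rule \<sigma>_ex)
  have px: "p x = \<sigma> (f h) (l h - 1 - j)" using hj p_side by simp
  then show "p x \<in> sides s m" using \<sigma>_in f_less hj by simp
  have lt: "l h - 1 - j < l (f h)" using hj lf by simp
  show "p x \<noteq> x"
    using \<sigma>_inj[of "f h" h "l h - 1 - j" j] lt hj px f_less pairings_neq[OF f, of h] by auto
  have "p (p x) = \<sigma> (f (f h)) (l (f h) - 1 - (l h - 1 - j))"
    unfolding px using p_side[OF f_less[OF hj(1)] lt] .
  then show "p (p x) = x"
    using hj lf pairings_double[OF f] by simp
qed (rule p_out)

lemma rotation_permutes: "rotation permutes sides s m"
  using pairings_permutes[OF p_pairing] nx_permutes by (rule permutes_compose)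

text \<open>The first side of h is glued to the last side of the run of f h, which ends where \<tau>
  (f h) starts. At the core corners the map thus turns as the graph does.\<close>

lemma rotation_outer: "h < n \<Longrightarrow> rotation (\<phi> h) = \<phi> (\<tau> (f h))"
  using p_side[of h 0] l1[of h] lf[of h] \<sigma>_end[of "f h"] f_less[of h]
  by (cases "l h") auto

text \<open>Interior corners are exchanged in pairs across the edge; these pairs are the bivalent
  vertices.\<close>

lemma rotation_inner:
  assumes "h < n" "0 < j" "j < l h"
  shows "rotation (\<sigma> h j) = \<sigma> (f h) (l h - j)"
proof -
  have "rotation (\<sigma> h j) = \<sigma> (f h) (Suc (l h - 1 - j))"
    using p_side assms by simp
  then show ?thesis using assms by (simp add: Suc_diff_Suc)
qed

lemma inner_iff:
  assumes "x \<in> sides s m"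
  shows "x \<notin> \<phi> ` {..<n} \<longleftrightarrow> (\<exists>h j. h < n \<and> 0 < j \<and> j < l h \<and> x = \<sigma> h j)"
proof
  assume "x \<notin> \<phi> ` {..<n}"
  moreover obtain h j where "h < n" "j < l h" "x = \<sigma> h j" using assms by (rule \<sigma>_ex)
  ultimately show "\<exists>h j. h < n \<and> 0 < j \<and> j < l h \<and> x = \<sigma> h j"
    by (cases "j = 0") auto
next
  assume "\<exists>h j. h < n \<and> 0 < j \<and> j < l h \<and> x = \<sigma> h j"
  then obtain h j where hj: "h < n" "0 < j" "j < l h" "x = \<sigma> h j" by auto
  show "x \<notin> \<phi> ` {..<n}"
  proof
    assume "x \<in> \<phi> ` {..<n}"
    then obtain h' where "h' < n" "x = \<sigma> h' 0" by auto
    then show False using \<sigma>_inj[of h h' j 0] hj l1[of h'] by auto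
  qed
qed

lemma inner:
  assumes "x \<in> sides s m" "x \<notin> \<phi> ` {..<n}"
  shows "rotation x \<in> sides s m - \<phi> ` {..<n}" "rotation x \<noteq> x" "rotation (rotation x) = x"
proof -
  obtain h j where hj: "h < n" "0 < j" "j < l h" "x = \<sigma> h j"
    using assms inner_iff by auto
  have r: "rotation x = \<sigma> (f h) (l h - j)" using rotation_inner hj by simp
  have fh: "f h < n" "f h \<noteq> h" "l (f h) = l h" "f (f h) = h"
    using f_less[OF hj(1)] pairings_neq[OF f] lf[OF hj(1)] pairings_double[OF f] hj by auto
  have j': "0 < l h - j" "l h - j < l (f h)" using hj fh by auto
  have in': "rotation x \<in> sides s m" using r \<sigma>_in fh by simp
  have "rotation x \<notin> \<phi> ` {..<n}"
    using inner_iff[OF in'] r fh j' by blast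
  with in' show "rotation x \<in> sides s m - \<phi> ` {..<n}" by simp
  show "rotation x \<noteq> x" using \<sigma>_inj[of "f h" h "l h - j" j] fh j' hj r by auto
  have "rotation (\<sigma> (f h) (l h - j)) = \<sigma> h j"
    using rotation_inner[OF fh(1) j'] fh hj by simp
  then show "rotation (rotation x) = x" using r hj by simp
qed

lemma \<tau>f_less: "h < n \<Longrightarrow> \<tau> (f h) < n"
  using permutes_in_image[OF \<tau>, of "f h"] f_less by simp

lemma core_set_eq:
  assumes "\<And>h. h < n \<Longrightarrow> \<tau> (f (\<tau> (f h))) \<noteq> h"
  shows "core_set s m p = \<phi> ` {..<n}"
proof (intro set_eqI iffI)
  fix x assume "x \<in> core_set s m p"
  then have "x \<in> sides s m" "rotation (rotation x) \<noteq> x" by (auto simp: core_set_def)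
  then show "x \<in> \<phi> ` {..<n}" using inner by blast
next
  fix x assume "x \<in> \<phi> ` {..<n}"
  then obtain h where h: "h < n" "x = \<phi> h" by auto
  have "rotation (rotation x) = \<phi> (\<tau> (f (\<tau> (f h))))"
    unfolding h rotation_outer[OF h(1)] rotation_outer[OF \<tau>f_less[OF h(1)]] ..
  then have "rotation (rotation x) \<noteq> x"
    using h assms[OF h(1)] \<phi>_inj \<tau>f_less by metis
  then show "x \<in> core_set s m p" using \<phi>_in h by (simp add: core_set_def)
qed

lemma leafless:
  assumes "\<And>h. h < n \<Longrightarrow> \<tau> (f h) \<noteq> h" and "i \<in> {1..s}"
  shows "leafless s m p i"
  unfolding leafless_def
proof (intro allI impI notI)
  fix j assume j: "j < m i" "p (i, j) = nx s m (i, j)"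
  let ?x = "p (i, j)"
  have "(i, j) \<in> sides s m" using j assms(2) by (simp add: in_sides)
  then have x: "?x \<in> sides s m" by (rule pairings_in[OF p_pairing])
  have "rotation ?x = nx s m (i, j)" using pairings_double[OF p_pairing, of "(i, j)"] by simp
  then have fp: "rotation ?x = ?x" using j(2) by simp
  show False
  proof (cases "?x \<in> \<phi> ` {..<n}")
    case True
    then obtain h where h: "h < n" "?x = \<phi> h" by auto
    then show False using fp rotation_outer[OF h(1)] \<phi>_inj[OF \<tau>f_less[OF h(1)] h(1)] assms(1) by simp
  next
    case False
    then show False using inner(2)[OF x False] fp by simp
  qed
qed

text \<open>A bivalent vertex has two corners and balances exactly one edge, so suppressing all of
  them keeps V - E. The relation between cells that expresses connectedness is literally the same
  for sides and for half-edges.\<close>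

lemma gluings_iff:
  assumes c: "\<And>h. h < n \<Longrightarrow> fst (\<phi> h) = c h"
  shows "p \<in> gluings g s (sides s m) (nx s m) fst \<longleftrightarrow> f \<in> gluings g s {..<n} \<tau> c"
proof (rule gluings_transfer[OF p_pairing f])
  have "{(fst x, fst (p x)) |x. x \<in> sides s m} = {(c h, c (f h)) |h. h \<in> {..<n}}"
  proof (intro set_eqI iffI)
    fix z assume "z \<in> {(fst x, fst (p x)) |x. x \<in> sides s m}"
    then obtain x where x: "x \<in> sides s m" "z = (fst x, fst (p x))" by auto
    obtain h j where hj: "h < n" "j < l h" "x = \<sigma> h j" using x(1) by (rule \<sigma>_ex)
    then have "z = (c h, c (f h))" using x p_side c f_less by simp
    then show "z \<in> {(c h, c (f h)) |h. h \<in> {..<n}}" using hj by auto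
  next
    fix z assume "z \<in> {(c h, c (f h)) |h. h \<in> {..<n}}"
    then obtain h where h: "h < n" "z = (c h, c (f h))" by auto
    have "p (\<phi> h) = \<sigma> (f h) (l h - 1)" using p_side[of h 0] h l1[of h] by simp
    then have "z = (fst (\<phi> h), fst (p (\<phi> h)))" using c f_less h by simp
    then show "z \<in> {(fst x, fst (p x)) |x. x \<in> sides s m}" using \<phi>_in h by blast
  qed
  then show "{(fst x, fst (p x)) |x. x \<in> sides s m}\<^sup>* = {(c h, c (f h)) |h. h \<in> {..<n}}\<^sup>*" by simp
  let ?K = "\<phi> ` {..<n}"
  have \<tau>f: "\<tau> \<circ> f permutes {..<n}"
    using pairings_permutes[OF f] \<tau> by (rule permutes_compose)
  have K: "?K \<subseteq> sides s m" using \<phi>_in by auto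
  have Kr: "rotation x \<in> ?K" if x: "x \<in> ?K" for x
  proof -
    obtain h where h: "h < n" "x = \<phi> h" using x by auto
    then show ?thesis using rotation_outer[OF h(1)] \<tau>f_less[OF h(1)] by simp
  qed
  have inj: "inj_on \<phi> {..<n}" using \<phi>_inj by (auto intro: inj_onI)
  have inv: "inv_into {..<n} \<phi> (\<phi> h) = h" if "h < n" for h
    using inj that by (simp add: inv_into_f_f)
  have 1: "card (orbit rotation ` ?K) = card (orbit (\<tau> \<circ> f) ` {..<n})"
  proof (rule card_orbits_eq[where \<iota> = \<phi> and \<pi> = "inv_into {..<n} \<phi>", OF _ _ rotation_permutes \<tau>f K Kr])
    show "\<phi> ((\<tau> \<circ> f) u) \<in> orbit rotation (\<phi> u)" if "u \<in> {..<n}" for u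
      using rotation_outer[of u] that orbit.base[of rotation "\<phi> u"] by simp
    show "inv_into {..<n} \<phi> v \<in> {..<n}" if "v \<in> ?K" for v using that inv by auto
    show "inv_into {..<n} \<phi> (rotation v) \<in> orbit (\<tau> \<circ> f) (inv_into {..<n} \<phi> v)" if v: "v \<in> ?K" for v
    proof -
      obtain h where h: "h < n" "v = \<phi> h" using v by auto
      have "inv_into {..<n} \<phi> (rotation v) = (\<tau> \<circ> f) h"
        unfolding h rotation_outer[OF h(1)] using inv[OF \<tau>f_less[OF h(1)]] by simp
      then show ?thesis unfolding h inv[OF h(1)] by (simp only: orbit.base)
    qed
    show "inv_into {..<n} \<phi> (\<phi> u) \<in> orbit (\<tau> \<circ> f) u" if "u \<in> {..<n}" for u
      using that inv orbit_self[OF \<tau>f] by simp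
    show "\<phi> (inv_into {..<n} \<phi> v) \<in> orbit rotation v" if v: "v \<in> ?K" for v
    proof -
      have "\<phi> (inv_into {..<n} \<phi> v) = v" using v by (rule f_inv_into_f)
      then show ?thesis using orbit_self[OF rotation_permutes finite_sides, of v] by simp
    qed
  qed auto
  have 2: "card (sides s m - ?K) = 2 * card (orbit rotation ` (sides s m - ?K))"
    by (rule card_involution_orbits[OF finite_sides rotation_permutes]) (use inner in auto)
  have 3: "card (orbit rotation ` sides s m) = card (orbit rotation ` ?K) + card (orbit rotation ` (sides s m - ?K))"
    by (rule card_orbits_split[OF finite_sides rotation_permutes K Kr])
  have 4: "card (sides s m) = n + card (sides s m - ?K)"
  proof -
    have "card ?K = n" using inj by (simp add: card_image)
    moreover have "card ?K \<le> card (sides s m)" using K by (intro card_mono) simp_all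
    ultimately show ?thesis using K by (simp add: card_Diff_subset)
  qed
  show "int (card (orbit rotation ` sides s m)) - int (card (sides s m) div 2) =
      int (card (orbit (\<tau> \<circ> f) ` {..<n})) - int (card {..<n} div 2)"
    using 1 2 3 4 by simp
qed

text \<open>Recovers the lengths from the starting corners alone, as needed for the uniqueness of
  the graph of a map with labelled core.\<close>

lemma length_least:
  assumes "h < n"
  shows "l h = (LEAST j. 0 < j \<and> \<sigma> h j \<in> \<phi> ` {..<n})"
proof (rule sym, rule Least_equality)
  show "0 < l h \<and> \<sigma> h (l h) \<in> \<phi> ` {..<n}"
    using l1[OF assms] \<sigma>_end[OF assms] permutes_in_image[OF \<tau>, of h] assms by auto
  fix j assume j: "0 < j \<and> \<sigma> h j \<in> \<phi> ` {..<n}"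
  show "l h \<le> j"
  proof (rule ccontr)
    assume "\<not> l h \<le> j"
    then have "\<exists>h' j'. h' < n \<and> 0 < j' \<and> j' < l h' \<and> \<sigma> h j = \<sigma> h' j'"
      using j assms by (intro exI[of _ h] exI[of _ j]) simp
    then have "\<sigma> h j \<notin> \<phi> ` {..<n}" using inner_iff[OF \<sigma>_in[OF assms]] by blast
    then show False using j by simp
  qed
qed

end

text \<open>The passage from maps to graphs: \<phi> numbers the core corners of a leafless map, and
  the graph is read off from p and \<phi>.\<close>

locale core_map =
  fixes g s n :: nat and m :: "nat \<Rightarrow> nat" and \<phi> :: "nat \<Rightarrow> nat \<times> nat" and p :: "nat \<times> nat \<Rightarrow> nat \<times> nat"
  assumes gl: "p \<in> gluings g s (sides s m) (nx s m) fst"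
    and leafless: "\<And>i. i \<in> {1..s} \<Longrightarrow> leafless s m p i"
    and m1: "\<And>i. i \<in> {1..s} \<Longrightarrow> 1 \<le> m i" and s1: "1 \<le> s" and gs: "(g, s) \<noteq> (0, 2)"
    and \<phi>: "bij_betw \<phi> {..<n} (core_set s m p)" "\<phi> \<in> extensional {..<n}"
begin

abbreviation "N \<equiv> nx s m"
abbreviation "D \<equiv> core_set s m p"

lemma pp: "p \<in> pairings (sides s m)" using gl by (rule gluings_pairings)

lemma D_sides: "x \<in> D \<Longrightarrow> x \<in> sides s m" by (simp add: core_set_def)

lemma rot_permutes: "N \<circ> p permutes sides s m"
  using pairings_permutes[OF pp] nx_permutes by (rule permutes_compose)

lemma rot_in: "N (p x) \<in> sides s m \<longleftrightarrow> x \<in> sides s m"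
  using permutes_in_image[OF rot_permutes, of x] by simp

lemma N_inj: "N x = N y \<longleftrightarrow> x = y"
  using nx_funpow_inj[where j = 1 and s = s and m = m] by simp

lemma p_inj: "p x = p y \<longleftrightarrow> x = y"
  using pairings_double[OF pp] by metis

lemma rot_D: "N (p x) \<in> D \<longleftrightarrow> x \<in> D"
  by (simp add: core_set_def rot_in N_inj p_inj)

lemma rot_neq: "x \<in> sides s m \<Longrightarrow> N (p x) \<noteq> x"
proof
  assume x: "x \<in> sides s m" "N (p x) = x"
  obtain i j where ij: "p x = (i, j)" by (cases "p x")
  then have "(i, j) \<in> sides s m" using pairings_in[OF pp x(1)] by simp
  then have "p (i, j) \<noteq> N (i, j)"
    using leafless[of i] by (auto simp: leafless_def in_sides)
  then show False using x ij pairings_double[OF pp, of x] by simp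
qed

lemma inner: "x \<in> sides s m \<Longrightarrow> x \<notin> D \<Longrightarrow> N (p (N (p x))) = x"
  by (simp add: core_set_def)

definition gap :: "nat \<times> nat \<Rightarrow> nat" where
  "gap x = (LEAST j. 0 < j \<and> (N ^^ j) x \<in> D)"

lemma full_turn: "x \<in> sides s m \<Longrightarrow> (N ^^ m (fst x)) x = x"
  by (cases x) (auto simp: nx_funpow in_sides)

lemma gap_props:
  assumes "x \<in> D"
  shows "0 < gap x" "(N ^^ gap x) x \<in> D" "\<And>j. 0 < j \<Longrightarrow> j < gap x \<Longrightarrow> (N ^^ j) x \<notin> D"
proof -
  have "0 < m (fst x)" using D_sides[OF assms] m1[of "fst x"] by (cases x) (auto simp: in_sides)
  then have "0 < m (fst x) \<and> (N ^^ m (fst x)) x \<in> D"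
    using full_turn[OF D_sides[OF assms]] assms by simp
  then have "0 < gap x \<and> (N ^^ gap x) x \<in> D" unfolding gap_def by (rule LeastI)
  then show "0 < gap x" "(N ^^ gap x) x \<in> D" by auto
  show "(N ^^ j) x \<notin> D" if "0 < j" "j < gap x" for j
    using not_less_Least[OF that(2)[unfolded gap_def]] that by simp
qed

text \<open>The last side of the run from x ends at the next core corner. Since gluing reverses
  directions, its partner is the first side of the run across the edge.\<close>

definition opp :: "nat \<times> nat \<Rightarrow> nat \<times> nat" where
  "opp x = p ((N ^^ (gap x - 1)) x)"

text \<open>At the bivalent corners in between the rotation has order 2, so the partner of the
  preceding side is the successor of the partner: reading one run backwards reads the opposite run
  forwards.\<close>

lemma opp_walk:
  assumes "x \<in> D" "j < gap x"
  shows "(N ^^ j) (opp x) = p ((N ^^ (gap x - 1 - j)) x)"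
  using assms(2)
proof (induction j)
  case 0
  then show ?case by (simp add: opp_def)
next
  case (Suc j)
  let ?y = "(N ^^ (gap x - 1 - j)) x" and ?y' = "(N ^^ (gap x - 1 - Suc j)) x"
  have "gap x - 1 - j = Suc (gap x - 1 - Suc j)" using Suc.prems by simp
  then have y: "?y = N ?y'" by simp
  have "?y \<notin> D" using gap_props(3)[OF assms(1)] Suc.prems by simp
  moreover have "?y \<in> sides s m" using D_sides[OF assms(1)] by (simp only: nx_funpow_in)
  ultimately have "N (p (N (p ?y))) = N ?y'"
    using trans[OF inner[of ?y] y] by blast
  then have "N (p ?y) = p ?y'" using N_inj pairings_double[OF pp] by metis
  then show ?case using Suc by simp
qed

lemma opp:
  assumes x: "x \<in> D"
  shows "opp x \<in> D" "gap (opp x) = gap x" "opp (opp x) = x" "opp x \<noteq> x" "(N ^^ gap x) (opp x) = N (p x)"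
proof -
  let ?L = "gap x"
  have L: "0 < ?L" using gap_props[OF x] by simp
  have NL: "(N ^^ ?L) z = N ((N ^^ (?L - 1)) z)" for z
    using L by (cases ?L) auto
  have "N (p (opp x)) = (N ^^ ?L) x"
    unfolding opp_def NL using pairings_double[OF pp] by simp
  then show in': "opp x \<in> D" using gap_props(2)[OF x] rot_D by metis
  show turn: "(N ^^ ?L) (opp x) = N (p x)"
    unfolding NL using opp_walk[OF x, of "?L - 1"] L by simp
  show gap: "gap (opp x) = ?L"
    unfolding gap_def[of "opp x"]
  proof (rule Least_equality)
    show "0 < ?L \<and> (N ^^ ?L) (opp x) \<in> D" using L turn rot_D x by simp
    fix j assume j: "0 < j \<and> (N ^^ j) (opp x) \<in> D"
    show "?L \<le> j"
    proof (rule ccontr)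
      assume "\<not> ?L \<le> j"
      then have jl: "j < ?L" by simp
      have "N (p ((N ^^ j) (opp x))) = (N ^^ Suc (?L - 1 - j)) x"
        unfolding opp_walk[OF x jl] using pairings_double[OF pp] by simp
      moreover have "(N ^^ Suc (?L - 1 - j)) x \<notin> D"
        by (rule gap_props(3)[OF x]) (use j jl in auto)
      ultimately show False using j rot_D by metis
    qed
  qed
  show "opp (opp x) = x"
    unfolding opp_def[of "opp x"] gap using opp_walk[OF x, of "?L - 1"] L pairings_double[OF pp] by simp
  \<comment> \<open>A run glued to itself in reverse order has, in its middle, a side glued to
    itself if its length is odd, and two neighbouring sides glued to each other, i.e. a leaf, if its
    length is even.\<close>
  show "opp x \<noteq> x"
  proof
    assume "opp x = x"
    then have w: "(N ^^ j) x = p ((N ^^ (?L - 1 - j)) x)" if "j < ?L" for j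
      using opp_walk[OF x that] by simp
    have ins: "(N ^^ j) x \<in> sides s m" for j using D_sides[OF x] by (simp add: nx_funpow_in)
    show False
    proof (cases "even ?L")
      case False
      then obtain q where "?L = 2 * q + 1" by (elim oddE)
      then show False using w[of q] pairings_neq[OF pp ins[of q]] by simp
    next
      case True
      then obtain q' where q': "?L = 2 * q'" by (elim evenE)
      then obtain q where q: "q' = Suc q" using L by (cases q') auto
      have "N ((N ^^ q) x) = p ((N ^^ q) x)"
        using w[of "Suc q"] q q' by simp
      then show False
        using rot_neq[of "p ((N ^^ q) x)"] pairings_in[OF pp ins[of q]] pairings_double[OF pp] by simp
    qed
  qed
qed

text \<open>Along a polygon with bivalent vertices only, the gluing runs in step with the
  neighbouring polygon, which then has no core corner either; by connectedness there is none at all.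
  So all vertices are bivalent, V = E, and s = 2 - 2 g leaves only the excluded case (0, 2).\<close>

lemma meets_D:
  assumes "i \<in> {1..s}"
  shows "\<exists>x\<in>D. fst x = i"
proof (rule ccontr)
  assume no: "\<not> (\<exists>x\<in>D. fst x = i)"
  define S where "S = {i'. \<not> (\<exists>x\<in>D. fst x = i')}"
  have iS: "i \<in> S" using no by (simp add: S_def)
  have step: "fst (p x) \<in> S" if x: "x \<in> sides s m" "fst x \<in> S" for x
  proof -
    \<comment> \<open>Walking forwards from p x amounts to walking backwards from x, one bivalent
      vertex at a time.\<close>
    have walk: "\<exists>x'. x' \<in> sides s m \<and> fst x' = fst x \<and> (N ^^ a) (p x) = p x'" for a
    proof (induction a)
      case 0
      then show ?case using x by (intro exI[of _ x]) simp
    next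
      case (Suc a)
      then obtain x' where x': "x' \<in> sides s m" "fst x' = fst x" "(N ^^ a) (p x) = p x'" by auto
      define x'' where "x'' = p (N (p x'))"
      have "x' \<notin> D" using x'(2) x(2) by (auto simp: S_def)
      then have e: "N x'' = x'" using inner[OF x'(1)] by (simp add: x''_def)
      then have "x'' \<in> sides s m" "fst x'' = fst x"
        using x' nx_funpow_in[where j = 1 and s = s and m = m and x = x''] fst_nx[of s m x''] by auto
      moreover have "(N ^^ Suc a) (p x) = p x''"
        using x'(3) pairings_double[OF pp] by (simp add: x''_def)
      ultimately show ?case by blast
    qed
    have "y \<notin> D" if fy: "fst y = fst (p x)" for y
    proof
      assume y: "y \<in> D"
      obtain a where "(N ^^ a) (p x) = y"
        using nx_transitive[OF pairings_in[OF pp x(1)] D_sides[OF y]] fy by auto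
      then obtain x' where x': "x' \<in> sides s m" "fst x' = fst x" "y = p x'" using walk by metis
      have "N (p y) \<in> D" using y rot_D by simp
      then have "N x' \<in> D" using x' pairings_double[OF pp] by simp
      moreover have "fst (N x') = fst x" using x' by simp
      ultimately show False using x(2) by (auto simp: S_def)
    qed
    then show ?thesis by (auto simp: S_def)
  qed
  have all: "j \<in> S" if "j \<in> {1..s}" for j
  proof -
    have "(i, j) \<in> {(fst x, fst (p x)) |x. x \<in> sides s m}\<^sup>*"
      using gl assms that by (auto simp: gluings_def)
    then show ?thesis
    proof induction
      case base
      then show ?case using iS .
    next
      case (step y z)
      then show ?case using \<open>\<And>x. x \<in> sides s m \<Longrightarrow> fst x \<in> S \<Longrightarrow> fst (p x) \<in> S\<close> by auto
    qed
  qed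
  have "D = {}"
  proof (rule ccontr)
    assume "D \<noteq> {}"
    then obtain x where x: "x \<in> D" by auto
    have "fst x \<in> {1..s}" using D_sides[OF x] by (cases x) (auto simp: in_sides)
    then show False using all x by (auto simp: S_def)
  qed
  then have "card (sides s m) = 2 * card (orbit (N \<circ> p) ` sides s m)"
    by (intro card_involution_orbits[OF finite_sides rot_permutes])
       (use rot_in rot_neq inner in auto)
  then have "int s = 2 - 2 * int g"
    using gl by (simp add: gluings_def)
  then have "s = 2 \<and> g = 0" using s1 by presburger
  then show False using gs by simp
qed

text \<open>Strictly inside the run of x' there is no core corner, so the two walks can meet only if
  they started together.\<close>

lemma gap_compare:
  assumes "x \<in> D" "x' \<in> D" "(N ^^ j) x = (N ^^ j') x'" "j \<le> j'" "j' - j < gap x'"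
  shows "x = x' \<and> j = j'"
proof -
  have "(N ^^ j) x = (N ^^ j) ((N ^^ (j' - j)) x')"
    using assms(3,4) by (metis funpow_add le_add_diff_inverse o_apply)
  then have e: "x = (N ^^ (j' - j)) x'" by (simp only: nx_funpow_inj)
  have "j' - j = 0"
  proof (rule ccontr)
    assume "j' - j \<noteq> 0"
    then have "x \<notin> D" using gap_props(3)[OF assms(2), of "j' - j"] assms(5) e by simp
    then show False using assms(1) by simp
  qed
  then show ?thesis using e assms(4) by simp
qed

definition \<psi> :: "nat \<times> nat \<Rightarrow> nat" where "\<psi> = inv_into {..<n} \<phi>"

lemma \<phi>_D: "h < n \<Longrightarrow> \<phi> h \<in> D"
  using \<phi>(1) by (auto simp: bij_betw_def)

lemma \<psi>: "x \<in> D \<Longrightarrow> \<psi> x < n" "x \<in> D \<Longrightarrow> \<phi> (\<psi> x) = x" "h < n \<Longrightarrow> \<psi> (\<phi> h) = h"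
proof -
  show "\<psi> (\<phi> h) = h" if "h < n"
    using bij_betw_inv_into_left[OF \<phi>(1)] that by (simp add: \<psi>_def)
  show "\<phi> (\<psi> x) = x" if "x \<in> D"
    using bij_betw_inv_into_right[OF \<phi>(1) that] by (simp add: \<psi>_def)
  show "\<psi> x < n" if "x \<in> D"
    using inv_into_into[of x \<phi> "{..<n}"] \<phi>(1) that by (simp add: \<psi>_def bij_betw_def)
qed

definition \<tau> :: "nat \<Rightarrow> nat" where "\<tau> h = (if h < n then \<psi> ((N ^^ gap (\<phi> h)) (\<phi> h)) else h)"
definition f :: "nat \<Rightarrow> nat" where "f h = (if h < n then \<psi> (opp (\<phi> h)) else h)"
definition l :: "nat \<Rightarrow> nat" where "l = (\<lambda>h\<in>{..<n}. gap (\<phi> h))"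
definition c :: "nat \<Rightarrow> nat" where "c = (\<lambda>h\<in>{..<n}. fst (\<phi> h))"

lemma \<phi>\<tau>: "h < n \<Longrightarrow> \<phi> (\<tau> h) = (N ^^ gap (\<phi> h)) (\<phi> h)"
  using \<psi>(2)[OF gap_props(2)[OF \<phi>_D]] by (simp add: \<tau>_def)

lemma \<phi>f: "h < n \<Longrightarrow> \<phi> (f h) = opp (\<phi> h)"
  using \<psi>(2)[OF opp(1)[OF \<phi>_D]] by (simp add: f_def)

lemma \<tau>_less: "h < n \<Longrightarrow> \<tau> h < n"
  using \<psi>(1)[OF gap_props(2)[OF \<phi>_D]] by (simp add: \<tau>_def)

lemma f_less: "h < n \<Longrightarrow> f h < n"
  using \<psi>(1)[OF opp(1)[OF \<phi>_D]] by (simp add: f_def)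

lemma \<tau>_permutes: "\<tau> permutes {..<n}"
proof -
  have "inj_on \<tau> {..<n}"
  proof (rule inj_onI)
    fix h h' assume h: "h \<in> {..<n}" "h' \<in> {..<n}" "\<tau> h = \<tau> h'"
    then have e: "(N ^^ gap (\<phi> h)) (\<phi> h) = (N ^^ gap (\<phi> h')) (\<phi> h')"
      using \<phi>\<tau>[of h] \<phi>\<tau>[of h'] by simp
    have "\<phi> h = \<phi> h'"
    proof (cases "gap (\<phi> h) \<le> gap (\<phi> h')")
      case True
      then show ?thesis
        using gap_compare[OF \<phi>_D \<phi>_D e True] gap_props(1)[OF \<phi>_D, of h] gap_props(1)[OF \<phi>_D, of h'] h by simp
    next
      case False
      then have le: "gap (\<phi> h') \<le> gap (\<phi> h)" by simp
      then show ?thesis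
        using gap_compare[OF \<phi>_D \<phi>_D e[symmetric] le] gap_props(1)[OF \<phi>_D, of h] gap_props(1)[OF \<phi>_D, of h'] h by simp
    qed
    then show "h = h'" using \<psi>(3) h by (metis lessThan_iff)
  qed
  moreover have "\<tau> ` {..<n} \<subseteq> {..<n}" using \<tau>_less by auto
  ultimately have "bij_betw \<tau> {..<n} {..<n}" by (simp add: bij_betw_def endo_inj_surj)
  then show ?thesis by (rule bij_imp_permutes) (simp add: \<tau>_def)
qed

lemma f_pairing: "f \<in> pairings {..<n}"
proof (rule pairingsI)
  fix h assume "h \<in> {..<n}"
  then have h: "h < n" by simp
  show "f h \<in> {..<n}" using f_less[OF h] by simp
  show "f h \<noteq> h" using \<phi>f[OF h] opp(4)[OF \<phi>_D[OF h]] by metis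
  have "\<phi> (f (f h)) = \<phi> h"
    using \<phi>f[OF f_less[OF h]] \<phi>f[OF h] opp(3)[OF \<phi>_D[OF h]] by simp
  then show "f (f h) = h" using \<psi>(3) h f_less by metis
qed (simp add: f_def)

lemma tile_bij: "bij_betw (\<lambda>(h, j). (N ^^ j) (\<phi> h)) (SIGMA h:{..<n}. {..<l h}) (sides s m)"
  unfolding bij_betw_def
proof
  show "inj_on (\<lambda>(h, j). (N ^^ j) (\<phi> h)) (SIGMA h:{..<n}. {..<l h})"
  proof (rule inj_onI, clarify)
    fix h j h' j' assume h: "h < n" "h' < n" "j < l h" "j' < l h'"
      and e: "(N ^^ j) (\<phi> h) = (N ^^ j') (\<phi> h')"
    have "\<phi> h = \<phi> h' \<and> j = j'"
    proof (cases "j \<le> j'")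
      case True
      have "j' - j < gap (\<phi> h')" using h by (simp add: l_def)
      from gap_compare[OF \<phi>_D[OF h(1)] \<phi>_D[OF h(2)] e True this] show ?thesis .
    next
      case False
      then have le: "j' \<le> j" by simp
      have "j - j' < gap (\<phi> h)" using h by (simp add: l_def)
      from gap_compare[OF \<phi>_D[OF h(2)] \<phi>_D[OF h(1)] e[symmetric] le this] show ?thesis by simp
    qed
    then show "h = h' \<and> j = j'" using \<psi>(3) h by metis
  qed
  show "(\<lambda>(h, j). (N ^^ j) (\<phi> h)) ` (SIGMA h:{..<n}. {..<l h}) = sides s m"
  proof
    show "(\<lambda>(h, j). (N ^^ j) (\<phi> h)) ` (SIGMA h:{..<n}. {..<l h}) \<subseteq> sides s m"
      using D_sides[OF \<phi>_D] by (auto simp: nx_funpow_in)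
    show "sides s m \<subseteq> (\<lambda>(h, j). (N ^^ j) (\<phi> h)) ` (SIGMA h:{..<n}. {..<l h})"
    proof
      fix y assume y: "y \<in> sides s m"
      have "fst y \<in> {1..s}" using y by (cases y) (auto simp: in_sides)
      from meets_D[OF this] obtain x0 where x0: "x0 \<in> D" "fst x0 = fst y" by blast
      have ex: "\<exists>a. \<exists>x\<in>D. (N ^^ a) x = y"
        using nx_transitive[OF D_sides[OF x0(1)] y x0(2)] x0 by auto
      define a where "a = (LEAST a. \<exists>x\<in>D. (N ^^ a) x = y)"
      have "\<exists>x\<in>D. (N ^^ a) x = y" unfolding a_def using ex by (rule LeastI_ex)
      then obtain x where x: "x \<in> D" "(N ^^ a) x = y" by auto
      have "a < gap x"
      proof (rule ccontr)
        assume "\<not> a < gap x"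
        then have "(N ^^ (a - gap x)) ((N ^^ gap x) x) = y"
          using x(2) by (metis funpow_add le_add_diff_inverse2 not_less o_apply)
        then have "\<exists>z\<in>D. (N ^^ (a - gap x)) z = y" using gap_props(2)[OF x(1)] by (rule bexI)
        then have "a \<le> a - gap x" unfolding a_def by (rule Least_le)
        then show False using gap_props(1)[OF x(1)] \<open>\<not> a < gap x\<close> by simp
      qed
      then show "y \<in> (\<lambda>(h, j). (N ^^ j) (\<phi> h)) ` (SIGMA h:{..<n}. {..<l h})"
        using x \<psi>(1,2)[of x] by (intro image_eqI[of _ _ "(\<psi> x, a)"]) (auto simp: l_def)
    qed
  qed
qed

sublocale subdivision s n m \<tau> f l \<phi> p
proof
  show "\<tau> permutes {..<n}" by (rule \<tau>_permutes)
  show "f \<in> pairings {..<n}" by (rule f_pairing)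
  show "1 \<le> l h" if "h < n" for h using gap_props(1)[OF \<phi>_D[OF that]] that by (simp add: l_def)
  show "l (f h) = l h" if "h < n" for h
    using \<phi>f[OF that] opp(2)[OF \<phi>_D[OF that]] f_less[OF that] that by (simp add: l_def)
  show "tiling s m n \<tau> l \<phi>"
    unfolding tiling_def using tile_bij \<phi>\<tau> \<phi>(2) D_sides[OF \<phi>_D] by (auto simp: PiE_def l_def)
  show "p x = x" if "x \<notin> sides s m" for x using pairings_out[OF pp that] .
  show "p ((N ^^ j) (\<phi> h)) = (N ^^ (l h - 1 - j)) (\<phi> (f h))" if "h < n" "j < l h" for h j
  proof -
    have j: "j < gap (\<phi> h)" "l h = gap (\<phi> h)" using that by (auto simp: l_def)
    have "gap (\<phi> h) - 1 - (gap (\<phi> h) - 1 - j) = j" using j by simp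
    then show ?thesis
      using opp_walk[OF \<phi>_D[OF that(1)], of "gap (\<phi> h) - 1 - j"] j \<phi>f[OF that(1)] by simp
  qed
qed

lemma graph: "(\<tau>, f, c) \<in> labelled_graphs g s n"
proof -
  have fstin: "fst (\<phi> h) \<in> {1..s}" if "h < n" for h
    using D_sides[OF \<phi>_D[OF that]] by (cases "\<phi> h") (auto simp: in_sides)
  have 1: "c \<in> {..<n} \<rightarrow>\<^sub>E {1..s}" using fstin by (auto simp: c_def)
  have 2: "c ` {..<n} = {1..s}"
  proof
    show "c ` {..<n} \<subseteq> {1..s}" using 1 by auto
    show "{1..s} \<subseteq> c ` {..<n}"
    proof
      fix i assume "i \<in> {1..s}"
      from meets_D[OF this] obtain x where "x \<in> D" "fst x = i" by blast
      then show "i \<in> c ` {..<n}" using \<psi>(1,2)[of x] by (intro image_eqI[of _ _ "\<psi> x"]) (auto simp: c_def)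
    qed
  qed
  have 3: "c h = c h' \<longleftrightarrow> h' \<in> orbit \<tau> h" if h: "h < n" "h' < n" for h h'
  proof
    assume "h' \<in> orbit \<tau> h"
    then have "h' < n \<and> c h' = c h"
    proof induction
      case base
      then show ?case using h \<tau>_less \<phi>\<tau> by (simp add: c_def)
    next
      case (step y)
      then have "y < n" "c y = c h" by auto
      moreover from this have "\<tau> y < n" "fst (\<phi> (\<tau> y)) = fst (\<phi> y)" using \<tau>_less \<phi>\<tau>[of y] by auto
      ultimately show ?case by (simp add: c_def)
    qed
    then show "c h = c h'" by simp
  next
    assume "c h = c h'"
    then have "fst (\<phi> h) = fst (\<phi> h')" using h by (simp add: c_def)
    then obtain a where "(N ^^ a) (\<phi> h) = \<phi> h'"
      using nx_transitive[OF D_sides[OF \<phi>_D[OF h(1)]] D_sides[OF \<phi>_D[OF h(2)]]] by auto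
    \<comment> \<open>Each application of \<tau> shortens the way to \<open>\<phi> h'\<close> by a
      gap, and a way shorter than the gap has length 0, because \<open>\<phi> h'\<close> is itself a
      core corner.\<close>
    then show "h' \<in> orbit \<tau> h" using h(1)
    proof (induction a arbitrary: h rule: less_induct)
      case (less a)
      show ?case
      proof (cases "a < gap (\<phi> h)")
        case True
        have "a = 0"
        proof (rule ccontr)
          assume "a \<noteq> 0"
          then show False using gap_props(3)[OF \<phi>_D[OF less.prems(2)], of a] True less.prems \<phi>_D[OF h(2)] by simp
        qed
        then have "h = h'" using less.prems \<psi>(3) h(2) by (metis funpow_0)
        then show ?thesis using orbit_self[OF \<tau>_permutes] by simp
      next
        case False
        then have "(N ^^ (a - gap (\<phi> h))) (\<phi> (\<tau> h)) = \<phi> h'"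
          using less.prems \<phi>\<tau>[OF less.prems(2)] by (metis funpow_add le_add_diff_inverse2 not_less o_apply)
        moreover have "a - gap (\<phi> h) < a" using gap_props(1)[OF \<phi>_D[OF less.prems(2)]] False by simp
        ultimately have "h' \<in> orbit \<tau> (\<tau> h)" using less.IH \<tau>_less[OF less.prems(2)] by blast
        then show ?thesis by (rule orbit_subset)
      qed
    qed
  qed
  have 4: "f \<in> gluings g s {..<n} \<tau> c"
    using gluings_iff[of c g] gl by (simp add: c_def)
  have 5: "\<tau> (f h) \<noteq> h \<and> \<tau> (f (\<tau> (f h))) \<noteq> h" if h: "h < n" for h
  proof
    have a: "\<phi> (\<tau> (f h)) = N (p (\<phi> h))" using rotation_outer[OF h] by simp
    then show "\<tau> (f h) \<noteq> h" using rot_neq[OF D_sides[OF \<phi>_D[OF h]]] by metis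
    have "\<phi> (\<tau> (f (\<tau> (f h)))) = N (p (N (p (\<phi> h))))"
      using rotation_outer[OF \<tau>f_less[OF h]] a by simp
    then show "\<tau> (f (\<tau> (f h))) \<noteq> h" using \<phi>_D[OF h] by (metis (mono_tags, lifting) core_set_def mem_Collect_eq)
  qed
  show ?thesis using \<tau>_permutes 1 2 3 4 5 by (auto simp: labelled_graphs_def)
qed

lemma lengths: "l \<in> edge_lengths n s f c m"
proof -
  have per: "perimeter n c l i = m i" if i: "i \<in> {1..s}" for i
  proof -
    let ?A = "SIGMA h:{h. h < n \<and> c h = i}. {..<l h}"
    have im: "(\<lambda>(h, j). (N ^^ j) (\<phi> h)) ` ?A = {i} \<times> {..<m i}"
    proof (intro set_eqI iffI)
      fix y assume "y \<in> (\<lambda>(h, j). (N ^^ j) (\<phi> h)) ` ?A"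
      then obtain h j where hj: "h < n" "c h = i" "y = (N ^^ j) (\<phi> h)" by auto
      then have "y \<in> sides s m" "fst y = i" using \<sigma>_in by (auto simp: c_def)
      then show "y \<in> {i} \<times> {..<m i}" by (cases y) (auto simp: in_sides)
    next
      fix y assume y: "y \<in> {i} \<times> {..<m i}"
      then have "y \<in> sides s m" using i by (cases y) (auto simp: in_sides)
      then obtain h j where hj: "h < n" "j < l h" "y = (N ^^ j) (\<phi> h)" by (rule \<sigma>_ex)
      have "fst y = fst (\<phi> h)" using hj by simp
      then have "c h = i" using hj(1) y by (auto simp: c_def)
      then show "y \<in> (\<lambda>(h, j). (N ^^ j) (\<phi> h)) ` ?A"
        using hj by (intro image_eqI[of _ _ "(h, j)"]) auto
    qed
    have "inj_on (\<lambda>(h, j). (N ^^ j) (\<phi> h)) ?A"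
      by (rule inj_on_subset[OF bij_betw_imp_inj_on[OF tile_bij]]) auto
    from card_image[OF this] have "card ?A = card ({i} \<times> {..<m i})" unfolding im by simp
    then show ?thesis by (simp add: perimeter_def)
  qed
  have "l \<in> {..<n} \<rightarrow>\<^sub>E {1..}" using l1 by (auto simp: l_def)
  then show ?thesis using per lf by (simp add: edge_lengths_def)
qed

end

section \<open>Leafless maps counted by their cores\<close>

lemma finite_labelled_graphs: "finite (labelled_graphs g s n)"
proof (rule finite_subset)
  show "labelled_graphs g s n \<subseteq> {\<tau>. \<tau> permutes {..<n}} \<times> pairings {..<n} \<times> ({..<n} \<rightarrow>\<^sub>E {1..s})"
    by (auto simp: labelled_graphs_def dest: gluings_pairings)
qed (intro finite_cartesian_product finite_permutations finite_pairings finite_PiE; simp)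

lemma edge_length_le:
  assumes "l \<in> edge_lengths n s f c m" "c \<in> {..<n} \<rightarrow>\<^sub>E {1..s}" "h < n"
  shows "l h \<le> m (c h)"
proof -
  have "c h \<in> {1..s}" using assms(2,3) by (metis PiE_mem lessThan_iff)
  then have "perimeter n c l (c h) = m (c h)" using assms(1) unfolding edge_lengths_def by blast
  moreover have "l h \<le> perimeter n c l (c h)"
    unfolding perimeter_def by (rule member_le_sum) (simp_all add: assms(3))
  ultimately show ?thesis by simp
qed

lemma finite_edge_lengths:
  assumes "c \<in> {..<n} \<rightarrow>\<^sub>E {1..s}"
  shows "finite (edge_lengths n s f c m)"
proof (rule finite_subset)
  show "edge_lengths n s f c m \<subseteq> (\<Pi>\<^sub>E h\<in>{..<n}. {..m (c h)})"
    using edge_length_le[OF _ assms]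
    by (intro subsetI PiE_I) (auto simp: edge_lengths_def PiE_iff extensional_def)
qed (intro finite_PiE; simp)

text \<open>Double count of the pairs of a leafless map with n core corners and a numbering \<phi>
  of these corners. A map has \<open>fact n\<close> numberings; on the other side, such a pair
  amounts to a labelled graph, edge lengths and a layout, and the layouts are counted by
  \<open>card_tiling_sets\<close>.\<close>

theorem card_leafless_maps:
  assumes s: "1 \<le> s" and gs: "(g, s) \<noteq> (0, 2)" and m: "\<And>i. i \<in> {1..s} \<Longrightarrow> 1 \<le> m i"
  shows "fact n * card {p \<in> leafless_maps g s m {1..s}. card (core_set s m p) = n} =
    (\<Sum>(\<tau>, f, c)\<in>labelled_graphs g s n. card (edge_lengths n s f c m) * (\<Prod>i=1..s. m i))"
proof -
  define P where "P = {p \<in> leafless_maps g s m {1..s}. card (core_set s m p) = n}"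
  define A where "A = (SIGMA p:P. {\<phi> \<in> {..<n} \<rightarrow>\<^sub>E core_set s m p. bij_betw \<phi> {..<n} (core_set s m p)})"
  define F where "F = (\<lambda>(\<tau>, c) l. {\<phi>. tiling s m n \<tau> l \<phi> \<and> (\<forall>h<n. fst (\<phi> h) = c h)})"
  define B where "B = (SIGMA G:labelled_graphs g s n. SIGMA l:edge_lengths n s (fst (snd G)) (snd (snd G)) m.
    F (fst G, snd (snd G)) l)"
  have finP: "finite P"
    unfolding P_def leafless_maps_def Maps_eq_gluings
    by (rule finite_subset[OF _ finite_gluings[OF finite_sides]]) auto
  have finD: "finite (core_set s m p)" for p
    by (rule finite_subset[OF _ finite_sides[of s m]]) (auto simp: core_set_def)
  have cA: "card A = fact n * card P"
  proof -
    have "card A = (\<Sum>p\<in>P. card {\<phi> \<in> {..<n} \<rightarrow>\<^sub>E core_set s m p. bij_betw \<phi> {..<n} (core_set s m p)})"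
      unfolding A_def
    proof (rule card_SigmaI[OF finP], rule ballI)
      fix p
      show "finite {\<phi> \<in> {..<n} \<rightarrow>\<^sub>E core_set s m p. bij_betw \<phi> {..<n} (core_set s m p)}"
        by (rule finite_subset[OF _ finite_PiE[of "{..<n}" "\<lambda>_. core_set s m p"]]) (use finD in auto)
    qed
    also have "\<dots> = (\<Sum>p\<in>P. fact n)"
      by (rule sum.cong[OF refl]) (use card_bijections[of "{..<n}"] finD in \<open>auto simp: P_def\<close>)
    finally show ?thesis by simp
  qed
  have cin: "c \<in> {..<n} \<rightarrow>\<^sub>E {1..s}" if "(\<tau>, f, c) \<in> labelled_graphs g s n" for \<tau> f c
    using that by (simp add: labelled_graphs_def)
  have finF: "finite (F G l)" for G l
    by (rule finite_subset[OF _ finite_PiE[of "{..<n}" "\<lambda>_. sides s m"]])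
       (auto simp: F_def tiling_def split: prod.splits)
  have cB: "card B = (\<Sum>(\<tau>, f, c)\<in>labelled_graphs g s n. card (edge_lengths n s f c m) * (\<Prod>i=1..s. m i))"
  proof -
    have "card B = (\<Sum>G\<in>labelled_graphs g s n. card (SIGMA l:edge_lengths n s (fst (snd G)) (snd (snd G)) m.
        F (fst G, snd (snd G)) l))"
      unfolding B_def
      by (rule card_SigmaI[OF finite_labelled_graphs])
         (auto intro!: finite_SigmaI finite_edge_lengths finF cin)
    also have "\<dots> = (\<Sum>(\<tau>, f, c)\<in>labelled_graphs g s n. card (edge_lengths n s f c m) * (\<Prod>i=1..s. m i))"
    proof (rule sum.cong[OF refl], clarify)
      fix \<tau> f c assume G: "(\<tau>, f, c) \<in> labelled_graphs g s n"
      have "card (SIGMA l:edge_lengths n s f c m. F (\<tau>, c) l) = (\<Sum>l\<in>edge_lengths n s f c m. card (F (\<tau>, c) l))"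
        by (rule card_SigmaI) (use finite_edge_lengths[OF cin[OF G]] finF in auto)
      also have "\<dots> = (\<Sum>l\<in>edge_lengths n s f c m. \<Prod>i=1..s. m i)"
        by (rule sum.cong[OF refl]) (use card_tiling_sets[OF s G _ m] in \<open>simp add: F_def\<close>)
      finally show "card (SIGMA l:edge_lengths n s (fst (snd (\<tau>, f, c))) (snd (snd (\<tau>, f, c))) m.
          F (fst (\<tau>, f, c), snd (snd (\<tau>, f, c))) l) = card (edge_lengths n s f c m) * (\<Prod>i=1..s. m i)"
        by simp
    qed
    finally show ?thesis .
  qed
  define R where "R = (\<lambda>(p, \<phi>) ((\<tau>, f, c :: nat \<Rightarrow> nat), l, \<phi>'). \<phi> = \<phi>' \<and> subdivision s n m \<tau> f l \<phi> p)"
  have memA: "(p, \<phi>) \<in> A \<longleftrightarrow> p \<in> gluings g s (sides s m) (nx s m) fst \<and> (\<forall>i\<in>{1..s}. leafless s m p i) \<and>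
      card (core_set s m p) = n \<and> \<phi> \<in> {..<n} \<rightarrow>\<^sub>E core_set s m p \<and> bij_betw \<phi> {..<n} (core_set s m p)" for p \<phi>
    by (auto simp: A_def P_def leafless_maps_def Maps_eq_gluings)
  have memB: "((\<tau>, f, c), l, \<phi>) \<in> B \<longleftrightarrow> (\<tau>, f, c) \<in> labelled_graphs g s n \<and> l \<in> edge_lengths n s f c m \<and>
      tiling s m n \<tau> l \<phi> \<and> (\<forall>h<n. fst (\<phi> h) = c h)" for \<tau> f c l \<phi>
    by (auto simp: B_def F_def)
  have "card A = card B"
  proof (rule card_eq_by_relation[where R = R])
    fix a assume "a \<in> A"
    then obtain p \<phi> where a: "a = (p, \<phi>)" and "(p, \<phi>) \<in> A" by (cases a) auto
    then interpret core_map g s n m \<phi> p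
      using s gs m by unfold_locales (auto simp: memA PiE_def)
    have "((\<tau>, f, c), l, \<phi>) \<in> B"
      using graph lengths T by (simp add: memB c_def)
    moreover have "R a ((\<tau>, f, c), l, \<phi>)"
      using subdivision_axioms by (simp add: R_def a)
    ultimately show "\<exists>b\<in>B. R a b" by blast
  next
    fix b assume "b \<in> B"
    then obtain \<tau> f c l \<phi> where b: "b = ((\<tau>, f, c), l, \<phi>)" and B: "((\<tau>, f, c), l, \<phi>) \<in> B"
      by (metis prod_cases3 prod_cases5 surj_pair)
    have G: "(\<tau>, f, c) \<in> labelled_graphs g s n" and l: "l \<in> edge_lengths n s f c m"
      and T: "tiling s m n \<tau> l \<phi>" and c: "\<And>h. h < n \<Longrightarrow> fst (\<phi> h) = c h"
      using B by (auto simp: memB)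
    let ?t = "\<lambda>(h, j). (nx s m ^^ j) (\<phi> h)" and ?D = "SIGMA h:{..<n}. {..<l h}"
    have inj: "inj_on ?t ?D" and onto: "?t ` ?D = sides s m" using T by (auto simp: tiling_def bij_betw_def)
    define p where "p x = (if x \<in> sides s m then
      (case inv_into ?D ?t x of (h, j) \<Rightarrow> (nx s m ^^ (l h - 1 - j)) (\<phi> (f h))) else x)" for x
    interpret subdivision s n m \<tau> f l \<phi> p
    proof
      show "\<tau> permutes {..<n}" using G by (simp add: labelled_graphs_def)
      show "f \<in> pairings {..<n}" using G by (auto simp: labelled_graphs_def dest: gluings_pairings)
      show "1 \<le> l h" "l (f h) = l h" if "h < n" for h
        using l that by (auto simp: edge_lengths_def PiE_iff)
      show "tiling s m n \<tau> l \<phi>" by (rule T)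
      show "p x = x" if "x \<notin> sides s m" for x using that by (simp add: p_def)
      show "p ((nx s m ^^ j) (\<phi> h)) = (nx s m ^^ (l h - 1 - j)) (\<phi> (f h))" if "h < n" "j < l h" for h j
      proof -
        have hj: "(h, j) \<in> ?D" using that by simp
        have "(nx s m ^^ j) (\<phi> h) = ?t (h, j)" by simp
        then have "inv_into ?D ?t ((nx s m ^^ j) (\<phi> h)) = (h, j)"
          using inv_into_f_f[OF inj hj] by simp
        moreover have "(nx s m ^^ j) (\<phi> h) \<in> sides s m"
          unfolding onto[symmetric] using hj by (intro image_eqI[of _ _ "(h, j)"]) auto
        ultimately show ?thesis by (simp add: p_def)
      qed
    qed
    have val: "\<And>h. h < n \<Longrightarrow> \<tau> (f h) \<noteq> h" "\<And>h. h < n \<Longrightarrow> \<tau> (f (\<tau> (f h))) \<noteq> h"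
      using G by (auto simp: labelled_graphs_def)
    have core: "core_set s m p = \<phi> ` {..<n}" by (rule core_set_eq[OF val(2)])
    have inj\<phi>: "inj_on \<phi> {..<n}" using \<phi>_inj by (auto intro: inj_onI)
    have "p \<in> gluings g s (sides s m) (nx s m) fst"
      using gluings_iff[OF c, of g] G by (simp add: labelled_graphs_def)
    then have "(p, \<phi>) \<in> A"
      unfolding memA core bij_betw_def using leafless[OF val(1)] inj\<phi> T
      by (auto simp: card_image tiling_def PiE_iff)
    then show "\<exists>a\<in>A. R a b" using subdivision_axioms by (intro bexI[of _ "(p, \<phi>)"]) (auto simp: R_def b)
  next
    fix a b b' assume ab: "a \<in> A" "b \<in> B" "b' \<in> B" "R a b" "R a b'"
    obtain p \<phi> where a: "a = (p, \<phi>)" by (cases a)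
    obtain \<tau> f c l \<phi>1 where b: "b = ((\<tau>, f, c), l, \<phi>1)" by (metis prod_cases3 prod_cases5 surj_pair)
    obtain \<tau>' f' c' l' \<phi>2 where b': "b' = ((\<tau>', f', c'), l', \<phi>2)" by (metis prod_cases3 prod_cases5 surj_pair)
    have \<phi>: "\<phi>1 = \<phi>" "\<phi>2 = \<phi>" using ab by (auto simp: R_def a b b')
    interpret S: subdivision s n m \<tau> f l \<phi> p using ab(4) by (auto simp: R_def a b)
    interpret S': subdivision s n m \<tau>' f' l' \<phi> p using ab(5) by (auto simp: R_def a b')
    have mB: "((\<tau>, f, c), l, \<phi>) \<in> B" "((\<tau>', f', c'), l', \<phi>) \<in> B" using ab \<phi> b b' by auto
    \<comment> \<open>\<phi> determines the lengths, then the ends of the runs and thereby \<tau>,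
      and finally f through the partner of the last side of each run.\<close>
    have ll: "l h = l' h" if "h < n" for h
      using S.length_least[OF that] S'.length_least[OF that] by simp
    have "l = l'"
      using mB ll unfolding memB edge_lengths_def by (intro PiE_ext[of l "{..<n}" "\<lambda>_. {1..}" l']) auto
    moreover have "c = c'"
    proof (rule PiE_ext)
      show "c \<in> {..<n} \<rightarrow>\<^sub>E {1..s}" "c' \<in> {..<n} \<rightarrow>\<^sub>E {1..s}" using mB cin unfolding memB by blast+
      show "c h = c' h" if "h \<in> {..<n}" for h using mB that unfolding memB by simp
    qed
    moreover have "\<tau> = \<tau>'"
    proof
      fix h show "\<tau> h = \<tau>' h"
      proof (cases "h < n")
        case True
        then have "\<phi> (\<tau> h) = \<phi> (\<tau>' h)" using S.\<sigma>_end[OF True] S'.\<sigma>_end[OF True] ll[OF True] by simp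
        moreover have "\<tau> h < n" "\<tau>' h < n"
          using permutes_in_image[OF S.\<tau>, of h] permutes_in_image[OF S'.\<tau>, of h] True by auto
        ultimately show ?thesis using S.\<phi>_inj by blast
      next
        case False
        then show ?thesis using permutes_not_in[OF S.\<tau>, of h] permutes_not_in[OF S'.\<tau>, of h] by simp
      qed
    qed
    moreover have "f = f'"
    proof (rule pairings_eqI[OF S.f S'.f])
      fix h assume "h \<in> {..<n}"
      then have h: "h < n" by simp
      have "\<phi> (f h) = \<phi> (f' h)"
        using S.p_side[OF h, of "l h - 1"] S'.p_side[OF h, of "l h - 1"] S.l1[OF h] ll[OF h] by simp
      then show "f h = f' h" using S.\<phi>_inj S.f_less S'.f_less h by blast
    qed
    ultimately show "b = b'" by (simp add: b b' \<phi>)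
  next
    fix a a' b assume ab: "a \<in> A" "a' \<in> A" "b \<in> B" "R a b" "R a' b"
    obtain p \<phi> where a: "a = (p, \<phi>)" by (cases a)
    obtain p' \<phi>' where a': "a' = (p', \<phi>')" by (cases a')
    obtain \<tau> f c l \<phi>1 where b: "b = ((\<tau>, f, c), l, \<phi>1)" by (metis prod_cases3 prod_cases5 surj_pair)
    have \<phi>: "\<phi>1 = \<phi>" "\<phi>' = \<phi>" using ab by (auto simp: R_def a a' b)
    interpret S: subdivision s n m \<tau> f l \<phi> p using ab(4) by (auto simp: R_def a b)
    interpret S': subdivision s n m \<tau> f l \<phi> p' using ab(5) \<phi> by (auto simp: R_def a' b)
    have "p = p'"
    proof (rule pairings_eqI[OF S.p_pairing S'.p_pairing])
      fix x assume "x \<in> sides s m"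
      then obtain h j where "h < n" "j < l h" "x = (nx s m ^^ j) (\<phi> h)" by (rule S.\<sigma>_ex)
      then show "p x = p' x" using S.p_side S'.p_side by simp
    qed
    then show "a = a'" using a a' \<phi> by simp
  qed
  then show ?thesis using cA cB by (simp add: P_def)
qed

section \<open>Trivalent graphs\<close>

lemma sum_card_orbits:
  assumes "finite H" "f permutes H"
  shows "card H = (\<Sum>C\<in>orbit f ` H. card C)"
proof -
  have "H = \<Union> (orbit f ` H)"
    using permutes_orbit_subset[OF assms(2)] orbit_self[OF assms(2,1)] by blast
  then have "card H = card (\<Union> (orbit f ` H))" by simp
  also have "\<dots> = (\<Sum>C\<in>orbit f ` H. card C)"
  proof (rule card_Union_disjoint)
    show "pairwise disjnt (orbit f ` H)"
      unfolding pairwise_def disjnt_def using orbit_eq_iff[OF assms(2,1)] by blast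
    show "finite C" if "C \<in> orbit f ` H" for C
      using that permutes_orbit_subset[OF assms(2)] assms(1) finite_subset by blast
  qed
  finally show ?thesis .
qed

locale labelled_graph =
  fixes g s n :: nat and \<tau> f c :: "nat \<Rightarrow> nat"
  assumes G: "(\<tau>, f, c) \<in> labelled_graphs g s n"
begin

abbreviation "r \<equiv> \<tau> \<circ> f"

lemma \<tau>: "\<tau> permutes {..<n}" using G by (simp add: labelled_graphs_def)
lemma gl: "f \<in> gluings g s {..<n} \<tau> c" using G by (simp add: labelled_graphs_def)
lemma f: "f \<in> pairings {..<n}" using gl by (rule gluings_pairings)
lemma ff [simp]: "f (f h) = h" using pairings_double[OF f] .
lemma c: "c \<in> {..<n} \<rightarrow>\<^sub>E {1..s}" using G by (simp add: labelled_graphs_def)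
lemma c_onto: "c ` {..<n} = {1..s}" using G by (simp add: labelled_graphs_def)
lemma cell: "h < n \<Longrightarrow> h' < n \<Longrightarrow> c h = c h' \<longleftrightarrow> h' \<in> orbit \<tau> h" using G by (simp add: labelled_graphs_def)
lemma r: "r permutes {..<n}" using pairings_permutes[OF f] \<tau> by (rule permutes_compose)
lemma r_less: "r h < n \<longleftrightarrow> h < n" using permutes_in_image[OF r, of h] by simp
lemma \<tau>_less: "\<tau> h < n \<longleftrightarrow> h < n" using permutes_in_image[OF \<tau>, of h] by simp
lemma f_less: "f h < n \<longleftrightarrow> h < n" using permutes_in_image[OF pairings_permutes[OF f], of h] by simp
lemma r_inj: "r h = r h' \<longleftrightarrow> h = h'" using permutes_inj[OF r] by (metis injD)
lemma val: "h < n \<Longrightarrow> r h \<noteq> h" "h < n \<Longrightarrow> r (r h) \<noteq> h" using G by (auto simp: labelled_graphs_def)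

lemma r_orbit: "h \<in> orbit r h" "r h \<in> orbit r h" "r (r h) \<in> orbit r h" "r (r (r h)) \<in> orbit r h"
  by (rule orbit_self[OF r finite_lessThan]) (intro orbit.intros)+

lemma orbit_card: "h < n \<Longrightarrow> 3 \<le> card (orbit r h)"
proof -
  assume h: "h < n"
  have "{h, r h, r (r h)} \<subseteq> orbit r h"
    using r_orbit[of h] by blast
  moreover have "finite (orbit r h)" by (rule finite_orbit[OF r_orbit(1)])
  ultimately have "card {h, r h, r (r h)} \<le> card (orbit r h)" by (rule card_mono[rotated])
  moreover have "card {h, r h, r (r h)} = 3" using val[OF h] r_inj[of h "r h"] by (auto simp: card_insert_if)
  ultimately show ?thesis by simp
qed

lemma n_even: "n = 2 * (n div 2)" and card_edges: "card ((\<lambda>h. {h, f h}) ` {..<n}) = n div 2"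
proof -
  have *: "n = 2 * card (orbit f ` {..<n})"
    using card_involution_orbits[OF _ pairings_permutes[OF f], of "{..<n}"] pairings_neq[OF f] f_less by simp
  show "n = 2 * (n div 2)" using * by presburger
  have "orbit f h = {h, f h}" for h
  proof
    show "orbit f h \<subseteq> {h, f h}"
    proof
      fix y assume "y \<in> orbit f h"
      then show "y \<in> {h, f h}" by induction auto
    qed
    show "{h, f h} \<subseteq> orbit f h"
      using orbit_self[OF pairings_permutes[OF f]] by (auto intro: orbit.base)
  qed
  then show "card ((\<lambda>h. {h, f h}) ` {..<n}) = n div 2" using * by simp
qed

lemma euler: "2 * int (card (orbit r ` {..<n})) = int n + 4 - 4 * int g - 2 * int s"
  using gl n_even unfolding gluings_def by (auto elim!: evenE)

text \<open>Valence at least 3 gives 3 V \<le> n, and Euler's relation gives 2 V = n + 4 - 4 g - 2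
  s. Eliminating V bounds the number n of half-edges, with equality exactly if all vertices are
  trivalent.\<close>

lemma n_le: "int n \<le> 12 * int g - 12 + 6 * int s"
  and n_eq: "int n = 12 * int g - 12 + 6 * int s \<longleftrightarrow> (\<forall>h<n. r (r (r h)) = h)"
proof -
  let ?V = "card (orbit r ` {..<n})"
  have n: "n = (\<Sum>C\<in>orbit r ` {..<n}. card C)"
    using sum_card_orbits[OF _ r] by simp
  have ge: "(\<Sum>C\<in>orbit r ` {..<n}. 3) \<le> (\<Sum>C\<in>orbit r ` {..<n}. card C)"
    by (rule sum_mono) (use orbit_card in auto)
  then show "int n \<le> 12 * int g - 12 + 6 * int s" using n euler by simp
  have iff: "int n = 12 * int g - 12 + 6 * int s \<longleftrightarrow> n = 3 * ?V"
    using euler by linarith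
  show "int n = 12 * int g - 12 + 6 * int s \<longleftrightarrow> (\<forall>h<n. r (r (r h)) = h)"
    unfolding iff
  proof
    assume n3: "n = 3 * ?V"
    have all3: "card C = 3" if "C \<in> orbit r ` {..<n}" for C
    proof (rule ccontr)
      assume "card C \<noteq> 3"
      then have "3 < card C" using orbit_card that by force
      then have "(\<Sum>C\<in>orbit r ` {..<n}. 3) < (\<Sum>C\<in>orbit r ` {..<n}. card C)"
        using that orbit_card by (intro sum_strict_mono_ex1) auto
      then show False using n n3 by simp
    qed
    show "\<forall>h<n. r (r (r h)) = h"
    proof (intro allI impI)
      fix h assume h: "h < n"
      have sub: "{h, r h, r (r h)} \<subseteq> orbit r h" "r (r (r h)) \<in> orbit r h"
        using r_orbit[of h] by blast+
      have "card {h, r h, r (r h)} = 3" using val[OF h] r_inj[of h "r h"] by (auto simp: card_insert_if)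
      moreover have "card (orbit r h) = 3" using all3 h by auto
      moreover have "finite (orbit r h)" by (rule finite_orbit[OF r_orbit(1)])
      ultimately have "{h, r h, r (r h)} = orbit r h" using sub card_subset_eq by metis
      then have "r (r (r h)) \<in> {h, r h, r (r h)}" using sub by simp
      moreover have "r (r (r h)) \<noteq> r (r h)" "r (r (r h)) \<noteq> r h"
        using val[of h] h r_inj by (simp_all del: o_apply)
      ultimately show "r (r (r h)) = h" by blast
    qed
  next
    assume r3: "\<forall>h<n. r (r (r h)) = h"
    have "card (orbit r h) \<le> 3" if "h < n" for h
    proof -
      have "orbit r h \<subseteq> {h, r h, r (r h)}"
      proof
        fix y assume "y \<in> orbit r h"
        then show "y \<in> {h, r h, r (r h)}" by induction (use r3 that in auto)
      qed
      then have "card (orbit r h) \<le> card {h, r h, r (r h)}" by (rule card_mono[rotated]) simp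
      also have "\<dots> \<le> 3" by (auto simp: card_insert_if)
      finally show ?thesis .
    qed
    then have "(\<Sum>C\<in>orbit r ` {..<n}. card C) \<le> (\<Sum>C\<in>orbit r ` {..<n}. 3)"
      by (intro sum_mono) auto
    then show "n = 3 * ?V" using n ge by simp
  qed
qed

text \<open>A vertex of valence at least 4 is split: two consecutive half-edges \<open>x\<close> and \<open>r x\<close> move to a new
  trivalent vertex, joined by a new edge \<open>{n, n + 1}\<close> to the remaining ones.\<close>

lemma split_vertex:
  assumes lt: "int n < 12 * int g - 12 + 6 * int s"
  shows "labelled_graphs g s (n + 2) \<noteq> {}"
proof -
  have "\<not> (\<forall>h<n. r (r (r h)) = h)" using lt n_eq by (metis less_irrefl)
  then obtain x where x: "x < n" and x3: "r (r (r x)) \<noteq> x" by blast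
  define a b where "a = r x" and "b = r (r x)"
  have ab: "a < n" "b < n" "a \<noteq> x" "b \<noteq> x" "a \<noteq> b" "r x = a" "r a = b" "r b \<noteq> x"
  proof -
    show "a < n" unfolding a_def r_less by (rule x)
    then show "b < n" unfolding b_def a_def[symmetric] r_less .
    show "a \<noteq> x" unfolding a_def by (rule val(1)[OF x])
    then show "a \<noteq> b" unfolding b_def a_def by (simp only: r_inj not_False_eq_True)
    show "b \<noteq> x" unfolding b_def by (rule val(2)[OF x])
    show "r x = a" "r a = b" unfolding a_def b_def by (rule refl)+
    show "r b \<noteq> x" unfolding b_def by (rule x3)
  qed
  define f' where "f' h = (if h = n then n + 1 else if h = n + 1 then n else f h)" for h
  \<comment> \<open>In the faces, n is inserted just before b and n + 1 just before x. The vertex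
    permutation then has the 3-cycle x, a, n, and in the old cycle n + 1 takes the place of x and a
    in front of b. Below, \<pi> sends a new half-edge to its successor in the same face.\<close>
  define \<tau>' where "\<tau>' h = (if h = n then b else if h = n + 1 then x else if h < n then
      (if \<tau> h = b then n else if \<tau> h = x then n + 1 else \<tau> h) else h)" for h
  define \<pi> where "\<pi> h = (if h = n then b else if h = n + 1 then x else h)" for h
  define c' where "c' = (\<lambda>h\<in>{..<n+2}. c (\<pi> h))"
  define r' where "r' = \<tau>' \<circ> f'"
  have \<tau>inj: "\<tau> h = \<tau> h' \<longleftrightarrow> h = h'" for h h' using permutes_inj[OF \<tau>] by (metis injD)
  have less: "h < n + 2 \<longleftrightarrow> h < n \<or> h = n \<or> h = n + 1" for h by auto
  have \<tau>': "\<tau>' permutes {..<n+2}"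
  proof -
    have "inj_on \<tau>' {..<n+2}"
    proof (rule inj_onI)
      fix u v assume uv: "u \<in> {..<n+2}" "v \<in> {..<n+2}" and eq: "\<tau>' u = \<tau>' v"
      have bx: "b < n" "b \<noteq> x" "x < n" using ab x by auto
      have "u < n \<or> u = n \<or> u = n + 1" "v < n \<or> v = n \<or> v = n + 1" using uv by auto
      then show "u = v"
        using eq bx \<tau>_less[of u] \<tau>_less[of v] \<tau>inj[of u v]
        by (elim disjE) (simp_all add: \<tau>'_def split: if_splits)
    qed
    moreover have "\<tau>' ` {..<n+2} \<subseteq> {..<n+2}"
    proof
      fix z assume "z \<in> \<tau>' ` {..<n+2}"
      then obtain u where u: "u < n + 2" "z = \<tau>' u" by auto
      then show "z \<in> {..<n+2}"
        using ab(2) x \<tau>_less[of u] by (cases "u < n") (auto simp: \<tau>'_def less)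
    qed
    ultimately have "bij_betw \<tau>' {..<n+2} {..<n+2}" by (simp add: bij_betw_def endo_inj_surj)
    then show ?thesis by (rule bij_imp_permutes) (auto simp: \<tau>'_def)
  qed
  have f'_less: "f' h < n + 2" if "h < n + 2" for h using that f_less[of h] by (auto simp: f'_def less)
  have f': "f' \<in> pairings {..<n+2}"
  proof (rule pairingsI)
    show "f' h = h" if "h \<notin> {..<n+2}" for h
      using that pairings_out[OF f, of h] by (auto simp: f'_def)
    show "f' h \<noteq> h" "f' (f' h) = h" if "h \<in> {..<n+2}" for h
      using that f_less[of h] pairings_neq[OF f, of h] by (auto simp: f'_def less)
  qed (use f'_less in auto)
  have r'p: "r' permutes {..<n+2}" unfolding r'_def using pairings_permutes[OF f'] \<tau>' by (rule permutes_compose)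
  have r'n: "r' n = x" "r' (n + 1) = b" by (auto simp: r'_def f'_def \<tau>'_def)
  have r'_old: "r' h = (if r h = b then n else if r h = x then n + 1 else r h)" if "h < n" for h
    using that f_less[of h] by (auto simp: r'_def f'_def \<tau>'_def)
  have rb: "r h = b \<longleftrightarrow> h = a" for h using r_inj[of h a] ab by (simp del: o_apply)
  have ra: "r h = a \<longleftrightarrow> h = x" for h using r_inj[of h x] ab by (simp del: o_apply)
  have r'xa: "r' x = a" "r' a = n" using r'_old[OF x] r'_old[OF ab(1)] ab by (auto simp del: o_apply)
  have r'_other: "r' h = (if r h = x then n + 1 else r h)" if "h < n" "h \<noteq> a" for h
    using r'_old[OF that(1)] rb[of h] that(2) by (simp del: o_apply)
  note self = orbit_self[OF \<tau>, simplified] and self' = orbit_self[OF \<tau>', simplified]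
  have \<pi>_less: "\<pi> h < n" if "h < n + 2" for h using that ab x by (auto simp: \<pi>_def less)
  have cells: "h' \<in> orbit \<tau>' h \<longleftrightarrow> \<pi> h' \<in> orbit \<tau> (\<pi> h)" if h: "h < n + 2" "h' < n + 2" for h h'
  proof
    assume "h' \<in> orbit \<tau>' h"
    then have "h' \<in> {..<n+2} \<and> \<pi> h' \<in> orbit \<tau> (\<pi> h)"
    proof (rule orbit_map)
      show "h \<in> {..<n+2}" using h by simp
      show "\<tau>' v \<in> {..<n+2}" if "v \<in> {..<n+2}" for v using that permutes_in_image[OF \<tau>'] by blast
      fix v assume "v \<in> {..<n+2}"
      then have "\<pi> (\<tau>' v) = \<tau> (\<pi> v) \<or> \<pi> (\<tau>' v) = \<pi> v"
        using \<tau>_less[of v] ab x by (auto simp: \<pi>_def \<tau>'_def less)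
      then show "\<pi> (\<tau>' v) \<in> orbit \<tau> (\<pi> v)" using self orbit.base by metis
    qed
    then show "\<pi> h' \<in> orbit \<tau> (\<pi> h)" by simp
  next
    assume "\<pi> h' \<in> orbit \<tau> (\<pi> h)"
    then have "\<pi> h' \<in> {..<n} \<and> id (\<pi> h') \<in> orbit \<tau>' (id (\<pi> h))"
    proof (rule orbit_map)
      show "\<pi> h \<in> {..<n}" using \<pi>_less h by simp
      show "\<tau> v \<in> {..<n}" if "v \<in> {..<n}" for v using that \<tau>_less by simp
      fix v assume "v \<in> {..<n}"
      then have "\<tau>' v = \<tau> v \<or> \<tau>' (\<tau>' v) = \<tau> v"
        using ab x by (auto simp: \<tau>'_def)
      then show "id (\<tau> v) \<in> orbit \<tau>' (id v)" by (metis id_apply orbit.base orbit.step)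
    qed
    then have 1: "\<pi> h' \<in> orbit \<tau>' (\<pi> h)" by simp
    have 2: "\<pi> v \<in> orbit \<tau>' v" if "v < n + 2" for v
    proof -
      have "\<pi> v = v \<or> \<pi> v = \<tau>' v" by (auto simp: \<pi>_def \<tau>'_def)
      then show ?thesis using self' orbit.base by metis
    qed
    have 3: "h' \<in> orbit \<tau>' (\<pi> h')"
      using 2[OF h(2)] orbit_eq_iff[OF \<tau>', of h' "\<pi> h'"] self' by auto
    show "h' \<in> orbit \<tau>' h" using orbit_trans[OF orbit_trans[OF 3 1] 2[OF h(1)]] .
  qed
  have c'in: "c' \<in> {..<n+2} \<rightarrow>\<^sub>E {1..s}"
    using c \<pi>_less by (auto simp: c'_def)
  have c'onto: "c' ` {..<n+2} = {1..s}"
  proof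
    show "c' ` {..<n+2} \<subseteq> {1..s}" using c'in by auto
    have "c h = c' h" if "h < n" for h using that by (simp add: c'_def \<pi>_def)
    then show "{1..s} \<subseteq> c' ` {..<n+2}" unfolding c_onto[symmetric] by auto
  qed
  have c'cell: "c' h = c' h' \<longleftrightarrow> h' \<in> orbit \<tau>' h" if "h < n + 2" "h' < n + 2" for h h'
    using cells[OF that] cell[OF \<pi>_less[OF that(1)] \<pi>_less[OF that(2)]] that by (simp add: c'_def)
  have valence: "r' h \<noteq> h \<and> r' (r' h) \<noteq> h" if h: "h < n + 2" for h
  proof -
    consider "h = n" | "h = n + 1" | "h = x" | "h = a" | "h < n" "h \<noteq> x" "h \<noteq> a"
      using h unfolding less by blast
    then show ?thesis
    proof cases
      case 1
      then show ?thesis using r'n r'xa x ab by simp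
    next
      case 2
      \<comment> \<open>Here the valence of the old vertex enters: since r b \<noteq> x, the cycle
        of n + 1 contains r b besides b.\<close>
      have "r' b = r b" using r'_other[OF ab(2)] ab by (simp del: o_apply)
      then show ?thesis using 2 r'n ab r_less[of b] by (simp del: o_apply)
    next
      case 3
      then show ?thesis using r'xa ab x by simp
    next
      case 4
      then show ?thesis using r'xa r'n ab x by simp
    next
      case 5
      show ?thesis
      proof (cases "r h = x")
        case True
        then have "r' h = n + 1" using r'_other 5 by (simp del: o_apply)
        moreover have "b \<noteq> h" using True ab by (metis)
        ultimately show ?thesis using r'n 5 by simp
      next
        case False
        then have e: "r' h = r h" using r'_other 5 by (simp del: o_apply)
        have "r h < n" "r h \<noteq> a" using 5 r_less ra by auto
        then have "r' (r h) = (if r (r h) = x then n + 1 else r (r h))" by (rule r'_other)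
        then show ?thesis using e val[OF 5(1)] 5 by (auto simp del: o_apply)
      qed
    qed
  qed
  let ?A = "{x, a, n}"
  let ?K = "{..<n+2} - ?A"
  have A: "?A \<subseteq> {..<n+2}" using x ab by auto
  have A_inv: "r' v \<in> ?A" if "v \<in> ?A" for v using that r'xa r'n by auto
  have r'inj: "r' u = r' v \<longleftrightarrow> u = v" for u v using permutes_inj[OF r'p] by (metis injD)
  have K_inv: "r' v \<in> ?K" if v: "v \<in> ?K" for v
  proof -
    have "r' v \<in> {..<n+2}" using v permutes_in_image[OF r'p] by blast
    moreover have "r' v \<noteq> x" "r' v \<noteq> a" "r' v \<noteq> n"
      using v r'inj[of v n] r'inj[of v x] r'inj[of v a] r'n r'xa by auto
    ultimately show ?thesis by auto
  qed
  have "orbit r' ` ?A = {orbit r' x}"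
  proof -
    have "a \<in> orbit r' x" "n \<in> orbit r' x" using r'xa by (metis orbit.base, metis orbit.base orbit.step)
    then have "orbit r' a = orbit r' x" "orbit r' n = orbit r' x"
      using orbit_eq_iff[OF r'p finite_lessThan, of x] by blast+
    then show ?thesis by auto
  qed
  then have VA: "card (orbit r' ` ?A) = 1" by simp
  define \<iota> where "\<iota> v = (if v = x \<or> v = a then n + 1 else v)" for v
  define \<rho> where "\<rho> v = (if v = n + 1 then x else v)" for v
  note rself = orbit_self[OF r, simplified] and r'self = orbit_self[OF r'p, simplified]
  \<comment> \<open>The old vertex survives with x and a collapsed into n + 1, and the other
    vertices do not change. Together with the new trivalent vertex, V and E both grow by
    one.\<close>
  have VK: "card (orbit r' ` ?K) = card (orbit r ` {..<n})"
  proof (rule card_orbits_eq[where \<iota> = \<iota> and \<pi> = \<rho>, OF _ _ r'p r _ K_inv])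
    show "\<iota> u \<in> ?K" if "u \<in> {..<n}" for u using that x ab by (auto simp: \<iota>_def)
    show "\<iota> (r u) \<in> orbit r' (\<iota> u)" if u: "u \<in> {..<n}" for u
    proof -
      consider "u = x" | "u = a" | "u \<noteq> x" "u \<noteq> a" by blast
      then show ?thesis
      proof cases
        case 1
        then have "\<iota> (r u) = \<iota> u" using ab by (simp add: \<iota>_def del: o_apply)
        then show ?thesis using r'self by simp
      next
        case 2
        then have "\<iota> (r u) = r' (\<iota> u)" using ab r'n by (simp add: \<iota>_def del: o_apply)
        then show ?thesis by (metis orbit.base)
      next
        case 3
        then have "r u \<noteq> a" using ra by blast
        then have "\<iota> (r u) = r' (\<iota> u)" using 3 r'_other[of u] u by (simp add: \<iota>_def del: o_apply)
        then show ?thesis by (metis orbit.base)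
      qed
    qed
    show "\<rho> v \<in> {..<n}" if "v \<in> ?K" for v using that x by (auto simp: \<rho>_def)
    show "\<rho> (r' v) \<in> orbit r (\<rho> v)" if v: "v \<in> ?K" for v
    proof (cases "v = n + 1")
      case True
      then have "\<rho> (r' v) = r (r (\<rho> v))" using r'n ab by (simp add: \<rho>_def del: o_apply)
      then show ?thesis by (metis orbit.base orbit.step)
    next
      case False
      then have v': "v < n" "v \<noteq> a" using v by auto
      have "r v < n" using v' r_less by blast
      then have "\<rho> (r' v) = r (\<rho> v)"
        using r'_other[OF v'] v' by (auto simp: \<rho>_def simp del: o_apply)
      then show ?thesis by (metis orbit.base)
    qed
    show "\<rho> (\<iota> u) \<in> orbit r u" if "u \<in> {..<n}" for u
    proof (cases "u = a")
      case True
      have "a \<in> orbit r x" using ab(6) orbit.base[of r x] by simp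
      then have "x \<in> orbit r a" using orbit_eq_iff[OF r, of x a] rself by (metis finite_lessThan orbit_eq_iff[OF r])
      then show ?thesis using True by (simp add: \<rho>_def \<iota>_def)
    next
      case False
      then have "\<rho> (\<iota> u) = u" using that by (auto simp: \<rho>_def \<iota>_def)
      then show ?thesis using rself by simp
    qed
    show "\<iota> (\<rho> v) \<in> orbit r' v" if "v \<in> ?K" for v
    proof -
      have "\<iota> (\<rho> v) = v" using that by (auto simp: \<rho>_def \<iota>_def)
      then show ?thesis using r'self by simp
    qed
  qed auto
  have V: "card (orbit r' ` {..<n+2}) = card (orbit r ` {..<n}) + 1"
    using card_orbits_split[OF _ r'p A A_inv] VA VK by simp
  have gl': "f' \<in> gluings g s {..<n+2} \<tau>' c'"
  proof -
    have sub: "{(c h, c (f h)) |h. h \<in> {..<n}} \<subseteq> {(c' h, c' (f' h)) |h. h \<in> {..<n+2}}"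
    proof
      fix z assume "z \<in> {(c h, c (f h)) |h. h \<in> {..<n}}"
      then obtain h where h: "h < n" "z = (c h, c (f h))" by auto
      then have "z = (c' h, c' (f' h))"
        using f_less[of h] by (simp add: c'_def f'_def \<pi>_def)
      moreover have "h \<in> {..<n+2}" using h by simp
      ultimately show "z \<in> {(c' h, c' (f' h)) |h. h \<in> {..<n+2}}" by blast
    qed
    have "(i, j) \<in> {(c' h, c' (f' h)) |h. h \<in> {..<n+2}}\<^sup>*" if "i \<in> {1..s}" "j \<in> {1..s}" for i j
    proof -
      have "(i, j) \<in> {(c h, c (f h)) |h. h \<in> {..<n}}\<^sup>*" using gl that unfolding gluings_def by blast
      then show ?thesis using rtrancl_mono[OF sub] by blast
    qed
    moreover have "int (card (orbit (\<tau>' \<circ> f') ` {..<n+2})) - int (card {..<n+2} div 2) + int s = 2 - 2 * int g"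
      using V gl unfolding r'_def gluings_def by simp
    ultimately show ?thesis using f' unfolding gluings_def by blast
  qed
  have "(\<tau>', f', c') \<in> labelled_graphs g s (n + 2)"
    unfolding labelled_graphs_def using \<tau>' c'in c'onto c'cell gl' valence by (auto simp: r'_def)
  then show ?thesis by blast
qed

end

text \<open>Splitting vertices adds two half-edges at a time until the maximal number is reached, so
  a graph of any size leads to a trivalent one. The purpose: f \<sim> 0 holds only if f vanishes
  eventually, so a leading coefficient 0 has to force all counts to vanish.\<close>

lemma labelled_graphs_empty:
  assumes "labelled_graphs g s N = {}" "int N = 12 * int g - 12 + 6 * int s"
  shows "labelled_graphs g s n = {}"
proof (rule ccontr)
  assume ne: "labelled_graphs g s n \<noteq> {}"
  have even_le: "even k \<and> int k \<le> 12 * int g - 12 + 6 * int s" if k: "labelled_graphs g s k \<noteq> {}" for k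
  proof -
    obtain \<tau> f c where "(\<tau>, f, c) \<in> labelled_graphs g s k" using k by auto
    then interpret labelled_graph g s k \<tau> f c by unfold_locales
    show ?thesis using n_even n_le by (metis dvd_triv_left)
  qed
  have step: "labelled_graphs g s (k + 2) \<noteq> {}" if k: "labelled_graphs g s k \<noteq> {}" "k < N" for k
  proof -
    obtain \<tau> f c where "(\<tau>, f, c) \<in> labelled_graphs g s k" using k(1) by auto
    then interpret labelled_graph g s k \<tau> f c by unfold_locales
    show ?thesis using split_vertex assms(2) k by simp
  qed
  have "labelled_graphs g s (n + 2 * j) \<noteq> {}" if "n + 2 * j \<le> N" for j
    using that
  proof (induction j)
    case 0
    then show ?case using ne by simp
  next
    case (Suc j)
    then show ?case using step[of "n + 2 * j"] by simp
  qed
  moreover have "n + 2 * ((N - n) div 2) = N"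
  proof -
    have "even N" using assms(2) by presburger
    then have "even (N - n)" "n \<le> N" using even_le[OF ne] assms(2) by auto
    then show ?thesis by simp
  qed
  ultimately show False using assms(1) by (metis order_refl)
qed

text \<open>Half-edges of one cell are joined by applying flip and rot in turn, and rot h lies in
  the same cell as flip h, because rot = (rot \<circ> flip) \<circ> flip. For the cells, both moves
  therefore cross the edge of h, and connectedness can be tested on cell numbers.\<close>

lemma rg_connected_iff:
  assumes fin: "finite (half_edges \<Gamma>)" and rot: "rot \<Gamma> permutes half_edges \<Gamma>"
    and flip: "flip \<Gamma> \<in> pairings (half_edges \<Gamma>)" and cn: "cells_numbered \<Gamma> s"
  shows "(\<forall>h\<in>half_edges \<Gamma>. \<forall>h'\<in>half_edges \<Gamma>.
      (h, h') \<in> {(x, y). x \<in> half_edges \<Gamma> \<and> (y = rot \<Gamma> x \<or> y = flip \<Gamma> x)}\<^sup>*) \<longleftrightarrow>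
    (\<forall>i\<in>{1..s}. \<forall>j\<in>{1..s}. (i, j) \<in> {(cell_no \<Gamma> x, cell_no \<Gamma> (flip \<Gamma> x)) |x. x \<in> half_edges \<Gamma>}\<^sup>*)"
    (is "(\<forall>h\<in>?H. \<forall>h'\<in>?H. (h, h') \<in> ?R\<^sup>*) \<longleftrightarrow> (\<forall>i\<in>_. \<forall>j\<in>_. (i, j) \<in> ?S\<^sup>*)")
proof -
  let ?c = "cell_no \<Gamma>" and ?t = "rot \<Gamma> \<circ> flip \<Gamma>"
  have t: "?t permutes ?H" using pairings_permutes[OF flip] rot by (rule permutes_compose)
  have onto: "?c ` ?H = {1..s}" using cn by (simp add: cells_numbered_def)
  have cell: "?c h = ?c h' \<longleftrightarrow> h' \<in> orbit ?t h" if "h \<in> ?H" "h' \<in> ?H" for h h'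
    using cn that orbit_eq_iff[OF t fin, of h h'] by (simp add: cells_numbered_def rg_cell_def)
  have flip_in: "flip \<Gamma> h \<in> ?H" if "h \<in> ?H" for h using pairings_in[OF flip that] .
  have rot_in: "rot \<Gamma> h \<in> ?H" if "h \<in> ?H" for h using permutes_in_image[OF rot] that by blast
  show ?thesis
  proof
    assume conn: "\<forall>h\<in>?H. \<forall>h'\<in>?H. (h, h') \<in> ?R\<^sup>*"
    show "\<forall>i\<in>{1..s}. \<forall>j\<in>{1..s}. (i, j) \<in> ?S\<^sup>*"
    proof (intro ballI)
      fix i j assume "i \<in> {1..s}" "j \<in> {1..s}"
      then have "i \<in> ?c ` ?H" "j \<in> ?c ` ?H" using onto by simp_all
      then obtain h h' where h: "h \<in> ?H" "i = ?c h" "h' \<in> ?H" "j = ?c h'" by blast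
      have "(h, h') \<in> ?R\<^sup>*" using conn h by simp
      then have "(?c h, ?c h') \<in> ?S\<^sup>*"
      proof induction
        case base
        then show ?case by simp
      next
        case (step y z)
        then have y: "y \<in> ?H" and z: "z = rot \<Gamma> y \<or> z = flip \<Gamma> y" by auto
        have "rot \<Gamma> y = ?t (flip \<Gamma> y)" using pairings_double[OF flip] by simp
        then have "rot \<Gamma> y \<in> orbit ?t (flip \<Gamma> y)" by (simp only: orbit.base)
        then have "?c (flip \<Gamma> y) = ?c (rot \<Gamma> y)"
          using cell[OF flip_in[OF y] rot_in[OF y]] by simp
        then have "(?c y, ?c z) \<in> ?S" using y z by auto
        then show ?case using step.IH by (rule rtrancl_into_rtrancl[rotated])
      qed
      then show "(i, j) \<in> ?S\<^sup>*" using h by simp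
    qed
  next
    assume conn: "\<forall>i\<in>{1..s}. \<forall>j\<in>{1..s}. (i, j) \<in> ?S\<^sup>*"
    have edge: "(x, flip \<Gamma> x) \<in> ?R\<^sup>*" "(x, rot \<Gamma> x) \<in> ?R\<^sup>*" if "x \<in> ?H" for x
      using that by auto
    have orb: "(h, h') \<in> ?R\<^sup>*" if h: "h \<in> ?H" and o: "h' \<in> orbit ?t h" for h h'
    proof -
      from o have "h' \<in> ?H \<and> (h, h') \<in> ?R\<^sup>*"
      proof induction
        case base
        have "(h, rot \<Gamma> (flip \<Gamma> h)) \<in> ?R\<^sup>*"
          using edge(1)[OF h] edge(2)[OF flip_in[OF h]] by (rule rtrancl_trans)
        then show ?case using h flip_in rot_in by simp
      next
        case (step y)
        then have y: "y \<in> ?H" "(h, y) \<in> ?R\<^sup>*" by auto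
        have "(y, rot \<Gamma> (flip \<Gamma> y)) \<in> ?R\<^sup>*"
          using edge(1)[OF y(1)] edge(2)[OF flip_in[OF y(1)]] by (rule rtrancl_trans)
        with y(2) have "(h, rot \<Gamma> (flip \<Gamma> y)) \<in> ?R\<^sup>*" by (rule rtrancl_trans)
        then show ?case using y flip_in rot_in by simp
      qed
      then show ?thesis by simp
    qed
    show "\<forall>h\<in>?H. \<forall>h'\<in>?H. (h, h') \<in> ?R\<^sup>*"
    proof (intro ballI)
      fix h h' assume h: "h \<in> ?H" "h' \<in> ?H"
      then have "?c h \<in> {1..s}" "?c h' \<in> {1..s}" using onto by blast+
      then have "(?c h, ?c h') \<in> ?S\<^sup>*" using conn by blast
      have "\<forall>z\<in>?H. ?c z = j \<longrightarrow> (h, z) \<in> ?R\<^sup>*" if "(?c h, j) \<in> ?S\<^sup>*" for j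
        using that
      proof induction
        case base
        show ?case
        proof (intro ballI impI)
          fix z assume z: "z \<in> ?H" "?c z = ?c h"
          then have "z \<in> orbit ?t h" using cell[OF h(1) z(1)] by simp
          then show "(h, z) \<in> ?R\<^sup>*" by (rule orb[OF h(1)])
        qed
      next
        case (step i j)
        then obtain x where x: "x \<in> ?H" "i = ?c x" "j = ?c (flip \<Gamma> x)" by auto
        show ?case
        proof (intro ballI impI)
          fix z assume z: "z \<in> ?H" "?c z = j"
          have 1: "(h, x) \<in> ?R\<^sup>*" using step.IH x by simp
          have "z \<in> orbit ?t (flip \<Gamma> x)" using cell[OF flip_in[OF x(1)] z(1)] x z by simp
          then have 2: "(flip \<Gamma> x, z) \<in> ?R\<^sup>*" by (rule orb[OF flip_in[OF x(1)]])
          show "(h, z) \<in> ?R\<^sup>*"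
            using rtrancl_trans[OF rtrancl_trans[OF 1 edge(1)[OF x(1)]] 2] .
        qed
      qed
      then show "(h, h') \<in> ?R\<^sup>*" using h \<open>(?c h, ?c h') \<in> ?S\<^sup>*\<close> by blast
    qed
  qed
qed

lemma card_rg_edges:
  assumes "finite (half_edges \<Gamma>)" "flip \<Gamma> \<in> pairings (half_edges \<Gamma>)"
  shows "card (half_edges \<Gamma>) = 2 * card (rg_edges \<Gamma>)"
proof -
  have *: "card (half_edges \<Gamma>) = 2 * card (orbit (flip \<Gamma>) ` half_edges \<Gamma>)"
    using card_involution_orbits[OF assms(1) pairings_permutes[OF assms(2)] order_refl]
      pairings_neq[OF assms(2)] pairings_in[OF assms(2)] pairings_double[OF assms(2)] by blast
  have "orbit (flip \<Gamma>) h = {h, flip \<Gamma> h}" for h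
  proof
    show "orbit (flip \<Gamma>) h \<subseteq> {h, flip \<Gamma> h}"
    proof
      fix y assume "y \<in> orbit (flip \<Gamma>) h"
      then show "y \<in> {h, flip \<Gamma> h}" by induction (auto simp: pairings_double[OF assms(2)])
    qed
    show "{h, flip \<Gamma> h} \<subseteq> orbit (flip \<Gamma>) h"
      using orbit_self[OF pairings_permutes[OF assms(2)] assms(1)] by (auto intro: orbit.base)
  qed
  then show ?thesis using * by (simp add: rg_edges_def)
qed

lemma card_rg_cells:
  assumes "finite (half_edges \<Gamma>)" "cells_numbered \<Gamma> s"
  shows "card (rg_cells \<Gamma>) = s"
proof -
  have c: "cell_no \<Gamma> h = cell_no \<Gamma> h' \<longleftrightarrow> rg_cell \<Gamma> h = rg_cell \<Gamma> h'"
    if "h \<in> half_edges \<Gamma>" "h' \<in> half_edges \<Gamma>" for h h'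
    using assms(2) that by (simp add: cells_numbered_def)
  have "card (rg_cell \<Gamma> ` half_edges \<Gamma>) = card (cell_no \<Gamma> ` half_edges \<Gamma>)"
  proof (rule antisym)
    show "card (rg_cell \<Gamma> ` half_edges \<Gamma>) \<le> card (cell_no \<Gamma> ` half_edges \<Gamma>)"
      by (rule card_image_le_factor[OF assms(1)]) (use c in blast)
    show "card (cell_no \<Gamma> ` half_edges \<Gamma>) \<le> card (rg_cell \<Gamma> ` half_edges \<Gamma>)"
      by (rule card_image_le_factor[OF assms(1)]) (use c in blast)
  qed
  then show ?thesis using assms(2) by (simp add: rg_cells_def cells_numbered_def)
qed

lemma trivalent_graphsD:
  assumes "\<Gamma> \<in> trivalent_graphs g s"
  shows "finite (half_edges \<Gamma>)" "half_edges \<Gamma> \<noteq> {}" "rot \<Gamma> permutes half_edges \<Gamma>"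
    "flip \<Gamma> \<in> pairings (half_edges \<Gamma>)" "cells_numbered \<Gamma> s"
    "\<And>h. h \<in> half_edges \<Gamma> \<Longrightarrow> card (orbit (rot \<Gamma>) h) = 3"
    "int (card (half_edges \<Gamma>)) = 12 * int g - 12 + 6 * int s"
proof -
  show *: "finite (half_edges \<Gamma>)" "half_edges \<Gamma> \<noteq> {}" "rot \<Gamma> permutes half_edges \<Gamma>"
    "flip \<Gamma> \<in> pairings (half_edges \<Gamma>)" "cells_numbered \<Gamma> s"
    using assms by (auto simp: trivalent_graphs_def ribbon_graph_def)
  show c3: "\<And>h. h \<in> half_edges \<Gamma> \<Longrightarrow> card (orbit (rot \<Gamma>) h) = 3"
    using assms by (auto simp: trivalent_graphs_def rg_vertices_def)
  have "card (half_edges \<Gamma>) = 3 * card (rg_vertices \<Gamma>)"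
  proof -
    have "(\<Sum>C\<in>orbit (rot \<Gamma>) ` half_edges \<Gamma>. card C) = (\<Sum>C\<in>orbit (rot \<Gamma>) ` half_edges \<Gamma>. 3)"
      by (rule sum.cong) (use c3 in auto)
    then show ?thesis using sum_card_orbits[OF *(1,3)] by (simp add: rg_vertices_def)
  qed
  moreover have "int (card (rg_vertices \<Gamma>)) - int (card (rg_edges \<Gamma>)) + int s = 2 - 2 * int g"
    using assms card_rg_cells[OF *(1,5)] by (simp add: trivalent_graphs_def rg_has_genus_def)
  ultimately show "int (card (half_edges \<Gamma>)) = 12 * int g - 12 + 6 * int s"
    using card_rg_edges[OF *(1,4)] by linarith
qed

text \<open>Labelled graphs store the face permutation; with the rotation \<tau> \<circ> f and an
  involution f, rot \<circ> flip is \<tau> again.\<close>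

definition graph_of :: "nat \<Rightarrow> (nat \<Rightarrow> nat) \<times> (nat \<Rightarrow> nat) \<times> (nat \<Rightarrow> nat) \<Rightarrow> nat numbered_ribbon_graph" where
  "graph_of n = (\<lambda>(\<tau>, f, c). \<lparr>half_edges = {..<n}, rot = \<tau> \<circ> f, flip = f, cell_no = c\<rparr>)"

lemma rg_iso_graph_of:
  "rg_iso \<Gamma> (graph_of n (\<tau>, f, c)) b \<longleftrightarrow> bij_betw b (half_edges \<Gamma>) {..<n} \<and>
    (\<forall>h\<in>half_edges \<Gamma>. b (rot \<Gamma> h) = \<tau> (f (b h)) \<and> b (flip \<Gamma> h) = f (b h) \<and> c (b h) = cell_no \<Gamma> h)"
  by (simp add: rg_iso_def graph_of_def)

lemma graph_of_trivalent:
  assumes G: "G \<in> labelled_graphs g s n" and n: "int n = 12 * int g - 12 + 6 * int s" and n0: "0 < n"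
  shows "graph_of n G \<in> trivalent_graphs g s"
proof -
  obtain \<tau> f c where G': "G = (\<tau>, f, c)" by (cases G)
  interpret labelled_graph g s n \<tau> f c using G G' by unfold_locales simp
  let ?\<Gamma> = "graph_of n G"
  have sel [simp]: "half_edges ?\<Gamma> = {..<n}" "rot ?\<Gamma> = r" "flip ?\<Gamma> = f" "cell_no ?\<Gamma> = c"
    by (simp_all add: graph_of_def G')
  have rf: "r \<circ> f = \<tau>" by (simp add: fun_eq_iff)
  have cn: "cells_numbered ?\<Gamma> s"
    unfolding cells_numbered_def rg_cell_def sel rf using c_onto cell orbit_eq_iff[OF \<tau>] by simp
  have conn: "\<forall>h\<in>half_edges ?\<Gamma>. \<forall>h'\<in>half_edges ?\<Gamma>.
      (h, h') \<in> {(x, y). x \<in> half_edges ?\<Gamma> \<and> (y = rot ?\<Gamma> x \<or> y = flip ?\<Gamma> x)}\<^sup>*"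
  proof (subst rg_connected_iff[OF _ _ _ cn])
    show "\<forall>i\<in>{1..s}. \<forall>j\<in>{1..s}. (i, j) \<in> {(cell_no ?\<Gamma> x, cell_no ?\<Gamma> (flip ?\<Gamma> x)) |x. x \<in> half_edges ?\<Gamma>}\<^sup>*"
      unfolding sel using gl unfolding gluings_def by blast
  qed (use r f in simp_all)
  have rg: "ribbon_graph ?\<Gamma>"
    unfolding ribbon_graph_def using conn r f n0 by (simp add: lessThan_empty_iff)
  have "card (rg_edges ?\<Gamma>) = n div 2" using card_edges by (simp add: rg_edges_def)
  then have "rg_has_genus ?\<Gamma> g"
    unfolding rg_has_genus_def using card_rg_cells[OF _ cn] gl
    by (simp add: rg_vertices_def gluings_def)
  moreover have "card v = 3" if v: "v \<in> rg_vertices ?\<Gamma>" for v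
  proof -
    obtain h where h: "h < n" "v = orbit r h" using v by (auto simp: rg_vertices_def)
    have r3: "r (r (r h)) = h" using n_eq n h(1) by blast
    have "v \<subseteq> {h, r h, r (r h)}"
    proof
      fix y assume "y \<in> v"
      then have "y \<in> orbit r h" using h by simp
      then show "y \<in> {h, r h, r (r h)}" by induction (use r3 in auto)
    qed
    then have "card v \<le> card {h, r h, r (r h)}" by (rule card_mono[rotated]) simp
    also have "\<dots> \<le> 3" by (auto simp: card_insert_if)
    finally show ?thesis using orbit_card[OF h(1)] h by simp
  qed
  ultimately show ?thesis using rg cn by (simp add: trivalent_graphs_def)
qed

text \<open>Transport of structure along \<open>b\<close>. With \<open>graph_of_unique\<close>, each
  numbering of the half-edges of \<Gamma> belongs to exactly one labelled graph.\<close>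

lemma graph_of_ex:
  assumes \<Gamma>: "\<Gamma> \<in> trivalent_graphs g s" and b: "bij_betw b (half_edges \<Gamma>) {..<n}"
  shows "\<exists>G\<in>labelled_graphs g s n. rg_iso \<Gamma> (graph_of n G) b"
proof -
  note D = trivalent_graphsD[OF \<Gamma>]
  let ?H = "half_edges \<Gamma>"
  define a where "a = inv_into ?H b"
  have ab: "a (b h) = h" if "h \<in> ?H" for h
    using bij_betw_inv_into_left[OF b that] by (simp add: a_def)
  have ba: "b (a k) = k" if "k < n" for k
    using bij_betw_inv_into_right[OF b] that by (simp add: a_def)
  have b_less: "b h < n" if "h \<in> ?H" for h using b that by (auto simp: bij_betw_def)
  have a_in: "a k \<in> ?H" if "k < n" for k
    using bij_betw_inv_into[OF b] that by (auto simp: a_def bij_betw_def)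
  have flip_in: "flip \<Gamma> h \<in> ?H" if "h \<in> ?H" for h using pairings_in[OF D(4) that] .
  have rot_in: "rot \<Gamma> h \<in> ?H" if "h \<in> ?H" for h using permutes_in_image[OF D(3)] that by blast
  define t where "t = rot \<Gamma> \<circ> flip \<Gamma>"
  have t: "t permutes ?H" unfolding t_def using pairings_permutes[OF D(4)] D(3) by (rule permutes_compose)
  have t_in: "t h \<in> ?H" if "h \<in> ?H" for h using permutes_in_image[OF t] that by blast
  define \<tau> where "\<tau> k = (if k < n then b (t (a k)) else k)" for k
  define f where "f k = (if k < n then b (flip \<Gamma> (a k)) else k)" for k
  define c where "c = (\<lambda>k\<in>{..<n}. cell_no \<Gamma> (a k))"
  have \<tau>: "\<tau> permutes {..<n}"
  proof (rule bij_imp_permutes)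
    have "bij_betw (b \<circ> t \<circ> a) {..<n} {..<n}"
      using bij_betw_trans[OF bij_betw_trans[OF bij_betw_inv_into[OF b] permutes_imp_bij[OF t]] b]
      by (simp add: a_def comp_assoc)
    then show "bij_betw \<tau> {..<n} {..<n}"
      by (rule bij_betw_cong[THEN iffD1, rotated]) (simp add: \<tau>_def)
  qed (simp add: \<tau>_def)
  have f: "f \<in> pairings {..<n}"
  proof (rule pairingsI)
    fix k assume "k \<in> {..<n}"
    then have k: "k < n" by simp
    show "f k \<in> {..<n}" using k b_less a_in flip_in by (simp add: f_def)
    show "f k \<noteq> k"
      using k ab[OF flip_in[OF a_in[OF k]]] pairings_neq[OF D(4) a_in[OF k]] by (auto simp: f_def)
    show "f (f k) = k"
      using k b_less[OF flip_in[OF a_in[OF k]]] ab[OF flip_in[OF a_in[OF k]]] ba[OF k]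
      by (simp add: f_def pairings_double[OF D(4)])
  qed (simp add: f_def)
  have fb: "b (flip \<Gamma> h) = f (b h)" if "h \<in> ?H" for h using that b_less ab by (simp add: f_def)
  have \<tau>b: "b (t h) = \<tau> (b h)" if "h \<in> ?H" for h using that b_less ab by (simp add: \<tau>_def)
  have cb: "c (b h) = cell_no \<Gamma> h" if "h \<in> ?H" for h using that b_less ab by (simp add: c_def)
  have rb: "b (rot \<Gamma> h) = \<tau> (f (b h))" if "h \<in> ?H" for h
    using \<tau>b[OF flip_in[OF that]] fb[OF that] by (simp add: t_def pairings_double[OF D(4)])
  have iso: "rg_iso \<Gamma> (graph_of n (\<tau>, f, c)) b"
    unfolding rg_iso_graph_of using b rb fb cb by simp
  have cells: "cell_no \<Gamma> h = cell_no \<Gamma> h' \<longleftrightarrow> h' \<in> orbit t h" if "h \<in> ?H" "h' \<in> ?H" for h h'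
    using D(5) that orbit_eq_iff[OF t D(1), of h h'] by (simp add: cells_numbered_def rg_cell_def t_def)
  have onto: "cell_no \<Gamma> ` ?H = {1..s}" using D(5) by (simp add: cells_numbered_def)
  have c1: "c \<in> {..<n} \<rightarrow>\<^sub>E {1..s}"
    unfolding c_def onto[symmetric] using a_in by auto
  have bH: "b ` ?H = {..<n}" using b by (simp add: bij_betw_def)
  have c2: "c ` {..<n} = {1..s}"
    unfolding onto[symmetric] bH[symmetric] image_image using cb by simp
  have c3: "c k = c k' \<longleftrightarrow> k' \<in> orbit \<tau> k" if k: "k < n" "k' < n" for k k'
  proof -
    have "b ` orbit t (a k) = orbit \<tau> (b (a k))"
    proof (rule orbit_inverse)
      show "a k \<in> orbit t (a k)" by (rule orbit_self[OF t D(1)])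
      fix x assume "x \<in> orbit t (a k)"
      then have "x \<in> ?H" using permutes_orbit_subset[OF t a_in[OF k(1)]] by blast
      then show "\<tau> (b x) = b (t x)" using \<tau>b by simp
    qed
    then have eq: "orbit \<tau> k = b ` orbit t (a k)" using ba[OF k(1)] by simp
    have sub: "orbit t (a k) \<subseteq> ?H" by (rule permutes_orbit_subset[OF t a_in[OF k(1)]])
    have "k' \<in> orbit \<tau> k \<longleftrightarrow> a k' \<in> orbit t (a k)"
    proof
      assume "k' \<in> orbit \<tau> k"
      then obtain x where "x \<in> orbit t (a k)" "k' = b x" unfolding eq by blast
      then show "a k' \<in> orbit t (a k)" using ab sub by auto
    next
      assume "a k' \<in> orbit t (a k)"
      then show "k' \<in> orbit \<tau> k" unfolding eq using ba[OF k(2)] by (metis imageI)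
    qed
    then show ?thesis using cells[OF a_in[OF k(1)] a_in[OF k(2)]] k by (simp add: c_def)
  qed
  have rp: "\<tau> \<circ> f permutes {..<n}" using pairings_permutes[OF f] \<tau> by (rule permutes_compose)
  have V: "card (orbit (\<tau> \<circ> f) ` {..<n}) = card (rg_vertices \<Gamma>)"
    unfolding rg_vertices_def
  proof (rule card_orbits_eq[where \<iota> = b and \<pi> = a, OF _ D(1) rp D(3) order_refl])
    show "(\<tau> \<circ> f) v \<in> {..<n}" if "v \<in> {..<n}" for v using permutes_in_image[OF rp] that by blast
    show "b (rot \<Gamma> u) \<in> orbit (\<tau> \<circ> f) (b u)" if "u \<in> ?H" for u
      using rb[OF that] orbit.base[of "\<tau> \<circ> f" "b u"] by simp
    show "a ((\<tau> \<circ> f) v) \<in> orbit (rot \<Gamma>) (a v)" if "v \<in> {..<n}" for v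
    proof -
      have v: "v < n" using that by simp
      have "(\<tau> \<circ> f) v = b (rot \<Gamma> (a v))" using rb[OF a_in[OF v]] ba[OF v] by simp
      then have "a ((\<tau> \<circ> f) v) = rot \<Gamma> (a v)" using ab[OF rot_in[OF a_in[OF v]]] by simp
      then show ?thesis by (simp only: orbit.base)
    qed
    show "a (b u) \<in> orbit (rot \<Gamma>) u" if "u \<in> ?H" for u
      using ab[OF that] orbit_self[OF D(3,1)] by simp
    show "b (a v) \<in> orbit (\<tau> \<circ> f) v" if "v \<in> {..<n}" for v
      using ba that orbit_self[OF rp] by simp
  qed (use b_less a_in in auto)
  have nH: "n = card ?H" using bij_betw_same_card[OF b] by simp
  have gl: "f \<in> gluings g s {..<n} \<tau> c"
  proof -
    have S: "{(c k, c (f k)) |k. k \<in> {..<n}} = {(cell_no \<Gamma> x, cell_no \<Gamma> (flip \<Gamma> x)) |x. x \<in> ?H}"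
    proof (intro set_eqI iffI)
      fix z assume "z \<in> {(c k, c (f k)) |k. k \<in> {..<n}}"
      then obtain k where k: "k < n" "z = (c k, c (f k))" by auto
      have "z = (cell_no \<Gamma> (a k), cell_no \<Gamma> (flip \<Gamma> (a k)))"
        using k cb[OF a_in[OF k(1)]] cb[OF flip_in[OF a_in[OF k(1)]]] fb[OF a_in[OF k(1)]] ba[OF k(1)] by simp
      then show "z \<in> {(cell_no \<Gamma> x, cell_no \<Gamma> (flip \<Gamma> x)) |x. x \<in> ?H}" using a_in[OF k(1)] by blast
    next
      fix z assume "z \<in> {(cell_no \<Gamma> x, cell_no \<Gamma> (flip \<Gamma> x)) |x. x \<in> ?H}"
      then obtain x where x: "x \<in> ?H" "z = (cell_no \<Gamma> x, cell_no \<Gamma> (flip \<Gamma> x))" by auto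
      have "z = (c (b x), c (f (b x)))"
        using x cb[OF x(1)] cb[OF flip_in[OF x(1)]] fb[OF x(1)] by simp
      moreover have "b x \<in> {..<n}" using b_less[OF x(1)] by simp
      ultimately show "z \<in> {(c k, c (f k)) |k. k \<in> {..<n}}" by blast
    qed
    have "ribbon_graph \<Gamma>" using \<Gamma> by (simp add: trivalent_graphs_def)
    then have "\<forall>i\<in>{1..s}. \<forall>j\<in>{1..s}. (i, j) \<in> {(c k, c (f k)) |k. k \<in> {..<n}}\<^sup>*"
      unfolding S using rg_connected_iff[OF D(1,3,4,5)] unfolding ribbon_graph_def by blast
    moreover have "int (card (rg_vertices \<Gamma>)) - int (card (rg_edges \<Gamma>)) + int s = 2 - 2 * int g"
      using \<Gamma> card_rg_cells[OF D(1,5)] by (simp add: trivalent_graphs_def rg_has_genus_def)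
    ultimately show ?thesis
      using f V nH card_rg_edges[OF D(1,4)] unfolding gluings_def by simp
  qed
  have val: "\<tau> (f k) \<noteq> k \<and> \<tau> (f (\<tau> (f k))) \<noteq> k" if k: "k < n" for k
  proof -
    let ?h = "a k"
    have h: "?h \<in> ?H" using a_in[OF k] .
    have e: "\<tau> (f k) = b (rot \<Gamma> ?h)" using rb[OF h] ba[OF k] by simp
    have e2: "\<tau> (f (\<tau> (f k))) = b (rot \<Gamma> (rot \<Gamma> ?h))" using rb[OF rot_in[OF h]] e by simp
    have not: "rot \<Gamma> ?h \<noteq> ?h \<and> rot \<Gamma> (rot \<Gamma> ?h) \<noteq> ?h"
    proof (rule ccontr)
      assume "\<not> ?thesis"
      then have *: "rot \<Gamma> (rot \<Gamma> ?h) = ?h" by auto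
      have "orbit (rot \<Gamma>) ?h \<subseteq> {?h, rot \<Gamma> ?h}"
      proof
        fix y assume "y \<in> orbit (rot \<Gamma>) ?h"
        then show "y \<in> {?h, rot \<Gamma> ?h}" by induction (use * in auto)
      qed
      then have "card (orbit (rot \<Gamma>) ?h) \<le> card {?h, rot \<Gamma> ?h}" by (rule card_mono[rotated]) simp
      also have "\<dots> \<le> 2" by (auto simp: card_insert_if)
      finally show False using D(6)[OF h] by simp
    qed
    then show ?thesis
      unfolding e2 using e ab[OF rot_in[OF h]] ab[OF rot_in[OF rot_in[OF h]]] by metis
  qed
  have "(\<tau>, f, c) \<in> labelled_graphs g s n"
    unfolding labelled_graphs_def using \<tau> c1 c2 c3 gl val by auto
  then show ?thesis using iso by blast
qed

lemma graph_of_unique: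
  assumes G: "G \<in> labelled_graphs g s n" "G' \<in> labelled_graphs g s n"
    and iso: "rg_iso \<Gamma> (graph_of n G) b" "rg_iso \<Gamma> (graph_of n G') b"
  shows "G = G'"
proof -
  obtain \<tau> f c where 1: "G = (\<tau>, f, c)" by (cases G)
  obtain \<tau>' f' c' where 2: "G' = (\<tau>', f', c')" by (cases G')
  interpret L: labelled_graph g s n \<tau> f c using G 1 by unfold_locales simp
  interpret L': labelled_graph g s n \<tau>' f' c' using G 2 by unfold_locales simp
  note i = iso[unfolded 1 2 rg_iso_graph_of]
  have ex: "\<exists>h\<in>half_edges \<Gamma>. k = b h" if "k < n" for k
    using i(1) that by (auto simp: bij_betw_def image_iff)
  have ff: "f = f'"
    by (rule pairings_eqI[OF L.f L'.f]) (use ex i in \<open>metis lessThan_iff\<close>)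
  have cc: "c = c'"
    by (rule PiE_ext[OF L.c L'.c]) (use ex i in \<open>metis lessThan_iff\<close>)
  have rr: "\<tau> (f k) = \<tau>' (f' k)" if "k < n" for k
    using ex[OF that] i by metis
  have "\<tau> k = \<tau>' k" for k
  proof (cases "k < n")
    case True
    then show ?thesis using rr[of "f k"] L.f_less ff L.ff by simp
  next
    case False
    then show ?thesis using permutes_not_in[OF L.\<tau>, of k] permutes_not_in[OF L'.\<tau>, of k] by simp
  qed
  then show ?thesis using 1 2 ff cc by auto
qed

text \<open>Composition with the fixed isomorphism \<open>b0\<close> turns automorphisms into
  isomorphisms. Off the half-edges the former are the identity and the latter undefined by
  extensionality, so both counts are counts of restrictions to the half-edges.\<close>

lemma card_isos_eq_card_Aut:
  assumes D: "finite (half_edges \<Gamma>)" "rot \<Gamma> permutes half_edges \<Gamma>" "flip \<Gamma> \<in> pairings (half_edges \<Gamma>)"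
    and b0: "rg_iso \<Gamma> (graph_of n G) b0"
  shows "card {b \<in> half_edges \<Gamma> \<rightarrow>\<^sub>E {..<n}. rg_iso \<Gamma> (graph_of n G) b} = card (rg_Aut \<Gamma>)"
proof -
  let ?H = "half_edges \<Gamma>"
  obtain \<tau> f c where G: "G = (\<tau>, f, c)" by (cases G)
  note i0 = b0[unfolded G rg_iso_graph_of]
  have b0b: "bij_betw b0 ?H {..<n}" using i0 by simp
  have b0inj: "h = h'" if "h \<in> ?H" "h' \<in> ?H" "b0 h = b0 h'" for h h'
    using b0b that by (auto simp: bij_betw_def inj_on_def)
  have flip_in: "flip \<Gamma> h \<in> ?H" if "h \<in> ?H" for h using pairings_in[OF D(3) that] .
  have rot_in: "rot \<Gamma> h \<in> ?H" if "h \<in> ?H" for h using permutes_in_image[OF D(2)] that by blast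
  have "card (rg_Aut \<Gamma>) = card {b \<in> ?H \<rightarrow>\<^sub>E {..<n}. rg_iso \<Gamma> (graph_of n G) b}"
  proof (rule card_eq_by_relation[where R = "\<lambda>a b. \<forall>h\<in>?H. b h = b0 (a h)"])
    fix a assume a: "a \<in> rg_Aut \<Gamma>"
    then have ap: "a permutes ?H" and ai: "rg_iso \<Gamma> \<Gamma> a" by (auto simp: rg_Aut_def)
    have a_in: "a h \<in> ?H" if "h \<in> ?H" for h using permutes_in_image[OF ap] that by blast
    let ?b = "restrict (b0 \<circ> a) ?H"
    have "bij_betw (b0 \<circ> a) ?H {..<n}" using permutes_imp_bij[OF ap] b0b by (rule bij_betw_trans)
    then have "bij_betw ?b ?H {..<n}" by (rule bij_betw_cong[THEN iffD1, rotated]) simp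
    then have "rg_iso \<Gamma> (graph_of n G) ?b"
      unfolding G rg_iso_graph_of using i0 ai a_in rot_in flip_in by (simp add: rg_iso_def)
    moreover have "?b \<in> ?H \<rightarrow>\<^sub>E {..<n}" using a_in b0b by (auto simp: bij_betw_def)
    ultimately show "\<exists>b\<in>{b \<in> ?H \<rightarrow>\<^sub>E {..<n}. rg_iso \<Gamma> (graph_of n G) b}. \<forall>h\<in>?H. b h = b0 (a h)"
      by (intro bexI[of _ ?b]) auto
  next
    fix b assume "b \<in> {b \<in> ?H \<rightarrow>\<^sub>E {..<n}. rg_iso \<Gamma> (graph_of n G) b}"
    then have ib: "rg_iso \<Gamma> (graph_of n G) b" by simp
    note ib' = ib[unfolded G rg_iso_graph_of]
    define q where "q = inv_into ?H b0"
    have q: "bij_betw q {..<n} ?H" unfolding q_def using b0b by (rule bij_betw_inv_into)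
    have b0q: "b0 (q k) = k" if "k < n" for k
      using bij_betw_inv_into_right[OF b0b] that by (simp add: q_def)
    define a where "a h = (if h \<in> ?H then q (b h) else h)" for h
    have "bij_betw (q \<circ> b) ?H ?H" using ib' q by (blast intro: bij_betw_trans)
    then have "bij_betw a ?H ?H" by (rule bij_betw_cong[THEN iffD1, rotated]) (simp add: a_def)
    then have ap: "a permutes ?H" by (rule bij_imp_permutes) (simp add: a_def)
    have a_in: "a h \<in> ?H" if "h \<in> ?H" for h using permutes_in_image[OF ap] that by blast
    have b_less: "b h < n" if "h \<in> ?H" for h using ib' that by (auto simp: bij_betw_def)
    have b0a: "b0 (a h) = b h" if "h \<in> ?H" for h using that b0q b_less by (simp add: a_def)
    have "rg_iso \<Gamma> \<Gamma> a"
      unfolding rg_iso_def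
    proof (intro conjI ballI)
      show "bij_betw a ?H ?H" by fact
      fix h assume h: "h \<in> ?H"
      have "b0 (a (rot \<Gamma> h)) = b0 (rot \<Gamma> (a h))"
        using b0a[OF rot_in[OF h]] ib' h i0 a_in[OF h] b0a[OF h] by simp
      then show "a (rot \<Gamma> h) = rot \<Gamma> (a h)" using b0inj a_in rot_in h by blast
      have "b0 (a (flip \<Gamma> h)) = b0 (flip \<Gamma> (a h))"
        using b0a[OF flip_in[OF h]] ib' h i0 a_in[OF h] b0a[OF h] by simp
      then show "a (flip \<Gamma> h) = flip \<Gamma> (a h)" using b0inj a_in flip_in h by blast
      have "c (b0 (a h)) = cell_no \<Gamma> (a h)" using i0 a_in[OF h] by blast
      moreover have "c (b h) = cell_no \<Gamma> h" using ib' h by blast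
      ultimately show "cell_no \<Gamma> (a h) = cell_no \<Gamma> h" using b0a[OF h] by simp
    qed
    then show "\<exists>a\<in>rg_Aut \<Gamma>. \<forall>h\<in>?H. b h = b0 (a h)"
      using ap b0a by (intro bexI[of _ a]) (auto simp: rg_Aut_def)
  next
    fix a b b' assume "b \<in> {b \<in> ?H \<rightarrow>\<^sub>E {..<n}. rg_iso \<Gamma> (graph_of n G) b}"
      "b' \<in> {b \<in> ?H \<rightarrow>\<^sub>E {..<n}. rg_iso \<Gamma> (graph_of n G) b}"
      "\<forall>h\<in>?H. b h = b0 (a h)" "\<forall>h\<in>?H. b' h = b0 (a h)"
    then show "b = b'" by (intro PiE_ext[of b ?H "\<lambda>_. {..<n}" b']) auto
  next
    fix a a' b assume a: "a \<in> rg_Aut \<Gamma>" "a' \<in> rg_Aut \<Gamma>"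
      "\<forall>h\<in>?H. b h = b0 (a h)" "\<forall>h\<in>?H. b h = b0 (a' h)"
    then have p: "a permutes ?H" "a' permutes ?H" by (auto simp: rg_Aut_def)
    show "a = a'"
    proof
      fix h show "a h = a' h"
      proof (cases "h \<in> ?H")
        case True
        then have "a h \<in> ?H" "a' h \<in> ?H" using permutes_in_image[OF p(1), of h] permutes_in_image[OF p(2), of h] by simp_all
        moreover have "b0 (a h) = b0 (a' h)" using a(3,4) True by simp
        ultimately show ?thesis by (rule b0inj)
      next
        case False
        then show ?thesis using permutes_not_in[OF p(1)] permutes_not_in[OF p(2)] by simp
      qed
    qed
  qed
  then show ?thesis by simp
qed

section \<open>Weights of labelled graphs and of isomorphism classes\<close>

definition edge_weight :: "(nat \<Rightarrow> complex) \<Rightarrow> nat \<Rightarrow> (nat \<Rightarrow> nat) \<Rightarrow> (nat \<Rightarrow> nat) \<Rightarrow> complex" where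
  "edge_weight z n f c = (\<Prod>e\<in>(\<lambda>h. {h, f h}) ` {..<n}.
     of_real (2 powr (- 1 / 2)) / (\<Sum>h\<in>e. csqrt (z (c h))))"

lemma edge_weight_iso:
  assumes iso: "rg_iso \<Gamma> (graph_of n (\<tau>, f, c)) b" and flip: "flip \<Gamma> \<in> pairings (half_edges \<Gamma>)"
  shows "(\<Prod>e\<in>rg_edges \<Gamma>. of_real (2 powr (- 1 / 2)) / (\<Sum>h\<in>e. csqrt (z (cell_no \<Gamma> h)))) = edge_weight z n f c"
proof -
  let ?H = "half_edges \<Gamma>"
  note i = iso[unfolded rg_iso_graph_of]
  have inj: "inj_on b ?H" and bH: "b ` ?H = {..<n}" using i by (auto simp: bij_betw_def)
  have sub: "e \<subseteq> ?H" if "e \<in> rg_edges \<Gamma>" for e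
    using that pairings_in[OF flip] by (auto simp: rg_edges_def)
  have im: "(\<lambda>h. {h, f h}) ` {..<n} = (\<lambda>e. b ` e) ` rg_edges \<Gamma>"
    unfolding bH[symmetric] rg_edges_def image_image using i by (intro image_cong) auto
  have "inj_on (\<lambda>e. b ` e) (rg_edges \<Gamma>)"
    by (rule inj_onI) (use sub inj inj_on_image_eq_iff in metis)
  then have "edge_weight z n f c = (\<Prod>e\<in>rg_edges \<Gamma>. of_real (2 powr (- 1 / 2)) / (\<Sum>h\<in>b ` e. csqrt (z (c h))))"
    unfolding edge_weight_def im by (simp add: prod.reindex)
  also have "\<dots> = (\<Prod>e\<in>rg_edges \<Gamma>. of_real (2 powr (- 1 / 2)) / (\<Sum>h\<in>e. csqrt (z (cell_no \<Gamma> h))))"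
  proof (rule prod.cong[OF refl])
    fix e assume e: "e \<in> rg_edges \<Gamma>"
    have "(\<Sum>h\<in>b ` e. csqrt (z (c h))) = (\<Sum>h\<in>e. csqrt (z (c (b h))))"
      using inj_on_subset[OF inj sub[OF e]] by (simp add: sum.reindex)
    also have "\<dots> = (\<Sum>h\<in>e. csqrt (z (cell_no \<Gamma> h)))"
      using sub[OF e] i by (intro sum.cong) auto
    finally show "of_real (2 powr (- 1 / 2)) / (\<Sum>h\<in>b ` e. csqrt (z (c h))) =
      of_real (2 powr (- 1 / 2)) / (\<Sum>h\<in>e. csqrt (z (cell_no \<Gamma> h)))" by simp
  qed
  finally show ?thesis by simp
qed

lemma rg_iso_refl: "rg_iso \<Gamma> \<Gamma> (\<lambda>x. x)"
  by (simp add: rg_iso_def bij_betw_def)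

lemma rg_iso_trans:
  assumes "rg_iso \<Gamma> \<Gamma>' f" "rg_iso \<Gamma>' \<Gamma>'' f'"
  shows "rg_iso \<Gamma> \<Gamma>'' (f' \<circ> f)"
proof -
  have "f h \<in> half_edges \<Gamma>'" if "h \<in> half_edges \<Gamma>" for h
    using assms(1) that by (auto simp: rg_iso_def bij_betw_def)
  then show ?thesis using assms unfolding rg_iso_def by (auto intro: bij_betw_trans)
qed

lemma rg_iso_sym:
  assumes "rg_iso \<Gamma> \<Gamma>' f" "rot \<Gamma> permutes half_edges \<Gamma>" "flip \<Gamma> \<in> pairings (half_edges \<Gamma>)"
  shows "\<exists>f'. rg_iso \<Gamma>' \<Gamma> f'"
proof (intro exI)
  let ?f' = "inv_into (half_edges \<Gamma>) f"
  have b: "bij_betw f (half_edges \<Gamma>) (half_edges \<Gamma>')" using assms(1) by (simp add: rg_iso_def)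
  show "rg_iso \<Gamma>' \<Gamma> ?f'"
    unfolding rg_iso_def
  proof (intro conjI ballI)
    show "bij_betw ?f' (half_edges \<Gamma>') (half_edges \<Gamma>)" using b by (rule bij_betw_inv_into)
    fix k assume k: "k \<in> half_edges \<Gamma>'"
    then obtain h where h: "h \<in> half_edges \<Gamma>" "k = f h" using b by (auto simp: bij_betw_def)
    have inv: "?f' (f x) = x" if "x \<in> half_edges \<Gamma>" for x using bij_betw_inv_into_left[OF b that] .
    have in': "rot \<Gamma> h \<in> half_edges \<Gamma>" "flip \<Gamma> h \<in> half_edges \<Gamma>"
      using h assms(2,3) by (auto simp: permutes_in_image pairings_in)
    have fh: "f (rot \<Gamma> h) = rot \<Gamma>' k" "f (flip \<Gamma> h) = flip \<Gamma>' k" "cell_no \<Gamma>' k = cell_no \<Gamma> h"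
      using assms(1) h by (auto simp: rg_iso_def)
    show "?f' (rot \<Gamma>' k) = rot \<Gamma> (?f' k)" "?f' (flip \<Gamma>' k) = flip \<Gamma> (?f' k)"
      "cell_no \<Gamma> (?f' k) = cell_no \<Gamma>' k"
      using inv[OF h(1)] inv[OF in'(1)] inv[OF in'(2)] fh h(2) by simp_all
  qed
qed

text \<open>The n! numberings of the half-edges of \<Gamma> are distributed over the labelled graphs
  isomorphic to \<Gamma>, and each of these receives as many as \<Gamma> has automorphisms. So the
  class occurs n! / |Aut| times among the labelled graphs, always with the same edge weight.\<close>

theorem sum_class_weight:
  assumes n: "int n = 12 * int g - 12 + 6 * int s" and n0: "0 < n"
  shows "(\<Sum>C\<in>trivalent_classes g s. class_weight z C) =
    (\<Sum>(\<tau>, f, c)\<in>labelled_graphs g s n. edge_weight z n f c) / fact n"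
proof -
  define TG where "TG = trivalent_graphs g s"
  define rel where "rel = {(\<Gamma>, \<Gamma>'). \<Gamma> \<in> TG \<and> \<Gamma>' \<in> TG \<and> (\<exists>f. rg_iso \<Gamma> \<Gamma>' f)}"
  let ?LG = "labelled_graphs g s n"
  define cls where "cls \<Gamma> = rel `` {\<Gamma>}" for \<Gamma>
  have classes: "trivalent_classes g s = cls ` TG"
    unfolding trivalent_classes_def quotient_def cls_def rel_def TG_def by auto
  have sym: "(\<Gamma>', \<Gamma>) \<in> rel" if "(\<Gamma>, \<Gamma>') \<in> rel" for \<Gamma> \<Gamma>'
    using that rg_iso_sym[of \<Gamma> \<Gamma>'] trivalent_graphsD(3,4)[of \<Gamma> g s] unfolding rel_def TG_def by blast
  have trans: "(\<Gamma>, \<Gamma>'') \<in> rel" if "(\<Gamma>, \<Gamma>') \<in> rel" "(\<Gamma>', \<Gamma>'') \<in> rel" for \<Gamma> \<Gamma>' \<Gamma>''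
    using that rg_iso_trans unfolding rel_def by blast
  have rel_refl: "(\<Gamma>, \<Gamma>) \<in> rel" if "\<Gamma> \<in> TG" for \<Gamma>
    using that rg_iso_refl unfolding rel_def by blast
  have cls_eq: "cls \<Gamma> = cls \<Gamma>' \<longleftrightarrow> (\<Gamma>, \<Gamma>') \<in> rel" if "\<Gamma> \<in> TG" "\<Gamma>' \<in> TG" for \<Gamma> \<Gamma>'
  proof
    assume "cls \<Gamma> = cls \<Gamma>'"
    moreover have "\<Gamma>' \<in> cls \<Gamma>'" using rel_refl[OF that(2)] by (simp add: cls_def)
    ultimately show "(\<Gamma>, \<Gamma>') \<in> rel" unfolding cls_def by blast
  next
    assume "(\<Gamma>, \<Gamma>') \<in> rel"
    then show "cls \<Gamma> = cls \<Gamma>'" using sym trans unfolding cls_def by blast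
  qed
  have GT: "graph_of n G \<in> TG" if "G \<in> ?LG" for G
    unfolding TG_def by (rule graph_of_trivalent[OF that n n0])
  have cardH: "card (half_edges \<Gamma>) = n" "finite (half_edges \<Gamma>)" if "\<Gamma> \<in> TG" for \<Gamma>
    using trivalent_graphsD(1,7)[of \<Gamma> g s] that n by (simp_all add: TG_def)
  have ex: "\<exists>G\<in>?LG. (\<Gamma>, graph_of n G) \<in> rel" if \<Gamma>: "\<Gamma> \<in> TG" for \<Gamma>
  proof -
    obtain b where "bij_betw b (half_edges \<Gamma>) {..<n}"
      using finite_same_card_bij[OF cardH(2)[OF \<Gamma>], of "{..<n}"] cardH(1)[OF \<Gamma>] by auto
    from graph_of_ex[OF \<Gamma>[unfolded TG_def] this] obtain G where "G \<in> ?LG" "rg_iso \<Gamma> (graph_of n G) b" by blast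
    then show ?thesis using \<Gamma> GT unfolding rel_def by blast
  qed
  have cls_im: "trivalent_classes g s = (\<lambda>G. cls (graph_of n G)) ` ?LG"
  proof
    show "trivalent_classes g s \<subseteq> (\<lambda>G. cls (graph_of n G)) ` ?LG"
    proof
      fix C assume "C \<in> trivalent_classes g s"
      then obtain \<Gamma> where \<Gamma>: "\<Gamma> \<in> TG" "C = cls \<Gamma>" unfolding classes by blast
      then obtain G where "G \<in> ?LG" "(\<Gamma>, graph_of n G) \<in> rel" using ex by blast
      then show "C \<in> (\<lambda>G. cls (graph_of n G)) ` ?LG" using \<Gamma> cls_eq GT by blast
    qed
    show "(\<lambda>G. cls (graph_of n G)) ` ?LG \<subseteq> trivalent_classes g s" unfolding classes using GT by blast
  qed
  let ?w = "\<lambda>(\<tau>, f, c). edge_weight z n f c"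
  have main: "(\<Sum>G\<in>{G \<in> ?LG. cls (graph_of n G) = C}. ?w G) = fact n * class_weight z C"
    if C: "C \<in> trivalent_classes g s" for C
  proof -
    define \<Gamma> where "\<Gamma> = (SOME \<Gamma>. \<Gamma> \<in> C)"
    obtain \<Gamma>0 where \<Gamma>0: "\<Gamma>0 \<in> TG" "C = cls \<Gamma>0" using C unfolding classes by blast
    then have "\<Gamma>0 \<in> C" using rel_refl by (simp add: cls_def)
    then have "\<Gamma> \<in> C" unfolding \<Gamma>_def by (rule someI)
    then have "(\<Gamma>0, \<Gamma>) \<in> rel" using \<Gamma>0 by (simp add: cls_def)
    then have \<Gamma>: "\<Gamma> \<in> TG" "C = cls \<Gamma>" using \<Gamma>0 cls_eq unfolding rel_def by blast+
    note D = trivalent_graphsD[OF \<Gamma>(1)[unfolded TG_def]]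
    let ?H = "half_edges \<Gamma>"
    let ?I = "\<lambda>G. {b \<in> ?H \<rightarrow>\<^sub>E {..<n}. rg_iso \<Gamma> (graph_of n G) b}"
    define L where "L = {G \<in> ?LG. cls (graph_of n G) = C}"
    have L: "G \<in> L \<longleftrightarrow> G \<in> ?LG \<and> (\<exists>b. rg_iso \<Gamma> (graph_of n G) b)" for G
      using cls_eq[OF \<Gamma>(1) GT[of G]] GT[of G] \<Gamma> unfolding L_def rel_def by blast
    have finL: "finite L" unfolding L_def using finite_labelled_graphs by simp
    have cardI: "card (?I G) = card (rg_Aut \<Gamma>)" if G: "G \<in> L" for G
    proof -
      obtain b where "rg_iso \<Gamma> (graph_of n G) b" using G L by blast
      then show ?thesis by (rule card_isos_eq_card_Aut[OF D(1,3,4)])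
    qed
    have finI: "finite (?I G)" for G
      by (rule finite_subset[OF _ finite_PiE[of ?H "\<lambda>_. {..<n}"]]) (use D(1) in auto)
    have "fact n = card {b \<in> ?H \<rightarrow>\<^sub>E {..<n}. bij_betw b ?H {..<n}}"
      using card_bijections[OF D(1), of "{..<n}"] cardH[OF \<Gamma>(1)] by simp
    also have "{b \<in> ?H \<rightarrow>\<^sub>E {..<n}. bij_betw b ?H {..<n}} = (\<Union>G\<in>L. ?I G)"
    proof (intro set_eqI iffI)
      fix b assume b: "b \<in> {b \<in> ?H \<rightarrow>\<^sub>E {..<n}. bij_betw b ?H {..<n}}"
      then have "bij_betw b ?H {..<n}" by blast
      from graph_of_ex[OF \<Gamma>(1)[unfolded TG_def] this] obtain G where
        "G \<in> ?LG" "rg_iso \<Gamma> (graph_of n G) b" by blast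
      then show "b \<in> (\<Union>G\<in>L. ?I G)" using b L by blast
    next
      fix b assume "b \<in> (\<Union>G\<in>L. ?I G)"
      then obtain G where "b \<in> ?H \<rightarrow>\<^sub>E {..<n}" "rg_iso \<Gamma> (graph_of n G) b" by blast
      then show "b \<in> {b \<in> ?H \<rightarrow>\<^sub>E {..<n}. bij_betw b ?H {..<n}}"
        by (cases G) (auto simp: rg_iso_graph_of)
    qed
    also have "card (\<Union>G\<in>L. ?I G) = (\<Sum>G\<in>L. card (?I G))"
    proof (rule card_UN_disjoint[OF finL])
      show "\<forall>G\<in>L. finite (?I G)" using finI by blast
      show "\<forall>G\<in>L. \<forall>G'\<in>L. G \<noteq> G' \<longrightarrow> ?I G \<inter> ?I G' = {}"
        using graph_of_unique L by blast
    qed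
    also have "\<dots> = card L * card (rg_Aut \<Gamma>)" using cardI by simp
    finally have fact: "fact n = card L * card (rg_Aut \<Gamma>)" by simp
    have aut0: "card (rg_Aut \<Gamma>) \<noteq> 0"
    proof
      assume "card (rg_Aut \<Gamma>) = 0"
      then have "(fact n :: nat) = 0" using fact by simp
      then show False by simp
    qed
    have factc: "(fact n :: complex) = of_nat (card L) * of_nat (card (rg_Aut \<Gamma>))"
      using fact by (metis of_nat_fact of_nat_mult)
    let ?P = "\<Prod>e\<in>rg_edges \<Gamma>. of_real (2 powr (- 1 / 2)) / (\<Sum>h\<in>e. csqrt (z (cell_no \<Gamma> h)))"
    have "(\<Sum>G\<in>L. ?w G) = (\<Sum>G\<in>L. ?P)"
    proof (rule sum.cong[OF refl])
      fix G assume G: "G \<in> L"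
      obtain \<tau> f c where e: "G = (\<tau>, f, c)" by (cases G)
      obtain b where "rg_iso \<Gamma> (graph_of n (\<tau>, f, c)) b" using G L e by blast
      from edge_weight_iso[OF this D(4)] show "?w G = ?P" using e by simp
    qed
    also have "\<dots> = of_nat (card L) * ?P" by simp
    also have "\<dots> = fact n * class_weight z C"
      unfolding class_weight_def rg_weight_def \<Gamma>_def[symmetric] factc using aut0 by simp
    finally show ?thesis unfolding L_def .
  qed
  have "(\<Sum>G\<in>?LG. ?w G) = (\<Sum>C\<in>trivalent_classes g s. \<Sum>G\<in>{G \<in> ?LG. cls (graph_of n G) = C}. ?w G)"
    by (rule sum.group[symmetric]) (use finite_labelled_graphs cls_im in auto)
  also have "\<dots> = fact n * (\<Sum>C\<in>trivalent_classes g s. class_weight z C)"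
    using main by (simp add: sum_distrib_left)
  finally show ?thesis by simp
qed

section \<open>A local limit theorem\<close>

definition central :: "nat \<Rightarrow> real" where
  "central k = real (k choose (k div 2)) / 2 ^ k"

text \<open>The factor m comes from the m positions of a cell in its polygon. If k - m is odd, the
  division rounds down, so that the weight has a limit along every sequence of m; parity is imposed
  separately.\<close>

definition walk_weight :: "nat \<Rightarrow> nat \<Rightarrow> real" where
  "walk_weight k m = (if m \<le> k then real m * real (k choose ((k - m) div 2)) / 2 ^ k else 0)"

text \<open>Divided by \<xi>, this is twice the density in \<xi> of the first passage time of
  Brownian motion at level y, which explains its Laplace transform.\<close>

definition gauss_weight :: "real \<Rightarrow> real \<Rightarrow> real" where
  "gauss_weight \<xi> y = sqrt (2 / (pi * \<xi>)) * y * exp (- (y\<^sup>2 / (2 * \<xi>)))"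

section \<open>Central binomial coefficients and Wallis' product\<close>

lemma central_even_Suc:
  "real ((2 * Suc q) choose Suc q) / 4 ^ Suc q = real ((2 * q) choose q) / 4 ^ q * ((2 * q + 1) / (2 * q + 2))"
proof -
  have 1: "Suc q * (2 * Suc q choose Suc q) = (2 * Suc q) * (Suc (2 * q) choose q)"
    using Suc_times_binomial[of q "Suc (2 * q)"] by simp
  have 2: "Suc q * (Suc (2 * q) choose q) = Suc (2 * q) * (2 * q choose q)"
    using Suc_times_binomial[of q "2 * q"] binomial_symmetric[of q "Suc (2 * q)"] by simp
  have e1: "real (q + 1) * real (2 * Suc q choose Suc q) = (2 * real q + 2) * real (Suc (2 * q) choose q)"
    using arg_cong[OF 1, of real] by (simp only: of_nat_mult of_nat_Suc) (simp add: algebra_simps)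
  have e2: "real (q + 1) * real (Suc (2 * q) choose q) = (2 * real q + 1) * real (2 * q choose q)"
    using arg_cong[OF 2, of real] by (simp only: of_nat_mult of_nat_Suc) (simp add: algebra_simps)
  define X Y Z where "X = real (2 * Suc q choose Suc q)" and "Y = real (Suc (2 * q) choose q)"
    and "Z = real (2 * q choose q)"
  have q: "real q + 1 \<noteq> 0" by simp
  have "(real q + 1) * X = (real q + 1) * (2 * Y)"
    using e1 unfolding X_def[symmetric] Y_def[symmetric] by (simp add: algebra_simps)
  then have X: "X = 2 * Y" using q by simp
  have Y: "Y = (2 * real q + 1) * Z / (real q + 1)"
    using e2 q unfolding Y_def[symmetric] Z_def[symmetric] by (simp add: field_simps)
  have "X / 4 ^ Suc q = Z / 4 ^ q * ((2 * real q + 1) / (2 * real q + 2))"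
  proof -
    have aux: "2 * (u * Z / w) / (4 * r) = Z / r * (u / (2 * w))" for u w r :: real by simp
    have "2 * real q + 2 = 2 * (real q + 1)" by simp
    then show ?thesis unfolding X Y using aux[of "2 * real q + 1" "real q + 1" "4 ^ q"] by simp
  qed
  then show ?thesis unfolding X_def Z_def by simp
qed

text \<open>From q to q + 1 the square is multiplied by ((2 q + 1) / (2 q + 2))^2, which the new
  Wallis factor and the change from 2 q + 1 to 2 q + 3 undo exactly.\<close>

lemma central_square:
  "(real ((2 * q) choose q) / 4 ^ q)\<^sup>2 * (2 * q + 1) * (\<Prod>k=1..q. (4 * real k ^ 2) / (4 * real k ^ 2 - 1)) = 1"
proof (induction q)
  case 0
  then show ?case by simp
next
  case (Suc q)
  define a where "a = real ((2 * q) choose q) / 4 ^ q"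
  define P where "P = (\<Prod>k=1..q. (4 * real k ^ 2) / (4 * real k ^ 2 - 1))"
  have f: "(4 * real (Suc q) ^ 2) / (4 * real (Suc q) ^ 2 - 1) = (2 * real q + 2)\<^sup>2 / ((2 * real q + 1) * (2 * real q + 3))"
    by (simp add: power2_eq_square algebra_simps)
  have "(real ((2 * Suc q) choose Suc q) / 4 ^ Suc q)\<^sup>2 * (2 * Suc q + 1) *
      (\<Prod>k=1..Suc q. (4 * real k ^ 2) / (4 * real k ^ 2 - 1)) =
      (a * ((2 * real q + 1) / (2 * real q + 2)))\<^sup>2 * (2 * real q + 3) *
      (P * ((2 * real q + 2)\<^sup>2 / ((2 * real q + 1) * (2 * real q + 3))))"
    unfolding central_even_Suc a_def P_def f[symmetric] by (simp add: algebra_simps)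
  also have "\<dots> = a\<^sup>2 * (2 * q + 1) * P"
  proof -
    have aux: "(a * (u / v))\<^sup>2 * w * (P * (v\<^sup>2 / (u * w))) = a\<^sup>2 * u * P"
      if "u \<noteq> 0" "v \<noteq> 0" "w \<noteq> 0" for u v w :: real
      using that by (simp add: field_simps power2_eq_square)
    have "2 * real q + 2 \<noteq> 0" "2 * real q + 1 \<noteq> 0" "2 * real q + 3 \<noteq> 0" by linarith+
    then show ?thesis using aux[of "2 * real q + 1" "2 * real q + 2" "2 * real q + 3"] by simp
  qed
  also have "\<dots> = 1" using Suc by (simp add: a_def P_def)
  finally show ?case .
qed

text \<open>An odd k has the central probability of k + 1: the two middle coefficients of an odd row
  are equal, and their sum is the next central coefficient.\<close>

lemma central_eq: "central k = real ((2 * ((k + 1) div 2)) choose ((k + 1) div 2)) / 4 ^ ((k + 1) div 2)"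
proof (cases "even k")
  case True
  then obtain q where "k = 2 * q" by (elim evenE)
  then show ?thesis by (simp add: central_def power_mult)
next
  case False
  then obtain q where q: "k = 2 * q + 1" by (elim oddE)
  have "(2 * Suc q choose Suc q) = 2 * (Suc (2 * q) choose q)"
    using binomial_symmetric[of q "Suc (2 * q)"] by simp
  then show ?thesis using q by (simp add: central_def power_mult)
qed

text \<open>Wallis' product takes the place of Stirling's formula. Since q is k / 2 rounded up, 2 q
  + 1 is k + 1 or k + 2, and its ratio to k tends to 1.\<close>

lemma central_limit: "(\<lambda>k. central k * sqrt (real k)) \<longlonglongrightarrow> sqrt (2 / pi)"
proof -
  let ?q = "\<lambda>k::nat. (k + 1) div 2"
  let ?P = "\<lambda>q. \<Prod>k=1..q. (4 * real k ^ 2) / (4 * real k ^ 2 - 1)"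
  have "(\<lambda>q. inverse (?P q)) \<longlonglongrightarrow> inverse (pi / 2)"
    by (intro tendsto_inverse wallis) simp
  moreover have "inverse (?P q) = (real ((2 * q) choose q) / 4 ^ q)\<^sup>2 * (2 * q + 1)" for q
    by (rule inverse_unique, subst mult.commute, rule central_square)
  ultimately have A: "(\<lambda>q. (real ((2 * q) choose q) / 4 ^ q)\<^sup>2 * (2 * real q + 1)) \<longlonglongrightarrow> 2 / pi"
    by (simp add: add.commute)
  have B: "filterlim ?q at_top at_top"
    unfolding filterlim_at_top
  proof
    fix Z :: nat
    show "\<forall>\<^sub>F k in sequentially. Z \<le> ?q k"
      by (rule eventually_sequentiallyI[of "2 * Z"]) simp
  qed
  have lim1: "(\<lambda>k. (central k)\<^sup>2 * (2 * real (?q k) + 1)) \<longlonglongrightarrow> 2 / pi"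
    unfolding central_eq using filterlim_compose[OF A B] .
  have lim2: "(\<lambda>k. real k / (2 * real (?q k) + 1)) \<longlonglongrightarrow> 1"
  proof (rule tendsto_sandwich)
    show "\<forall>\<^sub>F k in sequentially. real k / (real k + 2) \<le> real k / (2 * real (?q k) + 1)"
    proof (rule always_eventually, rule allI)
      fix k :: nat
      have "2 * ?q k + 1 \<le> k + 2" by simp
      then have "2 * real (?q k) + 1 \<le> real k + 2" by linarith
      then show "real k / (real k + 2) \<le> real k / (2 * real (?q k) + 1)"
        by (intro divide_left_mono) auto
    qed
    show "\<forall>\<^sub>F k in sequentially. real k / (2 * real (?q k) + 1) \<le> 1"
    proof (rule always_eventually, rule allI)
      fix k :: nat
      have "k \<le> 2 * ?q k + 1" by simp
      then have "real k \<le> 2 * real (?q k) + 1" by linarith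
      then show "real k / (2 * real (?q k) + 1) \<le> 1" by simp
    qed
    show "(\<lambda>k. real k / (real k + 2)) \<longlonglongrightarrow> 1" by real_asymp
  qed simp
  have "(\<lambda>k. sqrt ((central k)\<^sup>2 * (2 * real (?q k) + 1) * (real k / (2 * real (?q k) + 1)))) \<longlonglongrightarrow> sqrt (2 / pi * 1)"
    by (intro tendsto_real_sqrt tendsto_mult lim1 lim2)
  moreover have "sqrt ((central k)\<^sup>2 * (2 * real (?q k) + 1) * (real k / (2 * real (?q k) + 1))) = central k * sqrt (real k)" for k
  proof -
    have "2 * real (?q k) + 1 \<noteq> 0" by simp
    then have "(central k)\<^sup>2 * (2 * real (?q k) + 1) * (real k / (2 * real (?q k) + 1)) = (central k)\<^sup>2 * real k" by simp
    then show ?thesis by (simp add: real_sqrt_mult central_def)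
  qed
  ultimately show ?thesis by simp
qed

section \<open>Binomial coefficients off the centre\<close>

lemma binomial_ratio:
  assumes "d \<le> j" "j \<le> k"
  shows "real (k choose (j - d)) = real (k choose j) * (\<Prod>i<d. real (j - i) / real (k - j + i + 1))"
  using assms(1)
proof (induction d)
  case 0
  then show ?case by simp
next
  case (Suc d)
  define a where "a = j - Suc d"
  have a: "j - d = Suc a" "k - a = k - j + d + 1" "a < k" using Suc.prems assms(2) by (auto simp: a_def)
  obtain k' where k': "k = Suc k'" using a(3) by (cases k) auto
  have "Suc a * (k choose Suc a) = (k - a) * (k choose a)"
    using Suc_times_binomial[of a k'] binomial_absorb_comp[of k a] k' by simp
  then have "real (Suc a) * real (k choose Suc a) = real (k - a) * real (k choose a)"
    by (metis of_nat_mult)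
  then have "real (k choose a) = real (k choose Suc a) * (real (Suc a) / real (k - a))"
    using a(3) by (simp add: field_simps)
  moreover have "real (k choose Suc a) = real (k choose j) * (\<Prod>i<d. real (j - i) / real (k - j + i + 1))"
    using Suc.IH Suc.prems unfolding a(1) by simp
  ultimately show ?case
    unfolding a_def[symmetric] prod.lessThan_Suc a(1) a(2)[symmetric] by (simp only: mult.assoc)
qed

lemma sum_odd: "(\<Sum>i<d. 2 * real i + 1) = (real d)\<^sup>2"
  by (induction d) (auto simp: power2_eq_square algebra_simps)

lemma sum_even: "(\<Sum>i<d. 2 * real i + 2) = (real d)\<^sup>2 + real d"
  by (induction d) (auto simp: power2_eq_square algebra_simps)

text \<open>Each factor has the form 1 - u \<le> exp (- u) with u \<ge> (2 i + 1) / (k - j + d), and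
  the first d odd numbers add up to d^2.\<close>

lemma ratio_upper:
  assumes "d \<le> j" "2 * j \<le> k"
  shows "(\<Prod>i<d. real (j - i) / real (k - j + i + 1)) \<le> exp (- ((real d)\<^sup>2 / real (k - j + d)))"
proof -
  have "(\<Prod>i<d. real (j - i) / real (k - j + i + 1)) \<le> (\<Prod>i<d. exp (- ((2 * real i + 1) / real (k - j + d))))"
  proof (rule prod_mono, rule conjI)
    fix i assume "i \<in> {..<d}"
    then have i: "i < d" by simp
    let ?B = "real (k - j + i + 1)"
    have B: "0 < ?B" "?B \<le> real (k - j + d)" using i by auto
    have e: "real (j - i) / ?B = 1 - (real k - 2 * real j + 2 * real i + 1) / ?B"
      using assms i by (simp add: field_simps of_nat_diff)
    have "(2 * real i + 1) / real (k - j + d) \<le> (2 * real i + 1) / ?B"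
      using B by (intro divide_left_mono) auto
    also have "\<dots> \<le> (real k - 2 * real j + 2 * real i + 1) / ?B"
      using assms B by (intro divide_right_mono) auto
    finally have "real (j - i) / ?B \<le> 1 + (- ((2 * real i + 1) / real (k - j + d)))" using e by simp
    also have "\<dots> \<le> exp (- ((2 * real i + 1) / real (k - j + d)))" by (rule exp_ge_add_one_self)
    finally show "real (j - i) / ?B \<le> exp (- ((2 * real i + 1) / real (k - j + d)))" .
  qed simp
  also have "\<dots> = exp (- ((real d)\<^sup>2 / real (k - j + d)))"
    unfolding exp_sum[OF finite_lessThan, symmetric] sum_negf sum_divide_distrib[symmetric] sum_odd ..
  finally show ?thesis .
qed

text \<open>The reciprocal factors have the form 1 + u \<le> exp u. As k is 2 j or 2 j + 1, the
  numerator of u is at most 2 i + 2, and these bounds add up to d^2 + d.\<close>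

lemma ratio_lower:
  assumes "d < j" "2 * j \<le> k" "k \<le> 2 * j + 1"
  shows "exp (- (((real d)\<^sup>2 + real d) / real (j - d))) \<le> (\<Prod>i<d. real (j - i) / real (k - j + i + 1))"
proof -
  have "exp (- (((real d)\<^sup>2 + real d) / real (j - d))) = (\<Prod>i<d. exp (- ((2 * real i + 2) / real (j - d))))"
    unfolding exp_sum[OF finite_lessThan, symmetric] sum_negf sum_divide_distrib[symmetric] sum_even ..
  also have "\<dots> \<le> (\<Prod>i<d. real (j - i) / real (k - j + i + 1))"
  proof (rule prod_mono, rule conjI)
    fix i assume "i \<in> {..<d}"
    then have i: "i < d" by simp
    let ?A = "real (j - i)" and ?B = "real (k - j + i + 1)"
    have A: "0 < ?A" "real (j - d) \<le> ?A" "0 < real (j - d)" and B: "0 < ?B" using i assms by auto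
    have "?B / ?A = 1 + (real k - 2 * real j + 2 * real i + 1) / ?A"
      using assms i by (simp add: field_simps of_nat_diff)
    also have "\<dots> \<le> exp ((real k - 2 * real j + 2 * real i + 1) / ?A)" by (rule exp_ge_add_one_self)
    also have "(real k - 2 * real j + 2 * real i + 1) / ?A \<le> (2 * real i + 2) / ?A"
      using assms A by (intro divide_right_mono) auto
    also have "(2 * real i + 2) / ?A \<le> (2 * real i + 2) / real (j - d)"
      using A by (intro divide_left_mono) auto
    finally have "?B / ?A \<le> exp ((2 * real i + 2) / real (j - d))" by simp
    then have "inverse (exp ((2 * real i + 2) / real (j - d))) \<le> inverse (?B / ?A)"
      using A B by (intro le_imp_inverse_le) auto
    then show "exp (- ((2 * real i + 2) / real (j - d))) \<le> ?A / ?B"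
      by (simp add: exp_minus)
  qed simp
  finally show ?thesis .
qed

text \<open>Distance of the lower index (k - m) div 2 from the centre; up to rounding it is m /
  2.\<close>

definition depth :: "nat \<Rightarrow> nat \<Rightarrow> nat" where
  "depth k m = k div 2 - (k - m) div 2"

lemma walk_weight_eq:
  assumes "m \<le> k"
  shows "walk_weight k m = real m * central k *
    (\<Prod>i<depth k m. real (k div 2 - i) / real (k - k div 2 + i + 1))"
proof -
  have e: "k div 2 - depth k m = (k - m) div 2" and le: "depth k m \<le> k div 2"
    by (auto simp: depth_def)
  have "real (k choose ((k - m) div 2)) = real (k choose (k div 2)) *
      (\<Prod>i<depth k m. real (k div 2 - i) / real (k - k div 2 + i + 1))"
    using binomial_ratio[OF le, of k] unfolding e by simp
  then show ?thesis using assms unfolding walk_weight_def central_def by simp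
qed

lemma depth_bounds: "m \<le> k \<Longrightarrow> m \<le> 2 * depth k m + 1" "m \<le> k \<Longrightarrow> 2 * depth k m \<le> m + 1"
  by (auto simp: depth_def)

text \<open>The source of the dominating function for the lattice sums. The Gaussian tail is
  weakened to an exponential, because perimeters are linear in the edge lengths and an exponential
  of them splits into one factor for each edge.\<close>

lemma walk_weight_bound:
  "\<exists>C>0. \<forall>k\<ge>1. \<forall>m. walk_weight k m \<le> C * exp (- (real m / sqrt (real k)))"
proof -
  obtain C0 where C0: "C0 > 0" "\<And>k. norm (central k * sqrt (real k)) \<le> C0"
    using convergent_imp_Bseq[of "\<lambda>k. central k * sqrt (real k)"] central_limit
    unfolding Bseq_def convergent_def by blast
  have "walk_weight k m \<le> C0 * exp (25 / 4) * exp (- (real m / sqrt (real k)))" if k: "1 \<le> k" for k m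
  proof (cases "m \<le> k")
    case False
    then show ?thesis using C0(1) by (simp add: walk_weight_def)
  next
    case True
    define u where "u = real m / sqrt (real k)"
    define d where "d = depth k m"
    have sk: "1 \<le> sqrt (real k)" using k by simp
    have u0: "0 \<le> u" by (simp add: u_def)
    have mk: "real m = u * sqrt (real k)" using sk by (simp add: u_def)
    have dk: "k - k div 2 + d \<le> k" "0 < k - k div 2 + d"
      using k True by (auto simp: d_def depth_def)
    have d2: "(real m)\<^sup>2 / 4 - real m / 2 \<le> (real d)\<^sup>2"
    proof -
      have "real m - 1 \<le> 2 * real d" using depth_bounds(1)[OF True] by (simp add: d_def)
      show ?thesis
      proof (cases "m = 0")
        case True
        then show ?thesis by simp
      next
        case False
        then have "0 \<le> real m - 1" by simp
        then have "(real m - 1)\<^sup>2 \<le> (2 * real d)\<^sup>2"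
          using \<open>real m - 1 \<le> 2 * real d\<close> by (intro power_mono) auto
        then show ?thesis by (simp add: power2_eq_square algebra_simps)
      qed
    qed
    have "u\<^sup>2 / 4 - u / 2 \<le> (real d)\<^sup>2 / real k"
    proof -
      have "u\<^sup>2 / 4 - u / 2 \<le> u\<^sup>2 / 4 - u / (2 * sqrt (real k))"
      proof -
        have "u / (2 * sqrt (real k)) \<le> u / 2" using u0 sk by (intro divide_left_mono) auto
        then show ?thesis by simp
      qed
      also have "\<dots> = ((real m)\<^sup>2 / 4 - real m / 2) / real k"
        using k unfolding mk by (simp add: field_simps power2_eq_square)
      also have "\<dots> \<le> (real d)\<^sup>2 / real k" using d2 by (intro divide_right_mono) auto
      finally show ?thesis .
    qed
    also have "\<dots> \<le> (real d)\<^sup>2 / real (k - k div 2 + d)"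
    proof (intro divide_left_mono)
      show "real (k - k div 2 + d) \<le> real k" using dk(1) by (simp only: of_nat_le_iff)
      show "0 < real k * real (k - k div 2 + d)" using dk(2) k by (intro mult_pos_pos) auto
    qed simp
    finally have e: "exp (- ((real d)\<^sup>2 / real (k - k div 2 + d))) \<le> exp (u / 2 - u\<^sup>2 / 4)" by simp
    have "walk_weight k m \<le> real m * central k * exp (- ((real d)\<^sup>2 / real (k - k div 2 + d)))"
      unfolding walk_weight_eq[OF True]
      by (intro mult_left_mono, unfold d_def, rule ratio_upper) (auto simp: depth_def central_def)
    also have "\<dots> \<le> real m * central k * exp (u / 2 - u\<^sup>2 / 4)"
      using e by (intro mult_left_mono) (auto simp: central_def)
    also have "\<dots> = u * (central k * sqrt (real k)) * exp (u / 2 - u\<^sup>2 / 4)"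
      unfolding mk by simp
    also have "\<dots> \<le> u * C0 * exp (u / 2 - u\<^sup>2 / 4)"
      using C0(2)[of k] u0 by (intro mult_right_mono mult_left_mono) auto
    \<comment> \<open>The factor u is absorbed by exp u, and exp (- u) is split off; what remains is
      5 u / 2 - u^2 / 4, with maximum 25 / 4 at u = 5.\<close>
    also have "\<dots> \<le> exp u * C0 * exp (u / 2 - u\<^sup>2 / 4)"
    proof -
      have "u \<le> exp u" using exp_ge_add_one_self[of u] by linarith
      then show ?thesis using C0(1) by (intro mult_right_mono) auto
    qed
    also have "\<dots> = C0 * exp (5 * u / 2 - u\<^sup>2 / 4) * exp (- u)"
      by (simp add: exp_add[symmetric] mult.assoc mult.left_commute)
    also have "\<dots> \<le> C0 * exp (25 / 4) * exp (- u)"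
    proof -
      have "0 \<le> (u - 5)\<^sup>2" by simp
      then have "5 * u / 2 - u\<^sup>2 / 4 \<le> 25 / 4" by (simp add: power2_eq_square algebra_simps)
      then show ?thesis using C0(1) by (intro mult_right_mono mult_left_mono) auto
    qed
    finally show ?thesis by (simp add: u_def)
  qed
  then show ?thesis using C0(1) by (intro exI[of _ "C0 * exp (25 / 4)"]) auto
qed

lemma half_bounds:
  fixes a b c :: real
  assumes "0 < c"
  shows "a - 1 \<le> 2 * b \<Longrightarrow> (a / c - 1 / c) / 2 \<le> b / c"
    and "2 * b \<le> a + 1 \<Longrightarrow> b / c \<le> (a / c + 1 / c) / 2"
    and "2 * b \<le> a \<Longrightarrow> b / c \<le> (a / c) / 2"
proof -
  assume "a - 1 \<le> 2 * b"
  then have "(a - 1) / c \<le> 2 * b / c" using assms by (intro divide_right_mono) auto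
  then show "(a / c - 1 / c) / 2 \<le> b / c" by (simp add: diff_divide_distrib)
next
  assume "2 * b \<le> a + 1"
  then have "2 * b / c \<le> (a + 1) / c" using assms by (intro divide_right_mono) auto
  then show "b / c \<le> (a / c + 1 / c) / 2" by (simp add: add_divide_distrib)
next
  assume "2 * b \<le> a"
  then have "2 * b / c \<le> a / c" using assms by (intro divide_right_mono) auto
  then show "b / c \<le> (a / c) / 2" by simp
qed

text \<open>For k near \<xi> t and m near y sqrt t the depth d is near y sqrt t / 2, and both bounds
  for the ratio behave like exp (- d^2 / (k / 2)), whose exponent tends to - (y^2 / 4) / (\<xi> /
  2). The central coefficient contributes sqrt (2 / (pi k)).\<close>

lemma walk_weight_limit:
  fixes k m :: "real \<Rightarrow> nat"
  assumes \<xi>: "0 < \<xi>" and k: "((\<lambda>t. real (k t) / t) \<longlongrightarrow> \<xi>) at_top"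
    and m: "((\<lambda>t. real (m t) / sqrt t) \<longlongrightarrow> y) at_top"
  shows "((\<lambda>t. walk_weight (k t) (m t)) \<longlongrightarrow> gauss_weight \<xi> y) at_top"
proof -
  define j d where "j t = k t div 2" and "d t = depth (k t) (m t)" for t
  have t0: "\<forall>\<^sub>F t in at_top. (0::real) < t" by (rule eventually_gt_at_top)
  have inv: "((\<lambda>t::real. 1 / t) \<longlongrightarrow> 0) at_top" "((\<lambda>t::real. 1 / sqrt t) \<longlongrightarrow> 0) at_top"
    by real_asymp+
  have mt: "((\<lambda>t. real (m t) / t) \<longlongrightarrow> 0) at_top"
  proof (rule Lim_transform_eventually)
    show "((\<lambda>t. real (m t) / sqrt t * (1 / sqrt t)) \<longlongrightarrow> 0) at_top"
      using tendsto_mult[OF m inv(2)] by simp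
    show "\<forall>\<^sub>F t in at_top. real (m t) / sqrt t * (1 / sqrt t) = real (m t) / t"
      using t0 by eventually_elim simp
  qed
  have ev_mk: "\<forall>\<^sub>F t in at_top. m t \<le> k t"
  proof -
    have "\<forall>\<^sub>F t in at_top. real (m t) / t < \<xi> / 2" using order_tendstoD(2)[OF mt, of "\<xi> / 2"] \<xi> by simp
    moreover have "\<forall>\<^sub>F t in at_top. \<xi> / 2 < real (k t) / t" using order_tendstoD(1)[OF k, of "\<xi> / 2"] \<xi> by simp
    ultimately show ?thesis using t0
    proof eventually_elim
      case (elim t)
      then have "real (m t) / t < real (k t) / t" by linarith
      then show ?case using elim by (simp add: divide_less_cancel)
    qed
  qed
  have jt: "((\<lambda>t. real (j t) / t) \<longlongrightarrow> \<xi> / 2) at_top"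
  proof (rule tendsto_sandwich)
    have b: "real (k t) - 1 \<le> 2 * real (j t)" "2 * real (j t) \<le> real (k t)" for t
    proof -
      have "k t \<le> 2 * j t + 1" "2 * j t \<le> k t" unfolding j_def by auto
      then show "real (k t) - 1 \<le> 2 * real (j t)" "2 * real (j t) \<le> real (k t)" by linarith+
    qed
    show "\<forall>\<^sub>F t in at_top. (real (k t) / t - 1 / t) / 2 \<le> real (j t) / t"
      using t0 by eventually_elim (intro half_bounds b)
    show "\<forall>\<^sub>F t in at_top. real (j t) / t \<le> (real (k t) / t) / 2"
      using t0 by eventually_elim (intro half_bounds b)
    show "((\<lambda>t. (real (k t) / t - 1 / t) / 2) \<longlongrightarrow> \<xi> / 2) at_top"
      using tendsto_divide[OF tendsto_diff[OF k inv(1)] tendsto_const[of 2]] by simp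
    show "((\<lambda>t. (real (k t) / t) / 2) \<longlongrightarrow> \<xi> / 2) at_top"
      using tendsto_divide[OF k tendsto_const[of 2]] by simp
  qed
  have dt: "((\<lambda>t. real (d t) / sqrt t) \<longlongrightarrow> y / 2) at_top"
  proof (rule tendsto_sandwich)
    have b: "real (m t) - 1 \<le> 2 * real (d t)" "2 * real (d t) \<le> real (m t) + 1" if "m t \<le> k t" for t
      using depth_bounds[OF that] by (auto simp: d_def)
    show "\<forall>\<^sub>F t in at_top. (real (m t) / sqrt t - 1 / sqrt t) / 2 \<le> real (d t) / sqrt t"
      using t0 ev_mk by eventually_elim (intro half_bounds b; simp)
    show "\<forall>\<^sub>F t in at_top. real (d t) / sqrt t \<le> (real (m t) / sqrt t + 1 / sqrt t) / 2"
      using t0 ev_mk by eventually_elim (intro half_bounds b; simp)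
    show "((\<lambda>t. (real (m t) / sqrt t - 1 / sqrt t) / 2) \<longlongrightarrow> y / 2) at_top"
      using tendsto_divide[OF tendsto_diff[OF m inv(2)] tendsto_const[of 2]] by simp
    show "((\<lambda>t. (real (m t) / sqrt t + 1 / sqrt t) / 2) \<longlongrightarrow> y / 2) at_top"
      using tendsto_divide[OF tendsto_add[OF m inv(2)] tendsto_const[of 2]] by simp
  qed
  have dt': "((\<lambda>t. real (d t) / t) \<longlongrightarrow> 0) at_top"
  proof (rule Lim_transform_eventually)
    show "((\<lambda>t. real (d t) / sqrt t * (1 / sqrt t)) \<longlongrightarrow> 0) at_top"
      using tendsto_mult[OF dt inv(2)] by simp
    show "\<forall>\<^sub>F t in at_top. real (d t) / sqrt t * (1 / sqrt t) = real (d t) / t"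
      using t0 by eventually_elim simp
  qed
  have ev_dj: "\<forall>\<^sub>F t in at_top. d t < j t"
  proof -
    have "\<forall>\<^sub>F t in at_top. real (d t) / t < \<xi> / 4" using order_tendstoD(2)[OF dt', of "\<xi> / 4"] \<xi> by simp
    moreover have "\<forall>\<^sub>F t in at_top. \<xi> / 4 < real (j t) / t" using order_tendstoD(1)[OF jt, of "\<xi> / 4"] \<xi> by simp
    ultimately show ?thesis using t0
    proof eventually_elim
      case (elim t)
      then have "real (d t) / t < real (j t) / t" by linarith
      then show ?case using elim by (simp add: divide_less_cancel)
    qed
  qed
  have dd: "((\<lambda>t. (real (d t))\<^sup>2 / t) \<longlongrightarrow> y\<^sup>2 / 4) at_top"
  proof (rule Lim_transform_eventually)
    show "((\<lambda>t. (real (d t) / sqrt t)\<^sup>2) \<longlongrightarrow> y\<^sup>2 / 4) at_top"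
      using tendsto_power[OF dt, of 2] by (simp add: power_divide)
    show "\<forall>\<^sub>F t in at_top. (real (d t) / sqrt t)\<^sup>2 = (real (d t))\<^sup>2 / t"
      using t0 by eventually_elim (simp add: power_divide)
  qed
  define \<rho> where "\<rho> t = (\<Prod>i<d t. real (j t - i) / real (k t - j t + i + 1))" for t
  have \<rho>: "(\<rho> \<longlongrightarrow> exp (- (y\<^sup>2 / (2 * \<xi>)))) at_top"
  proof (rule tendsto_sandwich)
    show "\<forall>\<^sub>F t in at_top. exp (- (((real (d t))\<^sup>2 + real (d t)) / real (j t - d t))) \<le> \<rho> t"
      using ev_dj
    proof eventually_elim
      case (elim t)
      then show ?case unfolding \<rho>_def by (intro ratio_lower) (auto simp: j_def)
    qed
    show "\<forall>\<^sub>F t in at_top. \<rho> t \<le> exp (- ((real (d t))\<^sup>2 / real (k t - j t + d t)))"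
      using ev_dj
    proof eventually_elim
      case (elim t)
      then show ?case unfolding \<rho>_def by (intro ratio_upper) (auto simp: j_def)
    qed
    have "((\<lambda>t. ((real (d t))\<^sup>2 / t + real (d t) / t) / (real (j t) / t - real (d t) / t)) \<longlongrightarrow>
        (y\<^sup>2 / 4 + 0) / (\<xi> / 2 - 0)) at_top"
      using \<xi> by (intro tendsto_divide tendsto_add tendsto_diff dd dt' jt) auto
    moreover have "(y\<^sup>2 / 4 + 0) / (\<xi> / 2 - 0) = y\<^sup>2 / (2 * \<xi>)" by (simp add: field_simps)
    ultimately have lim1: "((\<lambda>t. ((real (d t))\<^sup>2 / t + real (d t) / t) / (real (j t) / t - real (d t) / t)) \<longlongrightarrow>
        y\<^sup>2 / (2 * \<xi>)) at_top" by simp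
    have "((\<lambda>t. ((real (d t))\<^sup>2 + real (d t)) / real (j t - d t)) \<longlongrightarrow> y\<^sup>2 / (2 * \<xi>)) at_top"
    proof (rule Lim_transform_eventually[OF lim1])
      have "\<forall>\<^sub>F t in at_top. ((real (d t))\<^sup>2 / t + real (d t) / t) / (real (j t) / t - real (d t) / t) =
          ((real (d t))\<^sup>2 + real (d t)) / real (j t - d t)"
        using t0 ev_dj
      proof eventually_elim
        case (elim t)
        have "((real (d t))\<^sup>2 / t + real (d t) / t) / (real (j t) / t - real (d t) / t) =
            (((real (d t))\<^sup>2 + real (d t)) / t) / ((real (j t) - real (d t)) / t)"
          by (simp add: add_divide_distrib diff_divide_distrib)
        also have "\<dots> = ((real (d t))\<^sup>2 + real (d t)) / (real (j t) - real (d t))"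
          using elim by simp
        finally show ?case using elim by (simp add: of_nat_diff)
      qed
      then show "\<forall>\<^sub>F t in at_top. ((real (d t))\<^sup>2 / t + real (d t) / t) / (real (j t) / t - real (d t) / t) =
          ((real (d t))\<^sup>2 + real (d t)) / real (j t - d t)" .
    qed
    then show "((\<lambda>t. exp (- (((real (d t))\<^sup>2 + real (d t)) / real (j t - d t)))) \<longlongrightarrow> exp (- (y\<^sup>2 / (2 * \<xi>)))) at_top"
      by (intro tendsto_exp tendsto_minus)
    have "((\<lambda>t. ((real (d t))\<^sup>2 / t) / (real (k t) / t - real (j t) / t + real (d t) / t)) \<longlongrightarrow>
        (y\<^sup>2 / 4) / (\<xi> - \<xi> / 2 + 0)) at_top"
      using \<xi> by (intro tendsto_divide tendsto_add tendsto_diff dd dt' jt k) auto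
    moreover have "(y\<^sup>2 / 4) / (\<xi> - \<xi> / 2 + 0) = y\<^sup>2 / (2 * \<xi>)" by (simp add: field_simps)
    ultimately have lim2: "((\<lambda>t. ((real (d t))\<^sup>2 / t) / (real (k t) / t - real (j t) / t + real (d t) / t)) \<longlongrightarrow>
        y\<^sup>2 / (2 * \<xi>)) at_top" by simp
    have "((\<lambda>t. (real (d t))\<^sup>2 / real (k t - j t + d t)) \<longlongrightarrow> y\<^sup>2 / (2 * \<xi>)) at_top"
    proof (rule Lim_transform_eventually[OF lim2])
      show "\<forall>\<^sub>F t in at_top. ((real (d t))\<^sup>2 / t) / (real (k t) / t - real (j t) / t + real (d t) / t) =
          (real (d t))\<^sup>2 / real (k t - j t + d t)"
        using t0
      proof eventually_elim
        case (elim t)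
        have "real (k t) / t - real (j t) / t + real (d t) / t = (real (k t) - real (j t) + real (d t)) / t"
          by (simp add: add_divide_distrib diff_divide_distrib)
        moreover have "j t \<le> k t" by (simp add: j_def)
        ultimately show ?case using elim by (simp add: of_nat_diff)
      qed
    qed
    then show "((\<lambda>t. exp (- ((real (d t))\<^sup>2 / real (k t - j t + d t)))) \<longlongrightarrow> exp (- (y\<^sup>2 / (2 * \<xi>)))) at_top"
      by (intro tendsto_exp tendsto_minus)
  qed
  have kinf: "filterlim k at_top at_top"
  proof -
    have "filterlim (\<lambda>t. real (k t) / t * t) at_top at_top"
      by (rule filterlim_tendsto_pos_mult_at_top[OF k \<xi>]) (rule filterlim_ident)
    then have "filterlim (\<lambda>t. real (k t)) at_top at_top"
      by (rule filterlim_mono_eventually[OF _ order_refl order_refl])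
         (use t0 in \<open>eventually_elim, simp\<close>)
    then show ?thesis by (simp add: filterlim_sequentially_iff_filterlim_real)
  qed
  have ck: "((\<lambda>t. central (k t) * sqrt (real (k t))) \<longlongrightarrow> sqrt (2 / pi)) at_top"
    using filterlim_compose[OF central_limit kinf] .
  have sk: "((\<lambda>t. sqrt (real (k t) / t)) \<longlongrightarrow> sqrt \<xi>) at_top"
    by (intro tendsto_real_sqrt k)
  have "((\<lambda>t. real (m t) / sqrt t / sqrt (real (k t) / t) * (central (k t) * sqrt (real (k t))) * \<rho> t) \<longlongrightarrow>
      y / sqrt \<xi> * sqrt (2 / pi) * exp (- (y\<^sup>2 / (2 * \<xi>)))) at_top"
    using \<xi> by (intro tendsto_mult tendsto_divide m sk ck \<rho>) auto
  then have "((\<lambda>t. walk_weight (k t) (m t)) \<longlongrightarrow> y / sqrt \<xi> * sqrt (2 / pi) * exp (- (y\<^sup>2 / (2 * \<xi>)))) at_top"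
  proof (rule Lim_transform_eventually)
    have k0: "\<forall>\<^sub>F t in at_top. 1 \<le> k t" using kinf by (simp add: filterlim_at_top)
    show "\<forall>\<^sub>F t in at_top. real (m t) / sqrt t / sqrt (real (k t) / t) * (central (k t) * sqrt (real (k t))) * \<rho> t =
        walk_weight (k t) (m t)"
      using t0 ev_mk k0
    proof eventually_elim
      case (elim t)
      have w: "walk_weight (k t) (m t) = real (m t) * central (k t) * \<rho> t"
        unfolding walk_weight_eq[OF elim(2)] \<rho>_def j_def d_def ..
      have "sqrt t * sqrt (real (k t) / t) = sqrt (real (k t))"
        using elim by (simp add: real_sqrt_mult[symmetric])
      then have e: "real (m t) / sqrt t / sqrt (real (k t) / t) = real (m t) / sqrt (real (k t))"
        by (simp only: divide_divide_eq_left)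
      have "sqrt (real (k t)) \<noteq> 0" using elim by simp
      then show ?case unfolding w e by simp
    qed
  qed
  moreover have "y / sqrt \<xi> * sqrt (2 / pi) * exp (- (y\<^sup>2 / (2 * \<xi>))) = gauss_weight \<xi> y"
  proof -
    have "sqrt (2 / (pi * \<xi>)) = sqrt (2 / pi) / sqrt \<xi>" by (simp add: real_sqrt_divide real_sqrt_mult)
    then show ?thesis unfolding gauss_weight_def by simp
  qed
  ultimately show ?thesis by simp
qed

section \<open>From lattice sums to integrals\<close>

lemma exp_halfline:
  assumes "0 < \<delta>"
  shows "integrable lborel (\<lambda>x::real. indicator {0..} x * exp (- (\<delta> * x)))"
    "(\<integral>x. indicator {0..} x * exp (- (\<delta> * x)) \<partial>lborel) = 1 / \<delta>"
proof -
  have "(\<integral>\<^sup>+x. ennreal (exp (- (\<delta> * x))) * indicator {0..} x \<partial>lborel) = ennreal (0 - (- exp (- (\<delta> * 0)) / \<delta>))"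
  proof (rule nn_integral_FTC_atLeast)
    show "DERIV (\<lambda>x. - exp (- (\<delta> * x)) / \<delta>) x :> exp (- (\<delta> * x))" for x
      using assms by (auto intro!: derivative_eq_intros)
    show "((\<lambda>x. - exp (- (\<delta> * x)) / \<delta>) \<longlongrightarrow> 0) at_top"
      using assms by real_asymp
  qed auto
  then have nn: "(\<integral>\<^sup>+x. ennreal (indicator {0..} x * exp (- (\<delta> * x))) \<partial>lborel) = ennreal (1 / \<delta>)"
    by (simp add: mult.commute ennreal_mult' ennreal_indicator)
  show "integrable lborel (\<lambda>x::real. indicator {0..} x * exp (- (\<delta> * x)))"
    by (rule integrableI_nonneg) (use nn in \<open>auto simp: ennreal_less_top\<close>)
  show "(\<integral>x. indicator {0..} x * exp (- (\<delta> * x)) \<partial>lborel) = 1 / \<delta>"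
    using assms by (intro integral_eq_nn_integral[THEN trans]) (use nn in auto)
qed

lemma prod_indicator_nonneg:
  assumes "finite E"
  shows "(\<Prod>e\<in>E. indicator {0..} (x e) :: real) = (if \<forall>e\<in>E. 0 \<le> x e then 1 else 0)"
  using assms by (auto intro!: prod.neutral simp: prod_zero_iff indicator_def)

text \<open>The coefficient \<open>a i e\<close> is the number of sides of the edge \<open>e\<close> that belong to the cell \<open>i\<close>.\<close>

locale incidence =
  fixes E :: "'e set" and s :: nat and a :: "nat \<Rightarrow> 'e \<Rightarrow> nat"
  assumes finE: "finite E" and cover: "\<And>e. e \<in> E \<Longrightarrow> \<exists>i\<in>{1..s}. 1 \<le> a i e"
    and even_sides: "\<And>e. e \<in> E \<Longrightarrow> even (\<Sum>i=1..s. a i e)"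
    and conn: "\<And>S. S \<subseteq> {1..s} \<Longrightarrow> (\<And>e. e \<in> E \<Longrightarrow> even (\<Sum>i\<in>S. a i e)) \<Longrightarrow> S = {} \<or> S = {1..s}"
    and s1: "1 \<le> s"
begin

sublocale product_sigma_finite "\<lambda>_::'e. lborel :: real measure"
  by unfold_locales

definition per :: "('e \<Rightarrow> nat) \<Rightarrow> nat \<Rightarrow> nat" where
  "per l i = (\<Sum>e\<in>E. a i e * l e)"

definition rper :: "('e \<Rightarrow> real) \<Rightarrow> nat \<Rightarrow> real" where
  "rper x i = (\<Sum>e\<in>E. real (a i e) * x e)"

text \<open>Character sum: the product over the cells of 1 plus a sign is expanded into a sum over
  sets S of cells. Summing over r kills S as soon as some edge has an odd number of sides in S. By
  \<open>conn\<close> only the empty set and the set of all cells survive, each contributing 2 ^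
  card E.\<close>

lemma card_parity:
  assumes \<kappa>: "even (\<Sum>i=1..s. \<kappa> i)"
  shows "card {r \<in> E \<rightarrow>\<^sub>E {1, 2}. \<forall>i\<in>{1..s}. even (\<kappa> i + per r i)} * 2 ^ s = 2 * 2 ^ card E"
proof -
  let ?P = "E \<rightarrow>\<^sub>E {1, 2::nat}"
  let ?V = "{r \<in> ?P. \<forall>i\<in>{1..s}. even (\<kappa> i + per r i)}"
  have finP: "finite ?P" using finE by (intro finite_PiE) auto
  have "(\<Sum>r\<in>?P. \<Prod>i\<in>{1..s}. (-1) ^ (\<kappa> i + per r i) + 1) = (\<Sum>r\<in>?P. if r \<in> ?V then 2 ^ s else (0::int))"
  proof (rule sum.cong[OF refl])
    fix r assume r: "r \<in> ?P"
    show "(\<Prod>i\<in>{1..s}. (-1) ^ (\<kappa> i + per r i) + 1) = (if r \<in> ?V then 2 ^ s else (0::int))"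
    proof (cases "r \<in> ?V")
      case True
      then have "(\<Prod>i\<in>{1..s}. (-1) ^ (\<kappa> i + per r i) + 1) = (\<Prod>i\<in>{1..s}. 2::int)"
        by (intro prod.cong) auto
      then show ?thesis using True by simp
    next
      case False
      then obtain i where "i \<in> {1..s}" "odd (\<kappa> i + per r i)" using r by blast
      then have "(\<Prod>i\<in>{1..s}. (-1) ^ (\<kappa> i + per r i) + 1) = (0::int)"
        by (intro prod_zero) (auto intro!: bexI[of _ i])
      then show ?thesis using False by simp
    qed
  qed
  also have "\<dots> = int (card ?V * 2 ^ s)"
    using finP by (simp add: sum.If_cases Int_def conj_commute)
  finally have count: "int (card ?V * 2 ^ s) = (\<Sum>r\<in>?P. \<Prod>i\<in>{1..s}. (-1) ^ (\<kappa> i + per r i) + 1)" ..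
  have chi: "(\<Sum>r\<in>?P. \<Prod>i\<in>S. (-1) ^ (\<kappa> i + per r i)) =
      (-1) ^ (\<Sum>i\<in>S. \<kappa> i) * (\<Prod>e\<in>E. if even (\<Sum>i\<in>S. a i e) then 2 else (0::int))"
    if S: "S \<subseteq> {1..s}" for S
  proof -
    have finS: "finite S" using S finite_subset by blast
    have "(\<Sum>r\<in>?P. \<Prod>i\<in>S. (-1::int) ^ (\<kappa> i + per r i)) =
        (\<Sum>r\<in>?P. (-1) ^ (\<Sum>i\<in>S. \<kappa> i) * (\<Prod>e\<in>E. ((-1) ^ (\<Sum>i\<in>S. a i e)) ^ r e))"
    proof (rule sum.cong[OF refl])
      fix r
      have "(\<Prod>i\<in>S. (-1::int) ^ (\<kappa> i + per r i)) = (-1) ^ (\<Sum>i\<in>S. \<kappa> i) * (-1) ^ (\<Sum>i\<in>S. per r i)"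
        by (simp add: power_add prod.distrib power_sum)
      also have "(\<Sum>i\<in>S. per r i) = (\<Sum>e\<in>E. (\<Sum>i\<in>S. a i e) * r e)"
        unfolding per_def by (subst sum.swap) (simp add: sum_distrib_right)
      also have "(-1::int) ^ \<dots> = (\<Prod>e\<in>E. ((-1) ^ (\<Sum>i\<in>S. a i e)) ^ r e)"
        by (simp add: power_sum power_mult)
      finally show "(\<Prod>i\<in>S. (-1::int) ^ (\<kappa> i + per r i)) =
          (-1) ^ (\<Sum>i\<in>S. \<kappa> i) * (\<Prod>e\<in>E. ((-1) ^ (\<Sum>i\<in>S. a i e)) ^ r e)" .
    qed
    also have "\<dots> = (-1) ^ (\<Sum>i\<in>S. \<kappa> i) * (\<Prod>e\<in>E. \<Sum>v\<in>{1,2}. ((-1::int) ^ (\<Sum>i\<in>S. a i e)) ^ v)"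
      by (subst prod_sum_PiE[OF finE]) (simp_all add: sum_distrib_left)
    also have "(\<Prod>e\<in>E. \<Sum>v\<in>{1,2}. ((-1::int) ^ (\<Sum>i\<in>S. a i e)) ^ v) =
        (\<Prod>e\<in>E. if even (\<Sum>i\<in>S. a i e) then 2 else (0::int))"
      by (rule prod.cong[OF refl]) (auto simp: uminus_power_if)
    finally show ?thesis .
  qed
  have "(\<Sum>r\<in>?P. \<Prod>i\<in>{1..s}. (-1::int) ^ (\<kappa> i + per r i) + 1) =
      (\<Sum>S\<in>Pow {1..s}. \<Sum>r\<in>?P. \<Prod>i\<in>S. (-1) ^ (\<kappa> i + per r i))"
  proof -
    have "(\<Prod>i\<in>{1..s}. (-1::int) ^ (\<kappa> i + per r i) + 1) = (\<Sum>S\<in>Pow {1..s}. \<Prod>i\<in>S. (-1) ^ (\<kappa> i + per r i))" for r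
      by (subst prod_add) simp_all
    then show ?thesis by (simp only: sum.swap[of _ ?P])
  qed
  also have "\<dots> = (\<Sum>S\<in>Pow {1..s}. (-1) ^ (\<Sum>i\<in>S. \<kappa> i) * (\<Prod>e\<in>E. if even (\<Sum>i\<in>S. a i e) then 2 else (0::int)))"
    by (rule sum.cong[OF refl]) (use chi in auto)
  also have "\<dots> = (\<Sum>S\<in>{{}, {1..s}}. (-1) ^ (\<Sum>i\<in>S. \<kappa> i) * (\<Prod>e\<in>E. if even (\<Sum>i\<in>S. a i e) then 2 else (0::int)))"
  proof (rule sum.mono_neutral_right)
    show "\<forall>S\<in>Pow {1..s} - {{}, {1..s}}. (-1) ^ (\<Sum>i\<in>S. \<kappa> i) * (\<Prod>e\<in>E. if even (\<Sum>i\<in>S. a i e) then 2 else (0::int)) = 0"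
    proof
      fix S assume S: "S \<in> Pow {1..s} - {{}, {1..s}}"
      then obtain e where e: "e \<in> E" "odd (\<Sum>i\<in>S. a i e)" using conn[of S] by blast
      then have "(\<Prod>e\<in>E. if even (\<Sum>i\<in>S. a i e) then 2 else (0::int)) = 0"
        using finE by (intro prod_zero) (auto intro!: bexI[of _ e])
      then show "(-1) ^ (\<Sum>i\<in>S. \<kappa> i) * (\<Prod>e\<in>E. if even (\<Sum>i\<in>S. a i e) then 2 else (0::int)) = 0" by simp
    qed
  qed auto
  also have "\<dots> = 2 ^ card E + 2 ^ card E"
  proof -
    have ne: "{} \<noteq> {1..s}" using s1 by auto
    have "(\<Prod>e\<in>E. if even (\<Sum>i\<in>{1..s}. a i e) then 2 else (0::int)) = (\<Prod>e\<in>E. 2)"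
      by (rule prod.cong) (use even_sides in auto)
    then show ?thesis using ne \<kappa> by simp
  qed
  finally have "int (card ?V * 2 ^ s) = int (2 * 2 ^ card E)" using count by simp
  then show ?thesis by (simp only: of_nat_eq_iff)
qed

text \<open>A positive integer is uniquely 2 q + r with r in {1, 2}. So r fixes all parities while q
  ranges over a full box, and q \<le> K corresponds to the bound 2 K + 2.\<close>

lemma sum_split_parity:
  fixes F :: "('e \<Rightarrow> nat) \<Rightarrow> real"
  shows "(\<Sum>l\<in>E \<rightarrow>\<^sub>E {1..2 * K + 2}. F l) =
    (\<Sum>r\<in>E \<rightarrow>\<^sub>E {1, 2}. \<Sum>q\<in>E \<rightarrow>\<^sub>E {..K}. F (\<lambda>e\<in>E. 2 * q e + r e))"
proof -
  have "(\<Sum>r\<in>E \<rightarrow>\<^sub>E {1, 2}. \<Sum>q\<in>E \<rightarrow>\<^sub>E {..K}. F (\<lambda>e\<in>E. 2 * q e + r e)) =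
      (\<Sum>(r, q)\<in>(E \<rightarrow>\<^sub>E {1, 2}) \<times> (E \<rightarrow>\<^sub>E {..K}). F (\<lambda>e\<in>E. 2 * q e + r e))"
    by (rule sum.cartesian_product)
  also have "\<dots> = (\<Sum>l\<in>E \<rightarrow>\<^sub>E {1..2 * K + 2}. F l)"
  proof (rule sum.reindex_bij_witness[of _
      "\<lambda>l. (\<lambda>e\<in>E. if even (l e) then 2 else 1, \<lambda>e\<in>E. (l e - 1) div 2)" "\<lambda>(r, q). \<lambda>e\<in>E. 2 * q e + r e"])
    fix b assume b: "b \<in> (E \<rightarrow>\<^sub>E {1, 2::nat}) \<times> (E \<rightarrow>\<^sub>E {..K})"
    obtain r q where rq: "b = (r, q)" "r \<in> E \<rightarrow>\<^sub>E {1, 2}" "q \<in> E \<rightarrow>\<^sub>E {..K}" using b by auto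
    have rv: "r e = 1 \<or> r e = 2" if "e \<in> E" for e using PiE_mem[OF rq(2) that] by simp
    have "(\<lambda>e\<in>E. if even ((\<lambda>e\<in>E. 2 * q e + r e) e) then 2 else 1) = r"
    proof
      fix e show "(\<lambda>e\<in>E. if even ((\<lambda>e\<in>E. 2 * q e + r e) e) then 2 else 1) e = r e"
        using rv[of e] PiE_arb[OF rq(2), of e] by (cases "e \<in> E") auto
    qed
    moreover have "(\<lambda>e\<in>E. ((\<lambda>e\<in>E. 2 * q e + r e) e - 1) div 2) = q"
    proof
      fix e show "(\<lambda>e\<in>E. ((\<lambda>e\<in>E. 2 * q e + r e) e - 1) div 2) e = q e"
        using rv[of e] PiE_arb[OF rq(3), of e] by (cases "e \<in> E") auto
    qed
    ultimately show "(\<lambda>e\<in>E. if even ((case b of (r, q) \<Rightarrow> \<lambda>e\<in>E. 2 * q e + r e) e) then 2 else 1,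
        \<lambda>e\<in>E. ((case b of (r, q) \<Rightarrow> \<lambda>e\<in>E. 2 * q e + r e) e - 1) div 2) = b" using rq by simp
    have "1 \<le> 2 * q e + r e \<and> 2 * q e + r e \<le> 2 * K + 2" if "e \<in> E" for e
    proof -
      have "q e \<le> K" using PiE_mem[OF rq(3) that] by simp
      then show ?thesis using rv[OF that] by auto
    qed
    then show "(case b of (r, q) \<Rightarrow> \<lambda>e\<in>E. 2 * q e + r e) \<in> E \<rightarrow>\<^sub>E {1..2 * K + 2}" using rq(1) by auto
    show "F (case b of (r, q) \<Rightarrow> \<lambda>e\<in>E. 2 * q e + r e) = (case b of (r, q) \<Rightarrow> F (\<lambda>e\<in>E. 2 * q e + r e))"
      using rq(1) by simp
  next
    fix l assume l: "l \<in> E \<rightarrow>\<^sub>E {1..2 * K + 2}"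
    have lv: "1 \<le> l e" "l e \<le> 2 * K + 2" if "e \<in> E" for e using PiE_mem[OF l that] by simp_all
    have h: "2 * ((l e - 1) div 2) + (if even (l e) then 2 else 1) = l e" "(l e - 1) div 2 \<le> K" if "e \<in> E" for e
    proof -
      show "2 * ((l e - 1) div 2) + (if even (l e) then 2 else 1) = l e" using lv(1)[OF that] by presburger
      show "(l e - 1) div 2 \<le> K" using lv(2)[OF that] by presburger
    qed
    show "(case (\<lambda>e\<in>E. if even (l e) then 2 else 1, \<lambda>e\<in>E. (l e - 1) div 2) of (r, q) \<Rightarrow> \<lambda>e\<in>E. 2 * q e + r e) = l"
    proof
      fix e show "(case (\<lambda>e\<in>E. if even (l e) then 2 else 1, \<lambda>e\<in>E. (l e - 1) div 2) of (r, q) \<Rightarrow> \<lambda>e\<in>E. 2 * q e + r e) e = l e"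
        using h(1)[of e] PiE_arb[OF l, of e] by (cases "e \<in> E") simp_all
    qed
    show "(\<lambda>e\<in>E. if even (l e) then 2 else 1, \<lambda>e\<in>E. (l e - 1) div 2) \<in> (E \<rightarrow>\<^sub>E {1, 2::nat}) \<times> (E \<rightarrow>\<^sub>E {..K})"
      using h(2) by auto
  qed
  finally show ?thesis by simp
qed

lemma per_cong: "(\<And>e. e \<in> E \<Longrightarrow> l e = l' e) \<Longrightarrow> per l i = per l' i"
  unfolding per_def by (rule sum.cong) auto

lemma le_per:
  assumes "e \<in> E"
  shows "\<exists>i\<in>{1..s}. l e \<le> per l i"
proof -
  obtain i where i: "i \<in> {1..s}" "1 \<le> a i e" using cover[OF assms] by blast
  have "l e \<le> a i e * l e" using i by simp
  also have "\<dots> \<le> per l i" unfolding per_def by (rule member_le_sum[OF assms]) (use finE in auto)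
  finally show ?thesis using i by auto
qed

text \<open>Every edge borders some cell, so decay in the perimeters implies decay in all edge
  lengths.\<close>

lemma sum_le_sum_per: "(\<Sum>e\<in>E. l e) \<le> (\<Sum>i=1..s. per l i)"
proof -
  have "(\<Sum>e\<in>E. l e) \<le> (\<Sum>e\<in>E. (\<Sum>i=1..s. a i e) * l e)"
  proof (rule sum_mono)
    fix e assume "e \<in> E"
    from cover[OF this] obtain i where i: "i \<in> {1..s}" "1 \<le> a i e" by blast
    have "a i e \<le> (\<Sum>i=1..s. a i e)" by (rule member_le_sum) (use i in auto)
    then show "l e \<le> (\<Sum>i=1..s. a i e) * l e" using i by simp
  qed
  also have "\<dots> = (\<Sum>i=1..s. per l i)"
    unfolding per_def sum_distrib_right by (rule sum.swap)
  finally show ?thesis .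
qed

section \<open>Lattice sums as integrals of step functions\<close>

definition cell_integrand :: "(nat \<Rightarrow> real) \<Rightarrow> ('e \<Rightarrow> real) \<Rightarrow> real" where
  "cell_integrand \<xi> x = (\<Prod>e\<in>E. indicator {0..} (x e)) * (\<Prod>i=1..s. gauss_weight (\<xi> i) (rper x i))"

definition cell_integral :: "(nat \<Rightarrow> real) \<Rightarrow> real" where
  "cell_integral \<xi> = (\<integral>x. cell_integrand \<xi> x \<partial>(\<Pi>\<^sub>M e\<in>E. lborel))"

text \<open>For x \<ge> 0 this rounds x sqrt t to the coset of the even numbers given by r. It is
  constant on boxes with sides 2 / sqrt t, the cells of a Riemann sum.\<close>

definition lattice :: "('e \<Rightarrow> nat) \<Rightarrow> real \<Rightarrow> ('e \<Rightarrow> real) \<Rightarrow> 'e \<Rightarrow> nat" where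
  "lattice r t x e = 2 * nat \<lfloor>x e * sqrt t / 2\<rfloor> + r e"

definition step_fun :: "('e \<Rightarrow> nat) \<Rightarrow> (real \<Rightarrow> nat \<Rightarrow> nat) \<Rightarrow> real \<Rightarrow> ('e \<Rightarrow> real) \<Rightarrow> real" where
  "step_fun r k t x = (\<Prod>e\<in>E. indicator {0..} (x e)) * (\<Prod>i=1..s. walk_weight (k t i) (per (lattice r t x) i))"

lemma walk_weight_nonneg: "0 \<le> walk_weight k m"
  by (simp add: walk_weight_def)

lemma off_orthant:
  assumes "\<not> (\<forall>e\<in>E. 0 \<le> x e)"
  shows "step_fun r k t x = 0" "cell_integrand \<xi> x = 0"
  using assms by (simp_all only: step_fun_def cell_integrand_def prod_indicator_nonneg[OF finE] if_False mult_zero_left)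

lemma on_orthant:
  assumes "\<forall>e\<in>E. 0 \<le> x e"
  shows "step_fun r k t x = (\<Prod>i=1..s. walk_weight (k t i) (per (lattice r t x) i))"
    "cell_integrand \<xi> x = (\<Prod>i=1..s. gauss_weight (\<xi> i) (rper x i))"
  unfolding step_fun_def cell_integrand_def prod_indicator_nonneg[OF finE] if_P[OF assms] by simp_all

lemma step_fun_eq_sum:
  assumes t: "0 < t" and K: "\<And>i. i \<in> {1..s} \<Longrightarrow> k t i \<le> K"
  shows "step_fun r k t x = (\<Sum>q\<in>E \<rightarrow>\<^sub>E {..K}. (\<Prod>i=1..s. walk_weight (k t i) (per (\<lambda>e. 2 * q e + r e) i)) *
    (\<Prod>e\<in>E. indicator {2 * real (q e) / sqrt t ..< 2 * (real (q e) + 1) / sqrt t} (x e)))"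
proof -
  let ?G = "\<lambda>q. \<Prod>i=1..s. walk_weight (k t i) (per (\<lambda>e. 2 * q e + r e) i)"
  have st: "0 < sqrt t" using t by simp
  have box: "(indicator {2 * real q / sqrt t ..< 2 * (real q + 1) / sqrt t} y :: real) =
      (if 0 \<le> y \<and> nat \<lfloor>y * sqrt t / 2\<rfloor> = q then 1 else 0)" for q y
  proof -
    have "y \<in> {2 * real q / sqrt t ..< 2 * (real q + 1) / sqrt t} \<longleftrightarrow> real q \<le> y * sqrt t / 2 \<and> y * sqrt t / 2 < real q + 1"
      using st by (auto simp: field_simps)
    also have "\<dots> \<longleftrightarrow> \<lfloor>y * sqrt t / 2\<rfloor> = int q" by (simp add: floor_eq_iff)
    also have "\<dots> \<longleftrightarrow> 0 \<le> y \<and> nat \<lfloor>y * sqrt t / 2\<rfloor> = q"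
    proof -
      have "0 \<le> \<lfloor>y * sqrt t / 2\<rfloor> \<longleftrightarrow> 0 \<le> y"
        using st by (simp add: zero_le_floor zero_le_mult_iff)
      moreover have "F = int q \<longleftrightarrow> b \<and> nat F = q" if "0 \<le> F \<longleftrightarrow> b" for F b
        using that by auto
      ultimately show ?thesis by blast
    qed
    finally show ?thesis by (simp add: indicator_def)
  qed
  have prod_box: "(\<Prod>e\<in>E. indicator {2 * real (q e) / sqrt t ..< 2 * (real (q e) + 1) / sqrt t} (x e) :: real) =
      (if \<forall>e\<in>E. 0 \<le> x e \<and> nat \<lfloor>x e * sqrt t / 2\<rfloor> = q e then 1 else 0)" for q
    unfolding box using finE by (auto intro!: prod.neutral simp: prod_zero_iff)
  show ?thesis
  proof (cases "\<forall>e\<in>E. 0 \<le> x e")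
    case False
    then have "step_fun r k t x = 0" by (rule off_orthant)
    moreover have "(\<Sum>q\<in>E \<rightarrow>\<^sub>E {..K}. ?G q *
        (\<Prod>e\<in>E. indicator {2 * real (q e) / sqrt t ..< 2 * (real (q e) + 1) / sqrt t} (x e))) = 0"
      unfolding prod_box by (rule sum.neutral) (use False in auto)
    ultimately show ?thesis by simp
  next
    case True
    define q0 where "q0 = (\<lambda>e\<in>E. nat \<lfloor>x e * sqrt t / 2\<rfloor>)"
    have lhs: "step_fun r k t x = ?G q0"
    proof -
      have "per (lattice r t x) i = per (\<lambda>e. 2 * q0 e + r e) i" for i
        by (rule per_cong) (simp add: lattice_def q0_def)
      then show ?thesis unfolding on_orthant[OF True] by simp
    qed
    have summand: "?G q * (\<Prod>e\<in>E. indicator {2 * real (q e) / sqrt t ..< 2 * (real (q e) + 1) / sqrt t} (x e)) =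
        (if q = q0 then ?G q0 else 0)" if q: "q \<in> E \<rightarrow>\<^sub>E {..K}" for q
    proof -
      have "(\<forall>e\<in>E. 0 \<le> x e \<and> nat \<lfloor>x e * sqrt t / 2\<rfloor> = q e) \<longleftrightarrow> q = q0"
      proof
        assume *: "\<forall>e\<in>E. 0 \<le> x e \<and> nat \<lfloor>x e * sqrt t / 2\<rfloor> = q e"
        show "q = q0"
        proof
          fix e show "q e = q0 e" using * q by (cases "e \<in> E") (auto simp: q0_def PiE_def extensional_def)
        qed
      next
        assume "q = q0"
        then show "\<forall>e\<in>E. 0 \<le> x e \<and> nat \<lfloor>x e * sqrt t / 2\<rfloor> = q e" using True by (simp add: q0_def)
      qed
      then show ?thesis unfolding prod_box by simp
    qed
    have "(\<Sum>q\<in>E \<rightarrow>\<^sub>E {..K}. ?G q *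
        (\<Prod>e\<in>E. indicator {2 * real (q e) / sqrt t ..< 2 * (real (q e) + 1) / sqrt t} (x e))) =
        (\<Sum>q\<in>E \<rightarrow>\<^sub>E {..K}. if q = q0 then ?G q0 else 0)"
      by (rule sum.cong[OF refl summand])
    also have "\<dots> = (if q0 \<in> E \<rightarrow>\<^sub>E {..K} then ?G q0 else 0)"
      using finE by (simp add: sum.delta finite_PiE)
    also have "\<dots> = ?G q0"
    \<comment> \<open>If q0 lies outside the range of the finite sum, some perimeter exceeds its k t
      i, where \<open>walk_weight\<close> is 0 by definition.\<close>
    proof (cases "q0 \<in> E \<rightarrow>\<^sub>E {..K}")
      case False
      have "\<exists>e\<in>E. \<not> q0 e \<le> K"
      proof (rule ccontr)
        assume "\<not> (\<exists>e\<in>E. \<not> q0 e \<le> K)"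
        then have le: "q0 e \<in> {..K}" if "e \<in> E" for e using that by blast
        have "q0 \<in> E \<rightarrow>\<^sub>E {..K}"
          by (rule PiE_I[OF le]) (simp_all only: q0_def restrict_apply if_False)
        then show False using False by blast
      qed
      then obtain e where e: "e \<in> E" "K < q0 e" by (metis not_le)
      obtain i where i: "i \<in> {1..s}" "2 * q0 e + r e \<le> per (\<lambda>e. 2 * q0 e + r e) i" using le_per[OF e(1), of "\<lambda>e. 2 * q0 e + r e"] by blast
      then have "walk_weight (k t i) (per (\<lambda>e. 2 * q0 e + r e) i) = 0"
        using K[OF i(1)] e(2) by (simp add: walk_weight_def)
      then have "?G q0 = 0" using i(1) by (intro prod_zero) auto
      then show ?thesis by simp
    qed simp
    finally show ?thesis using lhs by simp
  qed
qed

lemma integral_step_fun: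
  assumes t: "0 < t" and K: "\<And>i. i \<in> {1..s} \<Longrightarrow> k t i \<le> K"
  shows "(\<integral>x. step_fun r k t x \<partial>(\<Pi>\<^sub>M e\<in>E. lborel)) = (2 / sqrt t) ^ card E *
    (\<Sum>q\<in>E \<rightarrow>\<^sub>E {..K}. \<Prod>i=1..s. walk_weight (k t i) (per (\<lambda>e. 2 * q e + r e) i))"
proof -
  have st: "0 < sqrt t" using t by simp
  have int1: "integrable lborel (indicator {2 * real q / sqrt t ..< 2 * (real q + 1) / sqrt t} :: real \<Rightarrow> real)" for q
  proof (rule integrable_real_indicator)
    have "2 * real q / sqrt t \<le> 2 * (real q + 1) / sqrt t" using st by (intro divide_right_mono) auto
    then show "emeasure lborel {2 * real q / sqrt t ..< 2 * (real q + 1) / sqrt t} < \<infinity>"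
      by (simp add: emeasure_lborel_Ico)
  qed simp
  have int2: "(\<integral>y. indicator {2 * real q / sqrt t ..< 2 * (real q + 1) / sqrt t} y \<partial>lborel) = 2 / sqrt t" for q
  proof -
    have le: "2 * real q / sqrt t \<le> 2 * (real q + 1) / sqrt t" using st by (intro divide_right_mono) auto
    have "(\<integral>y. indicator {2 * real q / sqrt t ..< 2 * (real q + 1) / sqrt t} y \<partial>lborel) =
        2 * (real q + 1) / sqrt t - 2 * real q / sqrt t"
      using le by simp
    then show ?thesis by (simp add: diff_divide_distrib[symmetric])
  qed
  have "(\<integral>x. step_fun r k t x \<partial>(\<Pi>\<^sub>M e\<in>E. lborel)) =
      (\<integral>x. (\<Sum>q\<in>E \<rightarrow>\<^sub>E {..K}. (\<Prod>i=1..s. walk_weight (k t i) (per (\<lambda>e. 2 * q e + r e) i)) *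
    (\<Prod>e\<in>E. indicator {2 * real (q e) / sqrt t ..< 2 * (real (q e) + 1) / sqrt t} (x e))) \<partial>(\<Pi>\<^sub>M e\<in>E. lborel))"
    by (intro Bochner_Integration.integral_cong refl) (rule step_fun_eq_sum[where k = k, OF assms])
  also have "\<dots> = (\<Sum>q\<in>E \<rightarrow>\<^sub>E {..K}. (\<Prod>i=1..s. walk_weight (k t i) (per (\<lambda>e. 2 * q e + r e) i)) * (2 / sqrt t) ^ card E)"
  proof -
    let ?b = "\<lambda>q x. \<Prod>e\<in>E. indicator {2 * real (q e) / sqrt t ..< 2 * (real (q e) + 1) / sqrt t} (x e) :: real"
    have ip: "integrable (\<Pi>\<^sub>M e\<in>E. lborel) (?b q)" for q
      by (rule product_integrable_prod[OF finE int1])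
    have iv: "(\<integral>x. ?b q x \<partial>(\<Pi>\<^sub>M e\<in>E. lborel)) = (2 / sqrt t) ^ card E" for q
      unfolding product_integral_prod[OF finE int1] int2 prod_constant ..
    have "(\<integral>x. (\<Sum>q\<in>E \<rightarrow>\<^sub>E {..K}. (\<Prod>i=1..s. walk_weight (k t i) (per (\<lambda>e. 2 * q e + r e) i)) * ?b q x) \<partial>(\<Pi>\<^sub>M e\<in>E. lborel)) =
        (\<Sum>q\<in>E \<rightarrow>\<^sub>E {..K}. \<integral>x. (\<Prod>i=1..s. walk_weight (k t i) (per (\<lambda>e. 2 * q e + r e) i)) * ?b q x \<partial>(\<Pi>\<^sub>M e\<in>E. lborel))"
      by (rule Bochner_Integration.integral_sum) (intro integrable_mult_right ip)
    then show ?thesis by (simp only: integral_mult_right_zero iv)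
  qed
  finally show ?thesis by (simp add: sum_distrib_left mult.commute)
qed

lemma lattice_limit:
  assumes "0 \<le> x e"
  shows "((\<lambda>t. real (lattice r t x e) / sqrt t) \<longlongrightarrow> x e) at_top"
proof (rule tendsto_sandwich)
  have b: "x e * sqrt t - 2 \<le> real (lattice r t x e)" "real (lattice r t x e) \<le> x e * sqrt t + real (r e)" if "0 < t" for t
  proof -
    have nn: "0 \<le> x e * sqrt t / 2" using assms that by simp
    have "real (nat \<lfloor>x e * sqrt t / 2\<rfloor>) \<le> x e * sqrt t / 2" using nn by linarith
    moreover have "x e * sqrt t / 2 - 1 \<le> real (nat \<lfloor>x e * sqrt t / 2\<rfloor>)" using nn by linarith
    ultimately show "x e * sqrt t - 2 \<le> real (lattice r t x e)" "real (lattice r t x e) \<le> x e * sqrt t + real (r e)"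
      unfolding lattice_def of_nat_add of_nat_mult by (simp_all only: of_nat_numeral)
  qed
  show "\<forall>\<^sub>F t in at_top. x e - 2 / sqrt t \<le> real (lattice r t x e) / sqrt t"
    using eventually_gt_at_top[of 0]
  proof eventually_elim
    case (elim t)
    have "(x e * sqrt t - 2) / sqrt t \<le> real (lattice r t x e) / sqrt t" using b(1)[OF elim] elim by (intro divide_right_mono) auto
    then show ?case using elim by (simp add: diff_divide_distrib)
  qed
  show "\<forall>\<^sub>F t in at_top. real (lattice r t x e) / sqrt t \<le> x e + real (r e) / sqrt t"
    using eventually_gt_at_top[of 0]
  proof eventually_elim
    case (elim t)
    have "real (lattice r t x e) / sqrt t \<le> (x e * sqrt t + real (r e)) / sqrt t" using b(2)[OF elim] elim by (intro divide_right_mono) auto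
    then show ?case using elim by (simp add: add_divide_distrib)
  qed
  show "((\<lambda>t. x e - 2 / sqrt t) \<longlongrightarrow> x e) at_top" by real_asymp
  show "((\<lambda>t. x e + real (r e) / sqrt t) \<longlongrightarrow> x e) at_top" by real_asymp
qed

lemma measurable_rper [measurable]: "(\<lambda>x. rper x i) \<in> borel_measurable (\<Pi>\<^sub>M e\<in>E. lborel)"
  unfolding rper_def by measurable

lemma measurable_gauss_weight [measurable]: "gauss_weight \<xi> \<in> borel_measurable borel"
  unfolding gauss_weight_def[abs_def] by measurable

lemma measurable_cell_integrand [measurable]: "cell_integrand \<xi> \<in> borel_measurable (\<Pi>\<^sub>M e\<in>E. lborel)"
  unfolding cell_integrand_def[abs_def] by measurable

text \<open>Dominated convergence, which delivers the integrability of the limit along with the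
  limit of the integrals.\<close>

lemma step_fun_integral_limit:
  fixes k :: "real \<Rightarrow> nat \<Rightarrow> nat"
  assumes \<xi>: "\<And>i. i \<in> {1..s} \<Longrightarrow> 0 < \<xi> i"
    and k: "\<And>i. i \<in> {1..s} \<Longrightarrow> ((\<lambda>t. real (k t i) / t) \<longlongrightarrow> \<xi> i) at_top"
    and k1: "\<And>t i. i \<in> {1..s} \<Longrightarrow> 0 < k t i"
  shows "((\<lambda>t. \<integral>x. step_fun r k t x \<partial>(\<Pi>\<^sub>M e\<in>E. lborel)) \<longlongrightarrow> cell_integral \<xi>) at_top"
    and "integrable (\<Pi>\<^sub>M e\<in>E. lborel) (cell_integrand \<xi>)"
proof -
  let ?M = "\<Pi>\<^sub>M e\<in>E. lborel :: real measure"
  obtain C where C: "C > 0" "\<And>k m. 1 \<le> k \<Longrightarrow> walk_weight k m \<le> C * exp (- (real m / sqrt (real k)))"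
    using walk_weight_bound by blast
  obtain X where X: "X > 0" "\<And>i. i \<in> {1..s} \<Longrightarrow> \<xi> i < X"
  proof
    show "0 < 1 + (\<Sum>i=1..s. \<xi> i)" using \<xi> by (intro add_pos_nonneg sum_nonneg) (auto intro: less_imp_le)
    fix i assume i: "i \<in> {1..s}"
    have "\<xi> i \<le> (\<Sum>i=1..s. \<xi> i)" by (rule member_le_sum) (use \<xi> i in \<open>auto intro: less_imp_le\<close>)
    then show "\<xi> i < 1 + (\<Sum>i=1..s. \<xi> i)" by simp
  qed
  define \<delta> where "\<delta> = 1 / sqrt X"
  have \<delta>: "0 < \<delta>" using X by (simp add: \<delta>_def)
  \<comment> \<open>Dominates the step functions as soon as k t i < X t for all i: the exponential
    bounds in the perimeters are traded for one factor for each edge. Rounding lowers a coordinate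
    by at most 2 / sqrt t \<le> 2 for t \<ge> 1, which costs the factor exp (2 * \<delta>).\<close>
  define w where "w x = C ^ s * (\<Prod>e\<in>E. exp (2 * \<delta>) * (indicator {0..} (x e) * exp (- (\<delta> * x e))))" for x :: "'e \<Rightarrow> real"
  have ev: "\<forall>\<^sub>F t in at_top. \<forall>i\<in>{1..s}. real (k t i) / t < X"
    by (rule eventually_ball_finite) (use order_tendstoD(2)[OF k X(2)] in auto)
  have int_w: "integrable ?M w"
    unfolding w_def using product_integrable_prod[OF finE, of "\<lambda>_ y. exp (2 * \<delta>) * (indicator {0..} y * exp (- (\<delta> * y)))"]
      exp_halfline(1)[OF \<delta>] by (intro integrable_mult_right) simp
  have meas: "step_fun r k t \<in> borel_measurable ?M" for t
    unfolding step_fun_def[abs_def] per_def lattice_def by measurable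
  have bound: "\<forall>\<^sub>F t in at_top. AE x in ?M. norm (step_fun r k t x) \<le> w x"
    using ev eventually_ge_at_top[of 1]
  proof eventually_elim
    case (elim t)
    have st: "1 \<le> sqrt t" using elim by simp
    show ?case
    proof (rule AE_I2)
      fix x
      show "norm (step_fun r k t x) \<le> w x"
      proof (cases "\<forall>e\<in>E. 0 \<le> x e")
        case False
        then have "step_fun r k t x = 0" by (rule off_orthant)
        moreover have "0 \<le> w x" unfolding w_def using C(1) by (intro mult_nonneg_nonneg prod_nonneg) auto
        ultimately show ?thesis by simp
      next
        case True
        let ?l = "lattice r t x"
        have one: "walk_weight (k t i) (per ?l i) \<le> C * exp (- (\<delta> * (real (per ?l i) / sqrt t)))" if i: "i \<in> {1..s}" for i
        proof -
          have "real (k t i) < X * t" using elim(1) i elim(2) by (auto simp: field_simps)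
          then have "sqrt (real (k t i)) \<le> sqrt X * sqrt t" by (simp add: real_sqrt_mult[symmetric])
          then have "real (per ?l i) / (sqrt X * sqrt t) \<le> real (per ?l i) / sqrt (real (k t i))"
            using k1[OF i, of t] X(1) elim(2) by (intro divide_left_mono) (auto intro!: mult_pos_pos)
          then have "exp (- (real (per ?l i) / sqrt (real (k t i)))) \<le> exp (- (\<delta> * (real (per ?l i) / sqrt t)))"
            by (simp add: \<delta>_def)
          moreover have "walk_weight (k t i) (per ?l i) \<le> C * exp (- (real (per ?l i) / sqrt (real (k t i))))"
            by (rule C(2)) (use k1[OF i, of t] in simp)
          ultimately show ?thesis using C(1) by (meson mult_left_mono less_imp_le order_trans)
        qed
        have "norm (step_fun r k t x) = (\<Prod>i=1..s. walk_weight (k t i) (per ?l i))"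
          unfolding on_orthant[OF True] by (simp add: abs_prod walk_weight_nonneg)
        also have "\<dots> \<le> (\<Prod>i=1..s. C * exp (- (\<delta> * (real (per ?l i) / sqrt t))))"
          by (rule prod_mono) (use one walk_weight_nonneg in auto)
        also have "\<dots> = C ^ s * exp (- (\<delta> * ((\<Sum>i=1..s. real (per ?l i)) / sqrt t)))"
          by (simp add: prod.distrib exp_sum[symmetric] sum_negf sum_distrib_left[symmetric] sum_divide_distrib[symmetric])
        also have "\<dots> \<le> C ^ s * exp (- (\<delta> * ((\<Sum>e\<in>E. real (?l e)) / sqrt t)))"
        proof -
          have "(\<Sum>e\<in>E. real (?l e)) \<le> (\<Sum>i=1..s. real (per ?l i))"
            using sum_le_sum_per[of ?l] by (metis of_nat_le_iff of_nat_sum)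
          then have "(\<Sum>e\<in>E. real (?l e)) / sqrt t \<le> (\<Sum>i=1..s. real (per ?l i)) / sqrt t"
            using elim(2) by (intro divide_right_mono) auto
          then have "\<delta> * ((\<Sum>e\<in>E. real (?l e)) / sqrt t) \<le> \<delta> * ((\<Sum>i=1..s. real (per ?l i)) / sqrt t)"
            using \<delta> by (intro mult_left_mono) simp_all
          then have "exp (- (\<delta> * ((\<Sum>i=1..s. real (per ?l i)) / sqrt t))) \<le> exp (- (\<delta> * ((\<Sum>e\<in>E. real (?l e)) / sqrt t)))"
            by (simp only: exp_le_cancel_iff neg_le_iff_le)
          then show ?thesis using C(1) by (intro mult_left_mono) simp_all
        qed
        also have "\<dots> = C ^ s * (\<Prod>e\<in>E. exp (- (\<delta> * (real (?l e) / sqrt t))))"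
          using finE by (simp add: exp_sum[symmetric] sum_negf sum_distrib_left[symmetric] sum_divide_distrib[symmetric])
        also have "\<dots> \<le> w x"
          unfolding w_def
        proof (intro mult_left_mono prod_mono conjI)
          fix e assume e: "e \<in> E"
          have nn: "0 \<le> x e * sqrt t / 2" using True e elim(2) by simp
          have "x e * sqrt t / 2 - 1 \<le> real (nat \<lfloor>x e * sqrt t / 2\<rfloor>)" using nn by linarith
          then have "x e * sqrt t - 2 \<le> real (?l e)" by (simp add: lattice_def)
          then have "(x e * sqrt t - 2) / sqrt t \<le> real (?l e) / sqrt t" using elim(2) by (intro divide_right_mono) auto
          moreover have "(x e * sqrt t - 2) / sqrt t = x e - 2 / sqrt t" using elim(2) by (simp add: diff_divide_distrib)
          moreover have "2 / sqrt t \<le> 2 / 1" by (rule divide_left_mono) (use st in simp_all)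
          ultimately have "x e - 2 \<le> real (?l e) / sqrt t" by linarith
          then have "\<delta> * (x e - 2) \<le> \<delta> * (real (?l e) / sqrt t)" using \<delta> by (intro mult_left_mono) auto
          then have "- (\<delta> * (real (?l e) / sqrt t)) \<le> 2 * \<delta> + - (\<delta> * x e)" by (simp add: algebra_simps)
          then have "exp (- (\<delta> * (real (?l e) / sqrt t))) \<le> exp (2 * \<delta>) * exp (- (\<delta> * x e))"
            unfolding exp_add[symmetric] by simp
          then show "exp (- (\<delta> * (real (?l e) / sqrt t))) \<le> exp (2 * \<delta>) * (indicator {0..} (x e) * exp (- (\<delta> * x e)))"
            using True e by simp
        qed (use C(1) in auto)
        finally show ?thesis .
      qed
    qed
  qed
  have lim: "AE x in ?M. ((\<lambda>t. step_fun r k t x) \<longlongrightarrow> cell_integrand \<xi> x) at_top"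
  proof (rule AE_I2)
    fix x
    show "((\<lambda>t. step_fun r k t x) \<longlongrightarrow> cell_integrand \<xi> x) at_top"
    proof (cases "\<forall>e\<in>E. 0 \<le> x e")
      case False
      show ?thesis unfolding off_orthant[OF False] by (rule tendsto_const)
    next
      case True
      have "((\<lambda>t. \<Prod>i=1..s. walk_weight (k t i) (per (lattice r t x) i)) \<longlongrightarrow> (\<Prod>i=1..s. gauss_weight (\<xi> i) (rper x i))) at_top"
      proof (rule tendsto_prod)
        fix i assume i: "i \<in> {1..s}"
        show "((\<lambda>t. walk_weight (k t i) (per (lattice r t x) i)) \<longlongrightarrow> gauss_weight (\<xi> i) (rper x i)) at_top"
        proof (rule walk_weight_limit[OF \<xi>[OF i] k[OF i]])
          have "((\<lambda>t. \<Sum>e\<in>E. real (a i e) * (real (lattice r t x e) / sqrt t)) \<longlongrightarrow> rper x i) at_top"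
            unfolding rper_def using True by (intro tendsto_sum tendsto_mult tendsto_const lattice_limit) auto
          then show "((\<lambda>t. real (per (lattice r t x) i) / sqrt t) \<longlongrightarrow> rper x i) at_top"
            by (simp add: per_def sum_divide_distrib)
        qed
      qed
      then show ?thesis unfolding on_orthant[OF True] .
    qed
  qed
  show "((\<lambda>t. \<integral>x. step_fun r k t x \<partial>?M) \<longlongrightarrow> cell_integral \<xi>) at_top"
    unfolding cell_integral_def
    by (rule integral_dominated_convergence_at_top[OF measurable_cell_integrand meas int_w lim bound])
  show "integrable ?M (cell_integrand \<xi>)"
    by (rule integrable_dominated_convergence_at_top[OF measurable_cell_integrand meas int_w lim bound])
qed

text \<open>Parity restricts the lattice sum to \<open>2 ^ (card E + 1 - s)\<close> of the \<open>2 ^ card E\<close> cosets of the even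
  lattice, and each of these cosets contributes equally in the limit.\<close>

lemma lattice_sum_limit:
  fixes k :: "real \<Rightarrow> nat \<Rightarrow> nat"
  assumes \<xi>: "\<And>i. i \<in> {1..s} \<Longrightarrow> 0 < \<xi> i"
    and k: "\<And>i. i \<in> {1..s} \<Longrightarrow> ((\<lambda>t. real (k t i) / t) \<longlongrightarrow> \<xi> i) at_top"
    and k1: "\<And>t i. i \<in> {1..s} \<Longrightarrow> 0 < k t i" and even: "\<And>t. even (\<Sum>i=1..s. k t i)"
    and K: "\<And>t i. i \<in> {1..s} \<Longrightarrow> k t i \<le> K t"
  shows "((\<lambda>t. (\<Sum>l\<in>E \<rightarrow>\<^sub>E {1..2 * K t + 2}. \<Prod>i=1..s.
      if even (k t i + per l i) then walk_weight (k t i) (per l i) else 0) / sqrt t ^ card E)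
    \<longlongrightarrow> 2 * cell_integral \<xi> / 2 ^ s) at_top"
proof -
  let ?P = "E \<rightarrow>\<^sub>E {1, 2::nat}"
  let ?I = "\<lambda>r t. \<integral>x. step_fun r k t x \<partial>(\<Pi>\<^sub>M e\<in>E. lborel)"
  let ?V = "\<lambda>t. {r \<in> ?P. \<forall>i\<in>{1..s}. even (k t i + per r i)}"
  have finP: "finite ?P" using finE by (intro finite_PiE) auto
  have cardV: "real (card (?V t)) = 2 * 2 ^ card E / 2 ^ s" for t
  proof -
    have "real (card (?V t) * 2 ^ s) = real (2 * 2 ^ card E)" using card_parity[OF even[of t]] by simp
    then show ?thesis by (simp add: field_simps)
  qed
  have eq: "(\<Sum>l\<in>E \<rightarrow>\<^sub>E {1..2 * K t + 2}. \<Prod>i=1..s.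
      if even (k t i + per l i) then walk_weight (k t i) (per l i) else 0) / sqrt t ^ card E =
      (\<Sum>r\<in>?V t. ?I r t) / 2 ^ card E" if t: "0 < t" for t
  proof -
    have "(\<Sum>l\<in>E \<rightarrow>\<^sub>E {1..2 * K t + 2}. \<Prod>i=1..s.
        if even (k t i + per l i) then walk_weight (k t i) (per l i) else 0) =
        (\<Sum>r\<in>?P. \<Sum>q\<in>E \<rightarrow>\<^sub>E {..K t}. if r \<in> ?V t then
          (\<Prod>i=1..s. walk_weight (k t i) (per (\<lambda>e. 2 * q e + r e) i)) else 0)"
      unfolding sum_split_parity
    proof (intro sum.cong refl)
      fix r q assume r: "r \<in> ?P"
      have p: "per (\<lambda>e\<in>E. 2 * q e + r e) i = per (\<lambda>e. 2 * q e + r e) i" for i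
        by (rule per_cong) simp
      have ev: "even (k t i + per (\<lambda>e. 2 * q e + r e) i) \<longleftrightarrow> even (k t i + per r i)" for i
      proof -
        have "per (\<lambda>e. 2 * q e + r e) i = 2 * per q i + per r i"
          by (simp add: per_def sum.distrib sum_distrib_left algebra_simps)
        then show ?thesis by simp
      qed
      show "(\<Prod>i=1..s. if even (k t i + per (\<lambda>e\<in>E. 2 * q e + r e) i) then
          walk_weight (k t i) (per (\<lambda>e\<in>E. 2 * q e + r e) i) else 0) =
          (if r \<in> ?V t then (\<Prod>i=1..s. walk_weight (k t i) (per (\<lambda>e. 2 * q e + r e) i)) else 0)"
      proof (cases "r \<in> ?V t")
        case True
        then show ?thesis unfolding p ev by (auto intro!: prod.cong)
      next
        case False
        then obtain i where "i \<in> {1..s}" "odd (k t i + per r i)" using r by blast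
        then have "(\<Prod>i=1..s. if even (k t i + per r i) then
          walk_weight (k t i) (per (\<lambda>e. 2 * q e + r e) i) else 0) = 0"
          by (intro prod_zero) (auto intro!: bexI[of _ i])
        then show ?thesis unfolding p ev using False by (simp only: if_False)
      qed
    qed
    also have "\<dots> = (\<Sum>r\<in>?P. if r \<in> ?V t then
        (\<Sum>q\<in>E \<rightarrow>\<^sub>E {..K t}. \<Prod>i=1..s. walk_weight (k t i) (per (\<lambda>e. 2 * q e + r e) i)) else 0)"
    proof (rule sum.cong[OF refl])
      fix r
      show "(\<Sum>q\<in>E \<rightarrow>\<^sub>E {..K t}. if r \<in> ?V t then
          (\<Prod>i=1..s. walk_weight (k t i) (per (\<lambda>e. 2 * q e + r e) i)) else 0) = (if r \<in> ?V t then
          (\<Sum>q\<in>E \<rightarrow>\<^sub>E {..K t}. \<Prod>i=1..s. walk_weight (k t i) (per (\<lambda>e. 2 * q e + r e) i)) else 0)"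
        by (cases "r \<in> ?V t") (simp_all only: if_True if_False sum.neutral_const)
    qed
    also have "\<dots> = (\<Sum>r\<in>?V t. \<Sum>q\<in>E \<rightarrow>\<^sub>E {..K t}. \<Prod>i=1..s. walk_weight (k t i) (per (\<lambda>e. 2 * q e + r e) i))"
      using finP by (simp add: sum.inter_filter[symmetric])
    also have "\<dots> = (\<Sum>r\<in>?V t. ?I r t * (sqrt t / 2) ^ card E)"
    proof (intro sum.cong refl)
      fix r
      let ?S = "\<Sum>q\<in>E \<rightarrow>\<^sub>E {..K t}. \<Prod>i=1..s. walk_weight (k t i) (per (\<lambda>e. 2 * q e + r e) i)"
      have 1: "(2 / sqrt t) ^ card E * (sqrt t / 2) ^ card E = 1"
        using t by (simp add: power_mult_distrib[symmetric])
      have "?I r t = (2 / sqrt t) ^ card E * ?S" by (rule integral_step_fun[where k = k, OF t K])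
      then have "?I r t * (sqrt t / 2) ^ card E = ((2 / sqrt t) ^ card E * (sqrt t / 2) ^ card E) * ?S"
        by (simp only: mult_ac)
      then show "?S = ?I r t * (sqrt t / 2) ^ card E" unfolding 1 by simp
    qed
    also have "\<dots> = (\<Sum>r\<in>?V t. ?I r t) / 2 ^ card E * sqrt t ^ card E"
      unfolding sum_distrib_right[symmetric] power_divide by simp
    finally show ?thesis using t by simp
  qed
  have I: "((\<lambda>t. ?I r t) \<longlongrightarrow> cell_integral \<xi>) at_top" for r
    by (rule step_fun_integral_limit(1)[OF \<xi> k k1])
  have lim: "((\<lambda>t. (\<Sum>r\<in>?V t. ?I r t) / 2 ^ card E) \<longlongrightarrow> 2 * cell_integral \<xi> / 2 ^ s) at_top"
  proof -
    \<comment> \<open>The set of admissible r varies with t through the parities of k t i; only its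
      size is constant. So the deviations from the common limit are summed over all r, with 0 for
      the inadmissible ones.\<close>
    have "((\<lambda>t. \<Sum>r\<in>?P. (if r \<in> ?V t then ?I r t - cell_integral \<xi> else 0)) \<longlongrightarrow> (\<Sum>r\<in>?P. 0)) at_top"
    proof (rule tendsto_sum)
      fix r
      have "((\<lambda>t. ?I r t - cell_integral \<xi>) \<longlongrightarrow> 0) at_top"
        using tendsto_diff[OF I[of r] tendsto_const[of "cell_integral \<xi>"]] by simp
      then show "((\<lambda>t. if r \<in> ?V t then ?I r t - cell_integral \<xi> else 0) \<longlongrightarrow> 0) at_top"
        by (rule Lim_null_comparison[rotated, OF tendsto_norm_zero]) simp
    qed
    moreover have "(\<Sum>r\<in>?P. (if r \<in> ?V t then ?I r t - cell_integral \<xi> else 0)) =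
        (\<Sum>r\<in>?V t. ?I r t) - 2 * 2 ^ card E / 2 ^ s * cell_integral \<xi>" for t
    proof -
      have "(\<Sum>r\<in>?P. (if r \<in> ?V t then ?I r t - cell_integral \<xi> else 0)) = (\<Sum>r\<in>?V t. ?I r t - cell_integral \<xi>)"
        using finP by (simp add: sum.inter_filter[symmetric])
      also have "\<dots> = (\<Sum>r\<in>?V t. ?I r t) - real (card (?V t)) * cell_integral \<xi>"
        by (simp add: sum_subtractf)
      finally show ?thesis unfolding cardV .
    qed
    ultimately have "((\<lambda>t. (\<Sum>r\<in>?V t. ?I r t) - 2 * 2 ^ card E / 2 ^ s * cell_integral \<xi>) \<longlongrightarrow> 0) at_top"
      by simp
    then have "((\<lambda>t. \<Sum>r\<in>?V t. ?I r t) \<longlongrightarrow> 2 * 2 ^ card E / 2 ^ s * cell_integral \<xi>) at_top"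
      by (rule LIM_zero_cancel)
    from tendsto_divide[OF this tendsto_const[of "2 ^ card E"]] show ?thesis
      by (simp add: mult.commute)
  qed
  show ?thesis
    by (rule Lim_transform_eventually[OF lim], rule eventually_mono[OF eventually_gt_at_top[of 0]])
       (rule eq[symmetric])
qed

end

section \<open>The Laplace transform of the Gaussian weight\<close>

text \<open>The error function times sqrt pi / 2.\<close>

definition half_gauss :: "real \<Rightarrow> real" where
  "half_gauss u = (LBINT v=ereal 0..ereal u. exp (- v\<^sup>2))"

lemma half_gauss_deriv: "(half_gauss has_real_derivative exp (- u\<^sup>2)) (at u)"
proof -
  let ?r = "\<bar>u\<bar> + 1"
  have "((\<lambda>u. LBINT v=ereal 0..ereal u. exp (- v\<^sup>2)) has_vector_derivative exp (- u\<^sup>2)) (at u within {- ?r..?r})"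
    by (rule interval_integral_FTC2) (auto intro!: continuous_intros)
  moreover have "at u within {- ?r..?r} = at u"
    by (rule at_within_interior) auto
  ultimately show ?thesis
    by (simp add: half_gauss_def[abs_def] has_real_derivative_iff_has_vector_derivative)
qed

lemma half_gauss_minus: "half_gauss (- u) = - half_gauss u"
proof -
  have "half_gauss (- u) = (LBINT v=- ereal (- u)..- ereal 0. exp (- (- v)\<^sup>2))"
    unfolding half_gauss_def by (rule interval_integral_reflect)
  also have "\<dots> = (LBINT v=ereal u..ereal 0. exp (- v\<^sup>2))" by simp
  also have "\<dots> = - (LBINT v=ereal 0..ereal u. exp (- v\<^sup>2))" by (rule interval_integral_endpoints_reverse)
  finally show ?thesis by (simp add: half_gauss_def)
qed

lemma half_gauss_at_top: "(half_gauss \<longlongrightarrow> sqrt pi / 2) at_top"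
proof -
  have g: "has_bochner_integral lborel (\<lambda>x::real. indicator {0..} x *\<^sub>R exp (- x\<^sup>2 :: real)) (sqrt pi / 2)"
    using gaussian_moment_even_pos[of 0] by simp
  have "((\<lambda>y. \<integral>x. indicator {..y} x *\<^sub>R (indicator {0..} x *\<^sub>R exp (- x\<^sup>2 :: real)) \<partial>lborel) \<longlongrightarrow>
      (\<integral>x. indicator {0..} x *\<^sub>R exp (- x\<^sup>2 :: real) \<partial>lborel)) at_top"
    by (rule Bochner_Integration.tendsto_integral_at_top[where M = lborel and f = "\<lambda>x. indicator {0..} x *\<^sub>R exp (- x\<^sup>2 :: real)"]) (use g in \<open>auto simp: has_bochner_integral_iff\<close>)
  then have lim: "((\<lambda>y. \<integral>x. indicator {..y} x *\<^sub>R (indicator {0..} x *\<^sub>R exp (- x\<^sup>2 :: real)) \<partial>lborel) \<longlongrightarrow> sqrt pi / 2) at_top"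
    using g by (simp only: has_bochner_integral_iff)
  show ?thesis
  proof (rule Lim_transform_eventually[OF lim], rule eventually_mono[OF eventually_ge_at_top[of 0]])
    fix u :: real assume u: "0 \<le> u"
    have "half_gauss u = (LBINT v:{0..u}. exp (- v\<^sup>2))"
      unfolding half_gauss_def using u by (simp add: interval_integral_Icc)
    also have "\<dots> = (\<integral>x. indicator {..u} x *\<^sub>R (indicator {0..} x *\<^sub>R exp (- x\<^sup>2 :: real)) \<partial>lborel)"
      unfolding set_lebesgue_integral_def
      by (intro Bochner_Integration.integral_cong refl) (auto simp: indicator_def)
    finally show "(\<integral>x. indicator {..u} x *\<^sub>R (indicator {0..} x *\<^sub>R exp (- x\<^sup>2 :: real)) \<partial>lborel) = half_gauss u" ..
  qed
qed

lemma half_gauss_at_bot: "(half_gauss \<longlongrightarrow> - (sqrt pi / 2)) at_bot"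
proof -
  have "((\<lambda>u. - half_gauss u) \<longlongrightarrow> - (sqrt pi / 2)) at_top"
    by (intro tendsto_minus half_gauss_at_top)
  then have "((\<lambda>u. half_gauss (- u)) \<longlongrightarrow> - (sqrt pi / 2)) at_top"
    by (simp add: half_gauss_minus)
  then show ?thesis by (simp add: filterlim_at_bot_mirror)
qed

text \<open>The division by \<xi> belongs to the measure d\<xi> / \<xi>. The cut-off extends the
  function to the whole line, so that plain integrals over product measures can be used.\<close>

definition laplace_kernel :: "real \<Rightarrow> real \<Rightarrow> real" where
  "laplace_kernel y \<xi> = indicator {0<..} \<xi> * (gauss_weight \<xi> y / \<xi>)"

lemma laplace_kernel_nonneg: "0 \<le> y \<Longrightarrow> 0 \<le> laplace_kernel y \<xi>"
  by (auto simp: laplace_kernel_def gauss_weight_def indicator_def)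

text \<open>The antiderivative is the distribution function of the inverse Gaussian law.\<close>

lemma laplace_gauss_real:
  assumes y: "0 < y" and b: "0 < b"
  shows "integrable lborel (\<lambda>\<xi>. exp (- (b * \<xi>)) * laplace_kernel y \<xi>)"
    and "(\<integral>\<xi>. exp (- (b * \<xi>)) * laplace_kernel y \<xi> \<partial>lborel) = 2 * exp (- (y * sqrt 2 * sqrt b))"
proof -
  define w where "w = sqrt 2 * sqrt b"
  have w: "0 < w" "w\<^sup>2 = 2 * b" using b by (auto simp: w_def power_mult_distrib)
  define f where "f \<xi> = exp (- (b * \<xi>)) * (gauss_weight \<xi> y / \<xi>)" for \<xi>
  define F where "F \<xi> = - (2 / sqrt pi) * (exp (- (y * w)) * half_gauss ((y - w * \<xi>) / sqrt (2 * \<xi>)) +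
      exp (y * w) * half_gauss ((y + w * \<xi>) / sqrt (2 * \<xi>)))" for \<xi>
  define A where "A = - (exp (- (y * w)) + exp (y * w))"
  define B where "B = exp (- (y * w)) - exp (y * w)"
  have deriv: "(F has_real_derivative f \<xi>) (at \<xi>)" if \<xi>: "0 < \<xi>" for \<xi>
  proof -
    define q where "q = sqrt (2 * \<xi>)"
    have q: "0 < q" "q\<^sup>2 = 2 * \<xi>" using \<xi> by (auto simp: q_def)
    have dq: "((\<lambda>\<xi>. sqrt (2 * \<xi>)) has_real_derivative (1 / q)) (at \<xi>)"
      using \<xi> by (auto intro!: derivative_eq_intros simp: q_def field_simps)
    have q0: "sqrt (2 * \<xi>) \<noteq> 0" using \<xi> by simp
    have n1: "((\<lambda>\<xi>. y - w * \<xi>) has_real_derivative - w) (at \<xi>)"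
      and n2: "((\<lambda>\<xi>. y + w * \<xi>) has_real_derivative w) (at \<xi>)"
      by (auto intro!: derivative_eq_intros)
    note d1 = DERIV_divide[OF n1 dq q0, folded q_def] and d2 = DERIV_divide[OF n2 dq q0, folded q_def]
    note h1 = DERIV_chain2[OF half_gauss_deriv d1] and h2 = DERIV_chain2[OF half_gauss_deriv d2]
    have "(F has_real_derivative - (2 / sqrt pi) * (
        exp (- (y * w)) * (exp (- ((y - w * \<xi>) / sqrt (2 * \<xi>))\<^sup>2) * ((- w * q - (y - w * \<xi>) * (1 / q)) / (q * q))) +
        exp (y * w) * (exp (- ((y + w * \<xi>) / sqrt (2 * \<xi>))\<^sup>2) * ((w * q - (y + w * \<xi>) * (1 / q)) / (q * q))))) (at \<xi>)"
      unfolding F_def by (intro DERIV_cmult DERIV_add h1 h2)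
    \<comment> \<open>Completing the square: (y - w \<xi>)^2 / (2 \<xi>) = y^2 / (2 \<xi>) - y w + b
      \<xi>, because w^2 = 2 b. The factor exp (- y w) cancels the mixed term, and likewise for the
      other sign, so both summands share one exponential.\<close>
    moreover have "exp (- (y * w)) * exp (- ((y - w * \<xi>) / sqrt (2 * \<xi>))\<^sup>2) = exp (- (b * \<xi>)) * exp (- (y\<^sup>2 / (2 * \<xi>)))"
    proof -
      have "- (y * w) + - ((y - w * \<xi>) / sqrt (2 * \<xi>))\<^sup>2 = - (b * \<xi>) + - (y\<^sup>2 / (2 * \<xi>))"
        using \<xi> w(2) by (simp add: power_divide field_simps power2_eq_square)
      then show ?thesis by (simp only: exp_add[symmetric])
    qed
    moreover have "exp (y * w) * exp (- ((y + w * \<xi>) / sqrt (2 * \<xi>))\<^sup>2) = exp (- (b * \<xi>)) * exp (- (y\<^sup>2 / (2 * \<xi>)))"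
    proof -
      have "y * w + - ((y + w * \<xi>) / sqrt (2 * \<xi>))\<^sup>2 = - (b * \<xi>) + - (y\<^sup>2 / (2 * \<xi>))"
        using \<xi> w(2) by (simp add: power_divide field_simps power2_eq_square)
      then show ?thesis by (simp only: exp_add[symmetric])
    qed
    ultimately have "(F has_real_derivative - (2 / sqrt pi) * (exp (- (b * \<xi>)) * exp (- (y\<^sup>2 / (2 * \<xi>))) *
        ((- w * q - (y - w * \<xi>) * (1 / q)) / (q * q) + (w * q - (y + w * \<xi>) * (1 / q)) / (q * q)))) (at \<xi>)"
      by (simp only: mult.assoc[symmetric] distrib_left)
    moreover have "- (2 / sqrt pi) * (exp (- (b * \<xi>)) * exp (- (y\<^sup>2 / (2 * \<xi>))) *
        ((- w * q - (y - w * \<xi>) * (1 / q)) / (q * q) + (w * q - (y + w * \<xi>) * (1 / q)) / (q * q))) = f \<xi>"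
    proof -
      have "(- w * q - (y - w * \<xi>) * (1 / q)) / (q * q) + (w * q - (y + w * \<xi>) * (1 / q)) / (q * q) = - (2 * y / (q * (q * q)))"
        using q(1) by (simp add: field_simps)
      also have "\<dots> = - (y / (q * \<xi>))" using q by (simp add: power2_eq_square[symmetric])
      also have "\<dots> = - (y / (sqrt 2 * sqrt \<xi> * \<xi>))" by (simp add: q_def real_sqrt_mult)
      finally have e: "(- w * q - (y - w * \<xi>) * (1 / q)) / (q * q) + (w * q - (y + w * \<xi>) * (1 / q)) / (q * q) =
        - (y / (sqrt 2 * sqrt \<xi> * \<xi>))" .
      have "2 / sqrt 2 = sqrt 2" by (simp add: real_div_sqrt)
      then have s: "2 / (sqrt pi * (sqrt 2 * sqrt \<xi>)) = sqrt (2 / (pi * \<xi>))"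
      proof -
        have "2 / (A * (sqrt 2 * C)) = (2 / sqrt 2) / (A * C)" for A C :: real by simp
        then show ?thesis using \<open>2 / sqrt 2 = sqrt 2\<close> by (simp add: real_sqrt_divide real_sqrt_mult)
      qed
      have "- (2 / sqrt pi) * (exp (- (b * \<xi>)) * exp (- (y\<^sup>2 / (2 * \<xi>))) * - (y / (sqrt 2 * sqrt \<xi> * \<xi>))) =
          exp (- (b * \<xi>)) * (2 / (sqrt pi * (sqrt 2 * sqrt \<xi>)) * y * exp (- (y\<^sup>2 / (2 * \<xi>))) / \<xi>)"
        by (simp add: mult_ac)
      then show ?thesis unfolding e s f_def gauss_weight_def .
    qed
    ultimately show ?thesis by simp
  qed
  have sp: "sqrt pi \<noteq> 0" by simp
  have inf0: "filterlim (\<lambda>\<xi>. 1 / sqrt (2 * \<xi>)) at_top (at_right (0::real))" by real_asymp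
  have infI: "filterlim (\<lambda>\<xi>::real. \<xi> / sqrt (2 * \<xi>)) at_top at_top" by real_asymp
  have zI: "((\<lambda>\<xi>. y * (1 / \<xi>)) \<longlongrightarrow> 0) at_top"
  proof -
    have "((\<lambda>\<xi>::real. 1 / \<xi>) \<longlongrightarrow> 0) at_top" by real_asymp
    from tendsto_mult[OF tendsto_const[of y] this] show ?thesis by simp
  qed
  have arg0: "filterlim (\<lambda>\<xi>. (y + v * \<xi>) / sqrt (2 * \<xi>)) at_top (at_right 0)" for v
  proof -
    have "((\<lambda>\<xi>. y + v * \<xi>) \<longlongrightarrow> y + v * 0) (at_right 0)" by (intro tendsto_intros)
    then have "((\<lambda>\<xi>. y + v * \<xi>) \<longlongrightarrow> y) (at_right 0)" by simp
    from filterlim_tendsto_pos_mult_at_top[OF this y inf0] show ?thesis by simp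
  qed
  have argI: "\<forall>\<^sub>F \<xi> in at_top. (y * (1 / \<xi>) + v) * (\<xi> / sqrt (2 * \<xi>)) = (y + v * \<xi>) / sqrt (2 * \<xi>)" for v
    using eventually_gt_at_top[of 0] by eventually_elim (simp add: distrib_right)
  have limv: "((\<lambda>\<xi>. y * (1 / \<xi>) + v) \<longlongrightarrow> v) at_top" for v
    using tendsto_add[OF zI tendsto_const[of v]] by simp
  have lim0: "(F \<longlongrightarrow> A) (at_right 0)"
  proof -
    have "filterlim (\<lambda>\<xi>. (y - w * \<xi>) / sqrt (2 * \<xi>)) at_top (at_right 0)" using arg0[of "- w"] by simp
    from filterlim_compose[OF half_gauss_at_top this]
    have 1: "((\<lambda>\<xi>. half_gauss ((y - w * \<xi>) / sqrt (2 * \<xi>))) \<longlongrightarrow> sqrt pi / 2) (at_right 0)" .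
    have "filterlim (\<lambda>\<xi>. (y + w * \<xi>) / sqrt (2 * \<xi>)) at_top (at_right 0)" by (rule arg0)
    from filterlim_compose[OF half_gauss_at_top this]
    have 2: "((\<lambda>\<xi>. half_gauss ((y + w * \<xi>) / sqrt (2 * \<xi>))) \<longlongrightarrow> sqrt pi / 2) (at_right 0)" .
    have "(F \<longlongrightarrow> - (2 / sqrt pi) * (exp (- (y * w)) * (sqrt pi / 2) + exp (y * w) * (sqrt pi / 2))) (at_right 0)"
      unfolding F_def by (intro tendsto_intros 1 2)
    moreover have "- (2 / sqrt pi) * (exp (- (y * w)) * (sqrt pi / 2) + exp (y * w) * (sqrt pi / 2)) = A"
      by (simp add: A_def field_simps)
    ultimately show ?thesis by simp
  qed
  have limI: "(F \<longlongrightarrow> B) at_top"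
  proof -
    have "filterlim (\<lambda>\<xi>. (y - w * \<xi>) / sqrt (2 * \<xi>)) at_bot at_top"
    proof -
      have "filterlim (\<lambda>\<xi>. (y * (1 / \<xi>) + - w) * (\<xi> / sqrt (2 * \<xi>))) at_bot at_top"
        by (rule filterlim_tendsto_neg_mult_at_bot[OF limv _ infI]) (use w in simp)
      then have "filterlim (\<lambda>\<xi>. (y + - w * \<xi>) / sqrt (2 * \<xi>)) at_bot at_top"
        by (rule filterlim_cong[OF refl refl argI, THEN iffD1])
      then show ?thesis by simp
    qed
    from filterlim_compose[OF half_gauss_at_bot this]
    have 1: "((\<lambda>\<xi>. half_gauss ((y - w * \<xi>) / sqrt (2 * \<xi>))) \<longlongrightarrow> - (sqrt pi / 2)) at_top" .
    have "filterlim (\<lambda>\<xi>. (y + w * \<xi>) / sqrt (2 * \<xi>)) at_top at_top"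
      by (rule filterlim_cong[OF refl refl argI, THEN iffD1, OF filterlim_tendsto_pos_mult_at_top[OF limv w(1) infI]])
    from filterlim_compose[OF half_gauss_at_top this]
    have 2: "((\<lambda>\<xi>. half_gauss ((y + w * \<xi>) / sqrt (2 * \<xi>))) \<longlongrightarrow> sqrt pi / 2) at_top" .
    have "(F \<longlongrightarrow> - (2 / sqrt pi) * (exp (- (y * w)) * (- (sqrt pi / 2)) + exp (y * w) * (sqrt pi / 2))) at_top"
      unfolding F_def by (intro tendsto_intros 1 2)
    moreover have "- (2 / sqrt pi) * (exp (- (y * w)) * (- (sqrt pi / 2)) + exp (y * w) * (sqrt pi / 2)) = B"
      by (simp add: B_def field_simps)
    ultimately show ?thesis by simp
  qed
  have cont: "isCont f \<xi>" if "0 < \<xi>" for \<xi>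
    using that unfolding f_def gauss_weight_def by (auto intro!: continuous_intros)
  have nonneg: "0 \<le> f \<xi>" if "0 < \<xi>" for \<xi>
    using that y by (auto simp: f_def gauss_weight_def)
  \<comment> \<open>Nonnegativity of f yields integrability together with the value. In B - A the
    terms exp (y w) cancel and 2 exp (- y w) remains.\<close>
  have FTC: "set_integrable lborel (einterval (ereal 0) \<infinity>) f" "(LBINT \<xi>=ereal 0..\<infinity>. f \<xi>) = B - A"
    using interval_integral_FTC_nonneg[of "ereal 0" \<infinity> F f A B] deriv cont nonneg lim0 limI
    by (auto simp: ereal_tendsto_simps)
  have eq: "(\<lambda>\<xi>. indicator {0<..} \<xi> *\<^sub>R f \<xi>) = (\<lambda>\<xi>. exp (- (b * \<xi>)) * laplace_kernel y \<xi>)"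
    by (auto simp: fun_eq_iff f_def laplace_kernel_def indicator_def)
  show "integrable lborel (\<lambda>\<xi>. exp (- (b * \<xi>)) * laplace_kernel y \<xi>)"
    using FTC(1) unfolding set_integrable_def eq[symmetric] by simp
  have "(\<integral>\<xi>. exp (- (b * \<xi>)) * laplace_kernel y \<xi> \<partial>lborel) = B - A"
    using FTC(2) unfolding interval_integral_to_infinity_eq set_lebesgue_integral_def eq .
  then show "(\<integral>\<xi>. exp (- (b * \<xi>)) * laplace_kernel y \<xi> \<partial>lborel) = 2 * exp (- (y * sqrt 2 * sqrt b))"
    by (simp add: A_def B_def w_def mult.assoc)
qed

lemma measurable_laplace_kernel [measurable]: "laplace_kernel y \<in> borel_measurable borel"
  unfolding laplace_kernel_def[abs_def] gauss_weight_def by measurable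

text \<open>Both sides are analytic in \<open>z\<close>; the left side is expanded into a power series around a large real
  point \<open>b\<close>, whose disc of convergence contains \<open>z\<close>.\<close>

lemma laplace_gauss:
  assumes y: "0 < y" and z: "0 < Re z"
  shows "integrable lborel (\<lambda>\<xi>. exp (- (z * of_real \<xi>)) * of_real (laplace_kernel y \<xi>))" (is ?int)
    and "(\<integral>\<xi>. exp (- (z * of_real \<xi>)) * of_real (laplace_kernel y \<xi>) \<partial>lborel) =
      2 * exp (- (of_real (y * sqrt 2) * csqrt z))" (is ?val)
proof -
  let ?f = "laplace_kernel y"
  have int: "integrable lborel (\<lambda>\<xi>. exp (- (z * of_real \<xi>)) * of_real (?f \<xi>))" if "0 < Re z" for z
  proof (rule Bochner_Integration.integrable_bound[OF laplace_gauss_real(1)[OF y that]])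
    show "AE \<xi> in lborel. norm (exp (- (z * of_real \<xi>)) * of_real (?f \<xi>)) \<le> norm (exp (- (Re z * \<xi>)) * ?f \<xi>)"
      by (auto simp: norm_mult)
  qed measurable
  show ?int by (rule int[OF z])
  \<comment> \<open>With this b, |b - z|^2 = b^2 - b Re z < b^2, so z lies in the disc around b that
    touches the imaginary axis.\<close>
  define b where "b = (cmod z)\<^sup>2 / Re z"
  have "z \<noteq> 0" using z by auto
  then have b: "0 < b" unfolding b_def using z by (intro divide_pos_pos) auto
  define H where "H \<zeta> = (\<integral>\<xi>. exp (- ((of_real b - \<zeta>) * of_real \<xi>)) * of_real (?f \<xi>) \<partial>lborel)" for \<zeta> :: complex
  define M :: "nat \<Rightarrow> complex" where "M n = (\<integral>\<xi>. of_real (exp (- (b * \<xi>)) * ?f \<xi> * \<xi> ^ n / fact n) \<partial>lborel)" for n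
  \<comment> \<open>The factor exp (\<zeta> \<xi>) is expanded under the integral, where \<zeta>
    stands for b - z. Its partial sums are dominated by exp (|\<zeta>| \<xi>), which exp (- b \<xi>)
    absorbs since |\<zeta>| < b.\<close>
  have ser: "(\<lambda>n. M n * (\<zeta> - 0) ^ n) sums H \<zeta>" if \<zeta>: "\<zeta> \<in> ball 0 b" for \<zeta> :: complex
  proof -
    define r where "r = cmod \<zeta>"
    have r: "0 \<le> r" "r < b" using \<zeta> by (auto simp: r_def)
    define S where "S N \<xi> = of_real (exp (- (b * \<xi>)) * ?f \<xi>) * (\<Sum>n<N. (\<zeta> * of_real \<xi>) ^ n / fact n)" for N \<xi>
    have "(\<lambda>N. \<integral>\<xi>. S N \<xi> \<partial>lborel) \<longlonglongrightarrow> H \<zeta>"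
      unfolding H_def
    proof (rule integral_dominated_convergence)
      show "integrable lborel (\<lambda>\<xi>. exp (- ((b - r) * \<xi>)) * ?f \<xi>)"
        by (rule laplace_gauss_real(1)[OF y]) (use r in simp)
      show "S N \<in> borel_measurable lborel" for N unfolding S_def[abs_def] by measurable
      show "AE \<xi> in lborel. norm (S N \<xi>) \<le> exp (- ((b - r) * \<xi>)) * ?f \<xi>" for N
      proof (rule AE_I2)
        fix \<xi> :: real
        show "norm (S N \<xi>) \<le> exp (- ((b - r) * \<xi>)) * ?f \<xi>"
        proof (cases "0 < \<xi>")
          case False
          then show ?thesis by (simp add: S_def laplace_kernel_def)
        next
          case True
          have "norm (\<Sum>n<N. (\<zeta> * of_real \<xi>) ^ n / fact n) \<le> (\<Sum>n<N. (r * \<xi>) ^ n / fact n)"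
            by (rule order_trans[OF norm_sum])
               (use True in \<open>simp add: norm_divide norm_power norm_mult r_def\<close>)
          also have "\<dots> \<le> exp (r * \<xi>)"
          proof -
            have "summable (\<lambda>n. (r * \<xi>) ^ n / fact n)" using summable_exp[of "r * \<xi>"] by (simp add: field_simps)
            then have "(\<Sum>n<N. (r * \<xi>) ^ n / fact n) \<le> (\<Sum>n. (r * \<xi>) ^ n / fact n)"
              by (rule sum_le_suminf) (use r True in auto)
            then show ?thesis by (simp add: exp_def field_simps)
          qed
          finally have "norm (S N \<xi>) \<le> exp (- (b * \<xi>)) * ?f \<xi> * exp (r * \<xi>)"
            unfolding S_def norm_mult using laplace_kernel_nonneg[of y \<xi>] y
            by (intro mult_mono) (auto simp: norm_mult)
          also have "\<dots> = exp (- ((b - r) * \<xi>)) * ?f \<xi>"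
            by (simp add: exp_add[symmetric] algebra_simps flip: mult.assoc)
          finally show ?thesis .
        qed
      qed
      show "AE \<xi> in lborel. (\<lambda>N. S N \<xi>) \<longlonglongrightarrow> exp (- ((of_real b - \<zeta>) * of_real \<xi>)) * of_real (?f \<xi>)"
      proof (rule AE_I2)
        fix \<xi> :: real
        have "(\<lambda>n. (\<zeta> * of_real \<xi>) ^ n /\<^sub>R fact n) sums exp (\<zeta> * of_real \<xi>)" by (rule exp_converges)
        then have "(\<lambda>N. \<Sum>n<N. (\<zeta> * of_real \<xi>) ^ n / fact n) \<longlonglongrightarrow> exp (\<zeta> * of_real \<xi>)"
          by (simp add: sums_def scaleR_conv_of_real divide_inverse mult.commute)
        then have "(\<lambda>N. S N \<xi>) \<longlonglongrightarrow> of_real (exp (- (b * \<xi>)) * ?f \<xi>) * exp (\<zeta> * of_real \<xi>)"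
          unfolding S_def by (intro tendsto_mult tendsto_const)
        moreover have "of_real (exp (- (b * \<xi>)) * ?f \<xi>) * exp (\<zeta> * of_real \<xi>) =
            exp (- ((of_real b - \<zeta>) * of_real \<xi>)) * of_real (?f \<xi>)"
        proof -
          have "exp (- ((of_real b - \<zeta>) * of_real \<xi>)) = exp (of_real (- (b * \<xi>))) * exp (\<zeta> * of_real \<xi>)"
            unfolding exp_add[symmetric] by (simp add: algebra_simps)
          moreover have "complex_of_real (exp (- (b * \<xi>))) = exp (of_real (- (b * \<xi>)))" by (rule exp_of_real[symmetric])
          ultimately show ?thesis by (simp only: of_real_mult mult_ac)
        qed
        ultimately show "(\<lambda>N. S N \<xi>) \<longlonglongrightarrow> exp (- ((of_real b - \<zeta>) * of_real \<xi>)) * of_real (?f \<xi>)"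
          by (simp only:)
      qed
    qed measurable
    moreover have "(\<integral>\<xi>. S N \<xi> \<partial>lborel) = (\<Sum>n<N. M n * (\<zeta> - 0) ^ n)" for N
    proof -
      \<comment> \<open>The moments are finite because \<xi>^n / n! \<le> (2 / b)^n exp (b \<xi> /
        2), at the cost of half of the exponential decay.\<close>
      have intM: "integrable lborel (\<lambda>\<xi>. complex_of_real (exp (- (b * \<xi>)) * ?f \<xi> * \<xi> ^ n / fact n))" for n
      proof (rule Bochner_Integration.integrable_bound)
        have b2: "0 < b / 2" using b by simp
        show "integrable lborel (\<lambda>\<xi>. (2 / b) ^ n * (exp (- (b / 2 * \<xi>)) * ?f \<xi>))"
          by (intro integrable_mult_right laplace_gauss_real(1)[OF y b2])
        show "AE \<xi> in lborel. norm (complex_of_real (exp (- (b * \<xi>)) * ?f \<xi> * \<xi> ^ n / fact n)) \<le>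
            norm ((2 / b) ^ n * (exp (- (b / 2 * \<xi>)) * ?f \<xi>))"
        proof (rule AE_I2)
          fix \<xi> :: real
          show "norm (complex_of_real (exp (- (b * \<xi>)) * ?f \<xi> * \<xi> ^ n / fact n)) \<le>
            norm ((2 / b) ^ n * (exp (- (b / 2 * \<xi>)) * ?f \<xi>))"
          proof (cases "0 < \<xi>")
            case False
            then show ?thesis by (simp add: laplace_kernel_def)
          next
            case True
            have nn: "0 \<le> ?f \<xi>" using laplace_kernel_nonneg y by simp
            have "(b / 2 * \<xi>) ^ n / fact n \<le> exp (b / 2 * \<xi>)"
            proof -
              have "summable (\<lambda>n. (b / 2 * \<xi>) ^ n / fact n)" using summable_exp[of "b / 2 * \<xi>"] by (simp add: field_simps)
              then have "(\<Sum>k\<in>{n}. (b / 2 * \<xi>) ^ k / fact k) \<le> (\<Sum>n. (b / 2 * \<xi>) ^ n / fact n)"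
                by (rule sum_le_suminf) (use b True in auto)
              then show ?thesis by (simp add: exp_def field_simps)
            qed
            then have "(2 / b) ^ n * ((b / 2 * \<xi>) ^ n / fact n) \<le> (2 / b) ^ n * exp (b / 2 * \<xi>)"
              using b by (intro mult_left_mono) auto
            moreover have "(2 / b) ^ n * ((b / 2 * \<xi>) ^ n / fact n) = \<xi> ^ n / fact n"
            proof -
              have "(2 / b * (b / 2 * \<xi>)) ^ n = \<xi> ^ n" using b by simp
              then show ?thesis by (simp only: power_mult_distrib times_divide_eq_right)
            qed
            ultimately have p: "\<xi> ^ n / fact n \<le> (2 / b) ^ n * exp (b / 2 * \<xi>)" by simp
            have "exp (- (b * \<xi>)) * ?f \<xi> * (\<xi> ^ n / fact n) \<le> exp (- (b * \<xi>)) * ?f \<xi> * ((2 / b) ^ n * exp (b / 2 * \<xi>))"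
              using p nn by (intro mult_left_mono) auto
            also have "\<dots> = (2 / b) ^ n * ((exp (- (b * \<xi>)) * exp (b / 2 * \<xi>)) * ?f \<xi>)" by (simp add: mult_ac)
            also have "exp (- (b * \<xi>)) * exp (b / 2 * \<xi>) = exp (- (b / 2 * \<xi>))"
              unfolding exp_add[symmetric] by simp
            finally have le: "exp (- (b * \<xi>)) * ?f \<xi> * (\<xi> ^ n / fact n) \<le> (2 / b) ^ n * (exp (- (b / 2 * \<xi>)) * ?f \<xi>)" .
            have "norm (complex_of_real (exp (- (b * \<xi>)) * ?f \<xi> * \<xi> ^ n / fact n)) = exp (- (b * \<xi>)) * ?f \<xi> * (\<xi> ^ n / fact n)"
              unfolding norm_of_real using nn True by simp
            also note le
            also have "(2 / b) ^ n * (exp (- (b / 2 * \<xi>)) * ?f \<xi>) \<le> norm ((2 / b) ^ n * (exp (- (b / 2 * \<xi>)) * ?f \<xi>))"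
              by simp
            finally show ?thesis .
          qed
        qed
      qed measurable
      have "(\<integral>\<xi>. S N \<xi> \<partial>lborel) = (\<integral>\<xi>. (\<Sum>n<N. of_real (exp (- (b * \<xi>)) * ?f \<xi> * \<xi> ^ n / fact n) * \<zeta> ^ n) \<partial>lborel)"
        by (intro Bochner_Integration.integral_cong refl)
           (simp add: S_def sum_distrib_left power_mult_distrib mult_ac)
      also have "\<dots> = (\<Sum>n<N. \<integral>\<xi>. of_real (exp (- (b * \<xi>)) * ?f \<xi> * \<xi> ^ n / fact n) * \<zeta> ^ n \<partial>lborel)"
        by (rule Bochner_Integration.integral_sum) (intro integrable_mult_left intM)
      also have "\<dots> = (\<Sum>n<N. M n * (\<zeta> - 0) ^ n)"
        by (simp add: M_def integral_mult_left_zero del: of_real_mult of_real_divide of_real_power)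
      finally show ?thesis .
    qed
    ultimately show ?thesis by (simp add: sums_def)
  qed
  have holH: "H holomorphic_on ball 0 b" by (rule power_series_holomorphic[OF ser])
  define G where "G \<zeta> = 2 * exp (- (of_real (y * sqrt 2) * csqrt (of_real b - \<zeta>)))" for \<zeta> :: complex
  have nonneg: "of_real b - \<zeta> \<notin> \<real>\<^sub>\<le>\<^sub>0" if "\<zeta> \<in> ball 0 b" for \<zeta> :: complex
  proof
    assume "of_real b - \<zeta> \<in> \<real>\<^sub>\<le>\<^sub>0"
    then have "Re (of_real b - \<zeta>) \<le> 0" by (auto simp: complex_nonpos_Reals_iff)
    moreover have "Re \<zeta> \<le> cmod \<zeta>" by (rule complex_Re_le_cmod)
    ultimately show False using that by simp
  qed
  have holG: "G holomorphic_on ball 0 b"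
    unfolding G_def by (intro holomorphic_intros) (use nonneg in auto)
  \<comment> \<open>For real arguments the real transform applies, so H and G agree on a segment
    that accumulates at 0; the identity theorem extends this to the disc.\<close>
  have real: "H (of_real t) = G (of_real t)" if "t < b" for t :: real
  proof -
    have "H (of_real t) = (\<integral>\<xi>. complex_of_real (exp (- ((b - t) * \<xi>)) * ?f \<xi>) \<partial>lborel)"
      unfolding H_def
    proof (intro Bochner_Integration.integral_cong refl)
      fix \<xi> :: real
      have "exp (- ((of_real b - of_real t) * of_real \<xi>)) = complex_of_real (exp (- ((b - t) * \<xi>)))"
        by (simp add: exp_of_real[symmetric])
      then show "exp (- ((of_real b - of_real t) * of_real \<xi>)) * of_real (?f \<xi>) = complex_of_real (exp (- ((b - t) * \<xi>)) * ?f \<xi>)"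
        by simp
    qed
    also have "\<dots> = complex_of_real (2 * exp (- (y * sqrt 2 * sqrt (b - t))))"
      unfolding integral_complex_of_real by (subst laplace_gauss_real(2)[OF y]) (use that in auto)
    also have "\<dots> = G (of_real t)"
    proof -
      have "csqrt (of_real b - of_real t) = complex_of_real (sqrt (b - t))"
        using csqrt_of_real_nonneg[of "complex_of_real (b - t)"] that by simp
      then show ?thesis by (simp add: G_def exp_of_real[symmetric])
    qed
    finally show ?thesis .
  qed
  define \<zeta>0 where "\<zeta>0 = of_real b - z"
  have z0: "\<zeta>0 \<in> ball 0 b"
  proof -
    have "(cmod \<zeta>0)\<^sup>2 = b\<^sup>2 - 2 * b * Re z + (cmod z)\<^sup>2"
      unfolding cmod_power2 \<zeta>0_def by (simp add: power2_eq_square algebra_simps)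
    also have "(cmod z)\<^sup>2 = b * Re z" using z by (simp add: b_def)
    also have "b\<^sup>2 - 2 * b * Re z + b * Re z < b\<^sup>2" using b z by simp
    finally have "cmod \<zeta>0 < b" using b by (simp add: power2_less_imp_less)
    then show ?thesis by simp
  qed
  have "H \<zeta>0 - G \<zeta>0 = 0"
  proof (rule analytic_continuation[where f = "\<lambda>\<zeta>. H \<zeta> - G \<zeta>" and S = "ball 0 b" and U = "complex_of_real ` {0<..<b}" and \<xi> = 0])
    show "(\<lambda>\<zeta>. H \<zeta> - G \<zeta>) holomorphic_on ball 0 b" by (intro holomorphic_on_diff holH holG)
    show "complex_of_real ` {0<..<b} \<subseteq> ball 0 b" by auto
    show "0 islimpt complex_of_real ` {0<..<b}"
      unfolding islimpt_approachable
    proof (intro allI impI)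
      fix e :: real assume e: "0 < e"
      let ?x = "min (b / 2) (e / 2)"
      show "\<exists>x'\<in>complex_of_real ` {0<..<b}. x' \<noteq> 0 \<and> dist x' 0 < e"
        using e b by (intro bexI[of _ "of_real ?x"]) auto
    qed
    show "H \<zeta> - G \<zeta> = 0" if "\<zeta> \<in> complex_of_real ` {0<..<b}" for \<zeta>
      using that real by auto
  qed (use z0 b in auto)
  then show ?val by (simp add: H_def G_def \<zeta>0_def)
qed

lemma exp_halfline_complex:
  fixes c :: complex
  assumes c: "0 < Re c"
  shows "integrable lborel (\<lambda>x. of_real (indicator {0..} x) * exp (- (c * of_real x)))"
    and "(\<integral>x. of_real (indicator {0..} x) * exp (- (c * of_real x)) \<partial>lborel) = 1 / c"
proof -
  show int: "integrable lborel (\<lambda>x. of_real (indicator {0..} x) * exp (- (c * of_real x)))"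
  proof (rule Bochner_Integration.integrable_bound[OF exp_halfline(1)[OF c]])
    show "AE x in lborel. norm (of_real (indicator {0..} x) * exp (- (c * of_real x))) \<le>
        norm (indicator {0..} x * exp (- (Re c * x)))"
      by (auto simp: norm_mult)
  qed measurable
  have int': "set_integrable lborel (einterval (ereal 0) \<infinity>) (\<lambda>x. exp (- (c * of_real x)))"
  proof -
    have "set_integrable lborel {0..} (\<lambda>x::real. exp (- (c * of_real x)))"
      unfolding set_integrable_def using int by (simp add: scaleR_conv_of_real)
    then have "set_integrable lborel {0<..} (\<lambda>x::real. exp (- (c * of_real x)))"
      by (rule set_integrable_subset) auto
    then show ?thesis by simp
  qed
  have c0: "c \<noteq> 0" using c by auto
  have "(LBINT x=ereal 0..\<infinity>. exp (- (c * of_real x))) = 0 - (- 1 / c)"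
  proof (rule interval_integral_FTC_integrable[where F = "\<lambda>x. - exp (- (c * of_real x)) / c"])
    show "((\<lambda>x. - exp (- (c * of_real x)) / c) has_vector_derivative exp (- (c * of_real x))) (at x)" for x
      using c0 by (auto intro!: derivative_eq_intros has_vector_derivative_real_field simp: field_simps)
    show "isCont (\<lambda>x. exp (- (c * of_real x))) x" for x :: real by (intro continuous_intros)
    show "set_integrable lborel (einterval (ereal 0) \<infinity>) (\<lambda>x. exp (- (c * of_real x)))" by (rule int')
    have "isCont (\<lambda>x::real. - exp (- (c * of_real x)) / c) 0" using c0 by (intro continuous_intros) auto
    then have "((\<lambda>x::real. - exp (- (c * of_real x)) / c) \<longlongrightarrow> - exp (- (c * of_real 0)) / c) (at 0)"
      by (simp add: isCont_def)
    then show "(((\<lambda>x. - exp (- (c * of_real x)) / c) \<circ> real_of_ereal) \<longlongrightarrow> - 1 / c) (at_right (ereal 0))"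
      unfolding ereal_tendsto_simps by (auto intro: filterlim_at_split[THEN iffD1, THEN conjunct2])
    have "((\<lambda>x. exp (- (Re c * x)) / cmod c) \<longlongrightarrow> 0) at_top"
    proof -
      have "((\<lambda>x. exp (- (Re c * x))) \<longlongrightarrow> 0) at_top" using c by real_asymp
      then show ?thesis using tendsto_divide[OF _ tendsto_const[of "cmod c"]] c0 by fastforce
    qed
    then have "((\<lambda>x::real. - exp (- (c * of_real x)) / c) \<longlongrightarrow> 0) at_top"
      by (rule Lim_null_comparison[rotated]) (simp add: norm_divide)
    then show "(((\<lambda>x. - exp (- (c * of_real x)) / c) \<circ> real_of_ereal) \<longlongrightarrow> 0) (at_left \<infinity>)"
      unfolding ereal_tendsto_simps .
  qed simp
  then have "(LBINT x:{0<..}. exp (- (c * of_real x))) = 1 / c"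
    unfolding interval_integral_to_infinity_eq by simp
  moreover have "(LBINT x:{0<..}. exp (- (c * of_real x))) = (\<integral>x. of_real (indicator {0..} x) * exp (- (c * of_real x)) \<partial>lborel)"
    unfolding set_lebesgue_integral_def
  proof (rule integral_cong_AE)
    show "AE x in lborel. indicator {0<..} x *\<^sub>R exp (- (c * of_real x)) = of_real (indicator {0..} x) * exp (- (c * of_real x))"
      using AE_lborel_singleton[of 0] by eventually_elim (auto simp: indicator_def scaleR_conv_of_real)
  qed measurable
  ultimately show "(\<integral>x. of_real (indicator {0..} x) * exp (- (c * of_real x)) \<partial>lborel) = 1 / c" by simp
qed

section \<open>The number of maps as a sum over graphs and edge lengths\<close>

definition edges_of :: "nat \<Rightarrow> (nat \<Rightarrow> nat) \<Rightarrow> nat set set" where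
  "edges_of n f = (\<lambda>h. {h, f h}) ` {..<n}"

text \<open>On an edge this is 0, 1 or 2; the value 2 means that the same cell lies on both
  sides.\<close>

definition cell_sides :: "(nat \<Rightarrow> nat) \<Rightarrow> nat \<Rightarrow> nat set \<Rightarrow> nat" where
  "cell_sides c i e = card {h \<in> e. c h = i}"

context labelled_graph
begin

lemma edge_eq: "h \<in> {h', f h'} \<Longrightarrow> {h, f h} = {h', f h'}"
  by auto

lemma finite_edges_of: "finite (edges_of n f)"
  by (simp add: edges_of_def)

lemma edges_of_cases:
  assumes "e \<in> edges_of n f"
  obtains h where "h < n" "f h < n" "f h \<noteq> h" "e = {h, f h}"
  using assms pairings_neq[OF f] f_less by (auto simp: edges_of_def)

lemma sum_edge_cells:
  fixes u :: "nat \<Rightarrow> 'a :: comm_semiring_1"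
  assumes "e \<in> edges_of n f"
  shows "(\<Sum>i=1..s. of_nat (cell_sides c i e) * u i) = (\<Sum>h\<in>e. u (c h))"
proof -
  obtain h where h: "h < n" "f h < n" "e = {h, f h}" using assms by (rule edges_of_cases)
  have cin: "c x \<in> {1..s}" if "x \<in> e" for x
  proof -
    have "x < n" using that h by auto
    then show ?thesis using c_onto by blast
  qed
  have "(\<Sum>h\<in>e. u (c h)) = (\<Sum>i\<in>{1..s}. \<Sum>h\<in>{h \<in> e. c h = i}. u (c h))"
    by (rule sum.group[symmetric]) (use h cin in auto)
  also have "\<dots> = (\<Sum>i=1..s. of_nat (cell_sides c i e) * u i)"
    by (rule sum.cong[OF refl]) (simp add: cell_sides_def)
  finally show ?thesis by simp
qed

text \<open>A set of cells in which every edge has an even number of sides contains, with the cell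
  on one side of an edge, also the cell on the other side. Connectedness then makes it empty or
  everything.\<close>

lemma incidence: "incidence (edges_of n f) s (cell_sides c)" if "1 \<le> s"
proof
  show "finite (edges_of n f)" by (rule finite_edges_of)
  show "1 \<le> s" by fact
next
  fix e assume e: "e \<in> edges_of n f"
  obtain h where h: "h < n" "f h < n" "f h \<noteq> h" "e = {h, f h}" using e by (rule edges_of_cases)
  have "h \<in> {x \<in> e. c x = c h}" using h by simp
  moreover have "finite {x \<in> e. c x = c h}" using h by simp
  ultimately have "1 \<le> cell_sides c (c h) e"
    unfolding cell_sides_def by (metis One_nat_def Suc_leI card_gt_0_iff empty_iff)
  moreover have "c h \<in> {1..s}" using c_onto h(1) by blast
  ultimately show "\<exists>i\<in>{1..s}. 1 \<le> cell_sides c i e" by blast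
  have "(\<Sum>i=1..s. cell_sides c i e) = (\<Sum>h\<in>e. 1)"
    using sum_edge_cells[OF e, of "\<lambda>_. 1 :: nat"] by simp
  also have "\<dots> = 2" using h by simp
  finally show "even (\<Sum>i=1..s. cell_sides c i e)" by simp
next
  fix S assume S: "S \<subseteq> {1..s}" and ev: "\<And>e. e \<in> edges_of n f \<Longrightarrow> even (\<Sum>i\<in>S. cell_sides c i e)"
  have finS: "finite S" using S finite_subset by blast
  have closed: "c (f h) \<in> S" if h: "h < n" "c h \<in> S" for h
  proof -
    have e: "{h, f h} \<in> edges_of n f" using h by (simp add: edges_of_def)
    have ne: "f h \<noteq> h" using pairings_neq[OF f] h by simp
    have "(\<Sum>i\<in>S. cell_sides c i {h, f h}) = (\<Sum>i=1..s. cell_sides c i {h, f h} * (if i \<in> S then 1 else 0))"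
    proof -
      have "(\<Sum>i=1..s. cell_sides c i {h, f h} * (if i \<in> S then 1 else 0)) = (\<Sum>i\<in>{1..s}. if i \<in> S then cell_sides c i {h, f h} else 0)"
        by (rule sum.cong) auto
      also have "\<dots> = (\<Sum>i\<in>{1..s} \<inter> S. cell_sides c i {h, f h})" by (simp add: sum.inter_restrict)
      also have "{1..s} \<inter> S = S" using S by blast
      finally show ?thesis by simp
    qed
    also have "\<dots> = (\<Sum>x\<in>{h, f h}. if c x \<in> S then 1 else 0)"
      using sum_edge_cells[OF e, of "\<lambda>i. if i \<in> S then 1 else 0 :: nat"] by simp
    also have "\<dots> = 1 + (if c (f h) \<in> S then 1 else 0)" using ne h by simp
    finally show ?thesis using ev[OF e] by (simp split: if_splits)
  qed
  show "S = {} \<or> S = {1..s}"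
  proof (cases "S = {}")
    case False
    then obtain i where i: "i \<in> S" by blast
    have "j \<in> S" if j: "j \<in> {1..s}" for j
    proof -
      have "(i, j) \<in> {(c h, c (f h)) |h. h \<in> {..<n}}\<^sup>*"
        using gl S i j unfolding gluings_def by blast
      then show ?thesis
      proof induction
        case base
        then show ?case using i .
      next
        case (step y z)
        then obtain h where "h < n" "y = c h" "z = c (f h)" by auto
        then show ?case using closed step.IH by simp
      qed
    qed
    then show ?thesis using S by blast
  qed simp
qed

lemma occurring_cells:
  assumes "i \<in> {1..s}"
  shows "\<exists>e\<in>edges_of n f. 1 \<le> cell_sides c i e"
proof -
  have "i \<in> c ` {..<n}" using assms c_onto by simp
  then obtain h where h: "h < n" "i = c h" by auto
  have "h \<in> {x \<in> {h, f h}. c x = i}" using h by simp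
  moreover have "finite {x \<in> {h, f h}. c x = i}" by simp
  ultimately have "1 \<le> cell_sides c i {h, f h}"
    unfolding cell_sides_def by (metis One_nat_def Suc_leI card_gt_0_iff empty_iff)
  moreover have "{h, f h} \<in> edges_of n f" using h by (simp add: edges_of_def)
  ultimately show ?thesis by blast
qed

lemma perimeter_eq_per:
  assumes s: "1 \<le> s" and L: "\<And>h. h < n \<Longrightarrow> l h = L {h, f h}"
  shows "perimeter n c l i = incidence.per (edges_of n f) (cell_sides c) L i"
proof -
  interpret I: incidence "edges_of n f" s "cell_sides c" by (rule incidence[OF s])
  have "perimeter n c l i = (\<Sum>h\<in>{h. h < n \<and> c h = i}. L {h, f h})"
    unfolding perimeter_def by (rule sum.cong) (use L in auto)
  also have "\<dots> = (\<Sum>e\<in>edges_of n f. \<Sum>h\<in>{h \<in> {h. h < n \<and> c h = i}. {h, f h} = e}. L {h, f h})"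
    by (rule sum.group[symmetric]) (auto simp: edges_of_def)
  also have "\<dots> = (\<Sum>e\<in>edges_of n f. cell_sides c i e * L e)"
  proof (rule sum.cong[OF refl])
    fix e assume e: "e \<in> edges_of n f"
    obtain h0 where h0: "h0 < n" "f h0 < n" "e = {h0, f h0}" using e by (rule edges_of_cases)
    have "{h \<in> {h. h < n \<and> c h = i}. {h, f h} = e} = {h \<in> e. c h = i}"
      using h0 by auto
    moreover have "(\<Sum>h\<in>{h \<in> e. c h = i}. L {h, f h}) = (\<Sum>h\<in>{h \<in> e. c h = i}. L e)"
    proof (rule sum.cong[OF refl])
      fix h assume "h \<in> {h \<in> e. c h = i}"
      then have "{h, f h} = e" using edge_eq[of h h0] h0 by simp
      then show "L {h, f h} = L e" by simp
    qed
    ultimately show "(\<Sum>h\<in>{h \<in> {h. h < n \<and> c h = i}. {h, f h} = e}. L {h, f h}) = cell_sides c i e * L e"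
      by (simp add: cell_sides_def)
  qed
  finally show ?thesis by (simp add: I.per_def)
qed

text \<open>A length never exceeds a perimeter, hence is at most K; the larger bound 2 K + 2 has the
  form required by \<open>sum_split_parity\<close> and is the same for all perimeters.\<close>

lemma card_edge_lengths:
  assumes s: "1 \<le> s" and K: "\<And>i. i \<in> {1..s} \<Longrightarrow> m i \<le> K"
  shows "card (edge_lengths n s f c m) = card {L \<in> edges_of n f \<rightarrow>\<^sub>E {1..2 * K + 2}.
    \<forall>i\<in>{1..s}. incidence.per (edges_of n f) (cell_sides c) L i = m i}"
proof (rule card_eq_by_relation[where R = "\<lambda>l L. \<forall>h<n. l h = L {h, f h}"])
  fix l assume l: "l \<in> edge_lengths n s f c m"
  define L where "L = (\<lambda>e\<in>edges_of n f. l (SOME h. h \<in> e))"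
  have lf: "l (f h) = l h" if "h < n" for h using l that by (simp add: edge_lengths_def)
  have lL: "l h = L {h, f h}" if h: "h < n" for h
  proof -
    have "{h, f h} \<in> edges_of n f" using h by (simp add: edges_of_def)
    moreover have "(SOME x. x \<in> {h, f h}) \<in> {h, f h}" by (rule someI[of _ h]) simp
    ultimately show ?thesis using lf[OF h] unfolding L_def by auto
  qed
  have l1: "1 \<le> l h" if "h < n" for h using l that by (simp add: edge_lengths_def PiE_iff)
  have "L \<in> edges_of n f \<rightarrow>\<^sub>E {1..2 * K + 2}"
  proof (rule PiE_I)
    fix e assume "e \<in> edges_of n f"
    then obtain h where h: "h < n" "e = {h, f h}" by (rule edges_of_cases)
    have "c h \<in> {1..s}" using c_onto h(1) by blast
    then have "l h \<le> K" using edge_length_le[OF l c h(1)] K[of "c h"] by simp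
    then show "L e \<in> {1..2 * K + 2}" using lL[OF h(1)] l1[OF h(1)] h(2) by simp
  qed (simp add: L_def)
  moreover have "incidence.per (edges_of n f) (cell_sides c) L i = m i" if "i \<in> {1..s}" for i
    using perimeter_eq_per[where l = l and L = L, OF s lL] l that by (simp add: edge_lengths_def)
  ultimately show "\<exists>L\<in>{L \<in> edges_of n f \<rightarrow>\<^sub>E {1..2 * K + 2}.
      \<forall>i\<in>{1..s}. incidence.per (edges_of n f) (cell_sides c) L i = m i}. \<forall>h<n. l h = L {h, f h}"
    using lL by blast
next
  fix L assume L: "L \<in> {L \<in> edges_of n f \<rightarrow>\<^sub>E {1..2 * K + 2}.
      \<forall>i\<in>{1..s}. incidence.per (edges_of n f) (cell_sides c) L i = m i}"
  define l where "l = (\<lambda>h\<in>{..<n}. L {h, f h})"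
  have lL: "l h = L {h, f h}" if "h < n" for h using that by (simp add: l_def)
  have "l \<in> {..<n} \<rightarrow>\<^sub>E {1..}"
  proof (rule PiE_I)
    fix h assume "h \<in> {..<n}"
    then have "{h, f h} \<in> edges_of n f" by (simp add: edges_of_def)
    then have "L {h, f h} \<in> {1..2 * K + 2}" using L by blast
    then show "l h \<in> {1..}" using lL \<open>h \<in> {..<n}\<close> by simp
  qed (simp add: l_def)
  moreover have "l (f h) = l h" if "h < n" for h
    using lL[OF that] lL[of "f h"] f_less[of h] that by (simp add: insert_commute)
  moreover have "perimeter n c l i = m i" if "i \<in> {1..s}" for i
    using perimeter_eq_per[where l = l and L = L, OF s lL] L that by simp
  ultimately have "l \<in> edge_lengths n s f c m" by (simp add: edge_lengths_def)
  then show "\<exists>l\<in>edge_lengths n s f c m. \<forall>h<n. l h = L {h, f h}" using lL by blast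
next
  fix l L L' assume L: "L \<in> {L \<in> edges_of n f \<rightarrow>\<^sub>E {1..2 * K + 2}.
      \<forall>i\<in>{1..s}. incidence.per (edges_of n f) (cell_sides c) L i = m i}"
    "L' \<in> {L \<in> edges_of n f \<rightarrow>\<^sub>E {1..2 * K + 2}.
      \<forall>i\<in>{1..s}. incidence.per (edges_of n f) (cell_sides c) L i = m i}"
    and *: "\<forall>h<n. l h = L {h, f h}" "\<forall>h<n. l h = L' {h, f h}"
  have LE: "L \<in> edges_of n f \<rightarrow>\<^sub>E {1..2 * K + 2}" "L' \<in> edges_of n f \<rightarrow>\<^sub>E {1..2 * K + 2}" using L by blast+
  show "L = L'"
  proof (rule PiE_ext[OF LE])
    fix e assume "e \<in> edges_of n f"
    then obtain h where "h < n" "e = {h, f h}" by (rule edges_of_cases)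
    then show "L e = L' e" using * by metis
  qed
next
  fix l l' L assume l: "l \<in> edge_lengths n s f c m" "l' \<in> edge_lengths n s f c m"
    and *: "\<forall>h<n. l h = L {h, f h}" "\<forall>h<n. l' h = L {h, f h}"
  have lE: "l \<in> {..<n} \<rightarrow>\<^sub>E {1..}" "l' \<in> {..<n} \<rightarrow>\<^sub>E {1..}" using l by (simp_all add: edge_lengths_def)
  show "l = l'" by (rule PiE_ext[OF lE]) (use * in simp)
qed

text \<open>The lengths are grouped by their perimeters; groups outside the range of m contribute
  nothing, as \<Phi> vanishes there.\<close>

lemma sum_perimeters:
  fixes \<Phi> :: "nat \<Rightarrow> nat \<Rightarrow> real"
  assumes s: "1 \<le> s" and K: "\<And>i. i \<in> {1..s} \<Longrightarrow> k i \<le> K"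
    and \<Phi>: "\<And>i v. i \<in> {1..s} \<Longrightarrow> v \<notin> {1..k i} \<Longrightarrow> \<Phi> i v = 0"
  shows "(\<Sum>m\<in>(\<Pi>\<^sub>E i\<in>{1..s}. {1..k i}). real (card (edge_lengths n s f c m)) * (\<Prod>i=1..s. \<Phi> i (m i))) =
    (\<Sum>L\<in>edges_of n f \<rightarrow>\<^sub>E {1..2 * K + 2}. \<Prod>i=1..s. \<Phi> i (incidence.per (edges_of n f) (cell_sides c) L i))"
proof -
  let ?X = "edges_of n f \<rightarrow>\<^sub>E {1..2 * K + 2}" and ?M = "\<Pi>\<^sub>E i\<in>{1..s}. {1..k i}"
  let ?p = "incidence.per (edges_of n f) (cell_sides c)"
  define Y where "Y = {L \<in> ?X. \<forall>i\<in>{1..s}. ?p L i \<in> {1..k i}}"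
  have finX: "finite ?X" using finite_edges_of by (intro finite_PiE) auto
  have "(\<Sum>L\<in>?X. \<Prod>i=1..s. \<Phi> i (?p L i)) = (\<Sum>L\<in>Y. \<Prod>i=1..s. \<Phi> i (?p L i))"
  proof (rule sum.mono_neutral_right[OF finX])
    show "\<forall>L\<in>?X - Y. (\<Prod>i=1..s. \<Phi> i (?p L i)) = 0"
    proof
      fix L assume "L \<in> ?X - Y"
      then obtain i where i: "i \<in> {1..s}" "?p L i \<notin> {1..k i}" unfolding Y_def by blast
      show "(\<Prod>i=1..s. \<Phi> i (?p L i)) = 0"
        by (rule prod_zero) (use i \<Phi>[OF i] in blast)+
    qed
  qed (auto simp: Y_def)
  also have "\<dots> = (\<Sum>m\<in>?M. \<Sum>L\<in>{L \<in> Y. restrict (?p L) {1..s} = m}. \<Prod>i=1..s. \<Phi> i (?p L i))"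
  proof (rule sum.group[symmetric])
    show "finite Y" using finX by (simp add: Y_def)
    show "finite ?M" by (intro finite_PiE) auto
    show "(\<lambda>L. restrict (?p L) {1..s}) ` Y \<subseteq> ?M" unfolding Y_def by auto
  qed
  also have "\<dots> = (\<Sum>m\<in>?M. real (card (edge_lengths n s f c m)) * (\<Prod>i=1..s. \<Phi> i (m i)))"
  proof (rule sum.cong[OF refl])
    fix m assume m: "m \<in> ?M"
    have mk: "m i \<in> {1..k i}" if "i \<in> {1..s}" for i using PiE_mem[OF m that] .
    have eq: "restrict (?p L) {1..s} = m \<longleftrightarrow> (\<forall>i\<in>{1..s}. ?p L i = m i)" for L
    proof
      assume "restrict (?p L) {1..s} = m"
      then show "\<forall>i\<in>{1..s}. ?p L i = m i" by auto
    next
      assume *: "\<forall>i\<in>{1..s}. ?p L i = m i"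
      show "restrict (?p L) {1..s} = m"
      proof
        fix i show "restrict (?p L) {1..s} i = m i" using * PiE_arb[OF m, of i] by (cases "i \<in> {1..s}") auto
      qed
    qed
    have set: "{L \<in> Y. restrict (?p L) {1..s} = m} = {L \<in> ?X. \<forall>i\<in>{1..s}. ?p L i = m i}"
      unfolding Y_def eq using mk by auto
    have mK: "m i \<le> K" if "i \<in> {1..s}" for i using mk[OF that] K[OF that] by simp
    have "(\<Sum>L\<in>{L \<in> Y. restrict (?p L) {1..s} = m}. \<Prod>i=1..s. \<Phi> i (?p L i)) =
        (\<Sum>L\<in>{L \<in> ?X. \<forall>i\<in>{1..s}. ?p L i = m i}. \<Prod>i=1..s. \<Phi> i (m i))"
      unfolding set by (rule sum.cong[OF refl]) (auto intro!: prod.cong)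
    then show "(\<Sum>L\<in>{L \<in> Y. restrict (?p L) {1..s} = m}. \<Prod>i=1..s. \<Phi> i (?p L i)) =
        real (card (edge_lengths n s f c m)) * (\<Prod>i=1..s. \<Phi> i (m i))"
      by (subst card_edge_lengths[where K = K and m = m, OF s mK]) simp_all
  qed
  finally show ?thesis by simp
qed

end

text \<open>Maps are sorted by the number n of their core corners, and n \<le> N because a core of
  size n yields a labelled graph with n half-edges.\<close>

lemma card_leafless_maps_sum:
  assumes s: "1 \<le> s" and gs: "(g, s) \<noteq> (0, 2)" and m: "\<And>i. i \<in> {1..s} \<Longrightarrow> 1 \<le> m i"
    and N: "int N = 12 * int g - 12 + 6 * int s"
  shows "real (card (leafless_maps g s m {1..s})) =
    (\<Sum>n\<le>N. (\<Sum>(\<tau>, f, c)\<in>labelled_graphs g s n. real (card (edge_lengths n s f c m)) * (\<Prod>i=1..s. real (m i))) / fact n)"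
proof -
  let ?P = "leafless_maps g s m {1..s}"
  have finP: "finite ?P"
    unfolding leafless_maps_def Maps_eq_gluings by (rule finite_subset[OF _ finite_gluings[OF finite_sides]]) auto
  have le: "card (core_set s m p) \<le> N" if p: "p \<in> ?P" for p
  proof (rule ccontr)
    obtain n where n: "card (core_set s m p) = n" by simp
    assume gt: "\<not> card (core_set s m p) \<le> N"
    have "labelled_graphs g s n = {}"
    proof (rule ccontr)
      assume "labelled_graphs g s n \<noteq> {}"
      then obtain \<tau> f c where "(\<tau>, f, c) \<in> labelled_graphs g s n" by auto
      then interpret labelled_graph g s n \<tau> f c by unfold_locales
      show False using n_le N gt n by simp
    qed
    then have "card {p' \<in> ?P. card (core_set s m p') = n} = 0"
      using card_leafless_maps[where n = n, OF s gs m] by simp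
    then show False using p n finP by auto
  qed
  have "card ?P = (\<Sum>p\<in>?P. 1)" by simp
  also have "\<dots> = (\<Sum>n\<in>{..N}. \<Sum>p\<in>{p \<in> ?P. card (core_set s m p) = n}. 1)"
    by (rule sum.group[symmetric]) (use finP le in auto)
  finally have "real (card ?P) = (\<Sum>n\<le>N. real (card {p \<in> ?P. card (core_set s m p) = n}))"
    by (simp add: of_nat_sum)
  also have "\<dots> = (\<Sum>n\<le>N. (\<Sum>(\<tau>, f, c)\<in>labelled_graphs g s n. real (card (edge_lengths n s f c m)) * (\<Prod>i=1..s. real (m i))) / fact n)"
  proof (rule sum.cong[OF refl])
    fix n
    have "real (fact n) * real (card {p \<in> ?P. card (core_set s m p) = n}) =
        real (\<Sum>(\<tau>, f, c)\<in>labelled_graphs g s n. card (edge_lengths n s f c m) * (\<Prod>i=1..s. m i))"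
      using card_leafless_maps[where n = n, OF s gs m] by (simp only: of_nat_mult[symmetric])
    then show "real (card {p \<in> ?P. card (core_set s m p) = n}) =
        (\<Sum>(\<tau>, f, c)\<in>labelled_graphs g s n. real (card (edge_lengths n s f c m)) * (\<Prod>i=1..s. real (m i))) / fact n"
      by (simp add: field_simps case_prod_unfold of_nat_prod)
  qed
  finally show ?thesis .
qed

definition graph_sum :: "nat \<Rightarrow> nat \<Rightarrow> (nat \<Rightarrow> nat) \<Rightarrow> (nat \<Rightarrow> nat) \<Rightarrow> (nat \<Rightarrow> nat) \<Rightarrow> real" where
  "graph_sum n s f c k = (\<Sum>L\<in>edges_of n f \<rightarrow>\<^sub>E {1..2 * total_sides s k + 2}. \<Prod>i=1..s.
     if even (k i + incidence.per (edges_of n f) (cell_sides c) L i)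
     then walk_weight (k i) (incidence.per (edges_of n f) (cell_sides c) L i) else 0)"

text \<open>Combines leaf removal with the suppression of bivalent vertices. The identity is exact,
  so the asymptotic analysis concerns \<open>graph_sum\<close> alone.\<close>

theorem card_Maps_eq_graph_sum:
  assumes s: "1 \<le> s" and gs: "(g, s) \<noteq> (0, 1)" "(g, s) \<noteq> (0, 2)" and k: "\<And>i. i \<in> {1..s} \<Longrightarrow> 1 \<le> k i"
    and N: "int N = 12 * int g - 12 + 6 * int s"
  shows "real (card (Maps g s k)) / 2 ^ total_sides s k =
    (\<Sum>n\<le>N. (\<Sum>(\<tau>, f, c)\<in>labelled_graphs g s n. graph_sum n s f c k) / fact n)"
proof -
  let ?M = "\<Pi>\<^sub>E i\<in>{1..s}. {1..k i}"
  let ?K = "total_sides s k"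
  define \<Phi> where "\<Phi> i v = real (bcoef (k i) v) * real v" for i v
  have \<Phi>0: "\<Phi> i v = 0" if "v \<notin> {1..k i}" for i v
    using that by (auto simp: \<Phi>_def bcoef_def)
  \<comment> \<open>The binomial coefficient from the leaves and the factor v from the layouts
    combine to \<open>walk_weight\<close>, up to the power of 2 and the parity condition.\<close>
  have \<Phi>w: "\<Phi> i v = 2 ^ k i * (if even (k i + v) then walk_weight (k i) v else 0)" for i v
    by (auto simp: \<Phi>_def bcoef_def walk_weight_def)
  have kK: "k i \<le> ?K" if "i \<in> {1..s}" for i
    unfolding total_sides_def by (rule member_le_sum) (use that in auto)
  have "real (card (Maps g s k)) = (\<Sum>m\<in>?M. (\<Prod>i=1..s. real (bcoef (k i) (m i))) * real (card (leafless_maps g s m {1..s})))"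
    by (subst card_Maps_sum_leafless[OF gs(1)]) (use k in \<open>simp_all add: of_nat_sum of_nat_prod\<close>)
  also have "\<dots> = (\<Sum>m\<in>?M. \<Sum>n\<le>N. \<Sum>(\<tau>, f, c)\<in>labelled_graphs g s n.
      real (card (edge_lengths n s f c m)) * (\<Prod>i=1..s. \<Phi> i (m i)) / fact n)"
  proof (rule sum.cong[OF refl])
    fix m assume m: "m \<in> ?M"
    have m1: "1 \<le> m i" if "i \<in> {1..s}" for i using PiE_mem[OF m that] by simp
    show "(\<Prod>i=1..s. real (bcoef (k i) (m i))) * real (card (leafless_maps g s m {1..s})) =
      (\<Sum>n\<le>N. \<Sum>(\<tau>, f, c)\<in>labelled_graphs g s n. real (card (edge_lengths n s f c m)) * (\<Prod>i=1..s. \<Phi> i (m i)) / fact n)"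
    proof -
      have "(\<Prod>i=1..s. real (bcoef (k i) (m i))) * real (card (leafless_maps g s m {1..s})) =
          (\<Prod>i=1..s. real (bcoef (k i) (m i))) * (\<Sum>n\<le>N. (\<Sum>(\<tau>, f, c)\<in>labelled_graphs g s n.
            real (card (edge_lengths n s f c m)) * (\<Prod>i=1..s. real (m i))) / fact n)"
        by (rule arg_cong[OF card_leafless_maps_sum[OF s gs(2) _ N]]) (rule m1)
      also have "\<dots> = (\<Sum>n\<le>N. \<Sum>(\<tau>, f, c)\<in>labelled_graphs g s n.
          real (card (edge_lengths n s f c m)) * (\<Prod>i=1..s. \<Phi> i (m i)) / fact n)"
        by (simp add: \<Phi>_def prod.distrib case_prod_unfold sum_distrib_left sum_divide_distrib mult_ac)
      finally show ?thesis .
    qed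
  qed
  also have "\<dots> = (\<Sum>n\<le>N. \<Sum>G\<in>labelled_graphs g s n. \<Sum>m\<in>?M. case G of (\<tau>, f, c) \<Rightarrow>
      real (card (edge_lengths n s f c m)) * (\<Prod>i=1..s. \<Phi> i (m i)) / fact n)"
    by (subst sum.swap, rule sum.cong[OF refl], subst sum.swap) (simp add: case_prod_unfold)
  also have "\<dots> = (\<Sum>n\<le>N. \<Sum>(\<tau>, f, c)\<in>labelled_graphs g s n. 2 ^ ?K * graph_sum n s f c k / fact n)"
  proof (intro sum.cong refl, clarify)
    fix n \<tau> f c assume "(\<tau>, f, c) \<in> labelled_graphs g s n"
    then interpret labelled_graph g s n \<tau> f c by unfold_locales
    let ?p = "incidence.per (edges_of n f) (cell_sides c)"
    have "(\<Sum>m\<in>?M. real (card (edge_lengths n s f c m)) * (\<Prod>i=1..s. \<Phi> i (m i)) / fact n) =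
        (\<Sum>L\<in>edges_of n f \<rightarrow>\<^sub>E {1..2 * ?K + 2}. \<Prod>i=1..s. \<Phi> i (?p L i)) / fact n"
      unfolding sum_divide_distrib[symmetric] by (subst sum_perimeters[OF s kK \<Phi>0]) auto
    also have "(\<Sum>L\<in>edges_of n f \<rightarrow>\<^sub>E {1..2 * ?K + 2}. \<Prod>i=1..s. \<Phi> i (?p L i)) = 2 ^ ?K * graph_sum n s f c k"
      unfolding \<Phi>w prod.distrib graph_sum_def sum_distrib_left total_sides_def power_sum ..
    finally show "(\<Sum>m\<in>?M. real (card (edge_lengths n s f c m)) * (\<Prod>i=1..s. \<Phi> i (m i)) / fact n) =
        2 ^ ?K * graph_sum n s f c k / fact n" .
  qed
  also have "\<dots> = 2 ^ ?K * (\<Sum>n\<le>N. (\<Sum>(\<tau>, f, c)\<in>labelled_graphs g s n. graph_sum n s f c k) / fact n)"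
    by (simp add: sum_distrib_left sum_divide_distrib case_prod_unfold)
  finally show ?thesis by simp
qed

section \<open>The Laplace transform\<close>

text \<open>An explicit family of polygon lengths: even, so that \<open>total_sides\<close> is even
  for every t, and positive for every t because of the + 1. It serves to show that the asymptotic
  constant is unique, and to obtain the integrability of \<open>cell_integrand\<close> from a
  limit.\<close>

lemma even_approximation:
  assumes x: "(0::real) < x"
  shows "((\<lambda>t. real (2 * (nat \<lceil>x * t / 2\<rceil> + 1)) / t) \<longlongrightarrow> x) at_top"
proof (rule tendsto_sandwich)
  show "((\<lambda>t. x) \<longlongrightarrow> x) at_top" by simp
  show "((\<lambda>t. x + 4 / t) \<longlongrightarrow> x) at_top" by real_asymp
  show "\<forall>\<^sub>F t in at_top. x \<le> real (2 * (nat \<lceil>x * t / 2\<rceil> + 1)) / t"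
    using eventually_gt_at_top[of 0]
  proof eventually_elim
    case (elim t)
    have "x * t / 2 \<le> real (nat \<lceil>x * t / 2\<rceil>)" by (rule real_nat_ceiling_ge)
    then have "x * t \<le> real (2 * (nat \<lceil>x * t / 2\<rceil> + 1))" by simp
    then show ?case using elim by (simp add: pos_le_divide_eq)
  qed
  show "\<forall>\<^sub>F t in at_top. real (2 * (nat \<lceil>x * t / 2\<rceil> + 1)) / t \<le> x + 4 / t"
    using eventually_gt_at_top[of 0]
  proof eventually_elim
    case (elim t)
    have "0 < x * t" using elim x by simp
    then have "real (nat \<lceil>x * t / 2\<rceil>) \<le> x * t / 2 + 1" by linarith
    then have "real (2 * (nat \<lceil>x * t / 2\<rceil> + 1)) \<le> x * t + 4" by simp
    then have "real (2 * (nat \<lceil>x * t / 2\<rceil> + 1)) / t \<le> (x * t + 4) / t"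
      using elim by (intro divide_right_mono) auto
    then show ?case using elim by (simp add: add_divide_distrib)
  qed
qed

text \<open>The part of the integrand that does not depend on the graph; the indicators restrict to
  the open orthant, where \<open>map_fun\<close> is meaningful.\<close>

definition laplace_prefactor :: "nat \<Rightarrow> (nat \<Rightarrow> complex) \<Rightarrow> (nat \<Rightarrow> real) \<Rightarrow> complex" where
  "laplace_prefactor s z \<xi> = (\<Prod>i=1..s. exp (- (z i * of_real (\<xi> i))) * of_real (indicator {0<..} (\<xi> i) / \<xi> i))"

context incidence
begin

lemma rper_pos:
  assumes i: "i \<in> {1..s}" "\<exists>e\<in>E. 1 \<le> a i e" and x: "\<And>e. e \<in> E \<Longrightarrow> 0 < x e"
  shows "0 < rper x i"
proof -
  obtain e where e: "e \<in> E" "1 \<le> a i e" using i(2) by blast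
  have "0 < real (a i e) * x e" using e x by simp
  also have "\<dots> \<le> rper x i"
    unfolding rper_def
  proof (rule member_le_sum)
    fix e' assume "e' \<in> E - {e}"
    then show "0 \<le> real (a i e') * x e'" using x[of e'] by simp
  qed (use e(1) finE in auto)
  finally show ?thesis .
qed

lemma rper_nonneg:
  assumes "\<And>e. e \<in> E \<Longrightarrow> 0 \<le> x e"
  shows "0 \<le> rper x i"
  unfolding rper_def using assms by (intro sum_nonneg mult_nonneg_nonneg) auto

lemma cell_integrand_cases:
  shows "cell_integrand \<xi> x = (if \<forall>e\<in>E. 0 \<le> x e then \<Prod>i=1..s. gauss_weight (\<xi> i) (rper x i) else 0)"
proof (cases "\<forall>e\<in>E. 0 \<le> x e")
  case True
  then have "(\<Prod>e\<in>E. indicator {0..} (x e)) = (1::real)" by (intro prod.neutral) auto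
  then show ?thesis using True by (simp add: cell_integrand_def)
next
  case False
  then have "(\<Prod>e\<in>E. indicator {0..} (x e)) = (0::real)" using finE by (intro prod_zero) (auto simp: indicator_def)
  then show ?thesis using False by (simp only: cell_integrand_def if_False mult_zero_left)
qed

lemma cell_integrand_nonneg:
  assumes "\<And>i. i \<in> {1..s} \<Longrightarrow> 0 < \<xi> i"
  shows "0 \<le> cell_integrand \<xi> x"
proof -
  have "0 \<le> gauss_weight (\<xi> i) (rper x i)" if "i \<in> {1..s}" "\<forall>e\<in>E. 0 \<le> x e" for i
    using assms[OF that(1)] rper_nonneg[of x i] that(2) by (simp add: gauss_weight_def)
  then show ?thesis by (auto simp: cell_integrand_cases intro!: prod_nonneg)
qed

lemma integrable_cell_integrand:
  assumes \<xi>: "\<And>i. i \<in> {1..s} \<Longrightarrow> 0 < \<xi> i"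
  shows "integrable (\<Pi>\<^sub>M e\<in>E. lborel) (cell_integrand \<xi>)"
proof (rule step_fun_integral_limit(2)[where k = "\<lambda>t i. 2 * (nat \<lceil>\<xi> i * t / 2\<rceil> + 1)", OF \<xi>])
  show "((\<lambda>t. real (2 * (nat \<lceil>\<xi> i * t / 2\<rceil> + 1)) / t) \<longlongrightarrow> \<xi> i) at_top" if "i \<in> {1..s}" for i
    by (rule even_approximation[OF \<xi>[OF that]])
  show "0 < 2 * (nat \<lceil>\<xi> i * t / 2\<rceil> + 1)" for t i by (rule mult_pos_pos) simp_all
qed

lemma cell_integral_nonneg:
  assumes "\<And>i. i \<in> {1..s} \<Longrightarrow> 0 < \<xi> i"
  shows "0 \<le> cell_integral \<xi>"
  unfolding cell_integral_def by (intro integral_nonneg_AE AE_I2 cell_integrand_nonneg[OF assms])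

text \<open>The integrand is positive on the box of edge lengths in [1, 2], which has measure 1. A
  nonzero limit is what turns convergence of a quotient into \<sim>.\<close>

lemma cell_integral_pos:
  assumes \<xi>: "\<And>i. i \<in> {1..s} \<Longrightarrow> 0 < \<xi> i" and occ: "\<And>i. i \<in> {1..s} \<Longrightarrow> \<exists>e\<in>E. 1 \<le> a i e"
  shows "0 < cell_integral \<xi>"
proof (rule ccontr)
  let ?M = "\<Pi>\<^sub>M e\<in>E. lborel :: real measure"
  assume "\<not> 0 < cell_integral \<xi>"
  then have "cell_integral \<xi> = 0" using cell_integral_nonneg[where \<xi> = \<xi>, OF \<xi>] by simp
  then have ae: "AE x in ?M. cell_integrand \<xi> x = 0"
    unfolding cell_integral_def
    using integral_nonneg_eq_0_iff_AE[OF integrable_cell_integrand[OF \<xi>]] cell_integrand_nonneg[OF \<xi>] by auto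
  let ?B = "\<Pi>\<^sub>E e\<in>E. {1..2::real}"
  have B: "?B \<in> sets ?M" by (intro sets_PiM_I_finite finE) simp
  have pos: "cell_integrand \<xi> x \<noteq> 0" if x: "x \<in> ?B" for x
  proof -
    have x1: "1 \<le> x e" if "e \<in> E" for e using PiE_mem[OF x that] by simp
    have "0 < gauss_weight (\<xi> i) (rper x i)" if i: "i \<in> {1..s}" for i
    proof -
      have "0 < rper x i" using x1 by (intro rper_pos[OF i occ[OF i]]) force
      then show ?thesis using \<xi>[OF i] by (simp add: gauss_weight_def)
    qed
    then have "0 < (\<Prod>i=1..s. gauss_weight (\<xi> i) (rper x i))" by (intro prod_pos) blast
    moreover have "\<forall>e\<in>E. 0 \<le> x e" using x1 by force
    ultimately show ?thesis by (metis cell_integrand_cases less_irrefl)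
  qed
  have "AE x in ?M. x \<notin> ?B" using ae by eventually_elim (use pos in blast)
  then have "?B \<in> null_sets ?M" using AE_iff_null_sets[OF B] by simp
  then have "emeasure ?M ?B = 0" by blast
  moreover have "emeasure ?M ?B = 1"
    by (subst emeasure_PiM) (use finE in \<open>auto intro!: prod.neutral\<close>)
  ultimately show False by simp
qed

text \<open>Regroups a sum over cells by edges; this is how an exponential in the perimeters becomes
  a product over edges.\<close>

lemma sum_rper_mult:
  fixes w :: "nat \<Rightarrow> 'b::real_normed_field"
  shows "(\<Sum>i=1..s. of_real (rper x i) * w i) = (\<Sum>e\<in>E. (\<Sum>i=1..s. of_nat (a i e) * w i) * of_real (x e))"
proof -
  have "(\<Sum>i=1..s. of_real (rper x i) * w i) = (\<Sum>i=1..s. \<Sum>e\<in>E. of_nat (a i e) * w i * of_real (x e))"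
    unfolding rper_def by (simp add: sum_distrib_left sum_distrib_right mult_ac)
  also have "\<dots> = (\<Sum>e\<in>E. (\<Sum>i=1..s. of_nat (a i e) * w i) * of_real (x e))"
    by (subst sum.swap) (simp add: sum_distrib_right)
  finally show ?thesis .
qed

lemma sum_sides_pos:
  fixes w :: "nat \<Rightarrow> real"
  assumes e: "e \<in> E" and w: "\<And>i. i \<in> {1..s} \<Longrightarrow> 0 < w i"
  shows "0 < (\<Sum>i=1..s. real (a i e) * w i)"
proof -
  obtain i where i: "i \<in> {1..s}" "1 \<le> a i e" using cover[OF e] by blast
  have "0 < real (a i e) * w i" using i w[OF i(1)] by simp
  also have "\<dots> \<le> (\<Sum>i=1..s. real (a i e) * w i)"
  proof (rule member_le_sum)
    fix j assume "j \<in> {1..s} - {i}"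
    then show "0 \<le> real (a j e) * w j" using w[of j] by simp
  qed (use i in auto)
  finally show ?thesis .
qed

text \<open>Off this null set the points of the orthant have positive coordinates and hence positive
  perimeters, as the transform of the kernel requires.\<close>

lemma AE_nonzero: "AE x in \<Pi>\<^sub>M e\<in>E. lborel :: real measure. \<forall>e\<in>E. x e \<noteq> 0"
proof (rule AE_finite_allI[OF finE])
  fix e assume e: "e \<in> E"
  let ?A = "\<lambda>e'. if e' = e then {0::real} else UNIV"
  have "emeasure (\<Pi>\<^sub>M e\<in>E. lborel) (Pi\<^sub>E E ?A) = (\<Prod>e\<in>E. emeasure lborel (?A e))"
    by (rule emeasure_PiM[OF finE]) simp
  also have "\<dots> = 0" using e finE by (intro prod_zero) auto
  finally have "Pi\<^sub>E E ?A \<in> null_sets (\<Pi>\<^sub>M e\<in>E. lborel)"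
    by (intro null_setsI) (auto intro!: sets_PiM_I_finite finE)
  then show "AE x in \<Pi>\<^sub>M e\<in>E. lborel :: real measure. x e \<noteq> 0"
  proof (rule AE_I')
    show "{x \<in> space (\<Pi>\<^sub>M e\<in>E. lborel). \<not> x e \<noteq> 0} \<subseteq> Pi\<^sub>E E ?A"
      by (auto simp: space_PiM PiE_iff extensional_def)
  qed
qed

text \<open>The object of Fubini's theorem: integrating out x first leads to
  \<open>cell_integral\<close>, integrating out \<xi> first to a product over the edges.\<close>

definition joint_integrand :: "(nat \<Rightarrow> complex) \<Rightarrow> ('e \<Rightarrow> real) \<Rightarrow> (nat \<Rightarrow> real) \<Rightarrow> complex" where
  "joint_integrand z x \<xi> = of_real (\<Prod>e\<in>E. indicator {0..} (x e)) *
    (\<Prod>i=1..s. exp (- (z i * of_real (\<xi> i))) * of_real (laplace_kernel (rper x i) (\<xi> i)))"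

lemma measurable_joint_integrand:
  "(\<lambda>(x, \<xi>). joint_integrand z x \<xi>) \<in> borel_measurable ((\<Pi>\<^sub>M e\<in>E. lborel) \<Otimes>\<^sub>M (\<Pi>\<^sub>M i\<in>{1..s}. lborel))"
  unfolding joint_integrand_def laplace_kernel_def gauss_weight_def rper_def case_prod_unfold by measurable

lemma joint_integrand_eq: "joint_integrand z x \<xi> = laplace_prefactor s z \<xi> * of_real (cell_integrand \<xi> x)"
proof -
  have "(\<Prod>i=1..s. exp (- (z i * of_real (\<xi> i))) * of_real (laplace_kernel (rper x i) (\<xi> i))) =
      laplace_prefactor s z \<xi> * of_real (\<Prod>i=1..s. gauss_weight (\<xi> i) (rper x i))"
    unfolding laplace_prefactor_def of_real_prod prod.distrib[symmetric]
    by (rule prod.cong) (simp_all add: laplace_kernel_def)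
  then show ?thesis by (simp only: joint_integrand_def cell_integrand_def of_real_mult mult_ac)
qed

lemma norm_joint_integrand:
  "norm (joint_integrand z x \<xi>) = (\<Prod>e\<in>E. indicator {0..} (x e)) *
    (\<Prod>i=1..s. exp (- (Re (z i) * \<xi> i)) * laplace_kernel (rper x i) (\<xi> i))"
proof (cases "\<forall>e\<in>E. 0 \<le> x e")
  case True
  have "norm (exp (- (z i * of_real (\<xi> i))) * of_real (laplace_kernel (rper x i) (\<xi> i))) =
      exp (- (Re (z i) * \<xi> i)) * laplace_kernel (rper x i) (\<xi> i)" for i
    using laplace_kernel_nonneg[OF rper_nonneg[of x i]] True by (simp add: norm_mult norm_exp_eq_Re)
  then have "norm (\<Prod>i=1..s. exp (- (z i * of_real (\<xi> i))) * of_real (laplace_kernel (rper x i) (\<xi> i))) =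
      (\<Prod>i=1..s. exp (- (Re (z i) * \<xi> i)) * laplace_kernel (rper x i) (\<xi> i))"
    unfolding prod_norm[symmetric] by (simp only:)
  moreover have "0 \<le> (\<Prod>e\<in>E. indicator {0..} (x e) :: real)" by (intro prod_nonneg) simp
  ultimately show ?thesis
    unfolding joint_integrand_def by (simp only: norm_mult[where y = "prod _ {1..s}"] norm_of_real abs_of_nonneg)
next
  case False
  then have "(\<Prod>e\<in>E. indicator {0..} (x e)) = (0::real)" using finE by (intro prod_zero) (auto simp: indicator_def)
  then show ?thesis by (simp only: joint_integrand_def of_real_0 mult_zero_left norm_zero)
qed

context
  fixes z :: "nat \<Rightarrow> complex"
  assumes z: "\<And>i. i \<in> {1..s} \<Longrightarrow> 0 < Re (z i)" and occ: "\<And>i. i \<in> {1..s} \<Longrightarrow> \<exists>e\<in>E. 1 \<le> a i e"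
begin

text \<open>For fixed x the integral over \<xi> splits over the cells, with factors 2 exp (- y sqrt
  (2 z)) for the perimeters y. Their exponents are linear in the edge lengths and are regrouped by
  edges. The same computation with Re z gives the integral of the norm, the input for Fubini's
  theorem.\<close>

lemma inner_laplace:
  fixes x :: "'e \<Rightarrow> real"
  assumes x: "\<forall>e\<in>E. x e \<noteq> 0"
  shows "integrable (\<Pi>\<^sub>M i\<in>{1..s}. lborel) (joint_integrand z x)"
    and "(\<integral>\<xi>. joint_integrand z x \<xi> \<partial>(\<Pi>\<^sub>M i\<in>{1..s}. lborel)) =
      2 ^ s * (\<Prod>e\<in>E. of_real (indicator {0..} (x e)) *
        exp (- ((\<Sum>i=1..s. of_nat (a i e) * (of_real (sqrt 2) * csqrt (z i))) * of_real (x e))))"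
    and "(\<integral>\<xi>. norm (joint_integrand z x \<xi>) \<partial>(\<Pi>\<^sub>M i\<in>{1..s}. lborel)) =
      2 ^ s * (\<Prod>e\<in>E. indicator {0..} (x e) *
        exp (- ((\<Sum>i=1..s. real (a i e) * (sqrt 2 * sqrt (Re (z i)))) * x e)))"
proof -
  interpret N: product_sigma_finite "\<lambda>_::nat. lborel :: real measure" by unfold_locales
  let ?M = "\<Pi>\<^sub>M i\<in>{1..s}. lborel :: real measure"
  let ?I = "\<Prod>e\<in>E. indicator {0..} (x e) :: real"
  have "integrable ?M (joint_integrand z x) \<and>
    (\<integral>\<xi>. joint_integrand z x \<xi> \<partial>?M) = 2 ^ s * (\<Prod>e\<in>E. of_real (indicator {0..} (x e)) *
        exp (- ((\<Sum>i=1..s. of_nat (a i e) * (of_real (sqrt 2) * csqrt (z i))) * of_real (x e)))) \<and>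
    (\<integral>\<xi>. norm (joint_integrand z x \<xi>) \<partial>?M) =
      2 ^ s * (\<Prod>e\<in>E. indicator {0..} (x e) *
        exp (- ((\<Sum>i=1..s. real (a i e) * (sqrt 2 * sqrt (Re (z i)))) * x e)))"
  proof (cases "\<forall>e\<in>E. 0 < x e")
    case True
    have pos: "0 < rper x i" if "i \<in> {1..s}" for i using rper_pos[OF that occ[OF that]] True by blast
    have "(\<Prod>e\<in>E. indicator {0..} (x e)) = (1::real)" using True by (intro prod.neutral) auto
    then have J: "joint_integrand z x = (\<lambda>\<xi>. \<Prod>i=1..s. exp (- (z i * of_real (\<xi> i))) * of_real (laplace_kernel (rper x i) (\<xi> i)))"
      and NJ: "norm (joint_integrand z x \<xi>) = (\<Prod>i=1..s. exp (- (Re (z i) * \<xi> i)) * laplace_kernel (rper x i) (\<xi> i))" for \<xi>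
      by (simp only: joint_integrand_def[abs_def] of_real_1 mult_1_left, simp only: norm_joint_integrand mult_1_left)
    have ind: "indicator {0..} (x e) = (1::real)" if "e \<in> E" for e using True that by (simp add: less_imp_le)
    have "(\<integral>\<xi>. joint_integrand z x \<xi> \<partial>?M) = (\<Prod>i=1..s. 2 * exp (- (of_real (rper x i * sqrt 2) * csqrt (z i))))"
      unfolding J using laplace_gauss[OF pos z]
      by (subst N.product_integral_prod) (auto intro!: prod.cong)
    also have "\<dots> = 2 ^ s * exp (- (\<Sum>i=1..s. of_real (rper x i) * (of_real (sqrt 2) * csqrt (z i))))"
      by (simp add: prod.distrib exp_sum mult_ac flip: sum_negf)
    also have "\<dots> = 2 ^ s * (\<Prod>e\<in>E. exp (- ((\<Sum>i=1..s. of_nat (a i e) * (of_real (sqrt 2) * csqrt (z i))) * of_real (x e))))"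
      unfolding sum_rper_mult by (simp only: exp_sum[OF finE] flip: sum_negf)
    finally have 1: "(\<integral>\<xi>. joint_integrand z x \<xi> \<partial>?M) = \<dots>" .
    have "(\<integral>\<xi>. norm (joint_integrand z x \<xi>) \<partial>?M) = (\<Prod>i=1..s. 2 * exp (- (rper x i * sqrt 2 * sqrt (Re (z i)))))"
      unfolding NJ using laplace_gauss_real[OF pos z]
      by (subst N.product_integral_prod) (auto intro!: prod.cong)
    also have "\<dots> = 2 ^ s * exp (- (\<Sum>i=1..s. of_real (rper x i) * (sqrt 2 * sqrt (Re (z i)))))"
      by (simp add: prod.distrib exp_sum mult_ac flip: sum_negf)
    also have "\<dots> = 2 ^ s * (\<Prod>e\<in>E. exp (- ((\<Sum>i=1..s. real (a i e) * (sqrt 2 * sqrt (Re (z i)))) * x e)))"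
      unfolding sum_rper_mult by (simp only: exp_sum[OF finE] of_real_eq_id id_apply flip: sum_negf)
    finally have 2: "(\<integral>\<xi>. norm (joint_integrand z x \<xi>) \<partial>?M) = \<dots>" .
    have 3: "integrable ?M (joint_integrand z x)"
      unfolding J by (rule N.product_integrable_prod) (use laplace_gauss[OF pos z] in auto)
    show ?thesis using 1 2 3 ind by (simp cong: prod.cong)
  next
    case False
    then obtain e where e: "e \<in> E" "x e < 0" using x by force
    have "(\<Prod>e\<in>E. indicator {0..} (x e)) = (0::real)" using e finE by (intro prod_zero bexI[of _ e]) auto
    then have 0: "joint_integrand z x \<xi> = 0" for \<xi>
      by (simp only: joint_integrand_def of_real_0 mult_zero_left)
    have "(\<Prod>e\<in>E. of_real (indicator {0..} (x e)) * F e) = 0" for F :: "'e \<Rightarrow> complex"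
      using e finE by (intro prod_zero) (auto intro!: bexI[of _ e])
    moreover have "(\<Prod>e\<in>E. indicator {0..} (x e) * F e) = 0" for F :: "'e \<Rightarrow> real"
      using e finE by (intro prod_zero) (auto intro!: bexI[of _ e])
    ultimately show ?thesis unfolding 0[abs_def] by simp
  qed
  then show "integrable ?M (joint_integrand z x)"
    "(\<integral>\<xi>. joint_integrand z x \<xi> \<partial>?M) = 2 ^ s * (\<Prod>e\<in>E. of_real (indicator {0..} (x e)) *
        exp (- ((\<Sum>i=1..s. of_nat (a i e) * (of_real (sqrt 2) * csqrt (z i))) * of_real (x e))))"
    "(\<integral>\<xi>. norm (joint_integrand z x \<xi>) \<partial>?M) =
      2 ^ s * (\<Prod>e\<in>E. indicator {0..} (x e) *
        exp (- ((\<Sum>i=1..s. real (a i e) * (sqrt 2 * sqrt (Re (z i)))) * x e)))" by blast+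
qed

text \<open>Exchange of the order of integration. The remaining integral over x is a product of
  integrals of exp (- c x) over the half-line, each equal to 1 / c; here Re c > 0 because principal
  roots of numbers with positive real part have positive real part.\<close>

lemma laplace_cell_integral:
  shows "integrable (\<Pi>\<^sub>M i\<in>{1..s}. lborel) (\<lambda>\<xi>. laplace_prefactor s z \<xi> * of_real (cell_integral \<xi>))" (is ?int)
    and "(\<integral>\<xi>. laplace_prefactor s z \<xi> * of_real (cell_integral \<xi>) \<partial>(\<Pi>\<^sub>M i\<in>{1..s}. lborel)) =
      2 ^ s * (\<Prod>e\<in>E. 1 / (\<Sum>i=1..s. of_nat (a i e) * (of_real (sqrt 2) * csqrt (z i))))" (is ?val)
proof -
  interpret N: product_sigma_finite "\<lambda>_::nat. lborel :: real measure" by unfold_locales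
  let ?X = "\<Pi>\<^sub>M e\<in>E. lborel :: real measure" and ?Y = "\<Pi>\<^sub>M i\<in>{1..s}. lborel :: real measure"
  interpret X: sigma_finite_measure ?X by (rule sigma_finite[OF finE])
  interpret Y: sigma_finite_measure ?Y by (rule N.sigma_finite) simp
  interpret P: pair_sigma_finite ?X ?Y by unfold_locales
  let ?c = "\<lambda>e. \<Sum>i=1..s. of_nat (a i e) * (of_real (sqrt 2) * csqrt (z i))"
  let ?d = "\<lambda>e. \<Sum>i=1..s. real (a i e) * (sqrt 2 * sqrt (Re (z i)))"
  have d: "0 < ?d e" if "e \<in> E" for e
    by (rule sum_sides_pos[OF that]) (use z in simp)
  have c: "0 < Re (?c e)" if "e \<in> E" for e
  proof -
    have "0 < Re (csqrt (z i))" if "i \<in> {1..s}" for i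
      using z[OF that] by (simp add: add_nonneg_pos)
    then have "0 < (\<Sum>i=1..s. real (a i e) * (sqrt 2 * Re (csqrt (z i))))"
      by (intro sum_sides_pos[OF that]) simp
    then show ?thesis by (simp del: csqrt.sel)
  qed
  note meas = measurable_joint_integrand[of z]
  have intJ: "integrable (?X \<Otimes>\<^sub>M ?Y) (\<lambda>(x, \<xi>). joint_integrand z x \<xi>)"
  proof (rule P.Fubini_integrable[OF meas])
    have "integrable ?X (\<lambda>x. 2 ^ s * (\<Prod>e\<in>E. indicator {0..} (x e) * exp (- (?d e * x e))) :: real)"
      by (intro integrable_mult_right product_integrable_prod finE exp_halfline(1) d)
    then show "integrable ?X (\<lambda>x. \<integral>y. norm (case (x, y) of (x, \<xi>) \<Rightarrow> joint_integrand z x \<xi>) \<partial>?Y)"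
    proof (rule integrable_cong_AE_imp)
      show "(\<lambda>x. \<integral>y. norm (case (x, y) of (x, \<xi>) \<Rightarrow> joint_integrand z x \<xi>) \<partial>?Y) \<in> borel_measurable ?X"
        using meas by (intro Y.borel_measurable_lebesgue_integral) (simp add: case_prod_unfold)
      show "AE x in ?X. 2 ^ s * (\<Prod>e\<in>E. indicator {0..} (x e) * exp (- (?d e * x e))) =
          (\<integral>y. norm (case (x, y) of (x, \<xi>) \<Rightarrow> joint_integrand z x \<xi>) \<partial>?Y)"
        using AE_nonzero by eventually_elim (simp only: prod.case inner_laplace(3))
    qed
    show "AE x in ?X. integrable ?Y (\<lambda>y. case (x, y) of (x, \<xi>) \<Rightarrow> joint_integrand z x \<xi>)"
      using AE_nonzero by eventually_elim (simp only: prod.case, rule inner_laplace(1))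
  qed
  have inner: "(\<integral>x. joint_integrand z x \<xi> \<partial>?X) = laplace_prefactor s z \<xi> * of_real (cell_integral \<xi>)" for \<xi>
    unfolding joint_integrand_eq cell_integral_def by simp
  show ?int using P.integrable_snd[OF intJ] unfolding inner by simp
  have "(\<integral>\<xi>. laplace_prefactor s z \<xi> * of_real (cell_integral \<xi>) \<partial>?Y) = (\<integral>\<xi>. \<integral>x. joint_integrand z x \<xi> \<partial>?X \<partial>?Y)"
    unfolding inner ..
  also have "\<dots> = (\<integral>x. \<integral>\<xi>. joint_integrand z x \<xi> \<partial>?Y \<partial>?X)" by (rule P.Fubini_integral[OF intJ])
  also have "\<dots> = (\<integral>x. 2 ^ s * (\<Prod>e\<in>E. of_real (indicator {0..} (x e)) * exp (- (?c e * of_real (x e)))) \<partial>?X)"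
  proof (rule integral_cong_AE)
    show "(\<lambda>x. \<integral>\<xi>. joint_integrand z x \<xi> \<partial>?Y) \<in> borel_measurable ?X"
      using meas by (intro Y.borel_measurable_lebesgue_integral)
    show "(\<lambda>x. 2 ^ s * (\<Prod>e\<in>E. of_real (indicator {0..} (x e)) * exp (- (?c e * of_real (x e)))) :: complex) \<in> borel_measurable ?X"
      by measurable
    show "AE x in ?X. (\<integral>\<xi>. joint_integrand z x \<xi> \<partial>?Y) =
        2 ^ s * (\<Prod>e\<in>E. of_real (indicator {0..} (x e)) * exp (- (?c e * of_real (x e))))"
      using AE_nonzero by eventually_elim (rule inner_laplace(2))
  qed
  also have "\<dots> = 2 ^ s * (\<Prod>e\<in>E. 1 / ?c e)"
    unfolding integral_mult_right_zero
    by (subst product_integral_prod[OF finE]) (use exp_halfline_complex[OF c] in \<open>auto intro!: prod.cong\<close>)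
  finally show ?val .
qed

end

end

section \<open>Limit and Laplace transform for a single labelled graph\<close>

context labelled_graph
begin

lemma graph_sum_limit:
  fixes k :: "real \<Rightarrow> nat \<Rightarrow> nat"
  assumes s: "1 \<le> s" and \<xi>: "\<And>i. i \<in> {1..s} \<Longrightarrow> 0 < \<xi> i"
    and k: "\<And>i. i \<in> {1..s} \<Longrightarrow> ((\<lambda>t. real (k t i) / t) \<longlongrightarrow> \<xi> i) at_top"
    and k1: "\<And>t i. i \<in> {1..s} \<Longrightarrow> 0 < k t i" and even: "\<And>t. even (total_sides s (k t))"
  shows "((\<lambda>t. graph_sum n s f c (k t) / sqrt t ^ (n div 2)) \<longlongrightarrow>
    2 * incidence.cell_integral (edges_of n f) s (cell_sides c) \<xi> / 2 ^ s) at_top"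
proof -
  interpret I: incidence "edges_of n f" s "cell_sides c" by (rule incidence[OF s])
  have K: "k t i \<le> total_sides s (k t)" if "i \<in> {1..s}" for t i
    unfolding total_sides_def by (rule member_le_sum) (use that in auto)
  have card: "card (edges_of n f) = n div 2" unfolding edges_of_def by (rule card_edges)
  show ?thesis
    using I.lattice_sum_limit[where K = "\<lambda>t. total_sides s (k t)" and k = k and \<xi> = \<xi>, OF \<xi> k k1 even[unfolded total_sides_def] K]
    unfolding card graph_sum_def .
qed

lemma cell_integral_pos:
  assumes "1 \<le> s" and \<xi>: "\<And>i. i \<in> {1..s} \<Longrightarrow> 0 < \<xi> i"
  shows "0 < incidence.cell_integral (edges_of n f) s (cell_sides c) \<xi>"
  by (rule incidence.cell_integral_pos[OF incidence[OF assms(1)] \<xi> occurring_cells])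

text \<open>The sqrt 2 from sqrt (2 z) is pulled out of every edge factor and becomes the constant 2
  powr (- 1 / 2) of the edge weight.\<close>

lemma laplace_cell_integral:
  assumes s: "1 \<le> s" and z: "\<And>i. i \<in> {1..s} \<Longrightarrow> 0 < Re (z i)"
  shows "integrable (\<Pi>\<^sub>M i\<in>{1..s}. lborel)
      (\<lambda>\<xi>. laplace_prefactor s z \<xi> * of_real (incidence.cell_integral (edges_of n f) s (cell_sides c) \<xi>))"
    and "(\<integral>\<xi>. laplace_prefactor s z \<xi> * of_real (incidence.cell_integral (edges_of n f) s (cell_sides c) \<xi>)
      \<partial>(\<Pi>\<^sub>M i\<in>{1..s}. lborel)) = 2 ^ s * edge_weight z n f c"
proof -
  interpret I: incidence "edges_of n f" s "cell_sides c" by (rule incidence[OF s])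
  show "integrable (\<Pi>\<^sub>M i\<in>{1..s}. lborel) (\<lambda>\<xi>. laplace_prefactor s z \<xi> * of_real (I.cell_integral \<xi>))"
    by (rule I.laplace_cell_integral(1)[OF z occurring_cells])
  have "1 / (\<Sum>i=1..s. of_nat (cell_sides c i e) * (of_real (sqrt 2) * csqrt (z i))) =
      of_real (2 powr (- 1 / 2)) / (\<Sum>h\<in>e. csqrt (z (c h)))" if e: "e \<in> edges_of n f" for e
  proof -
    have "(2::real) powr (- 1 / 2) = 1 / sqrt 2" by (simp add: powr_minus powr_half_sqrt inverse_eq_divide)
    then show ?thesis
      unfolding sum_edge_cells[where u = "\<lambda>i. of_real (sqrt 2) * csqrt (z i)", OF e] by (simp flip: sum_distrib_left)
  qed
  then show "(\<integral>\<xi>. laplace_prefactor s z \<xi> * of_real (I.cell_integral \<xi>) \<partial>(\<Pi>\<^sub>M i\<in>{1..s}. lborel)) = 2 ^ s * edge_weight z n f c"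
    by (subst I.laplace_cell_integral(2)[OF z occurring_cells])
      (auto simp: edge_weight_def simp flip: edges_of_def intro!: prod.cong)
qed

end

definition map_lim :: "nat \<Rightarrow> nat \<Rightarrow> nat \<Rightarrow> (nat \<Rightarrow> real) \<Rightarrow> real" where
  "map_lim n g s \<xi> = (\<Sum>(\<tau>, f, c)\<in>labelled_graphs g s n.
     2 * incidence.cell_integral (edges_of n f) s (cell_sides c) \<xi> / 2 ^ s) / fact n"

section \<open>Asymptotics of the number of maps and the transform of the limit\<close>

context
  fixes g s N :: nat
  assumes s: "1 \<le> s" and gs: "(g, s) \<noteq> (0, 1)" "(g, s) \<noteq> (0, 2)"
    and N: "int N = 12 * int g - 12 + 6 * int s"
begin

text \<open>The sum of a graph with n half-edges grows like the power n div 2 of sqrt t. After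
  division by the power N div 2, the graphs with n < N tend to 0.\<close>

lemma card_Maps_limit:
  fixes k :: "real \<Rightarrow> nat \<Rightarrow> nat"
  assumes \<xi>: "\<And>i. i \<in> {1..s} \<Longrightarrow> 0 < \<xi> i"
    and k: "\<And>i. i \<in> {1..s} \<Longrightarrow> ((\<lambda>t. real (k t i) / t) \<longlongrightarrow> \<xi> i) at_top"
    and k1: "\<And>t i. i \<in> {1..s} \<Longrightarrow> 0 < k t i" and even: "\<And>t. even (total_sides s (k t))"
  shows "((\<lambda>t. real (card (Maps g s (k t))) / 2 ^ total_sides s (k t) / sqrt t ^ (N div 2)) \<longlongrightarrow>
    map_lim N g s \<xi>) at_top"
proof -
  let ?L = "\<lambda>n f c. 2 * incidence.cell_integral (edges_of n f) s (cell_sides c) \<xi> / 2 ^ s"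
  have N2: "N = 2 * (N div 2)" using N by presburger
  have lim: "((\<lambda>t. graph_sum n s f c (k t) / sqrt t ^ (N div 2)) \<longlongrightarrow> (if n = N then ?L n f c else 0)) at_top"
    if n: "n \<le> N" and G: "(\<tau>, f, c) \<in> labelled_graphs g s n" for n \<tau> f c
  proof -
    interpret G: labelled_graph g s n \<tau> f c using G by unfold_locales
    note lim = G.graph_sum_limit[where \<xi> = \<xi> and k = k, OF s \<xi> k k1 even]
    show ?thesis
    proof (cases "n = N")
      case True
      then show ?thesis using lim by simp
    next
      case False
      define j where "j = N div 2 - n div 2"
      have j: "0 < j" "N div 2 = n div 2 + j" using False n G.n_even N2 unfolding j_def by linarith+
      have "((\<lambda>t. 1 / sqrt t) \<longlongrightarrow> 0) at_top" by real_asymp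
      then have "((\<lambda>t. graph_sum n s f c (k t) / sqrt t ^ (n div 2) * (1 / sqrt t) ^ j) \<longlongrightarrow> ?L n f c * 0 ^ j) at_top"
        by (intro tendsto_mult lim tendsto_power)
      then show ?thesis using j False by (simp add: power_add power_divide zero_power)
    qed
  qed
  have eq: "real (card (Maps g s (k t))) / 2 ^ total_sides s (k t) =
      (\<Sum>n\<le>N. (\<Sum>(\<tau>, f, c)\<in>labelled_graphs g s n. graph_sum n s f c (k t)) / fact n)" for t
    by (rule card_Maps_eq_graph_sum[OF s gs _ N]) (use k1[of _ t] in \<open>simp add: Suc_le_eq\<close>)
  have "((\<lambda>t. \<Sum>n\<le>N. (\<Sum>(\<tau>, f, c)\<in>labelled_graphs g s n. graph_sum n s f c (k t) / sqrt t ^ (N div 2)) / fact n) \<longlongrightarrow>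
      (\<Sum>n\<le>N. (\<Sum>(\<tau>, f, c)\<in>labelled_graphs g s n. if n = N then ?L n f c else 0) / fact n)) at_top"
  proof (intro tendsto_sum tendsto_divide tendsto_const)
    fix n G assume "n \<in> {..N}" "G \<in> labelled_graphs g s n"
    then show "((\<lambda>t. case G of (\<tau>, f, c) \<Rightarrow> graph_sum n s f c (k t) / sqrt t ^ (N div 2)) \<longlongrightarrow>
        (case G of (\<tau>, f, c) \<Rightarrow> if n = N then ?L n f c else 0)) at_top"
      using lim[of n "fst G" "fst (snd G)" "snd (snd G)"] by (simp only: case_prod_unfold prod.collapse atMost_iff)
  qed simp
  moreover have "(\<Sum>n\<le>N. (\<Sum>(\<tau>, f, c)\<in>labelled_graphs g s n. if n = N then ?L n f c else 0) / fact n) = map_lim N g s \<xi>"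
  proof -
    have "(\<Sum>n\<le>N. (\<Sum>(\<tau>, f, c)\<in>labelled_graphs g s n. if n = N then ?L n f c else 0) / fact n) =
        (\<Sum>n\<le>N. if n = N then map_lim n g s \<xi> else 0)"
      by (rule sum.cong) (auto simp: map_lim_def)
    then show ?thesis by simp
  qed
  ultimately show ?thesis
    unfolding eq by (simp add: case_prod_unfold sum_divide_distrib mult_ac)
qed

lemma map_lim_pos:
  assumes "\<And>i. i \<in> {1..s} \<Longrightarrow> 0 < \<xi> i" and ne: "labelled_graphs g s N \<noteq> {}"
  shows "0 < map_lim N g s \<xi>"
proof -
  have "0 < (\<Sum>(\<tau>, f, c)\<in>labelled_graphs g s N. 2 * incidence.cell_integral (edges_of N f) s (cell_sides c) \<xi> / 2 ^ s)"
  proof (rule sum_pos[OF finite_labelled_graphs ne], clarify)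
    fix \<tau> f c assume "(\<tau>, f, c) \<in> labelled_graphs g s N"
    then interpret labelled_graph g s N \<tau> f c by unfold_locales
    show "0 < 2 * incidence.cell_integral (edges_of N f) s (cell_sides c) \<xi> / 2 ^ s"
      using cell_integral_pos[where \<xi> = \<xi>, OF s assms(1)] by simp
  qed
  then show ?thesis by (simp add: map_lim_def)
qed

text \<open>N div 2 = 6 g - 6 + 3 s is the number of edges of a trivalent graph, and each edge
  accounts for a factor sqrt t.\<close>

lemma sqrt_power_eq:
  assumes "0 < t"
  shows "sqrt t ^ (N div 2) = t powr (3 * real g - 3 + 3 * real s / 2)"
proof -
  have "int (N div 2) = 6 * int g - 6 + 3 * int s" using N by linarith
  then have "real (N div 2) = 6 * real g - 6 + 3 * real s" by linarith
  then have "3 * real g - 3 + 3 * real s / 2 = 1 / 2 * real (N div 2)" by simp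
  then show ?thesis using assms by (simp only: powr_powr[symmetric] powr_half_sqrt powr_realpow real_sqrt_gt_0_iff less_imp_le)
qed

lemma map_asymptotics_map_lim:
  assumes \<xi>: "\<And>i. i \<in> {1..s} \<Longrightarrow> 0 < \<xi> i"
  shows "map_asymptotics g s \<xi> (map_lim N g s \<xi>)"
  unfolding map_asymptotics_def
proof (intro allI impI)
  fix k :: "real \<Rightarrow> nat \<Rightarrow> nat"
  assume k: "(\<forall>t. (\<forall>i\<in>{1..s}. 0 < k t i) \<and> even (total_sides s (k t))) \<and>
    (\<forall>i\<in>{1..s}. ((\<lambda>t. real (k t i) / t) \<longlongrightarrow> \<xi> i) at_top)"
  let ?f = "\<lambda>t. real (card (Maps g s (k t))) / 2 ^ total_sides s (k t)"
  have "?f \<sim>[at_top] (\<lambda>t. map_lim N g s \<xi> * sqrt t ^ (N div 2))"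
  \<comment> \<open>Convergence of the quotient gives \<sim> only if the limit is nonzero. Without
    trivalent graphs the limit is 0, but then all counts vanish identically.\<close>
  proof (cases "labelled_graphs g s N = {}")
    case True
    have "labelled_graphs g s n = {}" for n by (rule labelled_graphs_empty[OF True N])
    then have "?f t = 0" for t
      using k by (subst card_Maps_eq_graph_sum[OF s gs _ N]) (auto simp: Suc_le_eq)
    then show ?thesis using True by (simp add: map_lim_def)
  next
    case False
    have "((\<lambda>t. ?f t / sqrt t ^ (N div 2)) \<longlongrightarrow> map_lim N g s \<xi>) at_top"
      using k by (intro card_Maps_limit \<xi>) auto
    then show ?thesis using map_lim_pos[where \<xi> = \<xi>, OF \<xi> False] by (intro asymp_equivI'_const) auto
  qed
  moreover have "\<forall>\<^sub>F t in at_top. map_lim N g s \<xi> * sqrt t ^ (N div 2) =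
      map_lim N g s \<xi> * t powr (3 * real g - 3 + 3 * real s / 2)"
    using eventually_gt_at_top[of 0] by eventually_elim (simp only: sqrt_power_eq)
  ultimately show "?f \<sim>[at_top] (\<lambda>t. map_lim N g s \<xi> * t powr (3 * real g - 3 + 3 * real s / 2))"
    by (rule asymp_equiv_trans[OF _ asymp_equiv_refl_ev])
qed

text \<open>Two constants are compared along one admissible family k: the power of t drops out, and
  what is left is a constant with limit 1, so that the constants are equal or both 0.\<close>

lemma map_fun_eq:
  assumes \<xi>: "\<And>i. i \<in> {1..s} \<Longrightarrow> 0 < \<xi> i"
  shows "Defs.map_fun g s \<xi> = map_lim N g s \<xi>"
  unfolding Defs.map_fun_def
proof (rule the_equality)
  show "map_asymptotics g s \<xi> (map_lim N g s \<xi>)" by (rule map_asymptotics_map_lim[OF \<xi>])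
  fix d assume d: "map_asymptotics g s \<xi> d"
  define k where "k t i = 2 * (nat \<lceil>\<xi> i * t / 2\<rceil> + 1)" for t i
  let ?p = "3 * real g - 3 + 3 * real s / 2" and ?L = "map_lim N g s \<xi>"
  have k: "(\<forall>t. (\<forall>i\<in>{1..s}. 0 < k t i) \<and> even (total_sides s (k t))) \<and>
    (\<forall>i\<in>{1..s}. ((\<lambda>t. real (k t i) / t) \<longlongrightarrow> \<xi> i) at_top)"
    using even_approximation[OF \<xi>] unfolding total_sides_def k_def by (auto intro!: dvd_sum)
  have asymp: "(\<lambda>t. real (card (Maps g s (k t))) / 2 ^ total_sides s (k t)) \<sim>[at_top] (\<lambda>t. d' * t powr ?p)"
    if "map_asymptotics g s \<xi> d'" for d'
    using that k unfolding map_asymptotics_def by blast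
  have "(\<lambda>t. d * t powr ?p) \<sim>[at_top] (\<lambda>t. ?L * t powr ?p)"
    using asymp[OF d] asymp[OF map_asymptotics_map_lim[where \<xi> = \<xi>, OF \<xi>]]
    by (rule asymp_equiv_trans[OF asymp_equiv_symI])
  then have "((\<lambda>t. if d * t powr ?p = 0 \<and> ?L * t powr ?p = 0 then 1 else d * t powr ?p / (?L * t powr ?p)) \<longlongrightarrow> 1) at_top"
    by (simp only: asymp_equiv_def)
  moreover have "\<forall>\<^sub>F t in at_top. (if d * t powr ?p = 0 \<and> ?L * t powr ?p = 0 then 1 else d * t powr ?p / (?L * t powr ?p)) =
      (if d = 0 \<and> ?L = 0 then 1 else d / ?L)"
    using eventually_gt_at_top[of 0] by eventually_elim simp
  ultimately have "((\<lambda>_::real. if d = 0 \<and> ?L = 0 then 1 else d / ?L) \<longlongrightarrow> 1) at_top"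
    by (rule Lim_transform_eventually)
  then have "(if d = 0 \<and> ?L = 0 then 1 else d / ?L) = 1" using tendsto_const_iff trivial_limit_at_top_linorder by blast
  then show "d = ?L" by (auto split: if_splits simp: divide_eq_1_iff)
qed

text \<open>Where some coordinate is not positive, both sides are 0: for a negative coordinate by
  the indicator, for a zero coordinate by the division by 0 in the integrand, which removes the
  unspecified value of \<open>map_fun\<close>.\<close>

lemma laplace_integrand_eq:
  assumes \<xi>: "\<xi> \<in> space (\<Pi>\<^sub>M i\<in>{1..s}. lborel)"
  shows "indicator (\<Pi>\<^sub>E i\<in>{1..s}. {0..}) \<xi> *\<^sub>R laplace_integrand g s z \<xi> =
    laplace_prefactor s z \<xi> * of_real (map_lim N g s \<xi>)"
proof (cases "\<forall>i\<in>{1..s}. 0 < \<xi> i")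
  case True
  then have pos: "0 < \<xi> i" if "i \<in> {1..s}" for i using that by blast
  have "\<xi> \<in> (\<Pi>\<^sub>E i\<in>{1..s}. {0..})" using \<xi> pos by (force simp: space_PiM PiE_iff)
  moreover have "laplace_prefactor s z \<xi> = (\<Prod>i=1..s. exp (- (z i * of_real (\<xi> i))) / of_real (\<xi> i))"
    unfolding laplace_prefactor_def by (rule prod.cong) (use pos in auto)
  then have "laplace_prefactor s z \<xi> = exp (- (\<Sum>i=1..s. z i * of_real (\<xi> i))) / of_real (\<Prod>i=1..s. \<xi> i)"
    by (simp add: prod_dividef exp_sum flip: sum_negf)
  ultimately show ?thesis by (simp only: laplace_integrand_def map_fun_eq[where \<xi> = \<xi>, OF pos] indicator_simps scaleR_one times_divide_eq_left)
next
  case False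
  then obtain i where i: "i \<in> {1..s}" "\<xi> i \<le> 0" by force
  have "laplace_prefactor s z \<xi> = 0"
    unfolding laplace_prefactor_def by (rule prod_zero) (use i in \<open>auto intro!: bexI[of _ i]\<close>)
  moreover have "indicator (\<Pi>\<^sub>E i\<in>{1..s}. {0..}) \<xi> *\<^sub>R laplace_integrand g s z \<xi> = 0"
  proof (cases "\<xi> i = 0")
    case True
    then have "(\<Prod>i=1..s. \<xi> i) = 0" using i by (intro prod_zero) auto
    then show ?thesis by (simp only: laplace_integrand_def of_real_0 div_by_0 scaleR_zero_right)
  next
    case False
    then have "\<xi> \<notin> (\<Pi>\<^sub>E i\<in>{1..s}. {0..})" using i by (auto dest: PiE_mem)
    then show ?thesis by simp
  qed
  ultimately show ?thesis by simp
qed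

text \<open>By linearity from the single graphs; 2 / 2 ^ s from \<open>map_lim\<close> and 2 ^ s
  from the transform leave the factor 2.\<close>

lemma laplace_map_fun:
  assumes z: "\<And>i. i \<in> {1..s} \<Longrightarrow> 0 < Re (z i)"
  shows "set_integrable (\<Pi>\<^sub>M i\<in>{1..s}. lborel) (\<Pi>\<^sub>E i\<in>{1..s}. {0..}) (laplace_integrand g s z)"
    and "(LINT \<xi>:(\<Pi>\<^sub>E i\<in>{1..s}. {0..})|(\<Pi>\<^sub>M i\<in>{1..s}. lborel). laplace_integrand g s z \<xi>) =
      2 * ((\<Sum>(\<tau>, f, c)\<in>labelled_graphs g s N. edge_weight z N f c) / fact N)"
proof -
  let ?M = "\<Pi>\<^sub>M i\<in>{1..s}. lborel :: real measure"
  define F where "F G \<xi> = (case G of (\<tau>, f, c) \<Rightarrow> laplace_prefactor s z \<xi> *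
    complex_of_real (incidence.cell_integral (edges_of N f) s (cell_sides c) \<xi>))" for G :: "(nat \<Rightarrow> nat) \<times> (nat \<Rightarrow> nat) \<times> (nat \<Rightarrow> nat)" and \<xi>
  have F: "integrable ?M (F G) \<and> integral\<^sup>L ?M (F G) = (case G of (\<tau>, f, c) \<Rightarrow> 2 ^ s * edge_weight z N f c)"
    if G: "G \<in> labelled_graphs g s N" for G
  proof -
    obtain \<tau> f c where eq: "G = (\<tau>, f, c)" by (cases G) auto
    interpret labelled_graph g s N \<tau> f c using G eq by unfold_locales simp
    have "F G = (\<lambda>\<xi>. laplace_prefactor s z \<xi> * of_real (incidence.cell_integral (edges_of N f) s (cell_sides c) \<xi>))"
      by (simp add: F_def eq fun_eq_iff)
    then show ?thesis using laplace_cell_integral[where z = z, OF s z] by (simp only: eq prod.case)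
  qed
  have eq: "indicator (\<Pi>\<^sub>E i\<in>{1..s}. {0..}) \<xi> *\<^sub>R laplace_integrand g s z \<xi> =
      2 / 2 ^ s / fact N * (\<Sum>G\<in>labelled_graphs g s N. F G \<xi>)" if "\<xi> \<in> space ?M" for \<xi>
    unfolding laplace_integrand_eq[OF that] map_lim_def F_def
    by (simp add: sum_distrib_left sum_divide_distrib case_prod_unfold mult_ac)
  have int: "integrable ?M (\<lambda>\<xi>. 2 / 2 ^ s / fact N * (\<Sum>G\<in>labelled_graphs g s N. F G \<xi>))"
    by (intro integrable_mult_right Bochner_Integration.integrable_sum) (use F in blast)
  show "set_integrable ?M (\<Pi>\<^sub>E i\<in>{1..s}. {0..}) (laplace_integrand g s z)"
    unfolding set_integrable_def by (rule iffD2[OF Bochner_Integration.integrable_cong int]) (use eq in auto)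
  have "(LINT \<xi>:(\<Pi>\<^sub>E i\<in>{1..s}. {0..})|?M. laplace_integrand g s z \<xi>) =
      (\<integral>\<xi>. 2 / 2 ^ s / fact N * (\<Sum>G\<in>labelled_graphs g s N. F G \<xi>) \<partial>?M)"
    unfolding set_lebesgue_integral_def by (rule Bochner_Integration.integral_cong) (use eq in auto)
  also have "\<dots> = 2 / 2 ^ s / fact N * (\<Sum>G\<in>labelled_graphs g s N. case G of (\<tau>, f, c) \<Rightarrow> 2 ^ s * edge_weight z N f c)"
    using F by (subst integral_mult_right_zero, subst Bochner_Integration.integral_sum) auto
  also have "\<dots> = 2 * ((\<Sum>(\<tau>, f, c)\<in>labelled_graphs g s N. edge_weight z N f c) / fact N)"
    by (simp add: case_prod_unfold flip: sum_distrib_left)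
  finally show "(LINT \<xi>:(\<Pi>\<^sub>E i\<in>{1..s}. {0..})|?M. laplace_integrand g s z \<xi>) = \<dots>" .
qed

end

theorem theorem3:
  fixes g s :: nat and z :: "nat \<Rightarrow> complex"
  assumes "1 \<le> s" and "(g, s) \<noteq> (0, 1)" and "(g, s) \<noteq> (0, 2)"
    and "\<forall>i\<in>{1..s}. 0 < Re (z i)"
  shows "set_integrable (\<Pi>\<^sub>M i\<in>{1..s}. lborel) (\<Pi>\<^sub>E i\<in>{1..s}. {0..}) (laplace_integrand g s z) \<and>
    (LINT \<xi>:(\<Pi>\<^sub>E i\<in>{1..s}. {0..})|(\<Pi>\<^sub>M i\<in>{1..s}. lborel). laplace_integrand g s z \<xi>)
      = 2 * (\<Sum>C\<in>trivalent_classes g s. class_weight z C)"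
proof -
  \<comment> \<open>For g = 0 the exclusions leave s \<ge> 3, and for g \<ge> 1 the value is at
    least 6. So trivalent graphs have half-edges, which \<open>sum_class_weight\<close>
    presupposes.\<close>
  have pos: "0 < 12 * int g - 12 + 6 * int s" using assms(1-3) by (cases g) auto
  obtain N where N: "int N = 12 * int g - 12 + 6 * int s" using pos by (metis nonneg_int_cases less_imp_le)
  have z: "0 < Re (z i)" if "i \<in> {1..s}" for i using assms(4) that by blast
  have "0 < N" using pos N by linarith
  then show ?thesis
    using laplace_map_fun[where z = z, OF assms(1-3) N z] sum_class_weight[OF N, of z] by simp
qed

end
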